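(* Let $\epsilon\in(0,\tfrac12]$, $P_1,P_2,P_3\in\mathbb{R}^2$, let $\Gamma_0=(u^{(1)}_0,u^{(2)}_0,u^{(3)}_0)\in\mathcal{T}_P$ be an initial triod, and assume that the continuum problem (CP) given in the context has a unique solution $\Gamma=(u^{(1)},u^{(2)},u^{(3)})$ on some interval $[0,T]$, $T\in(0,\infty)$, which satisfies the regularity assumption (A) given in the context with constant $c_0\in(0,\tfrac12]$. Then there exist $h_0>0$, depending on $\epsilon,T,\Gamma,c_0,C_p$, and a constant $C>0$, depending on $c_0$, $T$, $\epsilon$, $C_p$, and norms of the $u^{(i)}$ in the spaces listed in assumption (A), such that for every mesh size $h=1/J$ ($J\in\mathbb{N}$) with $h\le h_0$ the semi-discrete problem (SDP) given in the context admits a unique solution $\Gamma_h$, with $\Gamma_h(t)=(u^{(1)}_h(t),u^{(2)}_h(t),u^{(3)}_h(t))\in\mathcal{T}_{P,h}$ for $t\in[0,T]$, that satisfies the estimates $$\int_0^T\|u^{(i)}_t(t')-u^{(i)}_{ht}(t')\|_{L^2(\Omega)}^2\,dt'+\max_{t\in[0,T]}\|u^{(i)}_x(t)-u^{(i)}_{hx}(t)\|_{L^2(\Omega)}^2\le C h^2,\qquad i=1,2,3.$$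
   Context: Notation: $\Omega=[0,1]$. Subscripts $x$ and $t$ denote partial derivatives in space and time; $u_{hx}$ and $u_{ht}$ denote $\partial_x u_h$ and $\partial_t u_h$. For $a\in\mathbb{R}^2$, $a^\perp$ is the rotation of $a$ by $90^\circ$ (fixed orientation). A curve $v:\Omega\to\mathbb{R}^2$ is regular almost everywhere if $v_x\neq0$ a.e. Triods: for fixed $P=(P_1,P_2,P_3)$, $\mathcal{T}_P$ is the set of triples $(u^{(1)},u^{(2)},u^{(3)})$ with $u^{(i)}\in W^{1,2}(\Omega,\mathbb{R}^2)$ regular almost everywhere, $u^{(i)}(1)=P_i$ for $i=1,2,3$, and $u^{(1)}(0)=u^{(2)}(0)=u^{(3)}(0)$. $\mathcal{T}_0$ is the linear space of triples $(\varphi^{(1)},\varphi^{(2)},\varphi^{(3)})$ with $\varphi^{(i)}\in W^{1,2}(\Omega,\mathbb{R}^2)$, $\varphi^{(i)}(1)=0$ and $\varphi^{(1)}(0)=\varphi^{(2)}(0)=\varphi^{(3)}(0)$. Continuum problem (CP): find $\Gamma(t)=(u^{(1)}(t),u^{(2)}(t),u^{(3)}(t))\in\mathcal{T}_P$, $t\in[0,T]$, with $\Gamma(0)=\Gamma_0$ such that for almost every $t\in(0,T)$ and all $(\varphi^{(1)},\varphi^{(2)},\varphi^{(3)})\in\mathcal{T}_0$ $$\sum_{i=1}^3\Big(\int_\Omega \Big(u^{(i)}_t\cdot\tfrac{(u^{(i)}_x)^\perp}{|u^{(i)}_x|}\Big)\Big(\varphi^{(i)}\cdot\tfrac{(u^{(i)}_x)^\perp}{|u^{(i)}_x|}\Big)|u^{(i)}_x|\,dx+\epsilon\int_\Omega\Big(u^{(i)}_t\cdot\tfrac{u^{(i)}_x}{|u^{(i)}_x|}\Big)\Big(\varphi^{(i)}\cdot\tfrac{u^{(i)}_x}{|u^{(i)}_x|}\Big)|u^{(i)}_x|^2\,dx\Big)$$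 $$=-\sum_{i=1}^3\Big(\epsilon\int_\Omega u^{(i)}_x\cdot\varphi^{(i)}_x\,dx+\int_\Omega\tfrac{u^{(i)}_x}{|u^{(i)}_x|}\cdot\varphi^{(i)}_x\,dx\Big).$$ Assumption (A): for $i=1,2,3$, $u^{(i)}\in L^2((0,T),W^{2,2}(\Omega))$, $u^{(i)}_t\in L^\infty((0,T),W^{1,2}(\Omega))\cap L^2((0,T),W^{2,2}(\Omega))$, $u^{(i)}_0\in W^{2,2}(\Omega)$, and $0<c_0\le|u^{(i)}_x(t,x)|\le\frac1{c_0}$ on $[0,T]\times\Omega$. Finite elements: for $J\in\mathbb{N}$, $h=1/J$, $x_j=hj$ ($j=0,\dots,J$), $\Omega_j=[x_{j-1},x_j]$, let $S_h$ be the space of continuous functions $\Omega\to\mathbb{R}$ that are affine on each $\Omega_j$, and let $I_h$ be the (componentwise) Lagrange interpolation into $S_h$ at the nodes $x_j$. $C_p$ denotes a constant (independent of $h$) for which the standard interpolation estimates $\|v-I_hv\|_{L^2}\le C_ph^k\|v\|_{W^{k,2}}$ ($k=1,2$), $\|(v-I_hv)_x\|_{L^2}\le C_ph\|v\|_{W^{2,2}}$, $\|(I_hv)_x\|_{L^2}\le C_p\|v_x\|_{L^2}$, $\|v-I_hv\|_{L^\infty}\le C_ph^{1/2}\|v_x\|_{L^2}$, $\|(v-I_hv)_x\|_{L^\infty}\le C_ph^{1/2}\|v_{xx}\|_{L^2}$ and inverse estimates $\|w_{hx}\|_{L^2}\le\frac{C_p}{h}\|w_h\|_{L^2}$, $\|w_h\|_{L^\infty}\le\frac{C_p}{\sqrt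 h}\|w_h\|_{L^2}$ ($w_h\in S_h$; the inverse estimates also hold on each $\Omega_j$) hold. Discrete triods: $\mathcal{T}_{P,h}$ is the set of triples $(u^{(1)}_h,u^{(2)}_h,u^{(3)}_h)$ with $u^{(i)}_h\in S_h^2$ regular almost everywhere, $u^{(i)}_h(1)=P_i$, $u^{(1)}_h(0)=u^{(2)}_h(0)=u^{(3)}_h(0)$. $\mathcal{T}_{0,h}$ is the linear space (of dimension $6J-4$) of triples $(\varphi^{(1)}_h,\varphi^{(2)}_h,\varphi^{(3)}_h)\in(S_h^2)^3$ with $\varphi^{(i)}_h(1)=0$ and $\varphi^{(1)}_h(0)=\varphi^{(2)}_h(0)=\varphi^{(3)}_h(0)$. Semi-discrete problem (SDP): find a family $\Gamma_h(t)=(u^{(1)}_h(t),u^{(2)}_h(t),u^{(3)}_h(t))\in\mathcal{T}_{P,h}$, $t\in[0,T]$ (with each $u_h^{(i)}$ continuous on $[0,T]$ with values in $S_h^2$ and differentiable in time), such that $u^{(i)}_h(0)=I_hu^{(i)}_0$, $i=1,2,3$, and for all $t\in(0,T)$ and all $(\varphi^{(1)}_h,\varphi^{(2)}_h,\varphi^{(3)}_h)\in\mathcal{T}_{0,h}$ $$\sum_{i=1}^3\Big(\int_\Omega \Big(u^{(i)}_{ht}\cdot\tfrac{(u^{(i)}_{hx})^\perp}{|u^{(i)}_{hx}|}\Big)\Big(\varphi^{(i)}_h\cdot\tfrac{(u^{(i)}_{hx})^\perp}{|u^{(i)}_{hx}|}\Big)|u^{(i)}_{hx}|\,dx+\epsilon\int_\Omega\Big(u^{(i)}_{ht}\cdot\tfrac{u^{(i)}_{hx}}{|u^{(i)}_{hx}|}\Big)\Big(\varphi^{(i)}_h\cdot\tfrac{u^{(i)}_{hx}}{|u^{(i)}_{hx}|}\Big)|u^{(i)}_{hx}|^2\,dx\Big)$$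 $$=-\sum_{i=1}^3\Big(\epsilon\int_\Omega u^{(i)}_{hx}\cdot\varphi^{(i)}_{hx}\,dx+\int_\Omega\tfrac{u^{(i)}_{hx}}{|u^{(i)}_{hx}|}\cdot\varphi^{(i)}_{hx}\,dx\Big).$$ *)

theory Defs
  imports "HOL-Analysis.Analysis" "HOL-Probability.Essential_Supremum"
begin

section \<open>Sobolev functions on an interval\<close>

text \<open>
  All function spaces use (complete) Lebesgue measure, and functions are total functions whose values
  outside the interval in question play no role.
\<close>

definition square_integrable :: "real \<Rightarrow> real \<Rightarrow> (real \<Rightarrow> 'a::euclidean_space) \<Rightarrow> bool" where
  "square_integrable a b f \<longleftrightarrow>
     f \<in> borel_measurable (lebesgue_on {a..b}) \<and>
     integrable (lebesgue_on {a..b}) (\<lambda>x. (norm (f x))\<^sup>2)"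

definition L2_norm :: "real \<Rightarrow> real \<Rightarrow> (real \<Rightarrow> 'a::euclidean_space) \<Rightarrow> real" where
  "L2_norm a b f = sqrt (\<integral>x. (norm (f x))\<^sup>2 \<partial>lebesgue_on {a..b})"

definition Linf_norm :: "real \<Rightarrow> real \<Rightarrow> (real \<Rightarrow> 'a::euclidean_space) \<Rightarrow> ereal" where
  "Linf_norm a b f = esssup (lebesgue_on {a..b}) (\<lambda>x. ereal (norm (f x)))"

text \<open>Test functions are the continuously differentiable functions with compact support in the open interval.\<close>

definition test_function :: "real \<Rightarrow> real \<Rightarrow> (real \<Rightarrow> real) \<Rightarrow> bool" where
  "test_function a b \<eta> \<longleftrightarrow>
     (\<forall>x. \<eta> differentiable (at x)) \<and> continuous_on UNIV (deriv \<eta>) \<and>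
     (\<exists>c d. a < c \<and> d < b \<and> (\<forall>x. x \<notin> {c..d} \<longrightarrow> \<eta> x = 0))"

definition has_weak_deriv ::
  "real \<Rightarrow> real \<Rightarrow> (real \<Rightarrow> 'a::euclidean_space) \<Rightarrow> (real \<Rightarrow> 'a) \<Rightarrow> bool" where
  "has_weak_deriv a b v g \<longleftrightarrow>
     integrable (lebesgue_on {a..b}) v \<and> integrable (lebesgue_on {a..b}) g \<and>
     (\<forall>\<eta>. test_function a b \<eta> \<longrightarrow>
        (\<integral>x. deriv \<eta> x *\<^sub>R v x \<partial>lebesgue_on {a..b}) =
        - (\<integral>x. \<eta> x *\<^sub>R g x \<partial>lebesgue_on {a..b}))"

text \<open>
  The weak space derivative on \<open>\<Omega> = [0,1]\<close> is an arbitrary representative of its class modulo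
  null sets; everything below only depends on the class.
\<close>

definition dx :: "(real \<Rightarrow> 'a::euclidean_space) \<Rightarrow> (real \<Rightarrow> 'a)" where
  "dx v = (SOME g. has_weak_deriv 0 1 v g)"

primrec sobolev :: "nat \<Rightarrow> (real \<Rightarrow> 'a::euclidean_space) \<Rightarrow> bool" where
  "sobolev 0 v \<longleftrightarrow> square_integrable 0 1 v"
| "sobolev (Suc k) v \<longleftrightarrow>
     square_integrable 0 1 v \<and> (\<exists>g. has_weak_deriv 0 1 v g \<and> sobolev k g)"

type_synonym curve = "real \<Rightarrow> real^2"

text \<open>
  \<open>W k\<close> is the space $W^{k,2}(\Omega,\mathbb{R}^2)$ for \<open>k \<ge> 1\<close>; its elements are given by their
  continuous representatives, so that point values make sense.
\<close>

definition W :: "nat \<Rightarrow> curve set" where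
  "W k = {v. continuous_on {0..1} v \<and> sobolev k v}"

definition W_norm :: "nat \<Rightarrow> curve \<Rightarrow> real" where
  "W_norm k v = sqrt (\<Sum>j\<le>k. (L2_norm 0 1 ((dx ^^ j) v))\<^sup>2)"


section \<open>Bochner spaces\<close>

definition simple_W :: "nat \<Rightarrow> real \<Rightarrow> (real \<Rightarrow> curve) \<Rightarrow> bool" where
  "simple_W k T s \<longleftrightarrow>
     finite (s ` {0..T}) \<and> s ` {0..T} \<subseteq> W k \<and>
     (\<forall>v. {t \<in> {0..T}. s t = v} \<in> sets lebesgue)"

definition strongly_measurable_W :: "nat \<Rightarrow> real \<Rightarrow> (real \<Rightarrow> curve) \<Rightarrow> bool" where
  "strongly_measurable_W k T u \<longleftrightarrow>
     (AE t in lebesgue_on {0..T}. u t \<in> W k) \<and>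
     (\<exists>s. (\<forall>n. simple_W k T (s n)) \<and>
        (AE t in lebesgue_on {0..T}.
           (\<lambda>n::nat. W_norm k (\<lambda>x. s n t x - u t x)) \<longlonglongrightarrow> 0))"

definition L2_W :: "nat \<Rightarrow> real \<Rightarrow> (real \<Rightarrow> curve) set" where
  "L2_W k T = {u. strongly_measurable_W k T u \<and> square_integrable 0 T (\<lambda>t. W_norm k (u t))}"

definition Linf_W :: "nat \<Rightarrow> real \<Rightarrow> (real \<Rightarrow> curve) set" where
  "Linf_W k T = {u. strongly_measurable_W k T u \<and> Linf_norm 0 T (\<lambda>t. W_norm k (u t)) < \<infinity>}"

definition L2_W_norm :: "nat \<Rightarrow> real \<Rightarrow> (real \<Rightarrow> curve) \<Rightarrow> real" where
  "L2_W_norm k T u = L2_norm 0 T (\<lambda>t. W_norm k (u t))"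

definition Linf_W_norm :: "nat \<Rightarrow> real \<Rightarrow> (real \<Rightarrow> curve) \<Rightarrow> real" where
  "Linf_W_norm k T u = real_of_ereal (Linf_norm 0 T (\<lambda>t. W_norm k (u t)))"

text \<open>
  \<open>w\<close> is the weak time derivative of \<open>u\<close> in $L^2((0,T),W^{1,2}(\Omega))$. Evaluation at
  \<open>x\<close> is a bounded linear functional on $W^{1,2}(\Omega)$, hence commutes with Bochner integrals; so the
  defining identity of Bochner integrals may be read pointwise in \<open>x\<close>.
  Of \<open>u\<close> the time-continuous representative is taken, so that \<open>u t\<close> makes sense for every \<open>t\<close>.
\<close>

definition has_weak_time_deriv :: "real \<Rightarrow> (real \<Rightarrow> curve) \<Rightarrow> (real \<Rightarrow> curve) \<Rightarrow> bool" where
  "has_weak_time_deriv T u w \<longleftrightarrow>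
     w \<in> L2_W 1 T \<and>
     (\<forall>x\<in>{0..1}. continuous_on {0..T} (\<lambda>t. u t x) \<and>
        has_weak_deriv 0 T (\<lambda>t. u t x) (\<lambda>t. w t x))"


section \<open>Triods and the continuum problem\<close>

text \<open>A triple of curves is a function on the three-element type \<open>3\<close>.\<close>

type_synonym triple = "3 \<Rightarrow> curve"

definition perp :: "real^2 \<Rightarrow> real^2" where
  "perp a = vector [- (a $ 2), a $ 1]"

definition regular_ae :: "curve \<Rightarrow> bool" where
  "regular_ae v \<longleftrightarrow> (AE x in lebesgue_on {0..1}. dx v x \<noteq> 0)"

definition triods :: "(3 \<Rightarrow> real^2) \<Rightarrow> triple set" where
  "triods P = {v. (\<forall>i. v i \<in> W 1 \<and> regular_ae (v i) \<and> v i 1 = P i) \<and> (\<forall>i j. v i 0 = v j 0)}"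

definition triods0 :: "triple set" where
  "triods0 = {\<phi>. (\<forall>i. \<phi> i \<in> W 1 \<and> \<phi> i 1 = 0) \<and> (\<forall>i j. \<phi> i 0 = \<phi> j 0)}"

text \<open>The weak equation at a fixed time: \<open>v\<close> is the triod, \<open>w\<close> its velocity, \<open>\<phi>\<close> the test triple.\<close>

definition weak_equation :: "real \<Rightarrow> triple \<Rightarrow> triple \<Rightarrow> triple \<Rightarrow> bool" where
  "weak_equation \<epsilon> v w \<phi> \<longleftrightarrow>
     (\<Sum>i\<in>UNIV.
        (\<integral>x. (w i x \<bullet> (perp (dx (v i) x) /\<^sub>R norm (dx (v i) x))) *
              (\<phi> i x \<bullet> (perp (dx (v i) x) /\<^sub>R norm (dx (v i) x))) *
              norm (dx (v i) x) \<partial>lebesgue_on {0..1})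
        + \<epsilon> * (\<integral>x. (w i x \<bullet> (dx (v i) x /\<^sub>R norm (dx (v i) x))) *
                  (\<phi> i x \<bullet> (dx (v i) x /\<^sub>R norm (dx (v i) x))) *
                  (norm (dx (v i) x))\<^sup>2 \<partial>lebesgue_on {0..1}))
     = - (\<Sum>i\<in>UNIV.
        \<epsilon> * (\<integral>x. dx (v i) x \<bullet> dx (\<phi> i) x \<partial>lebesgue_on {0..1})
        + (\<integral>x. (dx (v i) x /\<^sub>R norm (dx (v i) x)) \<bullet> dx (\<phi> i) x \<partial>lebesgue_on {0..1}))"

text \<open>
  \<open>u i t x\<close> is the value of the \<open>i\<close>-th curve at time \<open>t\<close>, and \<open>ut\<close> is the time derivative of \<open>u\<close>.
  Requiring \<open>ut i\<close> in $L^2((0,T),W^{1,2}(\Omega))$ makes all integrals in the equation converge and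
  \<open>u i\<close> continuous in time with values in $W^{1,2}(\Omega)$.
\<close>

definition CP_solution ::
  "real \<Rightarrow> real \<Rightarrow> (3 \<Rightarrow> real^2) \<Rightarrow> triple \<Rightarrow> (3 \<Rightarrow> real \<Rightarrow> curve) \<Rightarrow> (3 \<Rightarrow> real \<Rightarrow> curve) \<Rightarrow> bool" where
  "CP_solution \<epsilon> T P u0 u ut \<longleftrightarrow>
     (\<forall>t\<in>{0..T}. (\<lambda>i. u i t) \<in> triods P) \<and>
     (\<forall>i. \<forall>x\<in>{0..1}. u i 0 x = u0 i x) \<and>
     (\<forall>i. has_weak_time_deriv T (u i) (ut i)) \<and>
     (AE t in lebesgue_on {0..T}. \<forall>\<phi>\<in>triods0.
        weak_equation \<epsilon> (\<lambda>i. u i t) (\<lambda>i. ut i t) \<phi>)"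

definition unique_CP_solution ::
  "real \<Rightarrow> real \<Rightarrow> (3 \<Rightarrow> real^2) \<Rightarrow> triple \<Rightarrow> (3 \<Rightarrow> real \<Rightarrow> curve) \<Rightarrow> (3 \<Rightarrow> real \<Rightarrow> curve) \<Rightarrow> bool" where
  "unique_CP_solution \<epsilon> T P u0 u ut \<longleftrightarrow>
     CP_solution \<epsilon> T P u0 u ut \<and>
     (\<forall>u' ut'. CP_solution \<epsilon> T P u0 u' ut' \<longrightarrow>
        (\<forall>i. \<forall>t\<in>{0..T}. \<forall>x\<in>{0..1}. u' i t x = u i t x))"

text \<open>
  The bounds on \<open>u\<^sub>x\<close> are stated for every \<open>t\<close> and almost every \<open>x\<close> because \<open>dx\<close> is only
  determined up to null sets; for the continuous representative of \<open>u\<^sub>x\<close> they hold for every \<open>x\<close>.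
\<close>

definition assumption_A ::
  "real \<Rightarrow> real \<Rightarrow> triple \<Rightarrow> (3 \<Rightarrow> real \<Rightarrow> curve) \<Rightarrow> (3 \<Rightarrow> real \<Rightarrow> curve) \<Rightarrow> bool" where
  "assumption_A c0 T u0 u ut \<longleftrightarrow>
     (\<forall>i. u i \<in> L2_W 2 T \<and> ut i \<in> Linf_W 1 T \<inter> L2_W 2 T \<and> u0 i \<in> W 2 \<and>
        (\<forall>t\<in>{0..T}. AE x in lebesgue_on {0..1}.
           c0 \<le> norm (dx (u i t) x) \<and> norm (dx (u i t) x) \<le> 1 / c0))"

definition A_norms ::
  "real \<Rightarrow> triple \<Rightarrow> (3 \<Rightarrow> real \<Rightarrow> curve) \<Rightarrow> (3 \<Rightarrow> real \<Rightarrow> curve) \<Rightarrow> 3 \<Rightarrow> real \<times> real \<times> real \<times> real" where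
  "A_norms T u0 u ut =
     (\<lambda>i. (L2_W_norm 2 T (u i), Linf_W_norm 1 T (ut i), L2_W_norm 2 T (ut i), W_norm 2 (u0 i)))"


section \<open>Finite elements and the semi-discrete problem\<close>

text \<open>The mesh size is \<open>h = 1 / J\<close>; \<open>fem J\<close> is $S_h^2$.\<close>

definition fem :: "nat \<Rightarrow> curve set" where
  "fem J = {v. continuous_on {0..1} v \<and>
     (\<forall>j\<in>{1..J}. \<exists>a b. \<forall>x\<in>{(real j - 1) / real J .. real j / real J}. v x = a + x *\<^sub>R b)}"

text \<open>Lagrange interpolation, expanded in the hat functions $\max(0, 1 - |x - x_j|/h)$.\<close>

definition interpol :: "nat \<Rightarrow> curve \<Rightarrow> curve" where
  "interpol J v x = (\<Sum>j\<le>J. max 0 (1 - \<bar>real J * x - real j\<bar>) *\<^sub>R v (real j / real J))"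

text \<open>
  The estimates defining $C_p$, for planar curves; the scalar ones are the special case of curves
  in a coordinate axis.
\<close>

definition interpolation_constant :: "real \<Rightarrow> bool" where
  "interpolation_constant Cp \<longleftrightarrow> 0 < Cp \<and>
     (\<forall>J\<ge>1. let h = 1 / real J in
        (\<forall>k\<in>{1,2}. \<forall>v\<in>W k. L2_norm 0 1 (\<lambda>x. v x - interpol J v x) \<le> Cp * h ^ k * W_norm k v) \<and>
        (\<forall>v\<in>W 2. L2_norm 0 1 (dx (\<lambda>x. v x - interpol J v x)) \<le> Cp * h * W_norm 2 v) \<and>
        (\<forall>v\<in>W 1. L2_norm 0 1 (dx (interpol J v)) \<le> Cp * L2_norm 0 1 (dx v)) \<and>
        (\<forall>v\<in>W 1. Linf_norm 0 1 (\<lambda>x. v x - interpol J v x)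
                   \<le> ereal (Cp * sqrt h * L2_norm 0 1 (dx v))) \<and>
        (\<forall>v\<in>W 2. Linf_norm 0 1 (dx (\<lambda>x. v x - interpol J v x))
                   \<le> ereal (Cp * sqrt h * L2_norm 0 1 (dx (dx v)))) \<and>
        (\<forall>w\<in>fem J.
           L2_norm 0 1 (dx w) \<le> Cp / h * L2_norm 0 1 w \<and>
           Linf_norm 0 1 w \<le> ereal (Cp / sqrt h * L2_norm 0 1 w) \<and>
           (\<forall>j\<in>{1..J}. let a = (real j - 1) * h; b = real j * h in
              L2_norm a b (dx w) \<le> Cp / h * L2_norm a b w \<and>
              Linf_norm a b w \<le> ereal (Cp / sqrt h * L2_norm a b w))))"

definition triods_h :: "nat \<Rightarrow> (3 \<Rightarrow> real^2) \<Rightarrow> triple set" where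
  "triods_h J P =
     {v. (\<forall>i. v i \<in> fem J \<and> regular_ae (v i) \<and> v i 1 = P i) \<and> (\<forall>i j. v i 0 = v j 0)}"

definition triods0_h :: "nat \<Rightarrow> triple set" where
  "triods0_h J = {\<phi>. (\<forall>i. \<phi> i \<in> fem J \<and> \<phi> i 1 = 0) \<and> (\<forall>i j. \<phi> i 0 = \<phi> j 0)}"

definition dt :: "(real \<Rightarrow> curve) \<Rightarrow> real \<Rightarrow> curve" where
  "dt u t x = vector_derivative (\<lambda>s. u s x) (at t)"

text \<open>
  $S_h^2$ is finite-dimensional, so continuity and differentiability in time with values in $S_h^2$
  are the same as pointwise in \<open>x\<close>.
\<close>

definition SDP_solution ::
  "nat \<Rightarrow> real \<Rightarrow> real \<Rightarrow> (3 \<Rightarrow> real^2) \<Rightarrow> triple \<Rightarrow> (3 \<Rightarrow> real \<Rightarrow> curve) \<Rightarrow> bool" where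
  "SDP_solution J \<epsilon> T P u0 uh \<longleftrightarrow>
     (\<forall>t\<in>{0..T}. (\<lambda>i. uh i t) \<in> triods_h J P) \<and>
     (\<forall>i. \<forall>x\<in>{0..1}. continuous_on {0..T} (\<lambda>t. uh i t x) \<and>
        (\<forall>t\<in>{0<..<T}. (\<lambda>s. uh i s x) differentiable (at t))) \<and>
     (\<forall>i. \<forall>x\<in>{0..1}. uh i 0 x = interpol J (u0 i) x) \<and>
     (\<forall>t\<in>{0<..<T}. \<forall>\<phi>\<in>triods0_h J.
        weak_equation \<epsilon> (\<lambda>i. uh i t) (\<lambda>i. dt (uh i) t) \<phi>)"

definition unique_SDP_solution ::
  "nat \<Rightarrow> real \<Rightarrow> real \<Rightarrow> (3 \<Rightarrow> real^2) \<Rightarrow> triple \<Rightarrow> (3 \<Rightarrow> real \<Rightarrow> curve) \<Rightarrow> bool" where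
  "unique_SDP_solution J \<epsilon> T P u0 uh \<longleftrightarrow>
     SDP_solution J \<epsilon> T P u0 uh \<and>
     (\<forall>uh'. SDP_solution J \<epsilon> T P u0 uh' \<longrightarrow>
        (\<forall>i. \<forall>t\<in>{0..T}. \<forall>x\<in>{0..1}. uh' i t x = uh i t x))"

definition velocity_error :: "(real \<Rightarrow> curve) \<Rightarrow> (real \<Rightarrow> curve) \<Rightarrow> real \<Rightarrow> real" where
  "velocity_error ut uh t = L2_norm 0 1 (\<lambda>x. ut t x - dt uh t x)"

definition gradient_error :: "(real \<Rightarrow> curve) \<Rightarrow> (real \<Rightarrow> curve) \<Rightarrow> real \<Rightarrow> real" where
  "gradient_error u uh t = L2_norm 0 1 (\<lambda>x. dx (u t) x - dx (uh t) x)"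

text \<open>
  Integrability of the first integrand is part of the claim (otherwise the integral would be 0 by
  convention), and the maximum is claimed to be attained, at \<open>s\<close>.
\<close>

definition error_estimate ::
  "real \<Rightarrow> (real \<Rightarrow> curve) \<Rightarrow> (real \<Rightarrow> curve) \<Rightarrow> (real \<Rightarrow> curve) \<Rightarrow> real \<Rightarrow> bool" where
  "error_estimate T u ut uh B \<longleftrightarrow>
     integrable (lebesgue_on {0..T}) (\<lambda>t. (velocity_error ut uh t)\<^sup>2) \<and>
     (\<exists>s\<in>{0..T}. (\<forall>t\<in>{0..T}. (gradient_error u uh t)\<^sup>2 \<le> (gradient_error u uh s)\<^sup>2) \<and>
        (\<integral>t. (velocity_error ut uh t)\<^sup>2 \<partial>lebesgue_on {0..T}) + (gradient_error u uh s)\<^sup>2 \<le> B)"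

end

theory Submission
  imports Defs "HOL-Probability.Discrete_Topology"
begin

text \<open>
  The difference \<open>\<phi>\<close> of the discrete velocity and the interpolated exact velocity is a test function in
  both weak equations. Tested with \<open>\<phi>\<close>, they control the norm of \<open>\<phi>\<close> and the time derivative of the relative energy
  \<open>\<epsilon> / 2 * (norm (q - p))\<^sup>2 + norm q - q \<bullet> sgn p\<close> of the discrete slopes \<open>q\<close> with respect to
  the exact slopes \<open>p\<close>, up to terms of order \<open>h\<^sup>2\<close> and quadratic terms in \<open>q - p\<close>; the weight of the
  latter is affine in the \<open>W 2\<close> norm of the exact velocity and hence integrable in time, so Gronwall's inequality yields the estimate.
  The slopes \<open>p\<close> are those of the interpolant of \<open>u\<close> on an auxiliary mesh of size \<open>h ^ 4\<close>:
  they are finitely many absolutely continuous functions of time, to which the chain rule applies, and they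
  are \<open>h\<^sup>2\<close>-close to the weak derivative of \<open>u\<close>, which is enough even after an inverse estimate.

  For existence, the slopes in the discrete velocity law are retracted onto balls around the slopes of the
  interpolated exact solution, which makes the law globally Lipschitz. The estimate holds as long as the
  retraction is inactive, and it bounds the distance of the slopes on each cell by a multiple of \<open>sqrt h\<close>;
  so for small \<open>h\<close> the retraction never becomes active.
\<close>

section \<open>Weak derivatives on an interval\<close>

text \<open>The main obstacle is regularity in time: two space derivatives of \<open>u\<close> are
  controlled only in the mean over time, and \<open>dx (u i t)\<close> is a representative chosen
  separately at each \<open>t\<close>, so nothing is known about it as a function of
  \<open>(t, x)\<close>. Time therefore enters only through point values \<open>u i t x\<close> at
  fixed \<open>x\<close>, and bounds on \<open>dx (u i t)\<close> at every \<open>t\<close> are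
  recovered from Lipschitz bounds, which survive integration of the velocity in time. The relative
  energy is the Bregman distance of \<open>\<epsilon> / 2 * (norm q)\<^sup>2 + norm q\<close>. Once
  the flux difference has been grouped with the difference of the slope velocities, the only factor
  left on the exact slope velocity is the second-order Taylor remainder of \<open>sgn\<close>. So
  that velocity, bounded in space but only square integrable in time, meets a term quadratic in
  \<open>q - p\<close>. The power 4 of the auxiliary mesh size has its origin in the sup-norm
  estimate for slopes, which gains only the square root of the mesh size. The constant of the
  theorem is fixed before the solution is, so it is assembled from numbers alone.\<close>

lemma AE_nonneg_of_integral_intervals:
  fixes f :: "real \<Rightarrow> real"
  assumes f: "integrable lebesgue f"
    and bnd: "\<And>x. x \<notin> {a..b} \<Longrightarrow> f x = 0"
    and nn: "\<And>c d. c \<le> d \<Longrightarrow> 0 \<le> set_lebesgue_integral lebesgue {c..d} f"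
  shows "AE x in lebesgue. 0 \<le> f x"
proof (rule ccontr)
  have [measurable]: "f \<in> borel_measurable lebesgue"
    using f by (rule borel_measurable_integrable)
  define S where "S = {x. f x < 0}"
  have S_sets: "S \<in> sets lebesgue"
  proof -
    have "{x \<in> space lebesgue. f x < 0} \<in> sets lebesgue" by measurable
    then show ?thesis by (simp add: S_def)
  qed
  \<comment> \<open>Half-open cells tile the line, so indicators of unions of cells are sums; a cell
    differs from the closed interval of the hypothesis by one point, a null set.\<close>
  have cell: "0 \<le> (\<integral>x. indicator {real_of_int m / real n..<(real_of_int m + 1) / real n} x * f x \<partial>lebesgue)"
    if "n > 0" for m :: int and n :: nat
  proof -
    have "(\<integral>x. indicator {real_of_int m / real n..<(real_of_int m + 1) / real n} x * f x \<partial>lebesgue)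
        = (\<integral>x. indicator {real_of_int m / real n..(real_of_int m + 1) / real n} x * f x \<partial>lebesgue)"
    proof (rule integral_cong_AE)
      have "AE x in lebesgue. x \<noteq> (real_of_int m + 1) / real n"
        by (rule AE_not_in[of "{(real_of_int m + 1) / real n}", simplified])
           (auto intro: negligible_iff_null_sets[THEN iffD1])
      then show "AE x in lebesgue. indicator {real_of_int m / real n..<(real_of_int m + 1) / real n} x * f x
          = indicator {real_of_int m / real n..(real_of_int m + 1) / real n} x * f x"
        by eventually_elim (auto simp: indicator_def)
    qed (intro borel_measurable_times borel_measurable_indicator; simp)+
    then show ?thesis
      using nn[of "real_of_int m / real n" "(real_of_int m + 1) / real n"] that
      by (simp add: set_lebesgue_integral_def divide_right_mono)
  qed
  have comp: "0 \<le> (\<integral>x. indicator K x * f x \<partial>lebesgue)" if K: "compact K" for K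
  proof -
    \<comment> \<open>\<open>C n\<close> is the union of the grid cells of width
      \<open>1 / n\<close> that meet \<open>K\<close>. As \<open>K\<close> is closed, a point
      outside \<open>K\<close> leaves \<open>C n\<close> once \<open>1 / n\<close> is below its
      distance to \<open>K\<close>, so dominated convergence passes from finite unions of cells to
      compact sets.\<close>
    define C where "C n = {x. \<exists>y\<in>K. \<lfloor>real n * x\<rfloor> = \<lfloor>real n * y\<rfloor>}" for n
    define Z where "Z n = (\<lambda>y. \<lfloor>real n * y\<rfloor>) ` K" for n
    have finZ: "finite (Z n)" for n
    proof -
      obtain B where B: "\<And>x. x \<in> K \<Longrightarrow> \<bar>x\<bar> \<le> B"
        using compact_imp_bounded[OF K] unfolding bounded_iff by auto
      have "Z n \<subseteq> {\<lfloor>- real n * B\<rfloor>..\<lfloor>real n * B\<rfloor>}"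
      proof -
        have "- (real n * B) \<le> real n * y" "real n * y \<le> real n * B" if "y \<in> K" for y
          using B[OF that] mult_left_mono[of y B "real n"] mult_left_mono[of "-B" y "real n"] by auto
        then show ?thesis
          unfolding Z_def by (auto intro!: floor_mono)
      qed
      then show ?thesis by (rule finite_subset) simp
    qed
    have C_eq: "C n = (\<Union>m\<in>Z n. {real_of_int m / real n..<(real_of_int m + 1) / real n})"
      and indC: "indicator (C n) x = (\<Sum>m\<in>Z n. indicator {real_of_int m / real n..<(real_of_int m + 1) / real n} x :: real)"
      if "n > 0" for n x
    proof -
      have cl: "x \<in> {real_of_int m / real n..<(real_of_int m + 1) / real n} \<longleftrightarrow> \<lfloor>real n * x\<rfloor> = m" for x m
        using that by (simp add: floor_eq_iff field_simps)
      show "C n = (\<Union>m\<in>Z n. {real_of_int m / real n..<(real_of_int m + 1) / real n})"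
        unfolding C_def Z_def by (auto simp only: UN_iff mem_Collect_eq cl image_iff set_eq_iff)
      show "indicator (C n) x = (\<Sum>m\<in>Z n. indicator {real_of_int m / real n..<(real_of_int m + 1) / real n} x :: real)"
        unfolding indicator_def cl using finZ[of n]
        by (auto simp: C_def Z_def)
    qed
    have meas: "C n \<in> sets lebesgue" if "n > 0" for n
      unfolding C_eq[OF that] using finZ[of n] by auto
    have "(\<lambda>n. \<integral>x. indicator (C (Suc n)) x * f x \<partial>lebesgue) \<longlonglongrightarrow> (\<integral>x. indicator K x * f x \<partial>lebesgue)"
    proof (rule integral_dominated_convergence[where w="\<lambda>x. \<bar>f x\<bar>"])
      have "closed K" using K by (rule compact_imp_closed)
      show "AE x in lebesgue. (\<lambda>n. indicator (C (Suc n)) x * f x) \<longlonglongrightarrow> indicator K x * f x"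
      proof (intro always_eventually allI)
        fix x
        show "(\<lambda>n. indicator (C (Suc n)) x * f x) \<longlonglongrightarrow> indicator K x * f x"
        proof (cases "x \<in> K")
          case True
          then have "x \<in> C n" for n by (auto simp: C_def)
          then show ?thesis using True by simp
        next
          case False
          then obtain e where e: "e > 0" "\<And>y. y \<in> K \<Longrightarrow> e \<le> dist x y"
            using \<open>closed K\<close> by (meson separate_point_closed)
          have "\<forall>\<^sub>F n in sequentially. 1 / real (Suc n) < e"
            using order_tendstoD(2)[OF LIMSEQ_Suc[OF lim_1_over_n] e(1)] by simp
          then have "\<forall>\<^sub>F n in sequentially. indicator (C (Suc n)) x * f x = indicator K x * f x"
          proof eventually_elim
            case (elim n)
            have "x \<notin> C (Suc n)"
            proof
              assume "x \<in> C (Suc n)"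
              then obtain y where y: "y \<in> K" "\<lfloor>real (Suc n) * x\<rfloor> = \<lfloor>real (Suc n) * y\<rfloor>"
                by (auto simp: C_def)
              have "\<bar>real (Suc n) * x - real (Suc n) * y\<bar> < 1"
                using y(2) by linarith
              then have "real (Suc n) * \<bar>x - y\<bar> < 1"
                by (simp add: right_diff_distrib[symmetric] abs_mult del: of_nat_Suc)
              then have "\<bar>x - y\<bar> < 1 / real (Suc n)"
                by (simp add: field_simps)
              then show False using e(2)[OF y(1)] elim by (simp add: dist_real_def)
            qed
            then show ?case using False by simp
          qed
          then show ?thesis by (rule tendsto_eventually)
        qed
      qed
      show "(\<lambda>x. indicator K x * f x) \<in> borel_measurable lebesgue"
        using \<open>closed K\<close> by (intro borel_measurable_times borel_measurable_indicator) auto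
      show "(\<lambda>x. indicator (C (Suc n)) x * f x) \<in> borel_measurable lebesgue" for n
        using meas[of "Suc n"] by (intro borel_measurable_times borel_measurable_indicator) auto
      show "AE x in lebesgue. norm (indicator (C (Suc n)) x * f x) \<le> \<bar>f x\<bar>" for n
        by (auto simp: indicator_def)
    qed (use f in auto)
    moreover have "0 \<le> (\<integral>x. indicator (C (Suc n)) x * f x \<partial>lebesgue)" for n
    proof -
      have "(\<integral>x. indicator (C (Suc n)) x * f x \<partial>lebesgue)
          = (\<integral>x. (\<Sum>m\<in>Z (Suc n). indicator {real_of_int m / real (Suc n)..<(real_of_int m + 1) / real (Suc n)} x * f x) \<partial>lebesgue)"
        by (subst indC) (auto simp: sum_distrib_right)
      also have "\<dots> = (\<Sum>m\<in>Z (Suc n). \<integral>x. indicator {real_of_int m / real (Suc n)..<(real_of_int m + 1) / real (Suc n)} x * f x \<partial>lebesgue)"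
        by (rule Bochner_Integration.integral_sum)
           (auto intro!: integrable_mult_indicator[where 'b=real, simplified] f)
      also have "\<dots> \<ge> 0"
        by (intro sum_nonneg cell) simp
      finally show ?thesis .
    qed
    ultimately show ?thesis
      by (meson LIMSEQ_le_const)
  qed
  assume "\<not> (AE x in lebesgue. 0 \<le> f x)"
  then have "emeasure lebesgue S \<noteq> 0"
    using S_sets by (subst (asm) AE_iff_measurable[OF S_sets]) (auto simp: S_def)
  have "S \<subseteq> {a..b}"
    using bnd by (force simp: S_def)
  then have Sfin: "emeasure lebesgue S < \<infinity>"
    using emeasure_mono[of S "{a..b}" lebesgue] emeasure_lborel_cbox_finite[of a b]
    by (simp add: le_less_trans)
  define e where "e = measure lebesgue S"
  have e: "emeasure lebesgue S = ennreal e" "0 < e"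
    using Sfin \<open>emeasure lebesgue S \<noteq> 0\<close> unfolding e_def
    by (auto simp: emeasure_eq_ennreal_measure less_top zero_less_measure_iff)
  \<comment> \<open>Inner regularity with the measure of \<open>S\<close> itself as tolerance: the
    part of \<open>S\<close> outside \<open>T\<close> is strictly smaller than \<open>S\<close>, so
    \<open>T\<close> cannot be null. But \<open>f\<close> is negative on \<open>T\<close> and has a
    nonnegative integral over it, which forces \<open>T\<close> to be null.\<close>
  obtain T where T: "closed T" "T \<subseteq> S" "S - T \<in> lmeasurable" "emeasure lebesgue (S - T) < ennreal e"
    using sets_lebesgue_inner_closed[OF S_sets \<open>0 < e\<close>] by blast
  have "compact T"
    using T(1,2) \<open>S \<subseteq> {a..b}\<close> by (meson bounded_closed_interval bounded_subset compact_eq_bounded_closed)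
  have "T \<in> sets lebesgue" using T(1) by auto
  have "AE x in lebesgue. indicator T x * - f x = 0"
  proof (rule integral_nonneg_eq_0_iff_AE[THEN iffD1])
    show int: "integrable lebesgue (\<lambda>x. indicator T x * - f x)"
      using \<open>T \<in> sets lebesgue\<close> by (intro integrable_mult_indicator[where 'b=real, simplified]) (use f in auto)
    show pos: "AE x in lebesgue. 0 \<le> indicator T x * - f x"
      using T(2) by (auto simp: indicator_def S_def intro!: always_eventually)
    have "0 \<le> (\<integral>x. indicator T x * - f x \<partial>lebesgue)"
      using pos by (rule integral_nonneg_AE)
    moreover have "(\<integral>x. indicator T x * - f x \<partial>lebesgue) = - (\<integral>x. indicator T x * f x \<partial>lebesgue)"
      by simp
    ultimately show "(\<integral>x. indicator T x * - f x \<partial>lebesgue) = 0"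
      using comp[OF \<open>compact T\<close>] by simp
  qed
  then have "AE x in lebesgue. x \<notin> T"
    by eventually_elim (use T(2) in \<open>auto simp: S_def indicator_def split: if_splits\<close>)
  then have "emeasure lebesgue T = 0"
    using \<open>T \<in> sets lebesgue\<close> by (subst (asm) AE_iff_measurable[OF \<open>T \<in> sets lebesgue\<close>]) auto
  then have "T \<in> null_sets lebesgue"
    using \<open>T \<in> sets lebesgue\<close> by auto
  then have "emeasure lebesgue (S - T) = emeasure lebesgue S"
    using S_sets by (rule emeasure_Diff_null_set)
  then show False using T(4) e by simp
qed

lemma integral_lebesgue_on_subinterval:
  fixes f :: "real \<Rightarrow> 'a::euclidean_space"
  assumes "{c..d} \<subseteq> {a..b}"
  shows "(\<integral>x. f x \<partial>lebesgue_on {c..d}) = (\<integral>x. indicator {c..d} x *\<^sub>R f x \<partial>lebesgue_on {a..b})"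
proof -
  have "(\<integral>x. f x \<partial>lebesgue_on {c..d}) = (\<integral>x. (if x \<in> {c..d} then f x else 0) \<partial>lebesgue_on {a..b})"
    using assms by (subst Lebesgue_Measure.integral_restrict) auto
  also have "\<dots> = (\<integral>x. indicator {c..d} x *\<^sub>R f x \<partial>lebesgue_on {a..b})"
    by (rule Bochner_Integration.integral_cong) (auto simp: indicator_def)
  finally show ?thesis .
qed

lemma AE_nonneg_on_of_integral_intervals:
  fixes f :: "real \<Rightarrow> real"
  assumes f: "integrable (lebesgue_on {a..b}) f"
    and nn: "\<And>c d. a \<le> c \<Longrightarrow> c \<le> d \<Longrightarrow> d \<le> b \<Longrightarrow> 0 \<le> (\<integral>x. f x \<partial>lebesgue_on {c..d})"
  shows "AE x in lebesgue_on {a..b}. 0 \<le> f x"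
proof -
  define F where "F x = (if x \<in> {a..b} then f x else 0)" for x
  have "AE x in lebesgue. 0 \<le> F x"
  proof (rule AE_nonneg_of_integral_intervals[where a=a and b=b])
    show "integrable lebesgue F"
      unfolding F_def by (rule Lebesgue_Measure.integrable_restrict_UNIV[THEN iffD2]) (use f in auto)
    show "0 \<le> set_lebesgue_integral lebesgue {c..d} F" if "c \<le> d" for c d
    proof -
      have "set_lebesgue_integral lebesgue {c..d} F
          = (\<integral>x. (if x \<in> {max a c..min b d} then f x else 0) \<partial>lebesgue)"
        unfolding set_lebesgue_integral_def
        by (rule Bochner_Integration.integral_cong) (auto simp: F_def indicator_def)
      also have "\<dots> = (\<integral>x. f x \<partial>lebesgue_on {max a c..min b d})"
        by (rule Lebesgue_Measure.integral_restrict_UNIV) auto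
      also have "\<dots> \<ge> 0"
      proof (cases "max a c \<le> min b d")
        case True
        then show ?thesis by (intro nn) auto
      qed simp
      finally show ?thesis .
    qed
  qed (auto simp: F_def)
  then show ?thesis
    by (subst AE_restrict_space_iff) (auto simp: F_def elim: eventually_mono)
qed

text \<open>Each basis direction \<open>e\<close> and its opposite are tested with the nonnegativity
  criterion; the factor \<open>DIM('a)\<close> is the price of passing from components to the norm
  through the l1 norm.\<close>

lemma AE_norm_le_of_integral_intervals:
  fixes f :: "real \<Rightarrow> 'a::euclidean_space"
  assumes f: "integrable (lebesgue_on {a..b}) f"
    and le: "\<And>c d. a \<le> c \<Longrightarrow> c \<le> d \<Longrightarrow> d \<le> b \<Longrightarrow> norm (\<integral>x. f x \<partial>lebesgue_on {c..d}) \<le> L * (d - c)"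
  shows "AE x in lebesgue_on {a..b}. norm (f x) \<le> real DIM('a) * L"
proof -
  have *: "AE x in lebesgue_on {a..b}. f x \<bullet> e \<le> L" if "norm e = 1" for e
  proof -
    have "AE x in lebesgue_on {a..b}. 0 \<le> L - f x \<bullet> e"
    proof (rule AE_nonneg_on_of_integral_intervals)
      show "integrable (lebesgue_on {a..b}) (\<lambda>x. L - f x \<bullet> e)"
        using f by (intro Bochner_Integration.integrable_diff) auto
      show "0 \<le> (\<integral>x. L - f x \<bullet> e \<partial>lebesgue_on {c..d})" if "a \<le> c" "c \<le> d" "d \<le> b" for c d
      proof -
        have fi: "integrable (lebesgue_on {c..d}) f"
          using f that by (intro integrable_subinterval[OF f]) auto
        have "(\<integral>x. L - f x \<bullet> e \<partial>lebesgue_on {c..d}) = L * (d - c) - (\<integral>x. f x \<partial>lebesgue_on {c..d}) \<bullet> e"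
          using fi that by (subst Bochner_Integration.integral_diff) (auto simp: measure_restrict_space)
        moreover have "(\<integral>x. f x \<partial>lebesgue_on {c..d}) \<bullet> e \<le> L * (d - c)"
          using Cauchy_Schwarz_ineq2[of "\<integral>x. f x \<partial>lebesgue_on {c..d}" e] le[OF that] \<open>norm e = 1\<close> by auto
        ultimately show ?thesis by simp
      qed
    qed
    then show ?thesis by eventually_elim simp
  qed
  have "AE x in lebesgue_on {a..b}. \<forall>e\<in>Basis. f x \<bullet> e \<le> L \<and> f x \<bullet> (- e) \<le> L"
    by (intro AE_finite_allI AE_conjI *) auto
  then show ?thesis
  proof eventually_elim
    case (elim x)
    have "norm (f x) \<le> (\<Sum>e\<in>Basis. \<bar>f x \<bullet> e\<bar>)" by (rule norm_le_l1)
    also have "\<dots> \<le> (\<Sum>e\<in>(Basis::'a set). L)"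
      using elim by (intro sum_mono) (auto simp: abs_le_iff)
    finally show ?case by simp
  qed
qed

lemma AE_eq_0_of_integral_intervals:
  fixes f :: "real \<Rightarrow> 'a::euclidean_space"
  assumes f: "integrable (lebesgue_on {a..b}) f"
    and le: "\<And>c d. a \<le> c \<Longrightarrow> c \<le> d \<Longrightarrow> d \<le> b \<Longrightarrow> (\<integral>x. f x \<partial>lebesgue_on {c..d}) = 0"
  shows "AE x in lebesgue_on {a..b}. f x = 0"
  using AE_norm_le_of_integral_intervals[OF f, of 0] le by auto

lemma integral_lebesgue_on_split:
  fixes g :: "real \<Rightarrow> 'a::euclidean_space"
  assumes g: "integrable (lebesgue_on {a..b}) g" and "a \<le> c" "c \<le> d" "d \<le> e" "e \<le> b"
  shows "(\<integral>x. g x \<partial>lebesgue_on {c..e}) = (\<integral>x. g x \<partial>lebesgue_on {c..d}) + (\<integral>x. g x \<partial>lebesgue_on {d..e})"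
proof -
  have i: "integrable (lebesgue_on {p..q}) g" if "a \<le> p" "q \<le> b" for p q
    using that by (intro integrable_subinterval[OF g]) auto
  then have "g integrable_on {c..e}"
    using assms by (intro integrable_on_lebesgue_on) auto
  then have "integral {c..d} g + integral {d..e} g = integral {c..e} g"
    using assms by (intro Henstock_Kurzweil_Integration.integral_combine) auto
  then show ?thesis
    using assms by (simp add: lebesgue_integral_eq_integral i)
qed

text \<open>A C^1 step that rises from 0 to 1 on \<open>[0, 2]\<close> and has the hat function
  \<open>tent\<close> as derivative. Test functions only have to be continuously differentiable, so
  quadratic pieces suffice.\<close>

definition ramp :: "real \<Rightarrow> real" where
  "ramp y = ((max 0 y)\<^sup>2 - 2 * (max 0 (y - 1))\<^sup>2 + (max 0 (y - 2))\<^sup>2) / 2"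

definition tent :: "real \<Rightarrow> real" where
  "tent y = max 0 y - 2 * max 0 (y - 1) + max 0 (y - 2)"

lemma max_0_square_has_real_derivative:
  "((\<lambda>y::real. (max 0 y)\<^sup>2) has_real_derivative 2 * max 0 y) (at y)"
proof -
  have "((\<lambda>h. ((max 0 (y + h))\<^sup>2 - (max 0 y)\<^sup>2) / h - 2 * max 0 y) \<longlongrightarrow> 0) (at 0)"
  proof (rule tendsto_0_le[where K=1])
    show "((\<lambda>h::real. h) \<longlongrightarrow> 0) (at 0)" by (rule tendsto_ident_at)
    have "\<bar>((max 0 (y + h))\<^sup>2 - (max 0 y)\<^sup>2) / h - 2 * max 0 y\<bar> \<le> \<bar>h\<bar>" if "h \<noteq> 0" for h
    proof -
      have "\<bar>(max 0 (y + h))\<^sup>2 - (max 0 y)\<^sup>2 - 2 * max 0 y * h\<bar> \<le> h\<^sup>2"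
      proof (cases "y \<ge> 0")
        case True
        show ?thesis
        proof (cases "y + h \<ge> 0")
          case True
          then show ?thesis using \<open>y \<ge> 0\<close> by (simp add: power2_eq_square algebra_simps)
        next
          case False
          then have "(y + h)\<^sup>2 \<le> h\<^sup>2"
            using \<open>y \<ge> 0\<close> by (intro abs_le_square_iff[THEN iffD1]) simp
          moreover have "(max 0 (y + h))\<^sup>2 - (max 0 y)\<^sup>2 - 2 * max 0 y * h = h\<^sup>2 - (y + h)\<^sup>2"
            using False \<open>y \<ge> 0\<close> by (simp add: power2_eq_square algebra_simps)
          moreover have "0 \<le> (y + h)\<^sup>2" by simp
          ultimately show ?thesis by linarith
        qed
      next
        case False
        show ?thesis
        proof (cases "y + h \<ge> 0")
          case True
          then have "(y + h)\<^sup>2 \<le> h\<^sup>2" using False by (intro power_mono) auto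
          then show ?thesis using False True by simp
        next
          case False
          then show ?thesis using \<open>\<not> y \<ge> 0\<close> by simp
        qed
      qed
      then have "\<bar>((max 0 (y + h))\<^sup>2 - (max 0 y)\<^sup>2 - 2 * max 0 y * h) / h\<bar> \<le> h\<^sup>2 / \<bar>h\<bar>"
        by (simp add: abs_divide divide_right_mono)
      also have "h\<^sup>2 / \<bar>h\<bar> = \<bar>h\<bar>" using that by (simp add: power2_eq_square abs_if)
      finally show ?thesis using that by (simp add: diff_divide_distrib)
    qed
    then show "\<forall>\<^sub>F h in at 0. norm (((max 0 (y + h))\<^sup>2 - (max 0 y)\<^sup>2) / h - 2 * max 0 y) \<le> norm h * 1"
      by (auto simp: eventually_at intro!: exI[of _ 1])
  qed
  then show ?thesis
    unfolding DERIV_def by (subst (asm) LIM_zero_iff)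
qed

lemma ramp_has_real_derivative: "(ramp has_real_derivative tent y) (at y)"
proof -
  have 1: "((\<lambda>y::real. (max 0 (y - k))\<^sup>2) has_real_derivative 2 * max 0 (y - k)) (at y)" for k
    using DERIV_shift[of "\<lambda>y. (max 0 y)\<^sup>2" _ y "- k"] max_0_square_has_real_derivative[of "y - k"] by simp
  have "((\<lambda>y. ((max 0 y)\<^sup>2 - 2 * (max 0 (y - 1))\<^sup>2 + (max 0 (y - 2))\<^sup>2) / 2) has_real_derivative
     (2 * max 0 y - 2 * (2 * max 0 (y - 1)) + 2 * max 0 (y - 2)) / 2) (at y)"
    by (intro DERIV_cdivide DERIV_add DERIV_diff DERIV_cmult 1 max_0_square_has_real_derivative)
  moreover have "(2 * max 0 y - 2 * (2 * max 0 (y - 1)) + 2 * max 0 (y - 2)) / 2 = tent y"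
    by (simp add: tent_def)
  ultimately show ?thesis
    by (simp only: ramp_def[abs_def])
qed

lemma ramp_0: "y \<le> 0 \<Longrightarrow> ramp y = 0" and ramp_1: "2 \<le> y \<Longrightarrow> ramp y = 1"
  by (simp_all add: ramp_def max_def) (simp add: power2_eq_square algebra_simps)

lemma tent_nonneg: "0 \<le> tent y" and tent_0: "y \<notin> {0..2} \<Longrightarrow> tent y = 0"
  by (auto simp: tent_def max_def)

lemma continuous_on_tent: "continuous_on S tent"
  unfolding tent_def[abs_def] by (intro continuous_intros)

lemma ramp_mono: "x \<le> y \<Longrightarrow> ramp x \<le> ramp y"
  using DERIV_nonneg_imp_nondecreasing[of x y ramp] ramp_has_real_derivative tent_nonneg by blast

lemma ramp_bounds: "0 \<le> ramp y" "ramp y \<le> 1"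
  using ramp_mono[of "min y 0" y] ramp_mono[of y "max y 2"] ramp_0[of "min y 0"] ramp_1[of "max y 2"] by auto

lemma scaled_ramp_has_real_derivative:
  "((\<lambda>x. ramp (r * (x - c))) has_real_derivative r * tent (r * (x - c))) (at x)"
proof -
  have "((\<lambda>x. r * (x - c)) has_real_derivative r) (at x)"
    by (auto intro!: derivative_eq_intros)
  from DERIV_chain2[OF ramp_has_real_derivative this] show ?thesis
    by (simp add: mult.commute)
qed

text \<open>The kernel has mass 1 and lives on \<open>[c, c + 2 / n]\<close>: a one-sided
  approximate identity at \<open>c\<close>. The condition \<open>c < b\<close> leaves room for its
  support on the right.\<close>

lemma integral_scaled_tent_tendsto:
  fixes v :: "real \<Rightarrow> 'a::euclidean_space"
  assumes v: "continuous_on {a..b} v" and c: "a < c" "c < b"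
  shows "(\<lambda>n. \<integral>x. (real n * tent (real n * (x - c))) *\<^sub>R v x \<partial>lebesgue_on {a..b}) \<longlonglongrightarrow> v c"
proof (rule LIMSEQ_I)
  fix e :: real assume "e > 0"
  obtain \<delta> where \<delta>: "\<delta> > 0" "\<And>x. x \<in> {a..b} \<Longrightarrow> dist x c < \<delta> \<Longrightarrow> dist (v x) (v c) < e / 2"
    using v c half_gt_zero[OF \<open>e > 0\<close>] unfolding continuous_on_iff by (meson atLeastAtMost_iff less_imp_le)
  obtain N :: nat where N: "2 / min \<delta> (b - c) < real N"
    using reals_Archimedean2 by blast
  show "\<exists>no. \<forall>n\<ge>no. norm ((\<integral>x. (real n * tent (real n * (x - c))) *\<^sub>R v x \<partial>lebesgue_on {a..b}) - v c) < e"
  proof (intro exI allI impI)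
    fix n assume "n \<ge> N"
    have n: "real n > 0" "2 < real n * \<delta>" "2 < real n * (b - c)"
    proof -
      have m: "0 < min \<delta> (b - c)" using \<delta> c by auto
      have "2 / min \<delta> (b - c) < real n" using N \<open>n \<ge> N\<close> by linarith
      then have *: "2 < real n * min \<delta> (b - c)" using m by (simp add: field_simps)
      show n0: "real n > 0"
        using * by (cases "n = 0") auto
      show "2 < real n * \<delta>" "2 < real n * (b - c)"
        using * mult_left_mono[of "min \<delta> (b - c)" \<delta> "real n"]
          mult_left_mono[of "min \<delta> (b - c)" "b - c" "real n"] by auto
    qed
    define k where "k x = real n * tent (real n * (x - c))" for x
    have k_cont: "continuous_on {a..b} k"
      unfolding k_def by (intro continuous_intros continuous_on_compose2[OF continuous_on_tent[of UNIV]]) auto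
    have k_nn: "0 \<le> k x" for x
      unfolding k_def by (intro mult_nonneg_nonneg tent_nonneg) simp
    have "(k has_integral ramp (real n * (b - c)) - ramp (real n * (a - c))) {a..b}"
      unfolding k_def using c
      by (intro fundamental_theorem_of_calculus)
         (auto intro: has_real_derivative_iff_has_vector_derivative[THEN iffD1]
            has_field_derivative_at_within scaled_ramp_has_real_derivative)
    moreover have "ramp (real n * (b - c)) = 1" "ramp (real n * (a - c)) = 0"
      using n c by (auto intro!: ramp_1 ramp_0 mult_nonneg_nonpos)
    ultimately have hk: "(k has_integral 1) {a..b}" by simp
    have kL: "integrable (lebesgue_on {a..b}) k"
      using k_cont by (rule continuous_imp_integrable_real)
    then have k1: "(\<integral>x. k x \<partial>lebesgue_on {a..b}) = 1"
      using hk by (simp add: lebesgue_integral_eq_integral integral_unique)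
    have kvL: "integrable (lebesgue_on {a..b}) (\<lambda>x. k x *\<^sub>R v x)"
      using continuous_imp_integrable_real[of a b "\<lambda>x. k x *\<^sub>R v x"] k_cont v by (auto intro!: continuous_intros)
    have "(\<integral>x. k x *\<^sub>R v x \<partial>lebesgue_on {a..b}) - v c
        = (\<integral>x. k x *\<^sub>R v x \<partial>lebesgue_on {a..b}) - (\<integral>x. k x *\<^sub>R v c \<partial>lebesgue_on {a..b})"
      using k1 kL by simp
    also have "\<dots> = (\<integral>x. k x *\<^sub>R (v x - v c) \<partial>lebesgue_on {a..b})"
      using kvL kL by (subst Bochner_Integration.integral_diff[symmetric]) (auto simp: scaleR_diff_right)
    also have "norm \<dots> \<le> (\<integral>x. k x * (e / 2) \<partial>lebesgue_on {a..b})"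
    proof (rule Bochner_Integration.integral_norm_bound_integral)
      show "integrable (lebesgue_on {a..b}) (\<lambda>x. k x *\<^sub>R (v x - v c))"
        using kvL kL by (simp add: scaleR_diff_right)
      show "integrable (lebesgue_on {a..b}) (\<lambda>x. k x * (e / 2))"
        using kL by simp
      fix x assume "x \<in> space (lebesgue_on {a..b})"
      then have x: "x \<in> {a..b}" by simp
      show "norm (k x *\<^sub>R (v x - v c)) \<le> k x * (e / 2)"
      proof (cases "k x = 0")
        case False
        then have "real n * (x - c) \<in> {0..2}"
          using tent_0[of "real n * (x - c)"] by (auto simp: k_def)
        then have r: "0 \<le> real n * (x - c)" "real n * (x - c) \<le> 2"
          by simp_all
        have "real n * (x - c) < real n * \<delta>"
          using r(2) n(2) by linarith
        have "0 \<le> x - c" using r(1) n(1) by (simp add: zero_le_mult_iff)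
        have "x - c < \<delta>"
          using mult_less_cancel_left_pos[OF n(1)] \<open>real n * (x - c) < real n * \<delta>\<close> by blast
        with \<open>0 \<le> x - c\<close> have "\<bar>x - c\<bar> < \<delta>" by simp
        then have "norm (v x - v c) < e / 2"
          using \<delta>(2)[OF x] by (simp add: dist_norm)
        then show ?thesis
          using mult_left_mono[of "norm (v x - v c)" "e / 2" "k x"] k_nn[of x] by simp
      qed simp
    qed
    also have "\<dots> = e / 2" using k1 by simp
    finally show "norm ((\<integral>x. (real n * tent (real n * (x - c))) *\<^sub>R v x \<partial>lebesgue_on {a..b}) - v c) < e"
      using \<open>e > 0\<close> unfolding k_def by simp
  qed
qed

lemma weak_deriv_integrable:
  assumes "has_weak_deriv a b v g"
  shows "integrable (lebesgue_on {a..b}) g" "integrable (lebesgue_on {a..b}) v"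
  using assms by (auto simp: has_weak_deriv_def)

text \<open>The test function is a difference of two steep ramps, a C^1 approximation of the
  indicator of the interval from \<open>c\<close> to \<open>d\<close>. Its derivative averages
  \<open>v\<close> near \<open>c\<close> minus \<open>v\<close> near \<open>d\<close>, and its
  product with \<open>g\<close> converges by domination.\<close>

lemma weak_deriv_ftc_interior:
  fixes v g :: "real \<Rightarrow> 'a::euclidean_space"
  assumes v: "continuous_on {a..b} v" and g: "has_weak_deriv a b v g"
    and c: "a < c" "c \<le> d" "d < b"
  shows "v d - v c = (\<integral>x. g x \<partial>lebesgue_on {c..d})"
proof -
  define \<eta> where "\<eta> n x = ramp (real n * (x - c)) - ramp (real n * (x - d))" for n x
  define k where "k n x = real n * tent (real n * (x - c)) - real n * tent (real n * (x - d))" for n x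
  have \<eta>': "(\<eta> n has_real_derivative k n x) (at x)" for n x
    unfolding \<eta>_def k_def by (intro DERIV_diff scaled_ramp_has_real_derivative)
  then have deriv: "deriv (\<eta> n) = k n" for n
    using DERIV_imp_deriv by blast
  have k_cont: "continuous_on S (k n)" for n S
    unfolding k_def by (intro continuous_intros continuous_on_compose2[OF continuous_on_tent[of UNIV]]) auto
  have \<eta>_cont: "continuous_on S (\<eta> n)" for n S
    using \<eta>' by (meson DERIV_isCont continuous_at_imp_continuous_on)
  \<comment> \<open>The ramp at \<open>d\<close> is complete only at \<open>d + 2 / n\<close>, which
    must stay below \<open>b\<close> for the support to be compact in the open interval.\<close>
  obtain N :: nat where N: "2 / (b - d) < real N"
    using reals_Archimedean2 by blast
  have gL: "integrable (lebesgue_on {a..b}) g"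
    using g by (rule weak_deriv_integrable)
  have \<eta>_test: "test_function a b (\<eta> n)" if "n \<ge> Suc N" for n
    unfolding test_function_def
  proof (intro conjI allI exI impI)
    show "\<eta> n differentiable at x" for x
      using \<eta>' real_differentiable_def by blast
    show "continuous_on UNIV (deriv (\<eta> n))" unfolding deriv by (rule k_cont)
    have n: "real n > 0" "2 / (b - d) < real n" using N that by auto
    show "a < c" "d + 2 / real n < b" using c n by (auto simp: field_simps)
    fix x assume x: "x \<notin> {c..d + 2 / real n}"
    show "\<eta> n x = 0"
    proof (cases "x < c")
      case True
      then show ?thesis using c n unfolding \<eta>_def by (auto simp: ramp_0 mult_nonneg_nonpos)
    next
      case False
      then have "x > d + 2 / real n" using x by auto
      then have "2 \<le> real n * (x - d)" using n by (simp add: field_simps)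
      moreover have "real n * (x - d) \<le> real n * (x - c)" using c n by (intro mult_left_mono) auto
      ultimately show ?thesis unfolding \<eta>_def by (simp add: ramp_1)
    qed
  qed
  have eq: "(\<integral>x. k n x *\<^sub>R v x \<partial>lebesgue_on {a..b}) = - (\<integral>x. \<eta> n x *\<^sub>R g x \<partial>lebesgue_on {a..b})"
    if "n \<ge> Suc N" for n
    using g \<eta>_test[OF that] unfolding has_weak_deriv_def deriv[symmetric] by blast
  have k_split: "(\<integral>x. k n x *\<^sub>R v x \<partial>lebesgue_on {a..b})
     = (\<integral>x. (real n * tent (real n * (x - c))) *\<^sub>R v x \<partial>lebesgue_on {a..b})
      - (\<integral>x. (real n * tent (real n * (x - d))) *\<^sub>R v x \<partial>lebesgue_on {a..b})" for n
  proof -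
    have "integrable (lebesgue_on {a..b}) (\<lambda>x. (real n * tent (real n * (x - e))) *\<^sub>R v x)" for e
      using v by (intro continuous_imp_integrable_real continuous_intros continuous_on_compose2[OF continuous_on_tent[of UNIV]]) auto
    then show ?thesis
      unfolding k_def scaleR_diff_left by (intro Bochner_Integration.integral_diff)
  qed
  have L1: "(\<lambda>n. \<integral>x. k n x *\<^sub>R v x \<partial>lebesgue_on {a..b}) \<longlonglongrightarrow> v c - v d"
    unfolding k_split using c by (intro tendsto_diff integral_scaled_tent_tendsto v) auto
  have L2: "(\<lambda>n. \<integral>x. \<eta> n x *\<^sub>R g x \<partial>lebesgue_on {a..b}) \<longlonglongrightarrow> (\<integral>x. indicator {c<..d} x *\<^sub>R g x \<partial>lebesgue_on {a..b})"
  proof (rule integral_dominated_convergence[where w="\<lambda>x. norm (g x)"])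
    have r: "(\<lambda>n. ramp (real n * (x - e))) \<longlonglongrightarrow> indicator {e<..} x" for x e
    proof (cases "x > e")
      case True
      obtain M :: nat where M: "2 / (x - e) < real M"
        using reals_Archimedean2 by blast
      have "\<forall>\<^sub>F n in sequentially. ramp (real n * (x - e)) = 1"
      proof (rule eventually_sequentiallyI[of M])
        fix n assume "n \<ge> M"
        then have "2 / (x - e) < real n" using M by linarith
        then show "ramp (real n * (x - e)) = 1" using True by (intro ramp_1) (simp add: field_simps)
      qed
      then show ?thesis using True by (simp add: tendsto_eventually)
    next
      case False
      then have "ramp (real n * (x - e)) = 0" for n by (intro ramp_0 mult_nonneg_nonpos) auto
      then show ?thesis using False by simp
    qed
    have "(\<lambda>n. \<eta> n x) \<longlonglongrightarrow> indicator {c<..} x - indicator {d<..} x" for x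
      unfolding \<eta>_def by (intro tendsto_diff r)
    moreover have "indicator {c<..} x - indicator {d<..} x = (indicator {c<..d} x :: real)" for x
      using c by (auto simp: indicator_def)
    ultimately show "AE x in lebesgue_on {a..b}. (\<lambda>n. \<eta> n x *\<^sub>R g x) \<longlonglongrightarrow> indicator {c<..d} x *\<^sub>R g x"
      by (intro always_eventually allI tendsto_scaleR) auto
    show "(\<lambda>x. indicator {c<..d} x *\<^sub>R g x) \<in> borel_measurable (lebesgue_on {a..b})"
      using gL c by (intro borel_measurable_scaleR borel_measurable_indicator) (auto simp: sets_restrict_space_iff)
    show "(\<lambda>x. \<eta> n x *\<^sub>R g x) \<in> borel_measurable (lebesgue_on {a..b})" for n
    proof (rule borel_measurable_scaleR)
      show "\<eta> n \<in> borel_measurable (lebesgue_on {a..b})"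
        by (intro continuous_imp_measurable_on_sets_lebesgue \<eta>_cont) auto
    qed (use gL in auto)
    have "\<bar>\<eta> n x\<bar> \<le> 1" for n x
      unfolding \<eta>_def using ramp_bounds[of "real n * (x - c)"] ramp_bounds[of "real n * (x - d)"] by linarith
    then show "AE x in lebesgue_on {a..b}. norm (\<eta> n x *\<^sub>R g x) \<le> norm (g x)" for n
      by (auto intro!: always_eventually mult_left_le_one_le)
  qed (use gL in auto)
  have "\<forall>\<^sub>F n in sequentially. - (\<integral>x. \<eta> n x *\<^sub>R g x \<partial>lebesgue_on {a..b}) = (\<integral>x. k n x *\<^sub>R v x \<partial>lebesgue_on {a..b})"
    using eq by (intro eventually_sequentiallyI[of "Suc N"]) simp
  with tendsto_minus[OF L2]
  have "(\<lambda>n. \<integral>x. k n x *\<^sub>R v x \<partial>lebesgue_on {a..b}) \<longlonglongrightarrow> - (\<integral>x. indicator {c<..d} x *\<^sub>R g x \<partial>lebesgue_on {a..b})"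
    by (rule Lim_transform_eventually)
  from LIMSEQ_unique[OF L1 this]
  have "v d - v c = (\<integral>x. indicator {c<..d} x *\<^sub>R g x \<partial>lebesgue_on {a..b})"
    by (metis minus_diff_eq minus_minus)
  also have "\<dots> = (\<integral>x. indicator {c..d} x *\<^sub>R g x \<partial>lebesgue_on {a..b})"
  proof (rule integral_cong_AE)
    have "AE x in lebesgue. x \<noteq> c"
      by (rule AE_not_in[of "{c}", simplified]) (auto intro: negligible_iff_null_sets[THEN iffD1])
    then have "AE x in lebesgue_on {a..b}. x \<noteq> c"
      by (subst AE_restrict_space_iff) (auto elim: eventually_mono)
    then show "AE x in lebesgue_on {a..b}. indicator {c<..d} x *\<^sub>R g x = indicator {c..d} x *\<^sub>R g x"
      by eventually_elim (auto simp: indicator_def)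
  qed (use gL c in \<open>auto intro!: borel_measurable_scaleR borel_measurable_indicator simp: sets_restrict_space_iff\<close>)
  also have "\<dots> = (\<integral>x. g x \<partial>lebesgue_on {c..d})"
    using c by (subst integral_lebesgue_on_subinterval) auto
  finally show ?thesis .
qed

text \<open>On the open interval \<open>v\<close> minus the indefinite integral of \<open>g\<close>
  is constant; both are continuous up to the endpoints, so the constancy extends to the closed
  interval.\<close>

lemma weak_deriv_ftc:
  fixes v g :: "real \<Rightarrow> 'a::euclidean_space"
  assumes v: "continuous_on {a..b} v" and g: "has_weak_deriv a b v g" and "a < b"
    and c: "a \<le> c" "c \<le> d" "d \<le> b"
  shows "v d - v c = (\<integral>x. g x \<partial>lebesgue_on {c..d})"
proof -
  have gL: "integrable (lebesgue_on {a..b}) g"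
    using g by (rule weak_deriv_integrable)
  define G where "G x = (\<integral>x. g x \<partial>lebesgue_on {a..x})" for x
  have G_cont: "continuous_on {a..b} G"
    unfolding G_def using gL by (rule indefinite_integral_continuous_real)
  have G_diff: "G q - G p = (\<integral>x. g x \<partial>lebesgue_on {p..q})" if "a \<le> p" "p \<le> q" "q \<le> b" for p q
    unfolding G_def using integral_lebesgue_on_split[OF gL, of a p q] that by simp
  define m where "m = (a + b) / 2"
  have m: "a < m" "m < b" using \<open>a < b\<close> by (auto simp: m_def)
  have int: "v x - G x = v m - G m" if "x \<in> {a<..<b}" for x
  proof (cases "x \<le> m")
    case True
    then show ?thesis using weak_deriv_ftc_interior[OF v g, of x m] G_diff[of x m] that m
      by (simp add: algebra_simps)
  next
    case False
    then show ?thesis using weak_deriv_ftc_interior[OF v g, of m x] G_diff[of m x] that m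
      by (simp add: algebra_simps)
  qed
  have all: "v x - G x = v m - G m" if "x \<in> {a..b}" for x
    using continuous_constant_on_closure[of "{a<..<b}" "\<lambda>x. v x - G x" "v m - G m" x] int that v G_cont \<open>a < b\<close>
    by (auto simp: closure_greaterThanLessThan intro!: continuous_intros)
  have "v c - G c = v m - G m" "v d - G d = v m - G m"
    using all c by auto
  then have "v d - v c = G d - G c"
    by (metis (no_types) add_diff_cancel_left' add_diff_eq diff_add_cancel diff_diff_eq2)
  then show ?thesis
    using G_diff[OF c] by simp
qed

lemma weak_deriv_unique:
  fixes v g :: "real \<Rightarrow> 'a::euclidean_space"
  assumes v: "continuous_on {a..b} v" and g: "has_weak_deriv a b v g" and g': "has_weak_deriv a b v g'"
    and "a < b"
  shows "AE x in lebesgue_on {a..b}. g x = g' x"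
proof -
  have i: "integrable (lebesgue_on {a..b}) g" "integrable (lebesgue_on {a..b}) g'"
    using g g' by (auto intro: weak_deriv_integrable)
  have "AE x in lebesgue_on {a..b}. g x - g' x = 0"
  proof (rule AE_eq_0_of_integral_intervals)
    fix c d assume c: "a \<le> c" "c \<le> d" "d \<le> b"
    have "integrable (lebesgue_on {c..d}) g" "integrable (lebesgue_on {c..d}) g'"
      using c by (auto intro!: integrable_subinterval[OF i(1)] integrable_subinterval[OF i(2)])
    then show "(\<integral>x. g x - g' x \<partial>lebesgue_on {c..d}) = 0"
      using weak_deriv_ftc[OF v g \<open>a < b\<close> c] weak_deriv_ftc[OF v g' \<open>a < b\<close> c] by simp
  qed (use i in auto)
  then show ?thesis by simp
qed

text \<open>Together with \<open>Lipschitz_of_weak_deriv\<close> this exchanges almost-everywhere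
  bounds on derivatives for Lipschitz bounds. The latter pass through time integrals of point
  values, and the present direction turns them back into bounds on \<open>dx\<close> at a single
  time.\<close>

lemma weak_deriv_Lipschitz:
  fixes v g :: "real \<Rightarrow> 'a::euclidean_space"
  assumes v: "continuous_on {a..b} v" and g: "has_weak_deriv a b v g" and "a < b"
    and L: "\<And>x y. x \<in> {a..b} \<Longrightarrow> y \<in> {a..b} \<Longrightarrow> norm (v x - v y) \<le> L * \<bar>x - y\<bar>"
  shows "AE x in lebesgue_on {a..b}. norm (g x) \<le> real DIM('a) * L"
proof (rule AE_norm_le_of_integral_intervals)
  show "norm (\<integral>x. g x \<partial>lebesgue_on {c..d}) \<le> L * (d - c)" if "a \<le> c" "c \<le> d" "d \<le> b" for c d
    using L[of d c] weak_deriv_ftc[OF v g \<open>a < b\<close> that] that by simp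
qed (use g in \<open>rule weak_deriv_integrable\<close>)

lemma Lipschitz_of_weak_deriv:
  fixes v g :: "real \<Rightarrow> 'a::euclidean_space"
  assumes v: "continuous_on {a..b} v" and g: "has_weak_deriv a b v g" and "a < b"
    and L: "AE x in lebesgue_on {a..b}. norm (g x) \<le> L" and "x \<in> {a..b}" "y \<in> {a..b}"
  shows "norm (v x - v y) \<le> L * \<bar>x - y\<bar>"
proof -
  have *: "norm (v d - v c) \<le> L * \<bar>d - c\<bar>" if c: "a \<le> c" "c \<le> d" "d \<le> b" for c d
  proof -
    have gL: "AE x in lebesgue_on {c..d}. norm (g x) \<le> L"
      using L c by (auto simp: AE_restrict_space_iff elim: eventually_mono)
    have gi: "integrable (lebesgue_on {c..d}) g"
      using c by (intro integrable_subinterval[OF weak_deriv_integrable(1)[OF g]]) auto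
    have "norm (\<integral>x. g x \<partial>lebesgue_on {c..d}) \<le> (\<integral>x. norm (g x) \<partial>lebesgue_on {c..d})"
      by (rule integral_norm_bound)
    also have "\<dots> \<le> (\<integral>x. L \<partial>lebesgue_on {c..d})"
      using gi gL by (intro integral_mono_AE) auto
    finally have "norm (\<integral>x. g x \<partial>lebesgue_on {c..d}) \<le> (\<integral>x. L \<partial>lebesgue_on {c..d})" .
    then show ?thesis
      using weak_deriv_ftc[OF v g \<open>a < b\<close> c] c by (simp add: measure_restrict_space mult.commute)
  qed
  show ?thesis
    using *[of x y] *[of y x] assms(5,6) by (cases "x \<le> y") (auto simp: norm_minus_commute abs_minus_commute)
qed

section \<open>Piecewise affine interpolation\<close>

lemma continuous_on_Icc_bounded:
  fixes f :: "real \<Rightarrow> 'a::real_normed_vector"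
  assumes "continuous_on {a..b} f"
  obtains B where "0 \<le> B" "\<And>x. x \<in> {a..b} \<Longrightarrow> norm (f x) \<le> B"
proof -
  obtain B where "\<forall>y\<in>f ` {a..b}. norm y \<le> B"
    using compact_imp_bounded[OF compact_continuous_image[OF assms compact_Icc]] unfolding bounded_iff ..
  then show thesis by (intro that[of "max 0 B"]) (auto simp: le_max_iff_disj)
qed

lemma integrable_continuous_scaleR:
  fixes f :: "real \<Rightarrow> 'a::euclidean_space" and k :: "real \<Rightarrow> real"
  assumes k: "continuous_on {a..b} k" and f: "integrable (lebesgue_on {a..b}) f"
  shows "integrable (lebesgue_on {a..b}) (\<lambda>x. k x *\<^sub>R f x)"
proof -
  obtain B where B: "0 \<le> B" "\<And>x. x \<in> {a..b} \<Longrightarrow> norm (k x) \<le> B"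
    using continuous_on_Icc_bounded[OF k] by metis
  have "k \<in> borel_measurable (lebesgue_on {a..b})"
    using k by (intro continuous_imp_measurable_on_sets_lebesgue) auto
  show ?thesis
  proof (rule Bochner_Integration.integrable_bound)
    show "integrable (lebesgue_on {a..b}) (\<lambda>x. B *\<^sub>R f x)" using f by simp
    show "(\<lambda>x. k x *\<^sub>R f x) \<in> borel_measurable (lebesgue_on {a..b})"
      using \<open>k \<in> _\<close> f by (intro borel_measurable_scaleR) auto
    show "AE x in lebesgue_on {a..b}. norm (k x *\<^sub>R f x) \<le> norm (B *\<^sub>R f x)"
      using B by (intro AE_I2) (simp add: mult_right_mono)
  qed
qed

lemma AE_lebesgue_on_neq: "AE x in lebesgue_on S. x \<noteq> (c::real)" if "S \<in> sets lebesgue"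
proof -
  have "AE x in lebesgue. x \<noteq> c"
    by (rule AE_not_in[of "{c}", simplified]) (auto intro: negligible_iff_null_sets[THEN iffD1])
  then show ?thesis
    using that by (subst AE_restrict_space_iff) (auto elim: eventually_mono)
qed

lemma cell_index:
  assumes "0 \<le> x" "x < 1" "1 \<le> J"
  obtains l where "l < J" "\<lfloor>real J * x\<rfloor> = int l" "real l \<le> real J * x" "real J * x < real l + 1"
proof
  have "0 \<le> real J * x" "real J * x < real J" using assms by auto
  then show "nat \<lfloor>real J * x\<rfloor> < J" "\<lfloor>real J * x\<rfloor> = int (nat \<lfloor>real J * x\<rfloor>)"
    "real (nat \<lfloor>real J * x\<rfloor>) \<le> real J * x" "real J * x < real (nat \<lfloor>real J * x\<rfloor>) + 1"
    by (auto simp: nat_less_iff floor_less_iff)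
qed

text \<open>Integrands built from discrete slopes see \<open>x\<close> only through the cell number
  \<open>\<lfloor>real K * x\<rfloor>\<close>, so their integrals are finite averages. The point
  \<open>x = 1\<close> has cell number \<open>K\<close>, outside the sum, but is a null set.\<close>

lemma has_bochner_integral_step:
  fixes \<Phi> :: "int \<Rightarrow> 'a::euclidean_space"
  assumes "1 \<le> K"
  shows "has_bochner_integral (lebesgue_on {0..1}) (\<lambda>x. \<Phi> \<lfloor>real K * x\<rfloor>) ((\<Sum>l<K. \<Phi> (int l)) /\<^sub>R real K)"
proof -
  define C where "C l = {real l / real K..<(real l + 1) / real K}" for l
  have C_sub: "C l \<subseteq> {0..1}" if "l < K" for l
  proof
    fix x assume "x \<in> C l"
    then have "real l / real K \<le> x" "x < (real l + 1) / real K" by (auto simp: C_def)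
    moreover have "0 \<le> real l / real K" by simp
    moreover have "(real l + 1) / real K \<le> 1" using that by (simp add: field_simps)
    ultimately have "0 \<le> x" "x \<le> 1" by linarith+
    then show "x \<in> {0..1}" by simp
  qed
  have C: "has_bochner_integral (lebesgue_on {0..1}) (\<lambda>x. indicator (C l) x *\<^sub>R \<Phi> (int l)) ((1 / real K) *\<^sub>R \<Phi> (int l))"
    if "l < K" for l
  proof -
    have "C l \<in> sets lebesgue" by (auto simp: C_def)
    then have e: "emeasure (lebesgue_on {0..1}) (C l) = ennreal (1 / real K)"
      using C_sub[OF that] assms
      by (subst emeasure_restrict_space) (auto simp: C_def  divide_right_mono diff_divide_distrib[symmetric])
    then have "measure (lebesgue_on {0..1}) (C l) = 1 / real K"
      by (simp add: measure_def)
    moreover have "C l \<in> sets (lebesgue_on {0..1})"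
      using C_sub[OF that] \<open>C l \<in> sets lebesgue\<close> by (auto simp: sets_restrict_space_iff)
    then have "has_bochner_integral (lebesgue_on {0..1}) (\<lambda>x. indicator (C l) x *\<^sub>R \<Phi> (int l)) (measure (lebesgue_on {0..1}) (C l) *\<^sub>R \<Phi> (int l))"
      using e by (intro has_bochner_integral_scaleR_left has_bochner_integral_real_indicator) auto
    ultimately show ?thesis by simp
  qed
  have eq: "(\<Sum>l<K. indicator (C l) x *\<^sub>R \<Phi> (int l)) = \<Phi> \<lfloor>real K * x\<rfloor>" if x: "x \<in> {0..1}" "x \<noteq> 1" for x
  proof -
    obtain m where m: "m < K" "\<lfloor>real K * x\<rfloor> = int m"
      using cell_index[of x K] x assms by auto
    have "x \<in> C l \<longleftrightarrow> l = m" for l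
    proof -
      have "x \<in> C l \<longleftrightarrow> \<lfloor>real K * x\<rfloor> = int l"
        using assms by (simp add: C_def floor_eq_iff field_simps)
      then show ?thesis using m by auto
    qed
    then have "(\<Sum>l<K. indicator (C l) x *\<^sub>R \<Phi> (int l)) = (\<Sum>l<K. if l = m then \<Phi> (int l) else 0)"
      by (intro sum.cong) (auto simp: indicator_def)
    then show ?thesis using m by simp
  qed
  have 1: "has_bochner_integral (lebesgue_on {0..1}) (\<lambda>x. \<Sum>l<K. indicator (C l) x *\<^sub>R \<Phi> (int l)) (\<Sum>l<K. (1 / real K) *\<^sub>R \<Phi> (int l))"
    by (intro has_bochner_integral_sum C) auto
  have ae: "AE x in lebesgue_on {0..1}. (\<Sum>l<K. indicator (C l) x *\<^sub>R \<Phi> (int l)) = \<Phi> \<lfloor>real K * x\<rfloor>"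
  proof -
    have "AE x in lebesgue_on {0..1}. x \<in> {0..1}" by (auto intro: AE_I2)
    moreover have "AE x in lebesgue_on {0..1::real}. x \<noteq> 1" by (rule AE_lebesgue_on_neq) auto
    ultimately show ?thesis by eventually_elim (rule eq)
  qed
  have m: "(\<lambda>x. \<Phi> \<lfloor>real K * x\<rfloor>) \<in> borel_measurable (lebesgue_on {0..1})"
  proof -
    have "(\<lambda>x. \<lfloor>real K * x\<rfloor>) \<in> measurable borel (count_space UNIV)" by measurable
    then have "(\<lambda>x. \<Phi> \<lfloor>real K * x\<rfloor>) \<in> borel_measurable borel"
      by (rule measurable_compose) auto
    then show ?thesis
      by (intro measurable_restrict_space1) (simp add: measurable_completion)
  qed
  have "has_bochner_integral (lebesgue_on {0..1}) (\<lambda>x. \<Phi> \<lfloor>real K * x\<rfloor>) (\<Sum>l<K. (1 / real K) *\<^sub>R \<Phi> (int l))"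
    using 1 m ae by (subst has_bochner_integral_cong_AE[symmetric]) (auto dest: borel_measurable_has_bochner_integral)
  then show ?thesis
    by (simp add: scaleR_sum_right divide_inverse)
qed

lemmas integrable_step = has_bochner_integral_step[THEN integrable.intros]
  and integral_step = has_bochner_integral_step[THEN has_bochner_integral_integral_eq]

text \<open>The hat expansion of \<open>interpol\<close> with free nodal values, so that
  interpolants, elements of \<open>fem\<close> and the states of the flow share one formula.\<close>

definition nodal :: "nat \<Rightarrow> (nat \<Rightarrow> 'a::real_vector) \<Rightarrow> real \<Rightarrow> 'a" where
  "nodal J y x = (\<Sum>j\<le>J. max 0 (1 - \<bar>real J * x - real j\<bar>) *\<^sub>R y j)"

text \<open>The difference quotient over the cell of \<open>x\<close>, defined for every function
  and at every point, in contrast to \<open>dx\<close>. At \<open>x = 1\<close> it refers to a cell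
  beyond the interval, which matters only on a null set.\<close>

definition slope :: "nat \<Rightarrow> (real \<Rightarrow> 'a::real_vector) \<Rightarrow> real \<Rightarrow> 'a" where
  "slope J v x = real J *\<^sub>R (v ((real_of_int \<lfloor>real J * x\<rfloor> + 1) / real J) - v (real_of_int \<lfloor>real J * x\<rfloor> / real J))"

lemma interpol_eq_nodal: "interpol J v = nodal J (\<lambda>j. v (real j / real J))"
  by (auto simp: interpol_def nodal_def)

lemma nodal_formula:
  assumes "l < J" "real l \<le> real J * x" "real J * x \<le> real l + 1"
  shows "nodal J y x = (1 - (real J * x - real l)) *\<^sub>R y l + (real J * x - real l) *\<^sub>R y (Suc l)"
proof -
  have "nodal J y x = (\<Sum>j\<in>{l, Suc l}. max 0 (1 - \<bar>real J * x - real j\<bar>) *\<^sub>R y j)"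
    unfolding nodal_def
  proof (rule sum.mono_neutral_right)
    show "\<forall>j\<in>{..J} - {l, Suc l}. max 0 (1 - \<bar>real J * x - real j\<bar>) *\<^sub>R y j = 0"
    proof
      fix j assume "j \<in> {..J} - {l, Suc l}"
      then have "j < l \<or> j > Suc l" by auto
      then have "1 \<le> \<bar>real J * x - real j\<bar>" using assms by (auto simp: abs_if)
      then show "max 0 (1 - \<bar>real J * x - real j\<bar>) *\<^sub>R y j = 0" by simp
    qed
  qed (use assms in auto)
  also have "\<dots> = (1 - (real J * x - real l)) *\<^sub>R y l + (real J * x - real l) *\<^sub>R y (Suc l)"
  proof -
    have "max 0 (1 - \<bar>real J * x - real l\<bar>) = 1 - (real J * x - real l)"
      "max 0 (1 - \<bar>real J * x - real (Suc l)\<bar>) = real J * x - real l"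
      using assms by auto
    then show ?thesis by simp
  qed
  finally show ?thesis .
qed

lemma nodal_node:
  assumes "j \<le> J" "1 \<le> J"
  shows "nodal J y (real j / real J) = y j"
proof (cases "j < J")
  case True
  then show ?thesis using nodal_formula[of j J "real j / real J" y] assms by simp
next
  case False
  then have "j = J" "J = Suc (J - 1)" using assms by auto
  then show ?thesis using nodal_formula[of "J - 1" J "real j / real J" y] assms by (simp add: of_nat_diff)
qed

lemma continuous_on_nodal: "continuous_on S (nodal J (y :: nat \<Rightarrow> 'a::real_normed_vector))"
  unfolding nodal_def by (intro continuous_intros)

lemma cell_bounds_iff:
  assumes "1 \<le> J"
  shows "x \<in> {(real (Suc l) - 1) / real J..real (Suc l) / real J} \<longleftrightarrow> real l \<le> real J * x \<and> real J * x \<le> real l + 1"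
  using assms by (simp add: pos_divide_le_eq pos_le_divide_eq mult.commute add.commute)

lemma nodal_fem:
  assumes "1 \<le> J"
  shows "nodal J y \<in> fem J"
  unfolding fem_def
proof (intro CollectI conjI ballI)
  show "continuous_on {0..1} (nodal J y)" by (rule continuous_on_nodal)
  fix j assume j: "j \<in> {1..J}"
  define l where "l = j - 1"
  have l: "j = Suc l" "l < J" using j by (auto simp: l_def)
  have "nodal J y x = ((1 + real l) *\<^sub>R y l - real l *\<^sub>R y (Suc l)) + x *\<^sub>R (real J *\<^sub>R (y (Suc l) - y l))"
    if "x \<in> {(real j - 1) / real J..real j / real J}" for x
  proof -
    have "real l \<le> real J * x" "real J * x \<le> real l + 1"
      using that cell_bounds_iff[OF assms, of x l] unfolding l by auto
    from nodal_formula[OF l(2) this, of y] show ?thesis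
      by (simp add: algebra_simps)
  qed
  then show "\<exists>a b. \<forall>x\<in>{(real j - 1) / real J..real j / real J}. nodal J y x = a + x *\<^sub>R b"
    by blast
qed

text \<open>On a cell an affine function is the convex combination of its end values with weight
  \<open>real J * x - real l\<close>, which is what the two active hat functions produce.\<close>

lemma fem_eq_nodal:
  assumes w: "w \<in> fem J" and J: "1 \<le> J" and x: "x \<in> {0..1}"
  shows "w x = nodal J (\<lambda>j. w (real j / real J)) x"
proof -
  obtain l where l: "l < J" "real l \<le> real J * x" "real J * x \<le> real l + 1"
  proof (cases "x = 1")
    case True
    then show ?thesis using that[of "J - 1"] J by (simp add: of_nat_diff)
  next
    case False
    then have "0 \<le> x" "x < 1" using x by auto
    then obtain l where "l < J" "real l \<le> real J * x" "real J * x < real l + 1"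
      using cell_index[OF _ _ J] by metis
    then show ?thesis by (intro that[of l]) auto
  qed
  have "Suc l \<in> {1..J}" using l by auto
  then obtain a b where ab: "\<And>x. x \<in> {(real (Suc l) - 1) / real J..real (Suc l) / real J} \<Longrightarrow> w x = a + x *\<^sub>R b"
    using w unfolding fem_def by blast
  have 1: "w x = a + x *\<^sub>R b"
    using l cell_bounds_iff[OF J, of x l] by (intro ab) blast
  have 2: "w (real l / real J) = a + (real l / real J) *\<^sub>R b"
    using J by (intro ab, subst cell_bounds_iff[OF J]) simp
  have 3: "w (real (Suc l) / real J) = a + (real (Suc l) / real J) *\<^sub>R b"
    using J by (intro ab, subst cell_bounds_iff[OF J]) simp
  define \<theta> where "\<theta> = real J * x - real l"
  have 4: "(1 - \<theta>) *\<^sub>R (a + p *\<^sub>R b) + \<theta> *\<^sub>R (a + q *\<^sub>R b) = a + ((1 - \<theta>) * p + \<theta> * q) *\<^sub>R b" for p q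
    by (simp add: algebra_simps)
  have 5: "(1 - \<theta>) * (real l / real J) + \<theta> * (real (Suc l) / real J) = x"
    using J by (simp add: \<theta>_def field_simps)
  show ?thesis
    unfolding nodal_formula[OF l] 1 2 3 \<theta>_def[symmetric] 4 5 ..
qed

lemma interpol_fem: "1 \<le> J \<Longrightarrow> interpol J v \<in> fem J"
  unfolding interpol_eq_nodal by (rule nodal_fem)

lemma interpol_node: "j \<le> J \<Longrightarrow> 1 \<le> J \<Longrightarrow> interpol J v (real j / real J) = v (real j / real J)"
  unfolding interpol_eq_nodal by (rule nodal_node)

lemma slope_cell:
  assumes "\<lfloor>real J * x\<rfloor> = int l"
  shows "slope J v x = real J *\<^sub>R (v (real (Suc l) / real J) - v (real l / real J))"
  unfolding slope_def assms by (simp add: add.commute)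

lemma slope_cong:
  assumes "\<And>j. j \<le> J \<Longrightarrow> v (real j / real J) = w (real j / real J)" "0 \<le> x" "x < 1" "1 \<le> J"
  shows "slope J v x = slope J w x"
proof -
  obtain l where "l < J" "\<lfloor>real J * x\<rfloor> = int l" using cell_index[OF assms(2-4)] .
  then show ?thesis using assms(1)[of l] assms(1)[of "Suc l"] by (simp add: slope_cell del: of_nat_Suc)
qed

lemma slope_diff: "slope J (\<lambda>x. v x - w x) x = slope J v x - slope J w x"
  by (simp add: slope_def algebra_simps)

lemma slope_step: "slope J v x = (\<lambda>m. real J *\<^sub>R (v ((real_of_int m + 1) / real J) - v (real_of_int m / real J))) \<lfloor>real J * x\<rfloor>"
  by (simp add: slope_def)

lemma integrable_slope:
  fixes v :: "real \<Rightarrow> 'a::euclidean_space"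
  shows "1 \<le> J \<Longrightarrow> integrable (lebesgue_on {0..1}) (slope J v)"
  using integrable_step[of J "\<lambda>m. real J *\<^sub>R (v ((real_of_int m + 1) / real J) - v (real_of_int m / real J))"]
  by (simp add: slope_def[abs_def])

lemma fem_vector_derivative:
  assumes w: "w \<in> fem J" and J: "1 \<le> J" and x: "x \<in> {0<..<1}" "\<And>j. j \<le> J \<Longrightarrow> x \<noteq> real j / real J"
  shows "(w has_vector_derivative slope J w x) (at x)"
proof -
  obtain l where l: "l < J" "\<lfloor>real J * x\<rfloor> = int l" "real l \<le> real J * x" "real J * x < real l + 1"
    using cell_index[of x J] x J by auto
  have "x \<noteq> real l / real J" using x(2)[of l] l(1) by simp
  then have "real l < real J * x" using l(3) J by (auto simp: field_simps less_le)
  define S where "S = {real l / real J<..<real (Suc l) / real J}"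
  have "x \<in> S" using \<open>real l < real J * x\<close> l(4) J by (auto simp: S_def field_simps)
  have "((\<lambda>y. (1 - (real J * y - real l)) *\<^sub>R w (real l / real J) + (real J * y - real l) *\<^sub>R w (real (Suc l) / real J))
     has_vector_derivative slope J w x) (at x)"
    unfolding slope_cell[OF l(2)] scaleR_diff_right
    by (auto intro!: derivative_eq_intros simp del: of_nat_Suc)
  then show ?thesis
  proof (rule has_vector_derivative_transform_within_open)
    show "open S" "x \<in> S" using \<open>x \<in> S\<close> by (auto simp: S_def)
    fix y assume y: "y \<in> S"
    then have "real l \<le> real J * y" "real J * y \<le> real l + 1"
      using J by (auto simp: S_def field_simps)
    moreover have "y \<in> {0..1}"
    proof -
      have "0 \<le> real l / real J" "real (Suc l) / real J \<le> 1" using l(1) by (auto simp: field_simps)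
      moreover have "real l / real J < y" "y < real (Suc l) / real J" using y by (auto simp: S_def)
      ultimately have "0 \<le> y" "y \<le> 1" by linarith+
      then show ?thesis by simp
    qed
    ultimately show "(1 - (real J * y - real l)) *\<^sub>R w (real l / real J) + (real J * y - real l) *\<^sub>R w (real (Suc l) / real J) = w y"
      using fem_eq_nodal[OF w J, of y] nodal_formula[OF l(1), of y "\<lambda>j. w (real j / real J)"] by (simp del: of_nat_Suc)
  qed
qed

text \<open>The product of a test function with \<open>w\<close> is continuous, and differentiable
  off the finitely many nodes, so the fundamental theorem with a finite exceptional set applies; the
  compact support removes the boundary terms.\<close>

lemma fem_has_weak_deriv:
  assumes w: "w \<in> fem J" and J: "1 \<le> J"
  shows "has_weak_deriv 0 1 w (slope J w)"
  unfolding has_weak_deriv_def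
proof (intro conjI allI impI)
  have wc: "continuous_on {0..1} w" using w by (auto simp: fem_def)
  show "integrable (lebesgue_on {0..1}) w" using wc by (rule continuous_imp_integrable_real)
  show iS: "integrable (lebesgue_on {0..1}) (slope J w)" using J by (rule integrable_slope)
  fix \<eta> assume \<eta>: "test_function 0 1 \<eta>"
  then have d: "(\<eta> has_real_derivative deriv \<eta> x) (at x)" for x
    by (simp add: test_function_def DERIV_deriv_iff_real_differentiable)
  have c: "continuous_on {0..1} \<eta>"
    using d by (meson DERIV_isCont continuous_at_imp_continuous_on)
  have c': "continuous_on {0..1} (deriv \<eta>)"
    using \<eta> continuous_on_subset unfolding test_function_def by blast
  have z: "\<eta> 0 = 0" "\<eta> 1 = 0" proof -
    obtain c d where "0 < c" "d < 1" "\<And>x. x \<notin> {c..d} \<Longrightarrow> \<eta> x = 0"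
      using \<eta> unfolding test_function_def by blast
    then show "\<eta> 0 = 0" "\<eta> 1 = 0" by auto
  qed
  have i1: "integrable (lebesgue_on {0..1}) (\<lambda>x. deriv \<eta> x *\<^sub>R w x)"
    by (intro continuous_imp_integrable_real continuous_intros c' wc)
  have i2: "integrable (lebesgue_on {0..1}) (\<lambda>x. \<eta> x *\<^sub>R slope J w x)"
    using c iS by (rule integrable_continuous_scaleR)
  have "((\<lambda>x. \<eta> x *\<^sub>R slope J w x + deriv \<eta> x *\<^sub>R w x) has_integral \<eta> 1 *\<^sub>R w 1 - \<eta> 0 *\<^sub>R w 0) {0..1}"
  proof (rule fundamental_theorem_of_calculus_interior_strong[of "(\<lambda>j. real j / real J) ` {..J}"])
    show "continuous_on {0..1} (\<lambda>x. \<eta> x *\<^sub>R w x)" by (intro continuous_intros c wc)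
    fix x assume x: "x \<in> {0<..<1} - (\<lambda>j. real j / real J) ` {..J}"
    show "((\<lambda>x. \<eta> x *\<^sub>R w x) has_vector_derivative \<eta> x *\<^sub>R slope J w x + deriv \<eta> x *\<^sub>R w x) (at x)"
      using x by (intro has_vector_derivative_scaleR d fem_vector_derivative[OF w J]) auto
  qed auto
  moreover have "((\<lambda>x. \<eta> x *\<^sub>R slope J w x + deriv \<eta> x *\<^sub>R w x) has_integral
      (\<integral>x. \<eta> x *\<^sub>R slope J w x + deriv \<eta> x *\<^sub>R w x \<partial>lebesgue_on {0..1})) {0..1}"
    using i1 i2 by (intro has_integral_integral_lebesgue_on) auto
  ultimately have "(\<integral>x. \<eta> x *\<^sub>R slope J w x + deriv \<eta> x *\<^sub>R w x \<partial>lebesgue_on {0..1}) = \<eta> 1 *\<^sub>R w 1 - \<eta> 0 *\<^sub>R w 0"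
    by (rule has_integral_unique[rotated])
  then have "(\<integral>x. \<eta> x *\<^sub>R slope J w x \<partial>lebesgue_on {0..1}) + (\<integral>x. deriv \<eta> x *\<^sub>R w x \<partial>lebesgue_on {0..1}) = 0"
    using i1 i2 z by simp
  then show "(\<integral>x. deriv \<eta> x *\<^sub>R w x \<partial>lebesgue_on {0..1}) = - (\<integral>x. \<eta> x *\<^sub>R slope J w x \<partial>lebesgue_on {0..1})"
    by (simp add: eq_neg_iff_add_eq_0 add.commute)
qed

section \<open>Sobolev membership, weak derivatives of finite elements and the interpolation
  constant\<close>

lemma square_integrable_continuous: "continuous_on {a..b} v \<Longrightarrow> square_integrable a b v"
  unfolding square_integrable_def
  by (intro conjI continuous_imp_measurable_on_sets_lebesgue continuous_imp_integrable_real continuous_intros) auto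

lemma square_integrable_slope:
  fixes v :: "real \<Rightarrow> 'a::euclidean_space"
  assumes "1 \<le> J" shows "square_integrable 0 1 (slope J v)"
  unfolding square_integrable_def
  using integrable_slope[OF assms, of v]
    integrable_step[OF assms, of "\<lambda>m. (norm (real J *\<^sub>R (v ((real_of_int m + 1) / real J) - v (real_of_int m / real J))))\<^sup>2"]
  by (auto simp: slope_def[abs_def])

lemma fem_W1:
  assumes "w \<in> fem J" "1 \<le> J" shows "w \<in> W 1"
  using assms fem_has_weak_deriv[OF assms] square_integrable_slope[OF assms(2), of w]
  by (auto simp: W_def fem_def intro!: square_integrable_continuous)

lemma W_antimono: "v \<in> W (Suc (Suc k)) \<Longrightarrow> v \<in> W (Suc k)"
proof -
  have "sobolev (Suc k) v \<Longrightarrow> sobolev k v" for k and v :: curve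
    by (induction k arbitrary: v) auto
  then show "v \<in> W (Suc (Suc k)) \<Longrightarrow> v \<in> W (Suc k)" by (auto simp: W_def)
qed

lemma W2_W1: "v \<in> W 2 \<Longrightarrow> v \<in> W 1"
  using W_antimono[of v 0] by (simp add: numeral_2_eq_2)

lemma W1_continuous: "v \<in> W 1 \<Longrightarrow> continuous_on {0..1} v"
  by (simp add: W_def)

lemma W1_weak_deriv_dx: "v \<in> W 1 \<Longrightarrow> has_weak_deriv 0 1 v (dx v)"
  using someI_ex[of "has_weak_deriv 0 1 v"] by (auto simp: W_def dx_def)

lemma dx_AE_eq:
  assumes "continuous_on {0..1} v" "has_weak_deriv 0 1 v g"
  shows "AE x in lebesgue_on {0..1}. dx v x = g x"
proof (rule weak_deriv_unique)
  show "has_weak_deriv 0 1 v (dx v)" unfolding dx_def by (rule someI[of "has_weak_deriv 0 1 v", OF assms(2)])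
qed (use assms in auto)

lemma square_integrable_cong_AE:
  assumes "square_integrable a b f" "AE x in lebesgue_on {a..b}. g x = f x" "g \<in> borel_measurable (lebesgue_on {a..b})"
  shows "square_integrable a b g"
proof -
  have "integrable (lebesgue_on {a..b}) (\<lambda>x. (norm (f x))\<^sup>2) = integrable (lebesgue_on {a..b}) (\<lambda>x. (norm (g x))\<^sup>2)"
    using assms by (intro integrable_cong_AE) (auto simp: square_integrable_def elim: eventually_mono)
  then show ?thesis using assms by (auto simp: square_integrable_def)
qed

lemma W1_square_integrable_dx: "v \<in> W 1 \<Longrightarrow> square_integrable 0 1 (dx v)"
proof -
  assume v: "v \<in> W 1"
  then obtain g where g: "has_weak_deriv 0 1 v g" "square_integrable 0 1 g"
    by (auto simp: W_def)
  show ?thesis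
    using g(2) dx_AE_eq[OF W1_continuous[OF v] g(1)]
    by (rule square_integrable_cong_AE)
       (use weak_deriv_integrable(1)[OF W1_weak_deriv_dx[OF v]] in \<open>rule borel_measurable_integrable\<close>)
qed

lemma dx_fem: "w \<in> fem J \<Longrightarrow> 1 \<le> J \<Longrightarrow> AE x in lebesgue_on {0..1}. dx w x = slope J w x"
  by (rule dx_AE_eq[OF _ fem_has_weak_deriv]) (auto simp: fem_def)

lemma has_weak_deriv_diff:
  assumes "has_weak_deriv 0 1 v g" "has_weak_deriv 0 1 w h"
    and "continuous_on {0..1} v" "continuous_on {0..1} w"
    and "square_integrable 0 1 g" "square_integrable 0 1 h"
  shows "has_weak_deriv 0 1 (\<lambda>x. v x - w x) (\<lambda>x. g x - h x)"
  unfolding has_weak_deriv_def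
proof (intro conjI allI impI)
  note i = weak_deriv_integrable[OF assms(1)] weak_deriv_integrable[OF assms(2)]
  show "integrable (lebesgue_on {0..1}) (\<lambda>x. v x - w x)" "integrable (lebesgue_on {0..1}) (\<lambda>x. g x - h x)"
    using i by auto
  fix \<eta> assume \<eta>: "test_function 0 1 \<eta>"
  note mult = integrable_continuous_scaleR
  have c: "continuous_on {0..1} \<eta>"
    using \<eta> by (intro continuous_at_imp_continuous_on) (auto simp: test_function_def intro: differentiable_imp_continuous_within)
  have c': "continuous_on {0..1} (deriv \<eta>)"
    using \<eta> continuous_on_subset unfolding test_function_def by blast
  show "(\<integral>x. deriv \<eta> x *\<^sub>R (v x - w x) \<partial>lebesgue_on {0..1}) = - (\<integral>x. \<eta> x *\<^sub>R (g x - h x) \<partial>lebesgue_on {0..1})"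
    using assms(1,2) \<eta> i mult[OF c] mult[OF c'] unfolding has_weak_deriv_def scaleR_diff_right
    by (subst (1 2) Bochner_Integration.integral_diff) auto
qed

text \<open>The estimates behind \<open>Cp\<close> speak of \<open>dx\<close> of a difference,
  whereas the argument compares \<open>dx v\<close> with difference quotients; this identifies the
  two.\<close>

lemma dx_diff_interpol:
  assumes v: "v \<in> W 1" and J: "1 \<le> J"
  shows "has_weak_deriv 0 1 (\<lambda>x. v x - interpol J v x) (\<lambda>x. dx v x - slope J v x)"
    and "AE x in lebesgue_on {0..1}. dx (\<lambda>x. v x - interpol J v x) x = dx v x - slope J v x"
proof -
  have I: "interpol J v \<in> fem J" using J by (rule interpol_fem)
  have "has_weak_deriv 0 1 (interpol J v) (slope J (interpol J v))" using I J by (rule fem_has_weak_deriv)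
  have c: "continuous_on {0..1} v" "continuous_on {0..1} (interpol J v)"
    using v I by (auto simp: W_def fem_def)
  have h: "has_weak_deriv 0 1 (\<lambda>x. v x - interpol J v x) (\<lambda>x. dx v x - slope J (interpol J v) x)"
    using W1_weak_deriv_dx[OF v] fem_has_weak_deriv[OF I J] c W1_square_integrable_dx[OF v] square_integrable_slope[OF J]
    by (rule has_weak_deriv_diff)
  \<comment> \<open>Slopes only read nodal values, where a curve and its interpolant agree;
    \<open>x = 1\<close> is left out because there \<open>slope\<close> reads a node beyond the
    mesh.\<close>
  have e: "AE x in lebesgue_on {0..1}. dx v x - slope J (interpol J v) x = dx v x - slope J v x"
  proof -
    have "AE x in lebesgue_on {0..1}. x \<in> {0..1}" by (auto intro: AE_I2)
    moreover have "AE x in lebesgue_on {0..1::real}. x \<noteq> 1" by (rule AE_lebesgue_on_neq) auto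
    ultimately show ?thesis
      by eventually_elim (use J in \<open>auto intro!: slope_cong interpol_node\<close>)
  qed
  have meas: "(\<lambda>x. dx v x - slope J (interpol J v) x) \<in> borel_measurable (lebesgue_on {0..1})"
    "(\<lambda>x. dx v x - slope J v x) \<in> borel_measurable (lebesgue_on {0..1})"
    using weak_deriv_integrable(1)[OF W1_weak_deriv_dx[OF v]] integrable_slope[OF J, of "interpol J v"] integrable_slope[OF J, of v]
    by auto
  show h': "has_weak_deriv 0 1 (\<lambda>x. v x - interpol J v x) (\<lambda>x. dx v x - slope J v x)"
    unfolding has_weak_deriv_def
  proof (intro conjI allI impI)
    show "integrable (lebesgue_on {0..1}) (\<lambda>x. v x - interpol J v x)" using h by (rule weak_deriv_integrable)
    show "integrable (lebesgue_on {0..1}) (\<lambda>x. dx v x - slope J v x)"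
      using weak_deriv_integrable(1)[OF W1_weak_deriv_dx[OF v]] integrable_slope[OF J, of v] by auto
    fix \<eta> assume \<eta>: "test_function 0 1 \<eta>"
    then have "\<eta> \<in> borel_measurable (lebesgue_on {0..1})"
      by (intro continuous_imp_measurable_on_sets_lebesgue continuous_at_imp_continuous_on)
         (auto simp: test_function_def intro: differentiable_imp_continuous_within)
    then have "(\<integral>x. \<eta> x *\<^sub>R (dx v x - slope J (interpol J v) x) \<partial>lebesgue_on {0..1}) = (\<integral>x. \<eta> x *\<^sub>R (dx v x - slope J v x) \<partial>lebesgue_on {0..1})"
      using e meas by (intro integral_cong_AE borel_measurable_scaleR) (auto elim: eventually_mono)
    then show "(\<integral>x. deriv \<eta> x *\<^sub>R (v x - interpol J v x) \<partial>lebesgue_on {0..1}) = - (\<integral>x. \<eta> x *\<^sub>R (dx v x - slope J v x) \<partial>lebesgue_on {0..1})"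
      using h \<eta> unfolding has_weak_deriv_def by simp
  qed
  show "AE x in lebesgue_on {0..1}. dx (\<lambda>x. v x - interpol J v x) x = dx v x - slope J v x"
    using c h' by (intro dx_AE_eq) (auto intro!: continuous_intros)
qed

lemma L2_norm_nonneg [simp]: "0 \<le> L2_norm a b f"
  by (simp add: L2_norm_def)

lemma L2_norm_square: "(L2_norm a b f)\<^sup>2 = (\<integral>x. (norm (f x))\<^sup>2 \<partial>lebesgue_on {a..b})"
  by (simp add: L2_norm_def)

lemma L2_norm_le_W_norm: "j \<le> k \<Longrightarrow> L2_norm 0 1 ((dx ^^ j) v) \<le> W_norm k v"
  unfolding W_norm_def
  by (rule real_le_rsqrt) (rule member_le_sum[of j "{..k}" "\<lambda>j. (L2_norm 0 1 ((dx ^^ j) v))\<^sup>2"], auto)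

lemma W_norm_nonneg [simp]: "0 \<le> W_norm k v"
  by (simp add: W_norm_def sum_nonneg)

lemma Linf_norm_AE:
  assumes "Linf_norm a b f \<le> ereal c"
  shows "AE x in lebesgue_on {a..b}. norm (f x) \<le> c"
  using esssup_AE[where M="lebesgue_on {a..b}" and f="\<lambda>x. ereal (norm (f x))"]
proof eventually_elim
  case (elim x)
  then show ?case using assms unfolding Linf_norm_def by (meson ereal_less_eq(3) order_trans)
qed

lemma interpolation_constantD:
  assumes "interpolation_constant Cp" "1 \<le> J"
  shows "0 < Cp"
    and "v \<in> W 1 \<Longrightarrow> L2_norm 0 1 (\<lambda>x. v x - interpol J v x) \<le> Cp * (1 / real J) * W_norm 1 v"
    and "v \<in> W 2 \<Longrightarrow> L2_norm 0 1 (dx (\<lambda>x. v x - interpol J v x)) \<le> Cp * (1 / real J) * W_norm 2 v"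
    and "v \<in> W 2 \<Longrightarrow> Linf_norm 0 1 (dx (\<lambda>x. v x - interpol J v x)) \<le> ereal (Cp * sqrt (1 / real J) * L2_norm 0 1 (dx (dx v)))"
    and "w \<in> fem J \<Longrightarrow> L2_norm 0 1 (dx w) \<le> Cp * real J * L2_norm 0 1 w"
    and "w \<in> fem J \<Longrightarrow> Linf_norm 0 1 w \<le> ereal (Cp * sqrt (real J) * L2_norm 0 1 w)"
proof -
  note d = assms(1)[unfolded interpolation_constant_def Let_def, THEN conjunct2, THEN spec[of _ J], THEN mp, OF assms(2)]
  note d2 = d[THEN conjunct2] note d3 = d2[THEN conjunct2] note d4 = d3[THEN conjunct2] note d5 = d4[THEN conjunct2]
  note d6 = d5[THEN conjunct2]
  show "0 < Cp" using assms(1) by (simp add: interpolation_constant_def)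
  show "v \<in> W 1 \<Longrightarrow> L2_norm 0 1 (\<lambda>x. v x - interpol J v x) \<le> Cp * (1 / real J) * W_norm 1 v"
    using d[THEN conjunct1, THEN bspec[of _ _ 1], THEN bspec[of _ _ v]] by simp
  show "v \<in> W 2 \<Longrightarrow> L2_norm 0 1 (dx (\<lambda>x. v x - interpol J v x)) \<le> Cp * (1 / real J) * W_norm 2 v"
    using d2[THEN conjunct1, THEN bspec[of _ _ v]] .
  show "v \<in> W 2 \<Longrightarrow> Linf_norm 0 1 (dx (\<lambda>x. v x - interpol J v x)) \<le> ereal (Cp * sqrt (1 / real J) * L2_norm 0 1 (dx (dx v)))"
    using d5[THEN conjunct1, THEN bspec[of _ _ v]] .
  show "w \<in> fem J \<Longrightarrow> L2_norm 0 1 (dx w) \<le> Cp * real J * L2_norm 0 1 w"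
    using d6[THEN bspec[of _ _ w], THEN conjunct1] by simp
  show "w \<in> fem J \<Longrightarrow> Linf_norm 0 1 w \<le> ereal (Cp * sqrt (real J) * L2_norm 0 1 w)"
    using d6[THEN bspec[of _ _ w], THEN conjunct2, THEN conjunct1] by (simp add: real_sqrt_divide)
qed

text \<open>The sup-norm estimate for slopes in Lipschitz form. In this form it involves point
  values only and can be integrated in time.\<close>

lemma interpol_error_Lipschitz:
  assumes Cp: "interpolation_constant Cp" and J: "1 \<le> J" and v: "v \<in> W 2" and x: "x \<in> {0..1}" "y \<in> {0..1}"
  shows "norm ((v x - interpol J v x) - (v y - interpol J v y)) \<le> Cp * sqrt (1 / real J) * W_norm 2 v * \<bar>x - y\<bar>"
proof -
  have v1: "v \<in> W 1" using v by (rule W2_W1)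
  have c: "continuous_on {0..1} (\<lambda>x. v x - interpol J v x)"
    using v interpol_fem[OF J, of v] by (auto simp: W_def fem_def intro!: continuous_intros)
  have "AE x in lebesgue_on {0..1}. norm (dx (\<lambda>x. v x - interpol J v x) x) \<le> Cp * sqrt (1 / real J) * L2_norm 0 1 (dx (dx v))"
    by (rule Linf_norm_AE) (rule interpolation_constantD(4)[OF Cp J v])
  moreover have "L2_norm 0 1 (dx (dx v)) \<le> W_norm 2 v"
    using L2_norm_le_W_norm[of 2 2 v] by (simp add: numeral_2_eq_2)
  then have "Cp * sqrt (1 / real J) * L2_norm 0 1 (dx (dx v)) \<le> Cp * sqrt (1 / real J) * W_norm 2 v"
    using interpolation_constantD(1)[OF Cp J] by (intro mult_left_mono) auto
  ultimately have "AE x in lebesgue_on {0..1}. norm (dx (\<lambda>x. v x - interpol J v x) x) \<le> Cp * sqrt (1 / real J) * W_norm 2 v"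
    by (auto elim: eventually_mono)
  with dx_diff_interpol(2)[OF v1 J]
  have "AE x in lebesgue_on {0..1}. norm (dx v x - slope J v x) \<le> Cp * sqrt (1 / real J) * W_norm 2 v"
    by eventually_elim simp
  from Lipschitz_of_weak_deriv[OF c dx_diff_interpol(1)[OF v1 J] _ this x] show ?thesis by simp
qed

section \<open>The relative energy of slopes\<close>

text \<open>Only \<open>p\<close> has to stay away from 0: for \<open>q = 0\<close> the convention
  \<open>sgn 0 = 0\<close> gives the bound directly, and otherwise scaling by \<open>norm p\<close>
  splits the difference into a change of vector and a change of length.\<close>

lemma norm_sgn_diff_le:
  fixes p q :: "'a::real_normed_vector"
  assumes "p \<noteq> 0"
  shows "norm (sgn p - sgn q) \<le> 2 * norm (p - q) / norm p"
proof (cases "q = 0")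
  case True
  then show ?thesis using assms by (simp add: norm_sgn)
next
  case False
  have "norm p *\<^sub>R (sgn p - sgn q) = (p - q) + (norm q - norm p) *\<^sub>R sgn q"
    using assms False by (simp add: sgn_div_norm algebra_simps)
  then have "norm p * norm (sgn p - sgn q) = norm ((p - q) + (norm q - norm p) *\<^sub>R sgn q)"
    by (metis norm_scaleR abs_norm_cancel)
  also have "\<dots> \<le> norm (p - q) + \<bar>norm q - norm p\<bar> * 1"
    using False by (intro order_trans[OF norm_triangle_ineq]) (simp add: norm_sgn)
  also have "\<dots> \<le> 2 * norm (p - q)"
    using norm_triangle_ineq3[of q p] by (simp add: norm_minus_commute)
  finally show ?thesis using assms by (simp add: field_simps)
qed

lemma norm_sgn_diff_square:
  fixes p q :: "'a::real_inner"
  assumes "p \<noteq> 0" "q \<noteq> 0"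
  shows "(norm (sgn q - sgn p))\<^sup>2 = 2 - 2 * (sgn q \<bullet> sgn p)"
proof -
  have "sgn q \<bullet> sgn q = 1" "sgn p \<bullet> sgn p = 1"
    using assms by (simp_all add: dot_square_norm norm_sgn)
  then show ?thesis
    by (simp add: power2_norm_eq_inner inner_diff_left inner_diff_right inner_commute)
qed

text \<open>The subtracted term is the derivative of \<open>sgn\<close> at \<open>p\<close> applied
  to \<open>q - p\<close>; since \<open>p\<close> lies in its kernel, \<open>q\<close> is written
  instead. So this is a Taylor remainder, quadratic without any smallness of
  \<open>q - p\<close>.\<close>

lemma sgn_second_order_remainder:
  fixes p q :: "'a::real_inner"
  assumes p: "p \<noteq> 0" and q: "q \<noteq> 0"
  shows "norm (sgn q - sgn p - (q - (q \<bullet> sgn p) *\<^sub>R sgn p) /\<^sub>R norm p) \<le> 4 * (norm (q - p))\<^sup>2 / (norm p)\<^sup>2"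
proof -
  define \<sigma> \<tau> s where "\<sigma> = sgn q" and "\<tau> = sgn p" and "s = \<sigma> \<bullet> \<tau>"
  have unit: "\<sigma> \<bullet> \<sigma> = 1" "\<tau> \<bullet> \<tau> = 1" "norm \<tau> = 1"
    using assms by (simp_all add: dot_square_norm norm_sgn \<sigma>_def \<tau>_def)
  have q_eq: "q = norm q *\<^sub>R \<sigma>" using q by (simp add: \<sigma>_def sgn_div_norm)
  have sq: "(norm (\<sigma> - \<tau>))\<^sup>2 = 2 - 2 * s"
    using norm_sgn_diff_square[OF p q] by (simp add: \<sigma>_def \<tau>_def s_def)
  have "sgn q - sgn p - (q - (q \<bullet> sgn p) *\<^sub>R sgn p) /\<^sub>R norm p
      = \<sigma> - \<tau> - (norm q / norm p) *\<^sub>R (\<sigma> - s *\<^sub>R \<tau>)"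
    unfolding \<tau>_def[symmetric] \<sigma>_def[symmetric]
    by (subst (1 2) q_eq) (simp add: s_def algebra_simps divide_inverse)
  \<comment> \<open>For unit vectors \<open>1 - s\<close> is half the squared distance of
    \<open>\<sigma>\<close> and \<open>\<tau>\<close>. This makes one summand visibly quadratic,
    while the other is a product of two first-order terms.\<close>
  also have "\<dots> = (1 - norm q / norm p) *\<^sub>R (\<sigma> - s *\<^sub>R \<tau>) - ((norm (\<sigma> - \<tau>))\<^sup>2 / 2) *\<^sub>R \<tau>"
  proof -
    have "(norm (\<sigma> - \<tau>))\<^sup>2 / 2 = 1 - s" using sq by simp
    then show ?thesis by (simp only:) (simp add: algebra_simps)
  qed
  finally have eq: "sgn q - sgn p - (q - (q \<bullet> sgn p) *\<^sub>R sgn p) /\<^sub>R norm p = \<dots>" .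
  have d: "norm (\<sigma> - \<tau>) \<le> 2 * norm (q - p) / norm p"
    using norm_sgn_diff_le[OF p, of q] by (simp add: \<sigma>_def \<tau>_def norm_minus_commute)
  have "(norm (\<sigma> - s *\<^sub>R \<tau>))\<^sup>2 = 1 - s\<^sup>2"
    unfolding power2_norm_eq_inner using unit
    by (simp add: inner_diff_left inner_diff_right inner_commute[of \<tau> \<sigma>] s_def[symmetric] power2_eq_square)
  also have "\<dots> \<le> (norm (\<sigma> - \<tau>))\<^sup>2"
    unfolding sq using zero_le_power2[of "1 - s"] by (simp add: power2_eq_square algebra_simps)
  finally have e: "norm (\<sigma> - s *\<^sub>R \<tau>) \<le> norm (\<sigma> - \<tau>)"
    by (rule power2_le_imp_le) simp
  have f: "\<bar>1 - norm q / norm p\<bar> \<le> norm (q - p) / norm p"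
  proof -
    have "\<bar>1 - norm q / norm p\<bar> = \<bar>norm p - norm q\<bar> / norm p"
      using p by (simp add: field_simps abs_divide[symmetric])
    also have "\<dots> \<le> norm (q - p) / norm p"
      using norm_triangle_ineq3[of p q] by (intro divide_right_mono) (auto simp: norm_minus_commute)
    finally show ?thesis .
  qed
  have "norm (sgn q - sgn p - (q - (q \<bullet> sgn p) *\<^sub>R sgn p) /\<^sub>R norm p)
     \<le> \<bar>1 - norm q / norm p\<bar> * norm (\<sigma> - s *\<^sub>R \<tau>) + (norm (\<sigma> - \<tau>))\<^sup>2 / 2"
    unfolding eq by (rule order_trans[OF norm_triangle_ineq4]) (simp add: unit)
  also have "\<dots> \<le> norm (q - p) / norm p * (2 * norm (q - p) / norm p) + (2 * norm (q - p) / norm p)\<^sup>2 / 2"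
    using d e by (intro add_mono mult_mono f divide_right_mono power_mono) auto
  also have "\<dots> = 4 * (norm (q - p))\<^sup>2 / (norm p)\<^sup>2"
    by (simp add: power2_eq_square)
  finally show ?thesis .
qed

text \<open>The Bregman distance of \<open>\<epsilon> / 2 * (norm q)\<^sup>2 + norm q\<close> at
  \<open>p \<noteq> 0\<close>. The norm alone is not strictly convex along rays, so the quadratic
  part supplies the control of \<open>q - p\<close>.\<close>

definition rel_energy :: "real \<Rightarrow> 'a::real_inner \<Rightarrow> 'a \<Rightarrow> real" where
  "rel_energy \<epsilon> p q = \<epsilon> / 2 * (norm (q - p))\<^sup>2 + (norm q - q \<bullet> sgn p)"

lemma rel_energy_ge: "\<epsilon> / 2 * (norm (q - p))\<^sup>2 \<le> rel_energy \<epsilon> p q"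
proof -
  have "q \<bullet> sgn p \<le> norm q * norm (sgn p)" by (rule norm_cauchy_schwarz)
  also have "\<dots> \<le> norm q" by (simp add: norm_sgn)
  finally show ?thesis by (simp add: rel_energy_def)
qed

text \<open>The angular part equals \<open>norm q / 2\<close> times the squared distance of the unit
  directions, to which the Lipschitz bound of \<open>sgn\<close> applies. This converse of
  \<open>rel_energy_ge\<close> serves to bound the energy at the initial time.\<close>

lemma rel_energy_le:
  assumes p: "p \<noteq> 0" and q: "q \<noteq> 0"
  shows "rel_energy \<epsilon> p q \<le> (\<epsilon> / 2 + 2 / norm q) * (norm (q - p))\<^sup>2"
proof -
  have "norm q - q \<bullet> sgn p = norm q * (1 - sgn q \<bullet> sgn p)"
    using q by (simp add: sgn_div_norm algebra_simps)
  also have "\<dots> = norm q / 2 * (norm (sgn q - sgn p))\<^sup>2"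
    by (simp add: norm_sgn_diff_square[OF p q])
  also have "\<dots> \<le> norm q / 2 * (2 * norm (q - p) / norm q)\<^sup>2"
    using norm_sgn_diff_le[OF q, of p] by (intro mult_left_mono power_mono) auto
  also have "\<dots> = 2 / norm q * (norm (q - p))\<^sup>2"
    using q by (simp add: power2_eq_square)
  finally show ?thesis by (simp add: rel_energy_def algebra_simps)
qed

lemma rel_energy_has_derivative:
  fixes z :: "'a::euclidean_space \<times> 'a"
  assumes "fst z \<noteq> 0" "snd z \<noteq> 0"
  shows "((\<lambda>z. rel_energy \<epsilon> (fst z) (snd z)) has_derivative
    (\<lambda>v. (- (\<epsilon> *\<^sub>R (snd z - fst z)) - (snd z - (snd z \<bullet> sgn (fst z)) *\<^sub>R sgn (fst z)) /\<^sub>R norm (fst z),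
          \<epsilon> *\<^sub>R (snd z - fst z) + sgn (snd z) - sgn (fst z)) \<bullet> v)) (at z)"
proof -
  have 1: "((\<lambda>z. norm (f z)) has_derivative (\<lambda>v. sgn (f z) \<bullet> f' v)) (at z)"
    if "(f has_derivative f') (at z)" "f z \<noteq> 0" for f f' :: "'a \<times> 'a \<Rightarrow> 'a"
  proof -
    have "((\<lambda>x. norm x) has_derivative (\<lambda>v. sgn (f z) \<bullet> v)) (at (f z))"
      using has_derivative_norm[OF that(2)] by (simp add: sgn_div_norm inner_commute)
    from has_derivative_compose[OF that(1) this] show ?thesis .
  qed
  have fs: "(fst has_derivative fst) (at z)" "(snd has_derivative snd) (at z)"
    by (auto intro!: bounded_linear_imp_has_derivative bounded_linear_fst bounded_linear_snd)
  have nz: "norm (fst z) \<noteq> 0" using assms by simp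
  note D1 = has_derivative_inner[OF has_derivative_diff[OF fs(2,1)] has_derivative_diff[OF fs(2,1)]]
  note D2 = 1[OF fs(2) assms(2)]
  note D3 = has_derivative_divide'[OF has_derivative_inner[OF fs(2,1)] 1[OF fs(1) assms(1)] nz]
  \<comment> \<open>The energy is first written with inner products and a quotient, the shape to
    which the rules \<open>D1\<close>, \<open>D2\<close> and \<open>D3\<close> apply.\<close>
  have "((\<lambda>z. \<epsilon> / 2 * ((snd z - fst z) \<bullet> (snd z - fst z)) + (norm (snd z) - (snd z \<bullet> fst z) / norm (fst z))) has_derivative
    (\<lambda>v. (- (\<epsilon> *\<^sub>R (snd z - fst z)) - (snd z - (snd z \<bullet> sgn (fst z)) *\<^sub>R sgn (fst z)) /\<^sub>R norm (fst z),
          \<epsilon> *\<^sub>R (snd z - fst z) + sgn (snd z) - sgn (fst z)) \<bullet> v)) (at z)"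
  proof (rule has_derivative_eq_rhs[OF has_derivative_add[OF has_derivative_mult_right[OF D1] has_derivative_diff[OF D2 D3]]])
    define x y n where "x = fst z" and "y = snd z" and "n = norm (fst z)"
    have n: "n \<noteq> 0" using assms by (simp add: n_def)
    have nx: "norm x = n" by (simp add: n_def x_def)
    have sx: "sgn (fst z) = (1 / n) *\<^sub>R x" by (simp add: x_def n_def sgn_div_norm divide_inverse)
    show "(\<lambda>h. \<epsilon> / 2 * ((snd z - fst z) \<bullet> (snd h - fst h) + (snd h - fst h) \<bullet> (snd z - fst z)) +
          (sgn (snd z) \<bullet> snd h - ((snd z \<bullet> fst h + snd h \<bullet> fst z) * norm (fst z) - snd z \<bullet> fst z * (sgn (fst z) \<bullet> fst h)) / (norm (fst z) * norm (fst z)))) =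
      (\<lambda>v. (- (\<epsilon> *\<^sub>R (snd z - fst z)) - (snd z - (snd z \<bullet> sgn (fst z)) *\<^sub>R sgn (fst z)) /\<^sub>R norm (fst z),
          \<epsilon> *\<^sub>R (snd z - fst z) + sgn (snd z) - sgn (fst z)) \<bullet> v)"
      unfolding sx unfolding n_def[symmetric] x_def[symmetric] y_def[symmetric]
    proof (rule ext, goal_cases)
      case (1 h)
      have c: "snd h \<bullet> x = x \<bullet> snd h" "snd h \<bullet> y = y \<bullet> snd h" "fst h \<bullet> x = x \<bullet> fst h" "fst h \<bullet> y = y \<bullet> fst h"
        "y \<bullet> x = x \<bullet> y"
        by (rule inner_commute)+
      have q: "inverse n * t = t / n" for t :: real
        by (simp add: divide_inverse)
      \<comment> \<open>After expansion only the values of the inner products remain, and the claim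
        is a rational identity in them.\<close>
      have r: "\<epsilon> / 2 * (d - b - (c - a) + (d - c - (b - a))) + (e - ((b + c) * n - k * (1 / n * a)) / (n * n))
         = - (\<epsilon> * (b - a)) - (b - 1 / n * k * (1 / n * a)) / n + (\<epsilon> * (d - c) + e - 1 / n * c)"
        for a b c d e k :: real
      proof -
        have "((b + c) * n - k * (1 / n * a)) / (n * n) = b / n + c / n - k * a / (n * n * n)"
          using n by (simp add: diff_divide_distrib add_divide_distrib distrib_right)
        moreover have "(b - 1 / n * k * (1 / n * a)) / n = b / n - k * a / (n * n * n)"
          using n by (simp add: diff_divide_distrib)
        ultimately show ?thesis by (simp add: algebra_simps)
      qed
      show ?case
        unfolding inner_prod_def fst_conv snd_conv inner_diff_left inner_add_left inner_minus_left inner_scaleR_left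
          inner_scaleR_right
        unfolding inner_diff_right c nx q
        by (rule r)
    qed
  qed
  moreover have "(\<lambda>z. \<epsilon> / 2 * ((snd z - fst z) \<bullet> (snd z - fst z)) + (norm (snd z) - (snd z \<bullet> fst z) / norm (fst z)))
      = (\<lambda>z::'a \<times> 'a. rel_energy \<epsilon> (fst z) (snd z))"
    unfolding rel_energy_def power2_norm_eq_inner sgn_div_norm inner_scaleR_right divide_inverse
    by (simp only: mult.commute)
  ultimately show ?thesis by (simp only:)
qed

section \<open>The anisotropic mass integrand\<close>

definition aniso :: "real \<Rightarrow> real^2 \<Rightarrow> real^2 \<Rightarrow> real^2 \<Rightarrow> real" where
  "aniso \<epsilon> p w \<phi> = (w \<bullet> perp (sgn p)) * (\<phi> \<bullet> perp (sgn p)) * norm p + \<epsilon> * ((w \<bullet> p) * (\<phi> \<bullet> p))"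

lemma inner_real2: "(a :: real^2) \<bullet> b = a $ 1 * b $ 1 + a $ 2 * b $ 2"
  by (simp add: inner_vec_def sum_2)

lemma perp_inner: "a \<bullet> perp b = - a $ 1 * b $ 2 + a $ 2 * b $ 1"
  by (simp add: inner_real2 perp_def)

lemma norm_perp [simp]: "norm (perp a) = norm a"
  by (simp add: norm_eq_sqrt_inner inner_real2 perp_def)

lemma perp_scaleR: "perp (c *\<^sub>R a) = c *\<^sub>R perp a"
  by (simp add: perp_def vec_eq_iff forall_2)

lemma perp_diff: "perp (a - b) = perp a - perp b"
  by (simp add: perp_def vec_eq_iff forall_2)

text \<open>The tangential weight \<open>(norm p)\<^sup>2\<close> cancels the two normalizations,
  which is why \<open>aniso\<close> has \<open>p\<close> itself in its tangential part. The
  right-hand side is the pair of integrands found in \<open>weak_equation\<close>.\<close>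

lemma aniso_eq:
  "aniso \<epsilon> p w \<phi> = (w \<bullet> (perp p /\<^sub>R norm p)) * (\<phi> \<bullet> (perp p /\<^sub>R norm p)) * norm p
     + \<epsilon> * ((w \<bullet> (p /\<^sub>R norm p)) * (\<phi> \<bullet> (p /\<^sub>R norm p)) * (norm p)\<^sup>2)"
  by (cases "p = 0") (simp_all add: aniso_def sgn_div_norm perp_scaleR power2_eq_square field_simps)

lemma aniso_add_left: "aniso \<epsilon> p (w + w') \<phi> = aniso \<epsilon> p w \<phi> + aniso \<epsilon> p w' \<phi>"
  and aniso_diff_left: "aniso \<epsilon> p (w - w') \<phi> = aniso \<epsilon> p w \<phi> - aniso \<epsilon> p w' \<phi>"
  and aniso_scaleR_left: "aniso \<epsilon> p (c *\<^sub>R w) \<phi> = c * aniso \<epsilon> p w \<phi>"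
  and aniso_commute: "aniso \<epsilon> p w \<phi> = aniso \<epsilon> p \<phi> w"
  by (simp_all add: aniso_def algebra_simps inner_add_left inner_diff_left)

lemma norm_perp_sgn_le: "norm (perp (sgn p)) \<le> 1"
  by (simp add: norm_sgn)

lemma inner_abs_le: "norm b \<le> B \<Longrightarrow> \<bar>a \<bullet> b\<bar> \<le> norm a * B"
  by (rule order_trans[OF Cauchy_Schwarz_ineq2]) (simp add: mult_left_mono)

lemma aniso_bound:
  assumes "0 \<le> \<epsilon>"
  shows "\<bar>aniso \<epsilon> p w \<phi>\<bar> \<le> (norm p + \<epsilon> * (norm p)\<^sup>2) * norm w * norm \<phi>"
proof -
  have "\<bar>(w \<bullet> perp (sgn p)) * (\<phi> \<bullet> perp (sgn p)) * norm p\<bar> \<le> (norm w * 1) * (norm \<phi> * 1) * norm p"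
    unfolding abs_mult by (intro mult_mono inner_abs_le norm_perp_sgn_le) auto
  moreover have "\<bar>\<epsilon> * ((w \<bullet> p) * (\<phi> \<bullet> p))\<bar> \<le> \<epsilon> * ((norm w * norm p) * (norm \<phi> * norm p))"
    unfolding abs_mult using assms by (intro mult_mono inner_abs_le) auto
  ultimately show ?thesis
    by (simp add: aniso_def power2_eq_square algebra_simps)
qed

text \<open>\<open>sgn p\<close> and \<open>perp (sgn p)\<close> form an orthonormal frame. The
  normal component is weighted by at least \<open>c\<close>, the tangential one by at least
  \<open>\<epsilon> * c\<^sup>2\<close>, hence the minimum.\<close>

lemma aniso_coercive:
  assumes "0 \<le> \<epsilon>" "0 < c" "c \<le> norm p"
  shows "min c (\<epsilon> * c\<^sup>2) * (norm w)\<^sup>2 \<le> aniso \<epsilon> p w w"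
proof -
  have p: "p \<noteq> 0" using assms by auto
  define \<tau> where "\<tau> = sgn p"
  have "\<tau> \<bullet> \<tau> = 1" using p by (simp add: \<tau>_def dot_square_norm norm_sgn)
  then have t: "\<tau>$1 * \<tau>$1 + \<tau>$2 * \<tau>$2 = 1" by (simp add: inner_real2)
  have "(w \<bullet> perp \<tau>)\<^sup>2 + (w \<bullet> \<tau>)\<^sup>2 = (w$1 * w$1 + w$2 * w$2) * (\<tau>$1 * \<tau>$1 + \<tau>$2 * \<tau>$2)"
    unfolding perp_inner inner_real2[of w \<tau>] by (simp add: power2_eq_square algebra_simps)
  also have "\<dots> = (norm w)\<^sup>2"
    unfolding t by (simp add: power2_norm_eq_inner inner_real2)
  finally have s: "(norm w)\<^sup>2 = (w \<bullet> perp \<tau>)\<^sup>2 + (w \<bullet> \<tau>)\<^sup>2" ..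
  have wp: "w \<bullet> p = norm p * (w \<bullet> \<tau>)" using p by (simp add: \<tau>_def sgn_div_norm)
  have "aniso \<epsilon> p w w = norm p * (w \<bullet> perp \<tau>)\<^sup>2 + \<epsilon> * (norm p)\<^sup>2 * (w \<bullet> \<tau>)\<^sup>2"
    unfolding aniso_def wp \<tau>_def[symmetric] by (simp add: power2_eq_square)
  moreover have "min c (\<epsilon> * c\<^sup>2) * (w \<bullet> perp \<tau>)\<^sup>2 \<le> norm p * (w \<bullet> perp \<tau>)\<^sup>2"
    using assms by (intro mult_right_mono) auto
  moreover have "\<epsilon> * c\<^sup>2 \<le> \<epsilon> * (norm p)\<^sup>2"
    using assms by (intro mult_left_mono power_mono) auto
  then have "min c (\<epsilon> * c\<^sup>2) * (w \<bullet> \<tau>)\<^sup>2 \<le> \<epsilon> * (norm p)\<^sup>2 * (w \<bullet> \<tau>)\<^sup>2"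
    by (intro mult_right_mono) auto
  ultimately show ?thesis
    unfolding s by (simp add: distrib_left)
qed

lemma abs_product_diff_le:
  fixes a b a' b' :: real
  assumes "\<bar>a\<bar> \<le> A" "\<bar>b'\<bar> \<le> B" "\<bar>a - a'\<bar> \<le> dA" "\<bar>b - b'\<bar> \<le> dB"
  shows "\<bar>a * b - a' * b'\<bar> \<le> A * dB + dA * B"
proof -
  have "a * b - a' * b' = a * (b - b') + (a - a') * b'" by (simp add: algebra_simps)
  moreover have "\<bar>a * (b - b')\<bar> \<le> A * dB" "\<bar>(a - a') * b'\<bar> \<le> dA * B"
    unfolding abs_mult using assms by (auto intro!: mult_mono)
  ultimately show ?thesis using abs_triangle_ineq[of "a * (b - b')" "(a - a') * b'"] by linarith
qed

text \<open>Each of the two unit directions changes by at most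
  \<open>2 * norm (p - q) / norm p\<close>, and the factor \<open>norm p\<close> cancels the
  denominator: this gives 4, and the change of length adds 1. So the constant contains no inverse
  power of the slopes.\<close>

lemma aniso_Lipschitz:
  assumes "0 \<le> \<epsilon>" "p \<noteq> 0" "q \<noteq> 0"
  shows "\<bar>aniso \<epsilon> p w \<phi> - aniso \<epsilon> q w \<phi>\<bar> \<le> (5 + \<epsilon> * (norm p + norm q)) * norm (p - q) * norm w * norm \<phi>"
proof -
  define \<delta> where "\<delta> = norm (p - q)"
  have sd: "norm (perp (sgn p) - perp (sgn q)) \<le> 2 * \<delta> / norm p"
    unfolding perp_diff[symmetric] norm_perp \<delta>_def using norm_sgn_diff_le[OF assms(2)] .
  have i: "\<bar>w \<bullet> perp (sgn x)\<bar> \<le> norm w" "\<bar>w \<bullet> perp (sgn p) - w \<bullet> perp (sgn q)\<bar> \<le> norm w * (2 * \<delta> / norm p)" for w x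
    using inner_abs_le[OF norm_perp_sgn_le, of w x] inner_abs_le[OF sd, of w] by (auto simp: inner_diff_right)
  have "\<bar>(w \<bullet> perp (sgn p)) * (\<phi> \<bullet> perp (sgn p)) - (w \<bullet> perp (sgn q)) * (\<phi> \<bullet> perp (sgn q))\<bar>
      \<le> norm w * (norm \<phi> * (2 * \<delta> / norm p)) + (norm w * (2 * \<delta> / norm p)) * norm \<phi>"
    by (intro abs_product_diff_le i)
  also have "\<dots> = norm w * norm \<phi> * (4 * \<delta> / norm p)" by (simp add: algebra_simps)
  finally have d1: "\<bar>(w \<bullet> perp (sgn p)) * (\<phi> \<bullet> perp (sgn p)) - (w \<bullet> perp (sgn q)) * (\<phi> \<bullet> perp (sgn q))\<bar>
      \<le> norm w * norm \<phi> * (4 * \<delta> / norm p)" .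
  have b1: "\<bar>(w \<bullet> perp (sgn q)) * (\<phi> \<bullet> perp (sgn q))\<bar> \<le> norm w * norm \<phi>"
    unfolding abs_mult by (intro mult_mono i) auto
  have "\<bar>norm p * ((w \<bullet> perp (sgn p)) * (\<phi> \<bullet> perp (sgn p))) - norm q * ((w \<bullet> perp (sgn q)) * (\<phi> \<bullet> perp (sgn q)))\<bar>
      \<le> norm p * (norm w * norm \<phi> * (4 * \<delta> / norm p)) + \<delta> * (norm w * norm \<phi>)"
    using norm_triangle_ineq3[of p q] by (intro abs_product_diff_le b1 d1) (auto simp: \<delta>_def)
  also have "\<dots> = 5 * \<delta> * norm w * norm \<phi>"
    using assms(2) by (simp add: algebra_simps)
  finally have 1: "\<bar>(w \<bullet> perp (sgn p)) * (\<phi> \<bullet> perp (sgn p)) * norm p - (w \<bullet> perp (sgn q)) * (\<phi> \<bullet> perp (sgn q)) * norm q\<bar>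
      \<le> 5 * \<delta> * norm w * norm \<phi>" by (simp add: mult_ac)
  have j: "\<bar>w \<bullet> x\<bar> \<le> norm w * norm x" "\<bar>w \<bullet> p - w \<bullet> q\<bar> \<le> norm w * \<delta>" for w x :: "real^2"
    unfolding inner_diff_right[symmetric] \<delta>_def by (auto intro: Cauchy_Schwarz_ineq2)
  have "\<bar>(w \<bullet> p) * (\<phi> \<bullet> p) - (w \<bullet> q) * (\<phi> \<bullet> q)\<bar> \<le> (norm w * norm p) * (norm \<phi> * \<delta>) + (norm w * \<delta>) * (norm \<phi> * norm q)"
    by (intro abs_product_diff_le j)
  also have "\<dots> = (norm p + norm q) * \<delta> * norm w * norm \<phi>" by (simp add: algebra_simps)
  finally have "\<bar>\<epsilon> * ((w \<bullet> p) * (\<phi> \<bullet> p)) - \<epsilon> * ((w \<bullet> q) * (\<phi> \<bullet> q))\<bar> \<le> \<epsilon> * ((norm p + norm q) * \<delta> * norm w * norm \<phi>)"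
    unfolding right_diff_distrib[symmetric] abs_mult using assms(1) by (simp add: mult_left_mono)
  moreover have "\<bar>aniso \<epsilon> p w \<phi> - aniso \<epsilon> q w \<phi>\<bar>
     \<le> \<bar>(w \<bullet> perp (sgn p)) * (\<phi> \<bullet> perp (sgn p)) * norm p - (w \<bullet> perp (sgn q)) * (\<phi> \<bullet> perp (sgn q)) * norm q\<bar>
       + \<bar>\<epsilon> * ((w \<bullet> p) * (\<phi> \<bullet> p)) - \<epsilon> * ((w \<bullet> q) * (\<phi> \<bullet> q))\<bar>"
    unfolding aniso_def by linarith
  ultimately show ?thesis
    using 1 by (simp add: \<delta>_def algebra_simps)
qed

text \<open>The curve \<open>z\<close> is only absolutely continuous, so the composition need not be
  differentiable everywhere. Instead, the defect \<open>E\<close> of the claimed identity is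
  additive over intervals and, near each point, at most \<open>2 * \<eta>\<close> times the integral
  \<open>V\<close> of \<open>norm z'\<close>; bisection makes this global for every
  \<open>\<eta>\<close>.\<close>

lemma chain_rule_indefinite_integral:
  fixes z z' :: "real \<Rightarrow> 'e::euclidean_space" and \<Psi> :: "'e \<Rightarrow> real"
  assumes z': "integrable (lebesgue_on {a..b}) z'"
    and z: "\<And>s t. a \<le> s \<Longrightarrow> s \<le> t \<Longrightarrow> t \<le> b \<Longrightarrow> z t - z s = (\<integral>r. z' r \<partial>lebesgue_on {s..t})"
    and S: "open S" "\<And>t. t \<in> {a..b} \<Longrightarrow> z t \<in> S"
    and \<Psi>: "\<And>x. x \<in> S \<Longrightarrow> (\<Psi> has_derivative (\<lambda>v. g x \<bullet> v)) (at x)"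
    and g: "continuous_on S g" and "a \<le> b"
  shows "integrable (lebesgue_on {a..b}) (\<lambda>r. g (z r) \<bullet> z' r)"
    and "\<Psi> (z b) - \<Psi> (z a) = (\<integral>r. g (z r) \<bullet> z' r \<partial>lebesgue_on {a..b})"
proof -
  have zi: "integrable (lebesgue_on {s..t}) z'" if "a \<le> s" "t \<le> b" for s t
    using that by (intro integrable_subinterval[OF z']) auto
  have z_cont: "continuous_on {a..b} z"
  proof -
    have "continuous_on {a..b} (\<lambda>t. z a + (\<integral>r. z' r \<partial>lebesgue_on {a..t}))"
      by (intro continuous_intros indefinite_integral_continuous_real z')
    then show ?thesis
      by (rule continuous_on_eq) (simp add: z[symmetric])
  qed
  have gz: "continuous_on {a..b} (\<lambda>r. g (z r))"
    using S(2) by (intro continuous_on_compose2[OF g z_cont]) auto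
  obtain B where B: "0 \<le> B" "\<And>r. r \<in> {a..b} \<Longrightarrow> norm (g (z r)) \<le> B"
    using continuous_on_Icc_bounded[OF gz] by metis
  have gm: "(\<lambda>r. g (z r)) \<in> borel_measurable (lebesgue_on {a..b})"
    using gz by (intro continuous_imp_measurable_on_sets_lebesgue) auto
  show int: "integrable (lebesgue_on {a..b}) (\<lambda>r. g (z r) \<bullet> z' r)"
  proof (rule Bochner_Integration.integrable_bound)
    show "integrable (lebesgue_on {a..b}) (\<lambda>r. B * norm (z' r))" using z' by simp
    show "(\<lambda>r. g (z r) \<bullet> z' r) \<in> borel_measurable (lebesgue_on {a..b})"
      using gm z' by (intro borel_measurable_inner) auto
    show "AE r in lebesgue_on {a..b}. norm (g (z r) \<bullet> z' r) \<le> norm (B * norm (z' r))"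
    proof (rule AE_I2)
      fix r assume "r \<in> space (lebesgue_on {a..b})"
      then have "norm (g (z r)) \<le> B" using B by simp
      then have "norm (g (z r)) * norm (z' r) \<le> B * norm (z' r)" by (rule mult_right_mono) simp
      then show "norm (g (z r) \<bullet> z' r) \<le> norm (B * norm (z' r))"
        using Cauchy_Schwarz_ineq2[of "g (z r)" "z' r"] B(1) by simp
    qed
  qed
  have gi: "integrable (lebesgue_on {s..t}) (\<lambda>r. g (z r) \<bullet> z' r)" if "a \<le> s" "t \<le> b" for s t
    using that by (intro integrable_subinterval[OF int]) auto
  define E where "E s t = \<Psi> (z t) - \<Psi> (z s) - (\<integral>r. g (z r) \<bullet> z' r \<partial>lebesgue_on {s..t})" for s t
  define V where "V s t = (\<integral>r. norm (z' r) \<partial>lebesgue_on {s..t})" for s t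
  have ni: "integrable (lebesgue_on {a..b}) (\<lambda>r. norm (z' r))" using z' by simp
  have main: "\<bar>E a b\<bar> \<le> 2 * \<eta> * V a b" if "\<eta> > 0" for \<eta>
  proof -
    define P where "P p q \<longleftrightarrow> (a \<le> p \<and> q \<le> b \<longrightarrow> \<bar>E p q\<bar> \<le> 2 * \<eta> * V p q)" for p q
    have "P a b"
      using \<open>a \<le> b\<close>
    proof (induction rule: Bolzano)
      case (trans p q r)
      show ?case
        unfolding P_def
      proof
        assume pr: "a \<le> p \<and> r \<le> b"
        have "E p r = E p q + E q r"
          unfolding E_def using trans pr by (subst integral_lebesgue_on_split[OF int, of p q r]) auto
        moreover have "2 * \<eta> * V p r = 2 * \<eta> * V p q + 2 * \<eta> * V q r"
          unfolding V_def distrib_left[symmetric] using trans pr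
          by (subst integral_lebesgue_on_split[OF ni, of p q r]) auto
        moreover have "\<bar>E p q\<bar> \<le> 2 * \<eta> * V p q" "\<bar>E q r\<bar> \<le> 2 * \<eta> * V q r"
          using trans pr by (auto simp: P_def)
        ultimately show "\<bar>E p r\<bar> \<le> 2 * \<eta> * V p r"
          by linarith
      qed
    next
      case (local x)
      then have "z x \<in> S" using S by auto
      then obtain e1 where e1: "e1 > 0" "ball (z x) e1 \<subseteq> S"
        using S(1) open_contains_ball by blast
      obtain e2 where e2: "e2 > 0" "\<And>y. y \<in> S \<Longrightarrow> dist y (z x) < e2 \<Longrightarrow> dist (g y) (g (z x)) < \<eta>"
        using g[unfolded continuous_on_iff, THEN bspec, OF \<open>z x \<in> S\<close>, THEN spec, THEN mp, OF \<open>\<eta> > 0\<close>] by blast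
      define e where "e = min e1 e2"
      have "e > 0" using e1 e2 by (simp add: e_def)
      have U: "y \<in> S" "norm (g y - g (z x)) \<le> \<eta>" if "y \<in> ball (z x) e" for y
      proof -
        show "y \<in> S" using that e1(2) by (auto simp: e_def)
        moreover have "dist y (z x) < e2" using that by (simp add: e_def dist_commute)
        ultimately have "dist (g y) (g (z x)) < \<eta>" by (rule e2(2))
        then show "norm (g y - g (z x)) \<le> \<eta>" by (simp add: dist_norm)
      qed
      obtain d where d: "d > 0" "\<And>y. y \<in> {a..b} \<Longrightarrow> dist y x < d \<Longrightarrow> dist (z y) (z x) < e"
        using z_cont[unfolded continuous_on_iff, THEN bspec, of x, THEN spec, THEN mp, OF _ \<open>e > 0\<close>] local by auto
      show ?case
        unfolding P_def
      proof (intro exI[of _ d] conjI allI impI)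
        fix s t assume st: "s \<le> x \<and> x \<le> t \<and> t - s < d" "a \<le> s \<and> t \<le> b"
        have zb: "z r \<in> ball (z x) e" if "r \<in> {s..t}" for r
        proof -
          have "r \<in> {a..b}" "dist r x < d" using st that by (auto simp: dist_real_def)
          then have "dist (z r) (z x) < e" by (rule d(2))
          then show ?thesis by (simp add: dist_commute)
        qed
        have zz: "norm (z t - z s) \<le> V s t"
          unfolding V_def using z[of s t] st integral_norm_bound[of "lebesgue_on {s..t}" z'] by simp
        \<comment> \<open>On a ball where \<open>g\<close> varies by at most \<open>\<eta>\<close>,
          \<open>\<Psi>\<close> differs from its linearization at \<open>z x\<close> by
          \<open>\<eta>\<close> times the increment. Replacing \<open>g (z x)\<close> by
          \<open>g (z r)\<close> under the integral below costs another \<open>\<eta>\<close>, hence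
          the factor 2.\<close>
        have "norm (\<Psi> (z t) - \<Psi> (z s) - g (z x) \<bullet> (z t - z s)) \<le> norm (z t - z s) * \<eta>"
        proof (rule differentiable_bound_linearization[where S="ball (z x) e" and f'="\<lambda>y v. g y \<bullet> v" and ?x0.0="z x"])
          show "z s + r *\<^sub>R (z t - z s) \<in> ball (z x) e" if "r \<in> {0..1}" for r
            using convexD_alt[OF convex_ball zb[of s] zb[of t], of r] st that by (simp add: algebra_simps)
          show "(\<Psi> has_derivative (\<lambda>v. g y \<bullet> v)) (at y within ball (z x) e)" if "y \<in> ball (z x) e" for y
            using \<Psi>[OF U(1)[OF that]] by (rule has_derivative_at_withinI)
          show "onorm ((\<lambda>v. g y \<bullet> v) - (\<lambda>v. g (z x) \<bullet> v)) \<le> \<eta>" if "y \<in> ball (z x) e" for y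
          proof (rule onorm_le)
            fix v
            have "norm (((\<lambda>v. g y \<bullet> v) - (\<lambda>v. g (z x) \<bullet> v)) v) \<le> norm (g y - g (z x)) * norm v"
              using Cauchy_Schwarz_ineq2[of "g y - g (z x)" v] by (simp add: inner_diff_left)
            also have "\<dots> \<le> \<eta> * norm v" using U(2)[OF that] by (rule mult_right_mono) simp
            finally show "norm (((\<lambda>v. g y \<bullet> v) - (\<lambda>v. g (z x) \<bullet> v)) v) \<le> \<eta> * norm v" .
          qed
        qed (use \<open>e > 0\<close> in auto)
        also have "\<dots> \<le> V s t * \<eta>" using zz \<open>\<eta> > 0\<close> by (intro mult_right_mono) auto
        finally have A: "\<bar>\<Psi> (z t) - \<Psi> (z s) - g (z x) \<bullet> (z t - z s)\<bar> \<le> \<eta> * V s t"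
          by (simp add: mult.commute)
        have zst: "integrable (lebesgue_on {s..t}) z'" "integrable (lebesgue_on {s..t}) (\<lambda>r. g (z r) \<bullet> z' r)"
          using zi gi st by auto
        have "g (z x) \<bullet> (z t - z s) - (\<integral>r. g (z r) \<bullet> z' r \<partial>lebesgue_on {s..t})
            = (\<integral>r. g (z x) \<bullet> z' r - g (z r) \<bullet> z' r \<partial>lebesgue_on {s..t})"
          using zst z[of s t] st by simp
        also have "norm \<dots> \<le> (\<integral>r. \<eta> * norm (z' r) \<partial>lebesgue_on {s..t})"
        proof (rule Bochner_Integration.integral_norm_bound_integral)
          fix r assume "r \<in> space (lebesgue_on {s..t})"
          then have r: "r \<in> {s..t}" by simp
          have "\<bar>(g (z r) - g (z x)) \<bullet> z' r\<bar> \<le> norm (g (z r) - g (z x)) * norm (z' r)" by (rule Cauchy_Schwarz_ineq2)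
          also have "\<dots> \<le> \<eta> * norm (z' r)" using U(2)[OF zb[OF r]] by (rule mult_right_mono) simp
          finally show "norm (g (z x) \<bullet> z' r - g (z r) \<bullet> z' r) \<le> \<eta> * norm (z' r)"
            by (simp add: inner_diff_left abs_minus_commute)
        qed (use zst in auto)
        also have "\<dots> = \<eta> * V s t" using zst by (simp add: V_def)
        finally show "\<bar>E s t\<bar> \<le> 2 * \<eta> * V s t"
          using A unfolding E_def real_norm_def by linarith
      qed (rule d)
    qed
    then show ?thesis by (simp add: P_def)
  qed
  have V0: "0 \<le> V a b" unfolding V_def by (rule Bochner_Integration.integral_nonneg) simp
  have "\<bar>E a b\<bar> \<le> 0 + e" if "e > 0" for e
  proof -
    have "\<bar>E a b\<bar> \<le> 2 * (e / (2 * (V a b + 1))) * V a b"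
      using V0 that by (intro main) auto
    also have "\<dots> \<le> e" using V0 that by (simp add: field_simps)
    finally show ?thesis by simp
  qed
  then have "E a b = 0" using field_le_epsilon[of "\<bar>E a b\<bar>" 0] by auto
  then show "\<Psi> (z b) - \<Psi> (z a) = (\<integral>r. g (z r) \<bullet> z' r \<partial>lebesgue_on {a..b})"
    by (simp add: E_def)
qed

text \<open>The weight is merely integrable, so there is no differential inequality to integrate. On
  intervals where the weight has mass \<open>D \<le> 1 / 2\<close>, monotonicity of the majorant
  \<open>X\<close> gives \<open>(1 - D) * X q \<le> X p\<close>, and bisection multiplies these
  local estimates.\<close>

lemma gronwall_integrable_weight:
  fixes \<alpha> R :: "real \<Rightarrow> real"
  assumes \<alpha>: "integrable (lebesgue_on {a..b}) \<alpha>" "\<And>t. t \<in> {a..b} \<Longrightarrow> 0 \<le> \<alpha> t"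
    and R: "continuous_on {a..b} R" "\<And>t. t \<in> {a..b} \<Longrightarrow> 0 \<le> R t"
    and le: "\<And>t. t \<in> {a..b} \<Longrightarrow> R t \<le> c + (\<integral>r. \<alpha> r * R r \<partial>lebesgue_on {a..t})"
    and t: "t \<in> {a..b}"
  shows "R t \<le> c * exp (2 * (\<integral>r. \<alpha> r \<partial>lebesgue_on {a..b}))"
proof -
  have \<alpha>R: "integrable (lebesgue_on {a..b}) (\<lambda>r. \<alpha> r * R r)"
    using integrable_continuous_scaleR[OF R(1) \<alpha>(1)] by (simp add: mult.commute)
  define X where "X t = c + (\<integral>r. \<alpha> r * R r \<partial>lebesgue_on {a..t})" for t
  define A where "A s t = (\<integral>r. \<alpha> r \<partial>lebesgue_on {s..t})" for s t
  have A_nn: "0 \<le> A s t" if "a \<le> s" "t \<le> b" for s t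
    unfolding A_def using that by (intro Bochner_Integration.integral_nonneg \<alpha>(2)) auto
  have X_diff: "X q - X p = (\<integral>r. \<alpha> r * R r \<partial>lebesgue_on {p..q})" if "a \<le> p" "p \<le> q" "q \<le> b" for p q
    unfolding X_def using integral_lebesgue_on_split[OF \<alpha>R, of a p q] that by simp
  have X_mono: "X p \<le> X q" if "a \<le> p" "p \<le> q" "q \<le> b" for p q
  proof -
    have "0 \<le> (\<integral>r. \<alpha> r * R r \<partial>lebesgue_on {p..q})"
      using that by (intro Bochner_Integration.integral_nonneg mult_nonneg_nonneg \<alpha>(2) R(2)) auto
    then show ?thesis using X_diff[OF that] by simp
  qed
  define P where "P p q \<longleftrightarrow> (a \<le> p \<and> q \<le> b \<longrightarrow> X q \<le> X p * exp (2 * A p q))" for p q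
  have "P a t"
    using t[THEN atLeastAtMost_iff[THEN iffD1], THEN conjunct1]
  proof (induction rule: Bolzano)
    case (trans p q r)
    show ?case
      unfolding P_def
    proof
      assume pr: "a \<le> p \<and> r \<le> b"
      have "X r \<le> X q * exp (2 * A q r)" using trans pr by (auto simp: P_def)
      also have "\<dots> \<le> (X p * exp (2 * A p q)) * exp (2 * A q r)" using trans pr by (intro mult_right_mono) (auto simp: P_def)
      also have "\<dots> = X p * exp (2 * A p r)"
        unfolding A_def using trans pr by (subst integral_lebesgue_on_split[OF \<alpha>(1), of p q r]) (auto simp: distrib_left exp_add)
      finally show "X r \<le> X p * exp (2 * A p r)" .
    qed
  next
    case (local x)
    have "continuous_on {a..b} (A a)"
      unfolding A_def using \<alpha>(1) by (rule indefinite_integral_continuous_real)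
    moreover have x: "x \<in> {a..b}" using local t by auto
    ultimately obtain d where d: "d > 0" "\<And>y. y \<in> {a..b} \<Longrightarrow> dist y x < d \<Longrightarrow> dist (A a y) (A a x) < 1 / 4"
      unfolding continuous_on_iff by (meson zero_less_divide_1_iff zero_less_numeral)
    show ?case
      unfolding P_def
    proof (intro exI[of _ d] conjI allI impI)
      fix p q assume pq: "p \<le> x \<and> x \<le> q \<and> q - p < d" "a \<le> p \<and> q \<le> b"
      define D where "D = A p q"
      have "D = A a q - A a p"
        unfolding D_def A_def using integral_lebesgue_on_split[OF \<alpha>(1), of a p q] pq by simp
      then have "D \<le> 1 / 2"
      proof -
        have "dist (A a q) (A a x) < 1 / 4"
          by (rule d(2)) (use pq in \<open>auto simp: dist_real_def\<close>)
        moreover have "dist (A a p) (A a x) < 1 / 4"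
          by (rule d(2)) (use pq in \<open>auto simp: dist_real_def\<close>)
        ultimately show ?thesis unfolding \<open>D = A a q - A a p\<close> dist_real_def by linarith
      qed
      have "0 \<le> D" unfolding D_def using pq by (intro A_nn) auto
      have "X q - X p = (\<integral>r. \<alpha> r * R r \<partial>lebesgue_on {p..q})" using pq by (intro X_diff) auto
      also have "\<dots> \<le> (\<integral>r. \<alpha> r * X q \<partial>lebesgue_on {p..q})"
      proof (rule integral_mono)
        show "integrable (lebesgue_on {p..q}) (\<lambda>r. \<alpha> r * R r)" using pq by (intro integrable_subinterval[OF \<alpha>R]) auto
        have "integrable (lebesgue_on {p..q}) \<alpha>" using pq by (intro integrable_subinterval[OF \<alpha>(1)]) auto
        then show "integrable (lebesgue_on {p..q}) (\<lambda>r. \<alpha> r * X q)" by simp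
        fix r assume "r \<in> space (lebesgue_on {p..q})"
        then have r: "r \<in> {p..q}" by simp
        have "R r \<le> X r" unfolding X_def using r pq by (intro le) auto
        also have "\<dots> \<le> X q" using r pq by (intro X_mono) auto
        finally show "\<alpha> r * R r \<le> \<alpha> r * X q" using r pq by (intro mult_left_mono \<alpha>(2)) auto
      qed
      also have "\<dots> = D * X q" by (simp add: D_def A_def)
      finally have 1: "(1 - D) * X q \<le> X p" by (simp add: algebra_simps)
      have "0 \<le> R q" "R q \<le> X q" unfolding X_def using pq by (auto intro!: R le)
      then have "0 \<le> X q" by simp
      \<comment> \<open>For \<open>0 \<le> D \<le> 1 / 2\<close> the product of \<open>1 - D\<close>
        and \<open>1 + 2 * D\<close> is at least 1, so \<open>1 / (1 - D)\<close> is at most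
        \<open>exp (2 * D)\<close>: the origin of the factor 2 in the exponent.\<close>
      have "D * D \<le> D * (1 / 2)" using \<open>0 \<le> D\<close> \<open>D \<le> 1 / 2\<close> by (intro mult_left_mono) auto
      then have "1 \<le> (1 - D) * (1 + 2 * D)" by (simp add: algebra_simps)
      also have "\<dots> \<le> (1 - D) * exp (2 * D)"
        using \<open>D \<le> 1 / 2\<close> exp_ge_add_one_self[of "2 * D"] by (intro mult_left_mono) auto
      finally have "X q \<le> ((1 - D) * exp (2 * D)) * X q" using \<open>0 \<le> X q\<close> by (simp add: mult_le_cancel_right1)
      also have "\<dots> = ((1 - D) * X q) * exp (2 * D)" by simp
      also have "\<dots> \<le> X p * exp (2 * D)" using 1 by (intro mult_right_mono) auto
      finally show "X q \<le> X p * exp (2 * A p q)" by (simp add: D_def)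
    qed (rule d)
  qed
  then have 1: "X t \<le> X a * exp (2 * A a t)" using t by (auto simp: P_def)
  have "X a = c"
  proof -
    have "(\<integral>r. \<alpha> r * R r \<partial>lebesgue_on {a..a}) = 0"
      by (rule integral_eq_zero_null_sets) (auto simp: null_sets_restrict_space)
    then show ?thesis by (simp add: X_def)
  qed
  have "0 \<le> c" using R(2)[of a] le[of a] \<open>X a = c\<close> t by (auto simp: X_def)
  have "A a t \<le> A a b"
    unfolding A_def using integral_lebesgue_on_split[OF \<alpha>(1), of a t b] t A_nn[of t b] by (auto simp: A_def)
  then have "X a * exp (2 * A a t) \<le> c * exp (2 * A a b)"
    using \<open>X a = c\<close> \<open>0 \<le> c\<close> by (simp add: mult_left_mono)
  moreover have "R t \<le> X t" unfolding X_def using t by (rule le)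
  ultimately show ?thesis using 1 by (simp add: A_def)
qed

section \<open>Differential equations and coercive forms\<close>

lemma continuous_on_Lipschitz_field:
  fixes f :: "real \<Rightarrow> 'e::real_normed_vector \<Rightarrow> 'f::real_normed_vector"
  assumes L: "\<And>t x y. t \<in> S \<Longrightarrow> norm (f t x - f t y) \<le> L * norm (x - y)"
    and f: "\<And>x. continuous_on S (\<lambda>t. f t x)" and y: "continuous_on S y"
  shows "continuous_on S (\<lambda>t. f t (y t))"
  unfolding continuous_on_def
proof
  fix s assume s: "s \<in> S"
  have "((\<lambda>t. f t (y t) - f t (y s)) \<longlongrightarrow> 0) (at s within S)"
  proof (rule Lim_null_comparison)
    show "\<forall>\<^sub>F t in at s within S. norm (f t (y t) - f t (y s)) \<le> L * norm (y t - y s)"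
      using L by (auto simp: eventually_at_filter)
    have "((\<lambda>t. norm (y t - y s)) \<longlongrightarrow> norm (y s - y s)) (at s within S)"
      using y s by (intro tendsto_norm tendsto_diff tendsto_const) (auto simp: continuous_on_def)
    then show "((\<lambda>t. L * norm (y t - y s)) \<longlongrightarrow> 0) (at s within S)"
      using tendsto_mult_right_zero by fastforce
  qed
  moreover have "((\<lambda>t. f t (y s)) \<longlongrightarrow> f s (y s)) (at s within S)"
    using f[of "y s"] s by (auto simp: continuous_on_def)
  ultimately show "((\<lambda>t. f t (y t)) \<longlongrightarrow> f s (y s)) (at s within S)"
    using tendsto_add[of "\<lambda>t. f t (y t) - f t (y s)" 0 "at s within S" "\<lambda>t. f t (y s)" "f s (y s)"] by simp
qed

text \<open>The weight \<open>exp (2 L t)\<close> makes the Picard operator a contraction on the whole interval.\<close>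

lemma Picard_Lindelof_global:
  fixes f :: "real \<Rightarrow> 'e::banach \<Rightarrow> 'e"
  assumes "0 \<le> T" "0 < L"
    and L: "\<And>t x y. t \<in> {0..T} \<Longrightarrow> norm (f t x - f t y) \<le> L * norm (x - y)"
    and f: "\<And>x. continuous_on {0..T} (\<lambda>t. f t x)"
  obtains y where "y 0 = x0" "\<And>t. t \<in> {0..T} \<Longrightarrow> (y has_vector_derivative f t (y t)) (at t within {0..T})"
proof -
  define w where "w r = exp (2 * L * r)" for r
  have w: "continuous_on S w" for S unfolding w_def by (intro continuous_intros)
  have w_pos: "w r > 0" for r by (simp add: w_def)
  \<comment> \<open>The fixed point \<open>z\<close> will be the solution divided by the weight
    \<open>w\<close>, so \<open>k z\<close> is the right-hand side of the equation along the
    rescaled curve.\<close>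
  define k where "k z r = f r (w r *\<^sub>R apply_bcontfun z r)" for z :: "real \<Rightarrow>\<^sub>C 'e" and r
  have k_cont: "continuous_on {0..T} (k z)" for z
    unfolding k_def by (intro continuous_on_Lipschitz_field[OF L f] continuous_intros w) auto
  \<comment> \<open>Bounded continuous functions live on the whole line; clamping time to
    \<open>[0, T]\<close> turns the Picard integral into one of them.\<close>
  define c where "c t = max 0 (min T t)" for t
  have c: "c t \<in> {0..T}" "continuous_on S c" for t S
    unfolding c_def using \<open>0 \<le> T\<close> by (auto intro!: continuous_intros)
  define h where "h z s = (1 / w s) *\<^sub>R (x0 + integral {0..s} (k z))" for z s
  have h_cont: "continuous_on {0..T} (h z)" for z
    unfolding h_def using w_pos
    by (intro continuous_intros w indefinite_integral_continuous_1 integrable_continuous_interval k_cont)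
       (auto simp: less_imp_neq[symmetric])
  have hc: "(\<lambda>t. h z (c t)) \<in> bcontfun" for z
  proof -
    obtain B where "\<And>s. s \<in> {0..T} \<Longrightarrow> norm (h z s) \<le> B" using continuous_on_Icc_bounded[OF h_cont] by metis
    then show ?thesis
      using c(1) by (intro bcontfun_normI[of _ B] continuous_on_compose2[OF h_cont c(2)]) auto
  qed
  define G where "G z = Bcontfun (\<lambda>t. h z (c t))" for z
  have G: "apply_bcontfun (G z) t = h z (c t)" for z t
    unfolding G_def using hc by (simp add: Bcontfun_inverse)
  have "\<forall>z z'. dist (G z) (G z') \<le> 1 / 2 * dist z z'"
  proof (intro allI)
    fix z z' :: "real \<Rightarrow>\<^sub>C 'e"
    have "norm (h z s - h z' s) \<le> 1 / 2 * dist z z'" if s: "s \<in> {0..T}" for s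
    proof -
      have ki: "k z integrable_on {0..s}" for z
        using s by (intro integrable_continuous_interval continuous_on_subset[OF k_cont]) auto
      \<comment> \<open>The integral of \<open>L * exp (2 * L * r)\<close> up to \<open>s\<close> is
        at most half of \<open>w s\<close>, which after division by \<open>w s\<close> leaves the
        contraction factor 1/2.\<close>
      have ft: "((\<lambda>r. L * w r * dist z z') has_integral (w s / 2 * dist z z' - w 0 / 2 * dist z z')) {0..s}"
        using s by (intro fundamental_theorem_of_calculus)
          (auto simp: w_def has_real_derivative_iff_has_vector_derivative[symmetric] intro!: derivative_eq_intros)
      have "norm (integral {0..s} (\<lambda>r. k z r - k z' r)) \<le> integral {0..s} (\<lambda>r. L * w r * dist z z')"
      proof (rule integral_norm_bound_integral)
        fix r assume "r \<in> {0..s}"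
        then have "norm (k z r - k z' r) \<le> L * norm (w r *\<^sub>R apply_bcontfun z r - w r *\<^sub>R apply_bcontfun z' r)"
          unfolding k_def using s by (intro L) auto
        also have "\<dots> = L * w r * dist (apply_bcontfun z r) (apply_bcontfun z' r)"
          using w_pos[of r] by (simp add: scaleR_diff_right[symmetric] dist_norm)
        also have "\<dots> \<le> L * w r * dist z z'"
          using \<open>0 < L\<close> w_pos[of r] by (intro mult_left_mono dist_bounded) auto
        finally show "norm (k z r - k z' r) \<le> L * w r * dist z z'" .
      qed (use ki ft in \<open>auto intro: Henstock_Kurzweil_Integration.integrable_diff\<close>)
      also have "\<dots> = (w s - w 0) / 2 * dist z z'"
        unfolding integral_unique[OF ft] by (simp add: left_diff_distrib diff_divide_distrib)
      also have "\<dots> \<le> w s / 2 * dist z z'"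
        using w_pos[of 0] by (intro mult_right_mono) auto
      finally have n: "norm (integral {0..s} (k z) - integral {0..s} (k z')) \<le> w s / 2 * dist z z'"
        using ki by (simp add: Henstock_Kurzweil_Integration.integral_diff)
      have "h z s - h z' s = (1 / w s) *\<^sub>R (integral {0..s} (k z) - integral {0..s} (k z'))"
        by (simp add: h_def algebra_simps)
      then have "norm (h z s - h z' s) = 1 / w s * norm (integral {0..s} (k z) - integral {0..s} (k z'))"
        using w_pos[of s] by simp
      also have "\<dots> \<le> 1 / w s * (w s / 2 * dist z z')"
        using w_pos[of s] by (intro mult_left_mono n) auto
      finally show ?thesis using w_pos[of s] by simp
    qed
    then show "dist (G z) (G z') \<le> 1 / 2 * dist z z'"
      using c(1) by (intro dist_bound) (simp add: G dist_norm)
  qed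
  then obtain z where z: "G z = z"
    using banach_fix_type[of "1 / 2" G] by auto
  define y where "y t = x0 + integral {0..t} (k z)" for t
  have zy: "w t *\<^sub>R apply_bcontfun z t = y t" if t: "t \<in> {0..T}" for t
  proof -
    have "apply_bcontfun z t = h z (c t)" using z G by metis
    moreover have "c t = t" using t by (auto simp: c_def)
    ultimately show ?thesis using w_pos[of t] by (simp add: h_def y_def)
  qed
  show thesis
  proof (rule that[of y])
    show "y 0 = x0" by (simp add: y_def)
    fix t assume t: "t \<in> {0..T}"
    have "((\<lambda>u. integral {0..u} (k z)) has_vector_derivative k z t) (at t within {0..T})"
      using k_cont t by (rule integral_has_vector_derivative)
    then have "(y has_vector_derivative k z t) (at t within {0..T})"
      unfolding y_def by (auto intro!: derivative_eq_intros)
    then show "(y has_vector_derivative f t (y t)) (at t within {0..T})"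
      using zy[OF t] by (simp add: k_def)
  qed
qed

text \<open>
  Induction on a finite set of linear functionals that separates the points of \<open>V\<close>, with one
  Gram-Schmidt step for each functional.
\<close>

lemma coercive_form_solvable:
  fixes a :: "'e::real_vector \<Rightarrow> 'e \<Rightarrow> real"
  assumes "finite L" and V: "subspace V"
    and L: "\<And>l. l \<in> L \<Longrightarrow> linear (l :: 'e \<Rightarrow> real)"
    and sep: "\<And>v. v \<in> V \<Longrightarrow> (\<And>l. l \<in> L \<Longrightarrow> l v = 0) \<Longrightarrow> v = 0"
    and a: "\<And>v. linear (a v)" "\<And>v. linear (\<lambda>u. a u v)"
    and pos: "\<And>v. v \<in> V \<Longrightarrow> v \<noteq> 0 \<Longrightarrow> a v v > 0"
    and b: "linear (b :: 'e \<Rightarrow> real)"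
  shows "\<exists>w\<in>V. \<forall>v\<in>V. a w v = b v"
  using assms(1) V L sep pos b
proof (induction L arbitrary: V b rule: finite_induct)
  case empty
  then have "V \<subseteq> {0}" "0 \<in> V" by (auto simp: subspace_0)
  then show ?case using a(1)[of 0] empty(5) by (intro bexI[of _ 0]) (auto simp: linear_0)
next
  case (insert l L)
  define V' where "V' = {v \<in> V. l v = 0}"
  have ll: "linear l" using insert.prems(2) by blast
  have V': "subspace V'"
    using insert.prems(1) ll unfolding V'_def subspace_def by (auto simp: linear_0 linear_add linear_scale)
  have IH: "\<exists>w\<in>V'. \<forall>v\<in>V'. a w v = b' v" if "linear b'" for b'
    using that insert.prems by (intro insert.IH V') (auto simp: V'_def)
  show ?case
  proof (cases "V' = V")
    case True
    then show ?thesis using IH[OF insert.prems(5)] by simp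
  next
    case False
    then obtain e where e: "e \<in> V" "l e \<noteq> 0" by (auto simp: V'_def)
    obtain p where p: "p \<in> V'" "\<And>v. v \<in> V' \<Longrightarrow> a p v = a e v" using IH[OF a(1)[of e]] by blast
    \<comment> \<open>\<open>d\<close> is \<open>e\<close> minus its projection onto
      \<open>V'\<close> with respect to \<open>a\<close>. Thus \<open>a d\<close> vanishes on
      \<open>V'\<close>, and adding a multiple of \<open>d\<close> to a solution on
      \<open>V'\<close> leaves the equations there intact.\<close>
    define d where "d = e - p"
    have pV: "p \<in> V" "l p = 0" using p(1) by (auto simp: V'_def)
    have d: "d \<in> V" "l d = l e" "d \<noteq> 0"
      using e pV insert.prems(1) ll linear_0[OF ll] by (auto simp: d_def subspace_diff linear_diff)
    have ad: "a d v = 0" if "v \<in> V'" for v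
      using p(2)[OF that] linear_diff[OF a(2)[of v], of e p] by (simp add: d_def)
    obtain w where w: "w \<in> V'" "\<And>v. v \<in> V' \<Longrightarrow> a w v = b v" using IH[OF insert.prems(5)] by blast
    have "a d d > 0" using insert.prems(4) d by blast
    \<comment> \<open>The coefficient that makes the equation hold in the one remaining direction
      \<open>d\<close>.\<close>
    define k where "k = (b d - a w d) / a d d"
    define w' where "w' = w + k *\<^sub>R d"
    have aw': "a w' v = a w v + k * a d v" for v
      unfolding w'_def using linear_add[OF a(2)[of v], of w "k *\<^sub>R d"] linear_scale[OF a(2)[of v], of k d] by simp
    show ?thesis
    proof (intro bexI[of _ w'] ballI)
      show "w' \<in> V" unfolding w'_def using w(1) d insert.prems(1) by (auto simp: V'_def subspace_add subspace_scale)
      fix v assume v: "v \<in> V"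
      define v' where "v' = v - (l v / l e) *\<^sub>R d"
      have v': "v' \<in> V'"
        unfolding V'_def v'_def using v d e insert.prems(1) ll
        by (auto simp: subspace_diff subspace_scale linear_diff linear_scale)
      have veq: "v = v' + (l v / l e) *\<^sub>R d" by (simp add: v'_def)
      have 1: "a w' v' = b v'" using aw' ad[OF v'] w(2)[OF v'] by simp
      have 2: "a w' d = b d" using aw'[of d] \<open>a d d > 0\<close> by (simp add: k_def)
      have "a w' v = a w' v' + (l v / l e) * a w' d"
        using linear_add[OF a(1)[of w'], of v' "(l v / l e) *\<^sub>R d"] linear_scale[OF a(1)[of w'], of "l v / l e" d]
        unfolding veq[symmetric] by simp
      also have "\<dots> = b v' + (l v / l e) * b d" using 1 2 by simp
      also have "\<dots> = b v" 
        using linear_add[OF insert.prems(5), of v' "(l v / l e) *\<^sub>R d"] linear_scale[OF insert.prems(5), of "l v / l e" d]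
        unfolding veq[symmetric] by simp
      finally show "a w' v = b v" .
    qed
  qed
qed

section \<open>Integrability of the terms of the weak equation\<close>

abbreviation unit_interval :: "real measure" where "unit_interval \<equiv> lebesgue_on {0..1}"

lemma integrable_bounded:
  fixes f :: "real \<Rightarrow> 'a::euclidean_space"
  assumes "f \<in> borel_measurable unit_interval" "AE x in unit_interval. norm (f x) \<le> B"
  shows "integrable unit_interval f"
proof -
  have "integrable unit_interval (\<lambda>x::real. B)" by simp
  then show ?thesis
    by (rule Bochner_Integration.integrable_bound) (use assms in \<open>auto elim: eventually_mono\<close>)
qed

lemma AE_unit_interval: "AE x in unit_interval. 0 \<le> x \<and> x < (1::real)"
proof -
  have "AE x in unit_interval. x \<in> {0..1::real}" by (auto intro: AE_I2)
  moreover have "AE x in unit_interval. x \<noteq> (1::real)" by (rule AE_lebesgue_on_neq) auto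
  ultimately show ?thesis by eventually_elim auto
qed

lemma measurable_perp [measurable]: "perp \<in> borel_measurable borel"
proof -
  have "linear perp" by (rule linearI) (simp_all add: perp_def vec_eq_iff forall_2)
  then show ?thesis
    by (intro borel_measurable_continuous_onI linear_continuous_on) (simp add: linear_conv_bounded_linear)
qed

lemma measurable_sgn_vec [measurable]: "(sgn :: real^2 \<Rightarrow> real^2) \<in> borel_measurable borel"
  unfolding sgn_div_norm[abs_def] by measurable

lemma measurable_aniso:
  assumes [measurable]: "p \<in> borel_measurable M" "w \<in> borel_measurable M" "\<phi> \<in> borel_measurable M"
  shows "(\<lambda>x. aniso \<epsilon> (p x) (w x) (\<phi> x)) \<in> borel_measurable M"
  unfolding aniso_def by measurable

lemma measurable_flux:
  fixes p :: "'a \<Rightarrow> real^2"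
  assumes [measurable]: "p \<in> borel_measurable M"
  shows "(\<lambda>x. \<epsilon> *\<^sub>R p x + sgn (p x)) \<in> borel_measurable M"
  by measurable

lemma continuous_measurable_unit:
  fixes w :: "real \<Rightarrow> 'a::euclidean_space"
  shows "continuous_on {0..1} w \<Longrightarrow> w \<in> borel_measurable unit_interval"
  by (intro continuous_imp_measurable_on_sets_lebesgue) auto

lemma integrable_aniso:
  assumes p: "p \<in> borel_measurable unit_interval" "AE x in unit_interval. norm (p x) \<le> B"
    and w: "continuous_on {0..1} w" "continuous_on {0..1} \<phi>" and "0 \<le> \<epsilon>"
  shows "integrable unit_interval (\<lambda>x. aniso \<epsilon> (p x) (w x) (\<phi> x))"
proof -
  obtain Bw where Bw: "0 \<le> Bw" "\<And>x. x \<in> {0..1} \<Longrightarrow> norm (w x) \<le> Bw" using continuous_on_Icc_bounded[OF w(1)] by metis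
  obtain Bf where Bf: "0 \<le> Bf" "\<And>x. x \<in> {0..1} \<Longrightarrow> norm (\<phi> x) \<le> Bf" using continuous_on_Icc_bounded[OF w(2)] by metis
  show ?thesis
  proof (rule integrable_bounded)
    show "(\<lambda>x. aniso \<epsilon> (p x) (w x) (\<phi> x)) \<in> borel_measurable unit_interval"
      by (rule measurable_aniso[OF p(1) continuous_measurable_unit[OF w(1)] continuous_measurable_unit[OF w(2)]])
    show "AE x in unit_interval. norm (aniso \<epsilon> (p x) (w x) (\<phi> x)) \<le> (B + \<epsilon> * B\<^sup>2) * Bw * Bf"
      using p(2) AE_unit_interval
    proof eventually_elim
      case (elim x)
      have "norm (aniso \<epsilon> (p x) (w x) (\<phi> x)) \<le> (norm (p x) + \<epsilon> * (norm (p x))\<^sup>2) * norm (w x) * norm (\<phi> x)"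
        using aniso_bound[OF \<open>0 \<le> \<epsilon>\<close>] by simp
      also have "\<dots> \<le> (B + \<epsilon> * B\<^sup>2) * Bw * Bf"
      proof -
        have B: "0 \<le> B" using elim norm_ge_zero[of "p x"] by linarith
        have 1: "norm (p x) + \<epsilon> * (norm (p x))\<^sup>2 \<le> B + \<epsilon> * B\<^sup>2"
          using elim \<open>0 \<le> \<epsilon>\<close> by (intro add_mono mult_left_mono power_mono) simp_all
        have 2: "norm (w x) \<le> Bw" "norm (\<phi> x) \<le> Bf" using Bw Bf elim by simp_all
        have 3: "0 \<le> B + \<epsilon> * B\<^sup>2" using B \<open>0 \<le> \<epsilon>\<close> by simp
        from mult_mono[OF mult_mono[OF 1 2(1) 3] 2(2)] show ?thesis using 3 Bw(1) by simp
      qed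
      finally show ?case .
    qed
  qed
qed

lemma norm_flux_le: "norm (\<epsilon> *\<^sub>R p + sgn p) \<le> \<epsilon> * norm p + 1" if "0 \<le> \<epsilon>" for p :: "'a::real_normed_vector"
  using norm_triangle_ineq[of "\<epsilon> *\<^sub>R p" "sgn p"] that by (simp add: norm_sgn split: if_splits)

lemma integrable_flux:
  assumes p: "p \<in> borel_measurable unit_interval" "AE x in unit_interval. norm (p x) \<le> B"
    and \<psi>: "integrable unit_interval \<psi>" and "0 \<le> \<epsilon>"
  shows "integrable unit_interval (\<lambda>x. (\<epsilon> *\<^sub>R p x + sgn (p x)) \<bullet> (\<psi> x :: real^2))"
proof (rule Bochner_Integration.integrable_bound)
  show "integrable unit_interval (\<lambda>x. (\<epsilon> * B + 1) * norm (\<psi> x))" using \<psi> by simp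
  show "(\<lambda>x. (\<epsilon> *\<^sub>R p x + sgn (p x)) \<bullet> \<psi> x) \<in> borel_measurable unit_interval"
    using measurable_flux[OF p(1)] \<psi> by (intro borel_measurable_inner) auto
  show "AE x in unit_interval. norm ((\<epsilon> *\<^sub>R p x + sgn (p x)) \<bullet> \<psi> x) \<le> norm ((\<epsilon> * B + 1) * norm (\<psi> x))"
    using p(2)
  proof eventually_elim
    case (elim x)
    have "\<bar>(\<epsilon> *\<^sub>R p x + sgn (p x)) \<bullet> \<psi> x\<bar> \<le> norm (\<epsilon> *\<^sub>R p x + sgn (p x)) * norm (\<psi> x)" by (rule Cauchy_Schwarz_ineq2)
    also have "\<dots> \<le> (\<epsilon> * B + 1) * norm (\<psi> x)"
      using norm_flux_le[OF \<open>0 \<le> \<epsilon>\<close>, of "p x"] mult_left_mono[OF elim \<open>0 \<le> \<epsilon>\<close>] by (intro mult_right_mono) auto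
    finally show ?case by simp
  qed
qed

text \<open>The slopes are arguments of their own rather than \<open>dx\<close> of a triple. The
  same form then takes weak derivatives, cellwise slopes, and retracted slopes that belong to no
  triod.\<close>

definition mass_form :: "real \<Rightarrow> (3 \<Rightarrow> real \<Rightarrow> real^2) \<Rightarrow> triple \<Rightarrow> triple \<Rightarrow> real" where
  "mass_form \<epsilon> p w \<phi> = (\<Sum>i\<in>UNIV. \<integral>x. aniso \<epsilon> (p i x) (w i x) (\<phi> i x) \<partial>unit_interval)"

definition flux_form :: "real \<Rightarrow> (3 \<Rightarrow> real \<Rightarrow> real^2) \<Rightarrow> (3 \<Rightarrow> real \<Rightarrow> real^2) \<Rightarrow> real" where
  "flux_form \<epsilon> p \<psi> = (\<Sum>i\<in>UNIV. \<integral>x. (\<epsilon> *\<^sub>R p i x + sgn (p i x)) \<bullet> \<psi> i x \<partial>unit_interval)"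

text \<open>\<open>weak_equation\<close> keeps the normal, tangential and flux integrals apart,
  while the forms collect them under one integral sign. Merging requires integrability of every
  part, which comes from the bound \<open>B\<close>, the continuity of \<open>w i\<close> and
  \<open>\<phi> i\<close> and the integrability of the derivatives of
  \<open>\<phi> i\<close>.\<close>

lemma weak_equation_iff:
  assumes v: "\<And>i. AE x in unit_interval. dx (v i) x = p i x" "\<And>i. dx (v i) \<in> borel_measurable unit_interval"
    and \<phi>: "\<And>i. AE x in unit_interval. dx (\<phi> i) x = \<psi> i x" "\<And>i. integrable unit_interval (dx (\<phi> i))"
    and p: "\<And>i. p i \<in> borel_measurable unit_interval" "\<And>i. AE x in unit_interval. norm (p i x) \<le> B"
    and w: "\<And>i. continuous_on {0..1} (w i)" "\<And>i. continuous_on {0..1} (\<phi> i)"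
    and \<psi>: "\<And>i. integrable unit_interval (\<psi> i)" and "0 \<le> \<epsilon>"
  shows "weak_equation \<epsilon> v w \<phi> \<longleftrightarrow> mass_form \<epsilon> p w \<phi> = - flux_form \<epsilon> p \<psi>"
proof -
  let ?d = "\<lambda>i x. dx (v i) x"
  have B: "AE x in unit_interval. norm (?d i x) \<le> B" for i
    using v(1)[of i] p(2)[of i] by eventually_elim simp
  have wm: "w i \<in> borel_measurable unit_interval" "\<phi> i \<in> borel_measurable unit_interval" for i
    using w by (auto intro: continuous_measurable_unit)
  note [measurable] = v(2) wm
  have "\<exists>B. \<forall>x\<in>{0..1}. norm (w i x) \<le> B" "\<exists>B. \<forall>x\<in>{0..1}. norm (\<phi> i x) \<le> B" for i
    by (meson continuous_on_Icc_bounded w)+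
  then obtain Bw Bf where Bw: "\<And>i x. x \<in> {0..1} \<Longrightarrow> norm (w i x) \<le> Bw i" and Bf: "\<And>i x. x \<in> {0..1} \<Longrightarrow> norm (\<phi> i x) \<le> Bf i"
    by metis
  have i2: "integrable unit_interval (\<lambda>x. (w i x \<bullet> (?d i x /\<^sub>R norm (?d i x))) * (\<phi> i x \<bullet> (?d i x /\<^sub>R norm (?d i x))) * (norm (?d i x))\<^sup>2)"
    for i
  proof (rule integrable_bounded[where B="(Bw i * 1) * (Bf i * 1) * B\<^sup>2"])
    show "AE x in unit_interval. norm ((w i x \<bullet> (?d i x /\<^sub>R norm (?d i x))) * (\<phi> i x \<bullet> (?d i x /\<^sub>R norm (?d i x))) * (norm (?d i x))\<^sup>2) \<le> (Bw i * 1) * (Bf i * 1) * B\<^sup>2"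
      using B[of i] AE_unit_interval
    proof eventually_elim
      case (elim x)
      have "norm (?d i x /\<^sub>R norm (?d i x)) \<le> 1" by (cases "?d i x = 0") simp_all
      from order_trans[OF inner_abs_le[OF this, of "w i x"]] order_trans[OF inner_abs_le[OF this, of "\<phi> i x"]] Bw[of x i] Bf[of x i] elim
      have "\<bar>w i x \<bullet> (?d i x /\<^sub>R norm (?d i x))\<bar> \<le> Bw i * 1" "\<bar>\<phi> i x \<bullet> (?d i x /\<^sub>R norm (?d i x))\<bar> \<le> Bf i * 1"
        by simp_all
      note b = this
      have n: "\<bar>(norm (?d i x))\<^sup>2\<bar> \<le> B\<^sup>2" using elim by (simp add: power_mono)
      have z: "0 \<le> Bw i * 1" using b(1) abs_ge_zero order_trans by blast
      have z': "0 \<le> Bf i * 1" using b(2) abs_ge_zero order_trans by blast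
      from mult_mono[OF mult_mono[OF b z abs_ge_zero] n] show ?case
        unfolding real_norm_def abs_mult using z z' by simp
    qed
  qed measurable
  have i12: "integrable unit_interval (\<lambda>x. aniso \<epsilon> (?d i x) (w i x) (\<phi> i x))" for i
    using v(2) B w \<open>0 \<le> \<epsilon>\<close> by (intro integrable_aniso)
  have i1: "integrable unit_interval (\<lambda>x. (w i x \<bullet> (perp (?d i x) /\<^sub>R norm (?d i x))) * (\<phi> i x \<bullet> (perp (?d i x) /\<^sub>R norm (?d i x))) * norm (?d i x))"
    for i
    using Bochner_Integration.integrable_diff[OF i12[of i] integrable_mult_right[OF i2[of i], of \<epsilon>]] unfolding aniso_eq by simp
  have m: "(\<integral>x. (w i x \<bullet> (perp (?d i x) /\<^sub>R norm (?d i x))) * (\<phi> i x \<bullet> (perp (?d i x) /\<^sub>R norm (?d i x))) * norm (?d i x) \<partial>unit_interval)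
      + \<epsilon> * (\<integral>x. (w i x \<bullet> (?d i x /\<^sub>R norm (?d i x))) * (\<phi> i x \<bullet> (?d i x /\<^sub>R norm (?d i x))) * (norm (?d i x))\<^sup>2 \<partial>unit_interval)
      = (\<integral>x. aniso \<epsilon> (p i x) (w i x) (\<phi> i x) \<partial>unit_interval)" for i
  proof -
    have "(\<integral>x. aniso \<epsilon> (p i x) (w i x) (\<phi> i x) \<partial>unit_interval) = (\<integral>x. aniso \<epsilon> (?d i x) (w i x) (\<phi> i x) \<partial>unit_interval)"
      using v(1)[of i] p(1) v(2) wm by (intro integral_cong_AE measurable_aniso) (auto elim: eventually_mono)
    then show ?thesis unfolding aniso_eq using i1[of i] i2[of i] by simp
  qed
  have f: "\<epsilon> * (\<integral>x. ?d i x \<bullet> dx (\<phi> i) x \<partial>unit_interval) + (\<integral>x. (?d i x /\<^sub>R norm (?d i x)) \<bullet> dx (\<phi> i) x \<partial>unit_interval)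
      = (\<integral>x. (\<epsilon> *\<^sub>R p i x + sgn (p i x)) \<bullet> \<psi> i x \<partial>unit_interval)" for i
  proof -
    have 1: "integrable unit_interval (\<lambda>x. (\<epsilon> *\<^sub>R ?d i x + sgn (?d i x)) \<bullet> dx (\<phi> i) x)"
      using v(2) B \<phi>(2) \<open>0 \<le> \<epsilon>\<close> by (intro integrable_flux)
    \<comment> \<open>The summands of the flux are separated by taking the flux with parameter 0,
      which is the direction alone, and subtracting it from the flux with parameter 1.\<close>
    have 2: "integrable unit_interval (\<lambda>x. (0 *\<^sub>R ?d i x + sgn (?d i x)) \<bullet> dx (\<phi> i) x)"
      using v(2) B \<phi>(2) by (intro integrable_flux) auto
    have 3: "integrable unit_interval (\<lambda>x. (1 *\<^sub>R ?d i x + sgn (?d i x)) \<bullet> dx (\<phi> i) x)"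
      using v(2) B \<phi>(2) by (intro integrable_flux) auto
    have 4: "integrable unit_interval (\<lambda>x. ?d i x \<bullet> dx (\<phi> i) x)"
      using Bochner_Integration.integrable_diff[OF 3 2] by (simp add: inner_add_left)
    have "(\<integral>x. (\<epsilon> *\<^sub>R p i x + sgn (p i x)) \<bullet> \<psi> i x \<partial>unit_interval) = (\<integral>x. (\<epsilon> *\<^sub>R ?d i x + sgn (?d i x)) \<bullet> dx (\<phi> i) x \<partial>unit_interval)"
    proof (rule integral_cong_AE)
      show "AE x in unit_interval. (\<epsilon> *\<^sub>R p i x + sgn (p i x)) \<bullet> \<psi> i x = (\<epsilon> *\<^sub>R ?d i x + sgn (?d i x)) \<bullet> dx (\<phi> i) x"
        using v(1)[of i] \<phi>(1)[of i] by eventually_elim simp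
    qed (use measurable_flux[OF p(1)[of i]] measurable_flux[OF v(2)[of i]] \<phi>(2)[of i] \<psi>[of i] in \<open>auto intro!: borel_measurable_inner\<close>)
    also have "\<dots> = (\<integral>x. \<epsilon> * (?d i x \<bullet> dx (\<phi> i) x) + sgn (?d i x) \<bullet> dx (\<phi> i) x \<partial>unit_interval)"
      by (simp add: inner_add_left)
    also have "\<dots> = \<epsilon> * (\<integral>x. ?d i x \<bullet> dx (\<phi> i) x \<partial>unit_interval) + (\<integral>x. sgn (?d i x) \<bullet> dx (\<phi> i) x \<partial>unit_interval)"
      using 2 4 by (subst Bochner_Integration.integral_add) auto
    finally show ?thesis by (simp add: sgn_div_norm)
  qed
  show ?thesis
    unfolding weak_equation_def mass_form_def flux_form_def m f ..
qed

section \<open>The velocity as a function of the slopes\<close>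

definition cell_field :: "nat \<Rightarrow> (3 \<Rightarrow> nat \<Rightarrow> 'a) \<Rightarrow> 3 \<Rightarrow> real \<Rightarrow> 'a" where
  "cell_field J p i x = p i (nat \<lfloor>real J * x\<rfloor>)"

definition tri_norm2 :: "triple \<Rightarrow> real" where
  "tri_norm2 \<phi> = (\<Sum>i\<in>UNIV. \<integral>x. (norm (\<phi> i x))\<^sup>2 \<partial>unit_interval)"

lemma AE_cell: "1 \<le> J \<Longrightarrow> AE x in unit_interval. \<exists>l<J. \<lfloor>real J * x\<rfloor> = int l"
  using AE_unit_interval by eventually_elim (meson cell_index)

lemma cell_field_AE:
  assumes "1 \<le> J" "\<And>m. m < J \<Longrightarrow> R (p i m)"
  shows "AE x in unit_interval. R (cell_field J p i x)"
  using AE_cell[OF assms(1)] by eventually_elim (auto simp: cell_field_def assms(2))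

lemma cell_field_measurable:
  fixes p :: "3 \<Rightarrow> nat \<Rightarrow> 'a::euclidean_space"
  shows "1 \<le> J \<Longrightarrow> cell_field J p i \<in> borel_measurable unit_interval"
  using integrable_step[of J "\<lambda>m. p i (nat m)"] by (simp add: cell_field_def[abs_def])

lemma fem_continuous: "w \<in> fem J \<Longrightarrow> continuous_on {0..1} w"
  by (simp add: fem_def)

lemma triods0_hD:
  assumes "\<phi> \<in> triods0_h J"
  shows "\<phi> i \<in> fem J" "continuous_on {0..1} (\<phi> i)"
  using assms by (auto simp: triods0_h_def intro: fem_continuous)

lemma integrable_norm_square:
  fixes f :: "real \<Rightarrow> 'a::euclidean_space"
  shows "square_integrable 0 1 f \<Longrightarrow> integrable unit_interval (\<lambda>x. (norm (f x))\<^sup>2)"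
  by (simp add: square_integrable_def)

lemma integrable_norm_square_continuous:
  fixes f :: "real \<Rightarrow> 'a::euclidean_space"
  shows "continuous_on {0..1} f \<Longrightarrow> integrable unit_interval (\<lambda>x. (norm (f x))\<^sup>2)"
  by (intro integrable_norm_square square_integrable_continuous)

lemma tri_norm2_nonneg: "0 \<le> tri_norm2 \<phi>"
  unfolding tri_norm2_def by (intro sum_nonneg Bochner_Integration.integral_nonneg) simp

lemma fem_slope_L2:
  assumes Cp: "interpolation_constant Cp" and J: "1 \<le> J" and w: "w \<in> fem J"
  shows "(\<integral>x. (norm (slope J w x))\<^sup>2 \<partial>unit_interval) \<le> (Cp * real J)\<^sup>2 * (\<integral>x. (norm (w x))\<^sup>2 \<partial>unit_interval)"
proof -
  have "(L2_norm 0 1 (dx w))\<^sup>2 \<le> (Cp * real J * L2_norm 0 1 w)\<^sup>2"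
    using interpolation_constantD(5)[OF Cp J w] by (intro power_mono) auto
  moreover have "(\<integral>x. (norm (dx w x))\<^sup>2 \<partial>unit_interval) = (\<integral>x. (norm (slope J w x))\<^sup>2 \<partial>unit_interval)"
  proof (rule integral_cong_AE)
    show "AE x in unit_interval. (norm (dx w x))\<^sup>2 = (norm (slope J w x))\<^sup>2"
      using dx_fem[OF w J] by eventually_elim simp
  qed (use W1_square_integrable_dx[OF fem_W1[OF w J]] square_integrable_slope[OF J, of w] in \<open>auto simp: square_integrable_def\<close>)
  ultimately show ?thesis
    by (simp add: L2_norm_square power_mult_distrib)
qed

text \<open>The set where the bound holds is closed and, having full measure in the open interval,
  contains it; the closure of the latter includes the endpoints.\<close>

lemma continuous_norm_le_of_AE:
  assumes f: "continuous_on {0..1} f" and AE: "AE x in unit_interval. norm (f x) \<le> c" and x: "x \<in> {0..1::real}"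
  shows "norm (f x :: 'a::real_normed_vector) \<le> c"
proof -
  let ?C = "{x \<in> {0..1}. norm (f x) \<le> c}"
  have C: "closed ?C"
  proof -
    have "?C = {0..1} \<inter> (\<lambda>x. norm (f x)) -` {..c}" by auto
    then show ?thesis
      using continuous_closed_preimage[OF continuous_on_norm[OF f] closed_atLeastAtMost closed_atMost, of c] by simp
  qed
  have "y \<in> ?C" if y: "y \<in> {0<..<1}" for y
  proof (rule mem_closed_if_AE_lebesgue_open[OF _ C _ y])
    show "AE x\<in>{0<..<1} in lebesgue. x \<in> ?C"
      using AE by (auto simp: AE_restrict_space_iff elim: eventually_mono)
  qed simp
  then have "closure {0<..<1::real} \<subseteq> ?C" using C by (intro closure_minimal) auto
  then show ?thesis using x by (auto simp: closure_greaterThanLessThan)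
qed

lemma fem_sup_L2:
  assumes Cp: "interpolation_constant Cp" and J: "1 \<le> J" and w: "w \<in> fem J" and x: "x \<in> {0..1}"
  shows "norm (w x) \<le> Cp * sqrt (real J) * sqrt (\<integral>x. (norm (w x))\<^sup>2 \<partial>unit_interval)"
proof -
  have "AE x in unit_interval. norm (w x) \<le> Cp * sqrt (real J) * L2_norm 0 1 w"
    by (rule Linf_norm_AE) (rule interpolation_constantD(6)[OF Cp J w])
  from continuous_norm_le_of_AE[OF fem_continuous[OF w] this x] show ?thesis
    by (simp add: L2_norm_def)
qed

lemma Young: "0 < \<theta> \<Longrightarrow> a * b \<le> \<theta> * b\<^sup>2 + a\<^sup>2 / (4 * \<theta>)" for a b \<theta> :: real
proof -
  assume t: "0 < \<theta>"
  have "0 \<le> (2 * \<theta> * b - a)\<^sup>2 / (4 * \<theta>)" using t by simp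
  also have "\<dots> = \<theta> * b\<^sup>2 + a\<^sup>2 / (4 * \<theta>) - a * b"
    using t by (simp add: power2_eq_square diff_divide_distrib add_divide_distrib algebra_simps)
  finally show ?thesis by simp
qed

lemma mass_form_coercive:
  assumes p: "\<And>i. p i \<in> borel_measurable unit_interval" "\<And>i. AE x in unit_interval. c \<le> norm (p i x)"
    "\<And>i. AE x in unit_interval. norm (p i x) \<le> D"
    and \<phi>: "\<And>i. continuous_on {0..1} (\<phi> i)" and "0 \<le> \<epsilon>" "0 < c"
  shows "min c (\<epsilon> * c\<^sup>2) * tri_norm2 \<phi> \<le> mass_form \<epsilon> p \<phi> \<phi>"
  unfolding tri_norm2_def mass_form_def sum_distrib_left
proof (rule sum_mono)
  fix i
  have "(\<integral>x. min c (\<epsilon> * c\<^sup>2) * (norm (\<phi> i x))\<^sup>2 \<partial>unit_interval) \<le> (\<integral>x. aniso \<epsilon> (p i x) (\<phi> i x) (\<phi> i x) \<partial>unit_interval)"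
  proof (rule integral_mono_AE)
    show "integrable unit_interval (\<lambda>x. aniso \<epsilon> (p i x) (\<phi> i x) (\<phi> i x))"
      using p \<phi> \<open>0 \<le> \<epsilon>\<close> by (intro integrable_aniso)
    show "AE x in unit_interval. min c (\<epsilon> * c\<^sup>2) * (norm (\<phi> i x))\<^sup>2 \<le> aniso \<epsilon> (p i x) (\<phi> i x) (\<phi> i x)"
      using p(2)[of i] by eventually_elim (rule aniso_coercive[OF \<open>0 \<le> \<epsilon>\<close> \<open>0 < c\<close>])
  qed (use integrable_norm_square_continuous[OF \<phi>] in auto)
  then show "min c (\<epsilon> * c\<^sup>2) * (\<integral>x. (norm (\<phi> i x))\<^sup>2 \<partial>unit_interval) \<le> (\<integral>x. aniso \<epsilon> (p i x) (\<phi> i x) (\<phi> i x) \<partial>unit_interval)"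
    by simp
qed

lemma mass_form_diff:
  assumes p: "\<And>i. p i \<in> borel_measurable unit_interval" "\<And>i. AE x in unit_interval. norm (p i x) \<le> D"
    and w: "\<And>i. continuous_on {0..1} (w i)" "\<And>i. continuous_on {0..1} (w' i)" "\<And>i. continuous_on {0..1} (\<phi> i)"
    and "0 \<le> \<epsilon>"
  shows "mass_form \<epsilon> p (\<lambda>i x. w i x - w' i x) \<phi> = mass_form \<epsilon> p w \<phi> - mass_form \<epsilon> p w' \<phi>"
  unfolding mass_form_def sum_subtractf[symmetric] aniso_diff_left
  using p w \<open>0 \<le> \<epsilon>\<close> by (intro sum.cong refl Bochner_Integration.integral_diff integrable_aniso)

text \<open>The discrete equation at one time, read as a linear system for the velocity
  \<open>w\<close> with prescribed cell slopes \<open>p\<close>; these slopes need not be those of a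
  triod.\<close>

definition solves_velocity :: "nat \<Rightarrow> real \<Rightarrow> (3 \<Rightarrow> nat \<Rightarrow> real^2) \<Rightarrow> triple \<Rightarrow> bool" where
  "solves_velocity J \<epsilon> p w \<longleftrightarrow> w \<in> triods0_h J \<and>
     (\<forall>\<phi>\<in>triods0_h J. mass_form \<epsilon> (cell_field J p) w \<phi> = - flux_form \<epsilon> (cell_field J p) (\<lambda>i. slope J (\<phi> i)))"

lemma triods0_h_diff:
  assumes J: "1 \<le> J" and w: "w \<in> triods0_h J" "w' \<in> triods0_h J"
  shows "(\<lambda>i x. w i x - w' i x) \<in> triods0_h J"
proof -
  have "(\<lambda>x. w i x - w' i x) \<in> fem J" for i
    unfolding fem_def
  proof (intro CollectI conjI ballI)
    show "continuous_on {0..1} (\<lambda>x. w i x - w' i x)" using w by (intro continuous_intros triods0_hD)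
    fix j assume j: "j \<in> {1..J}"
    obtain a b where 1: "\<forall>x\<in>{(real j - 1) / real J..real j / real J}. w i x = a + x *\<^sub>R b"
      using triods0_hD(1)[OF w(1), of i] j unfolding fem_def by blast
    obtain a' b' where 2: "\<forall>x\<in>{(real j - 1) / real J..real j / real J}. w' i x = a' + x *\<^sub>R b'"
      using triods0_hD(1)[OF w(2), of i] j unfolding fem_def by blast
    show "\<exists>a b. \<forall>x\<in>{(real j - 1) / real J..real j / real J}. w i x - w' i x = a + x *\<^sub>R b"
      using 1 2 by (intro exI[of _ "a - a'"] exI[of _ "b - b'"]) (simp add: algebra_simps)
  qed
  then show ?thesis using w by (auto simp: triods0_h_def) metis
qed

text \<open>The velocity itself is the test function. The flux is paired with its slope, which the
  inverse estimate bounds at the price of a factor \<open>real J\<close>; such constants are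
  harmless here because the bound is used on one fixed mesh.\<close>

lemma velocity_bound:
  assumes Cp: "interpolation_constant Cp" and J: "1 \<le> J" and eps: "0 < \<epsilon>" and c: "0 < c"
    and p: "\<And>i m. m < J \<Longrightarrow> c \<le> norm (p i m) \<and> norm (p i m) \<le> D"
    and w: "solves_velocity J \<epsilon> p w"
  defines "lam \<equiv> min c (\<epsilon> * c\<^sup>2)"
  shows "tri_norm2 w \<le> 3 * (\<epsilon> * D + 1)\<^sup>2 * (Cp * real J)\<^sup>2 / lam\<^sup>2"
proof -
  let ?p = "cell_field J p"
  \<comment> \<open>Chosen so that the inverse estimate turns \<open>\<theta>\<close> times the
    squared slope norm into half of the coercivity.\<close>
  define \<theta> where "\<theta> = lam / (2 * (Cp * real J)\<^sup>2)"
  have lam: "lam > 0" using c eps by (simp add: lam_def)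
  have CJ: "Cp * real J > 0" using interpolation_constantD(1)[OF Cp J] J by simp
  have th: "\<theta> > 0"
    unfolding \<theta>_def by (rule divide_pos_pos[OF lam], rule mult_pos_pos, simp, rule zero_less_power[OF CJ])
  have w0: "w \<in> triods0_h J" using w by (simp add: solves_velocity_def)
  have pm: "?p i \<in> borel_measurable unit_interval" for i using J by (rule cell_field_measurable)
  have pb: "AE x in unit_interval. c \<le> norm (?p i x)" "AE x in unit_interval. norm (?p i x) \<le> D" for i
    using p J by (auto intro!: cell_field_AE)
  have "lam * tri_norm2 w \<le> mass_form \<epsilon> ?p w w"
    unfolding lam_def using pm pb triods0_hD[OF w0] eps c by (intro mass_form_coercive) auto
  also have "\<dots> = - flux_form \<epsilon> ?p (\<lambda>i. slope J (w i))" using w w0 by (simp add: solves_velocity_def)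
  also have "\<dots> = (\<Sum>i\<in>UNIV. - (\<integral>x. (\<epsilon> *\<^sub>R ?p i x + sgn (?p i x)) \<bullet> slope J (w i) x \<partial>unit_interval))"
    by (simp add: flux_form_def sum_negf)
  also have "\<dots> \<le> (\<Sum>i\<in>(UNIV::3 set). lam / 2 * (\<integral>x. (norm (w i x))\<^sup>2 \<partial>unit_interval) + (\<epsilon> * D + 1)\<^sup>2 / (4 * \<theta>))"
  proof (rule sum_mono)
    fix i :: 3
    have sq: "integrable unit_interval (slope J (w i))" "integrable unit_interval (\<lambda>x. (norm (slope J (w i) x))\<^sup>2)"
      using integrable_slope[OF J] integrable_norm_square[OF square_integrable_slope[OF J]] by auto
    have "- (\<integral>x. (\<epsilon> *\<^sub>R ?p i x + sgn (?p i x)) \<bullet> slope J (w i) x \<partial>unit_interval)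
       = (\<integral>x. - ((\<epsilon> *\<^sub>R ?p i x + sgn (?p i x)) \<bullet> slope J (w i) x) \<partial>unit_interval)" by simp
    also have "\<dots> \<le> (\<integral>x. \<theta> * (norm (slope J (w i) x))\<^sup>2 + (\<epsilon> * D + 1)\<^sup>2 / (4 * \<theta>) \<partial>unit_interval)"
    proof (rule integral_mono_AE)
      show "integrable unit_interval (\<lambda>x. - ((\<epsilon> *\<^sub>R ?p i x + sgn (?p i x)) \<bullet> slope J (w i) x))"
        using integrable_flux[OF pm pb(2) sq(1)] eps by auto
      show "AE x in unit_interval. - ((\<epsilon> *\<^sub>R ?p i x + sgn (?p i x)) \<bullet> slope J (w i) x) \<le> \<theta> * (norm (slope J (w i) x))\<^sup>2 + (\<epsilon> * D + 1)\<^sup>2 / (4 * \<theta>)"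
        using pb(2)[of i]
      proof eventually_elim
        case (elim x)
        have "norm (\<epsilon> *\<^sub>R ?p i x + sgn (?p i x)) \<le> \<epsilon> * D + 1"
          using norm_flux_le[of \<epsilon> "?p i x"] mult_left_mono[OF elim, of \<epsilon>] eps by linarith
        then have "- ((\<epsilon> *\<^sub>R ?p i x + sgn (?p i x)) \<bullet> slope J (w i) x) \<le> (\<epsilon> * D + 1) * norm (slope J (w i) x)"
          using Cauchy_Schwarz_ineq2[of "\<epsilon> *\<^sub>R ?p i x + sgn (?p i x)" "slope J (w i) x"]
            mult_right_mono[of "norm (\<epsilon> *\<^sub>R ?p i x + sgn (?p i x))" "\<epsilon> * D + 1" "norm (slope J (w i) x)"] by simp
        also note Young[OF th]
        finally show ?case .
      qed
    qed (use sq in auto)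
    also have "\<dots> = \<theta> * (\<integral>x. (norm (slope J (w i) x))\<^sup>2 \<partial>unit_interval) + (\<epsilon> * D + 1)\<^sup>2 / (4 * \<theta>)"
      using sq by (simp add: measure_restrict_space)
    also have "\<theta> * (\<integral>x. (norm (slope J (w i) x))\<^sup>2 \<partial>unit_interval) \<le> \<theta> * ((Cp * real J)\<^sup>2 * (\<integral>x. (norm (w i x))\<^sup>2 \<partial>unit_interval))"
      using fem_slope_L2[OF Cp J triods0_hD(1)[OF w0]] th by (intro mult_left_mono) auto
    also have "\<dots> = lam / 2 * (\<integral>x. (norm (w i x))\<^sup>2 \<partial>unit_interval)"
      using interpolation_constantD(1)[OF Cp J] J by (auto simp: \<theta>_def)
    finally show "- (\<integral>x. (\<epsilon> *\<^sub>R ?p i x + sgn (?p i x)) \<bullet> slope J (w i) x \<partial>unit_interval)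
       \<le> lam / 2 * (\<integral>x. (norm (w i x))\<^sup>2 \<partial>unit_interval) + (\<epsilon> * D + 1)\<^sup>2 / (4 * \<theta>)" by simp
  qed
  also have "\<dots> = lam / 2 * tri_norm2 w + 3 * ((\<epsilon> * D + 1)\<^sup>2 / (4 * \<theta>))"
    by (simp add: tri_norm2_def sum.distrib sum_distrib_left)
  finally have "lam / 2 * tri_norm2 w \<le> 3 * ((\<epsilon> * D + 1)\<^sup>2 / (4 * \<theta>))" by simp
  also have "\<dots> = lam / 2 * (3 * (\<epsilon> * D + 1)\<^sup>2 * (Cp * real J)\<^sup>2 / lam\<^sup>2)"
    using lam interpolation_constantD(1)[OF Cp J] J by (simp add: \<theta>_def power2_eq_square)
  finally show ?thesis using lam by (simp only: mult_le_cancel_left_pos half_gt_zero)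
qed

lemma flux_Lipschitz:
  fixes p q :: "'a::real_normed_vector"
  assumes "0 \<le> \<epsilon>" "0 < c" "c \<le> norm p"
  shows "norm ((\<epsilon> *\<^sub>R p + sgn p) - (\<epsilon> *\<^sub>R q + sgn q)) \<le> (\<epsilon> + 2 / c) * norm (p - q)"
proof -
  have p: "p \<noteq> 0" "0 < norm p" using assms by auto
  have "norm (sgn p - sgn q) \<le> 2 * norm (p - q) / norm p" by (rule norm_sgn_diff_le[OF p(1)])
  also have "\<dots> \<le> 2 * norm (p - q) / c" using assms p by (intro divide_left_mono) auto
  finally have "norm (sgn p - sgn q) \<le> 2 / c * norm (p - q)" by simp
  moreover have "(\<epsilon> *\<^sub>R p + sgn p) - (\<epsilon> *\<^sub>R q + sgn q) = \<epsilon> *\<^sub>R (p - q) + (sgn p - sgn q)" by (simp add: algebra_simps)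
  moreover have "norm (\<epsilon> *\<^sub>R (p - q)) = \<epsilon> * norm (p - q)" using assms(1) by simp
  ultimately show ?thesis
    using norm_triangle_ineq[of "\<epsilon> *\<^sub>R (p - q)" "sgn p - sgn q"] by (simp only: distrib_right)
qed

text \<open>Two systems are subtracted and tested with the difference \<open>e\<close> of their
  solutions. The change of slopes acts on the fluxes and on the mass form with the fixed velocity
  \<open>w'\<close>, whose size is controlled by \<open>velocity_bound\<close>.\<close>

lemma velocity_Lipschitz:
  assumes Cp: "interpolation_constant Cp" and J: "1 \<le> J" and eps: "0 < \<epsilon>" and c: "0 < c"
  obtains k where "0 \<le> k"
    "\<And>p p' w w' \<delta>. (\<And>i m. m < J \<Longrightarrow> c \<le> norm (p i m) \<and> norm (p i m) \<le> D) \<Longrightarrow>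
       (\<And>i m. m < J \<Longrightarrow> c \<le> norm (p' i m) \<and> norm (p' i m) \<le> D) \<Longrightarrow>
       (\<And>i m. m < J \<Longrightarrow> norm (p i m - p' i m) \<le> \<delta>) \<Longrightarrow>
       solves_velocity J \<epsilon> p w \<Longrightarrow> solves_velocity J \<epsilon> p' w' \<Longrightarrow>
       tri_norm2 (\<lambda>i x. w i x - w' i x) \<le> k * \<delta>\<^sup>2"
proof
  define lam where "lam = min c (\<epsilon> * c\<^sup>2)"
  define N where "N = 3 * (\<epsilon> * D + 1)\<^sup>2 * (Cp * real J)\<^sup>2 / lam\<^sup>2"
  define L where "L = 5 + \<epsilon> * (D + D)"
  \<comment> \<open>Flux and mass terms each absorb a quarter of the coercivity, leaving half of it
    on the left.\<close>
  define \<theta> where "\<theta> = lam / (4 * (Cp * real J)\<^sup>2)"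
  define k where "k = (3 * ((\<epsilon> + 2 / c)\<^sup>2 / (4 * \<theta>)) + L\<^sup>2 / lam * N) / (lam / 2)"
  have lam: "lam > 0" using c eps by (simp add: lam_def)
  have CJ: "Cp * real J > 0" using interpolation_constantD(1)[OF Cp J] J by simp
  have th: "\<theta> > 0"
    unfolding \<theta>_def by (rule divide_pos_pos[OF lam], rule mult_pos_pos, simp, rule zero_less_power[OF CJ])
  show "0 \<le> k" unfolding k_def N_def using lam th by simp
  fix p p' w w' \<delta>
  assume p: "\<And>i m. m < J \<Longrightarrow> c \<le> norm (p i m) \<and> norm (p i m) \<le> D"
    and p': "\<And>i m. m < J \<Longrightarrow> c \<le> norm (p' i m) \<and> norm (p' i m) \<le> D"
    and d: "\<And>i m. m < J \<Longrightarrow> norm (p i m - p' i m) \<le> \<delta>"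
    and w: "solves_velocity J \<epsilon> p w" and w': "solves_velocity J \<epsilon> p' w'"
  let ?p = "cell_field J p" and ?q = "cell_field J p'"
  define e where "e = (\<lambda>i x. w i x - w' i x)"
  have w0: "w \<in> triods0_h J" "w' \<in> triods0_h J" using w w' by (auto simp: solves_velocity_def)
  have e0: "e \<in> triods0_h J" unfolding e_def using triods0_h_diff[OF J w0] .
  note wc = triods0_hD(2)[OF w0(1)] triods0_hD(2)[OF w0(2)] triods0_hD(2)[OF e0]
  have pm: "?p i \<in> borel_measurable unit_interval" "?q i \<in> borel_measurable unit_interval" for i
    using J by (auto intro: cell_field_measurable)
  have pb: "AE x in unit_interval. c \<le> norm (?p i x)" "AE x in unit_interval. norm (?p i x) \<le> D"
    "AE x in unit_interval. c \<le> norm (?q i x)" "AE x in unit_interval. norm (?q i x) \<le> D" for i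
    using p p' J by (auto intro!: cell_field_AE)
  have db: "AE x in unit_interval. norm (?p i x - ?q i x) \<le> \<delta>" for i
    using AE_cell[OF J] by eventually_elim (auto simp: cell_field_def d)
  have "lam * tri_norm2 e \<le> mass_form \<epsilon> ?p e e"
    unfolding lam_def using pm pb wc eps c by (intro mass_form_coercive) auto
  also have "\<dots> = mass_form \<epsilon> ?p w e - mass_form \<epsilon> ?p w' e"
    unfolding e_def using pm pb wc eps by (intro mass_form_diff) (auto simp: e_def intro!: continuous_intros)
  also have "\<dots> = flux_form \<epsilon> ?q (\<lambda>i. slope J (e i)) - flux_form \<epsilon> ?p (\<lambda>i. slope J (e i)) + (mass_form \<epsilon> ?q w' e - mass_form \<epsilon> ?p w' e)"
    using w w' e0 by (simp add: solves_velocity_def)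
  also have "\<dots> = (\<Sum>i\<in>UNIV. \<integral>x. ((\<epsilon> *\<^sub>R ?q i x + sgn (?q i x)) \<bullet> slope J (e i) x - (\<epsilon> *\<^sub>R ?p i x + sgn (?p i x)) \<bullet> slope J (e i) x)
       + (aniso \<epsilon> (?q i x) (w' i x) (e i x) - aniso \<epsilon> (?p i x) (w' i x) (e i x)) \<partial>unit_interval)"
  proof -
    have "integrable unit_interval (\<lambda>x. (\<epsilon> *\<^sub>R ?q i x + sgn (?q i x)) \<bullet> slope J (e i) x)"
      "integrable unit_interval (\<lambda>x. (\<epsilon> *\<^sub>R ?p i x + sgn (?p i x)) \<bullet> slope J (e i) x)"
      "integrable unit_interval (\<lambda>x. aniso \<epsilon> (?q i x) (w' i x) (e i x))"
      "integrable unit_interval (\<lambda>x. aniso \<epsilon> (?p i x) (w' i x) (e i x))" for i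
      using pm[of i] pb[of i] wc integrable_slope[OF J] eps by (auto intro!: integrable_flux integrable_aniso)
    then show ?thesis
      unfolding flux_form_def mass_form_def sum_subtractf[symmetric] sum.distrib[symmetric] by simp
  qed
  also have "\<dots> \<le> (\<Sum>i\<in>(UNIV::3 set). lam / 4 * (\<integral>x. (norm (e i x))\<^sup>2 \<partial>unit_interval) + ((\<epsilon> + 2 / c) * \<delta>)\<^sup>2 / (4 * \<theta>)
      + (lam / 4 * (\<integral>x. (norm (e i x))\<^sup>2 \<partial>unit_interval) + (L * \<delta>)\<^sup>2 / lam * (\<integral>x. (norm (w' i x))\<^sup>2 \<partial>unit_interval)))"
  proof (rule sum_mono)
    fix i :: 3
    have sq: "integrable unit_interval (\<lambda>x. (norm (slope J (e i) x))\<^sup>2)" "integrable unit_interval (\<lambda>x. (norm (e i x))\<^sup>2)"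
      "integrable unit_interval (\<lambda>x. (norm (w' i x))\<^sup>2)"
      using integrable_norm_square[OF square_integrable_slope[OF J]] integrable_norm_square_continuous[OF wc(2)]
        integrable_norm_square_continuous[OF wc(3)] by auto
    have "(\<integral>x. ((\<epsilon> *\<^sub>R ?q i x + sgn (?q i x)) \<bullet> slope J (e i) x - (\<epsilon> *\<^sub>R ?p i x + sgn (?p i x)) \<bullet> slope J (e i) x)
       + (aniso \<epsilon> (?q i x) (w' i x) (e i x) - aniso \<epsilon> (?p i x) (w' i x) (e i x)) \<partial>unit_interval)
     \<le> (\<integral>x. \<theta> * (norm (slope J (e i) x))\<^sup>2 + ((\<epsilon> + 2 / c) * \<delta>)\<^sup>2 / (4 * \<theta>)
         + (lam / 4 * (norm (e i x))\<^sup>2 + (L * \<delta>)\<^sup>2 / lam * (norm (w' i x))\<^sup>2) \<partial>unit_interval)"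
    proof (rule integral_mono_AE)
      show "integrable unit_interval (\<lambda>x. ((\<epsilon> *\<^sub>R ?q i x + sgn (?q i x)) \<bullet> slope J (e i) x - (\<epsilon> *\<^sub>R ?p i x + sgn (?p i x)) \<bullet> slope J (e i) x)
       + (aniso \<epsilon> (?q i x) (w' i x) (e i x) - aniso \<epsilon> (?p i x) (w' i x) (e i x)))"
        using pm[of i] pb[of i] wc integrable_slope[OF J] eps
        by (intro Bochner_Integration.integrable_add Bochner_Integration.integrable_diff) (auto intro!: integrable_flux integrable_aniso)
      show "AE x in unit_interval. ((\<epsilon> *\<^sub>R ?q i x + sgn (?q i x)) \<bullet> slope J (e i) x - (\<epsilon> *\<^sub>R ?p i x + sgn (?p i x)) \<bullet> slope J (e i) x)
       + (aniso \<epsilon> (?q i x) (w' i x) (e i x) - aniso \<epsilon> (?p i x) (w' i x) (e i x))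
       \<le> \<theta> * (norm (slope J (e i) x))\<^sup>2 + ((\<epsilon> + 2 / c) * \<delta>)\<^sup>2 / (4 * \<theta>)
         + (lam / 4 * (norm (e i x))\<^sup>2 + (L * \<delta>)\<^sup>2 / lam * (norm (w' i x))\<^sup>2)"
        using pb(1)[of i] pb(2)[of i] pb(3)[of i] pb(4)[of i] db[of i]
      proof eventually_elim
        case (elim x)
        define P Q s where "P = ?p i x" and "Q = ?q i x" and "s = slope J (e i) x"
        note el = elim[folded P_def Q_def s_def]
        have "norm ((\<epsilon> *\<^sub>R Q + sgn Q) - (\<epsilon> *\<^sub>R P + sgn P)) \<le> (\<epsilon> + 2 / c) * norm (Q - P)"
          using el eps c by (intro flux_Lipschitz) auto
        also have "\<dots> \<le> (\<epsilon> + 2 / c) * \<delta>"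
          using el eps c by (intro mult_left_mono) (auto simp: norm_minus_commute)
        finally have "(\<epsilon> *\<^sub>R Q + sgn Q) \<bullet> s - (\<epsilon> *\<^sub>R P + sgn P) \<bullet> s \<le> ((\<epsilon> + 2 / c) * \<delta>) * norm s"
          unfolding inner_diff_left[symmetric] by (intro order_trans[OF norm_cauchy_schwarz] mult_right_mono) auto
        also note Young[OF th]
        finally have 1: "(\<epsilon> *\<^sub>R Q + sgn Q) \<bullet> s - (\<epsilon> *\<^sub>R P + sgn P) \<bullet> s \<le> \<theta> * (norm s)\<^sup>2 + ((\<epsilon> + 2 / c) * \<delta>)\<^sup>2 / (4 * \<theta>)" .
        have nz: "Q \<noteq> 0" "P \<noteq> 0" using el c by auto
        have "aniso \<epsilon> Q (w' i x) (e i x) - aniso \<epsilon> P (w' i x) (e i x) \<le> (5 + \<epsilon> * (norm Q + norm P)) * norm (Q - P) * norm (w' i x) * norm (e i x)"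
          using aniso_Lipschitz[OF _ nz, of \<epsilon> "w' i x" "e i x"] eps by simp
        also have "\<dots> \<le> L * \<delta> * norm (w' i x) * norm (e i x)"
        proof -
          have "5 + \<epsilon> * (norm Q + norm P) \<le> L" unfolding L_def using el eps by (intro add_left_mono mult_left_mono) auto
          moreover have "0 \<le> 5 + \<epsilon> * (norm Q + norm P)" using eps by simp
          moreover have "norm (Q - P) \<le> \<delta>" using el by (simp add: norm_minus_commute)
          ultimately have "(5 + \<epsilon> * (norm Q + norm P)) * norm (Q - P) \<le> L * \<delta>" by (intro mult_mono) auto
          then show ?thesis by (intro mult_right_mono) auto
        qed
        also have "\<dots> \<le> (lam / 4) * (norm (e i x))\<^sup>2 + (L * \<delta> * norm (w' i x))\<^sup>2 / (4 * (lam / 4))"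
          using lam by (intro Young) auto
        also have "\<dots> = lam / 4 * (norm (e i x))\<^sup>2 + (L * \<delta>)\<^sup>2 / lam * (norm (w' i x))\<^sup>2"
          by (simp add: power_mult_distrib)
        finally show ?case using 1 unfolding P_def Q_def s_def by linarith
      qed
    qed (use sq in auto)
    also have "\<dots> = \<theta> * (\<integral>x. (norm (slope J (e i) x))\<^sup>2 \<partial>unit_interval) + ((\<epsilon> + 2 / c) * \<delta>)\<^sup>2 / (4 * \<theta>)
       + (lam / 4 * (\<integral>x. (norm (e i x))\<^sup>2 \<partial>unit_interval) + (L * \<delta>)\<^sup>2 / lam * (\<integral>x. (norm (w' i x))\<^sup>2 \<partial>unit_interval))"
      using sq by (simp add: measure_restrict_space)
    also have "\<theta> * (\<integral>x. (norm (slope J (e i) x))\<^sup>2 \<partial>unit_interval) \<le> \<theta> * ((Cp * real J)\<^sup>2 * (\<integral>x. (norm (e i x))\<^sup>2 \<partial>unit_interval))"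
      using fem_slope_L2[OF Cp J triods0_hD(1)[OF e0]] th by (intro mult_left_mono) auto
    also have "\<dots> = lam / 4 * (\<integral>x. (norm (e i x))\<^sup>2 \<partial>unit_interval)" using interpolation_constantD(1)[OF Cp J] J by (auto simp: \<theta>_def)
    finally show "(\<integral>x. ((\<epsilon> *\<^sub>R ?q i x + sgn (?q i x)) \<bullet> slope J (e i) x - (\<epsilon> *\<^sub>R ?p i x + sgn (?p i x)) \<bullet> slope J (e i) x)
       + (aniso \<epsilon> (?q i x) (w' i x) (e i x) - aniso \<epsilon> (?p i x) (w' i x) (e i x)) \<partial>unit_interval)
     \<le> lam / 4 * (\<integral>x. (norm (e i x))\<^sup>2 \<partial>unit_interval) + ((\<epsilon> + 2 / c) * \<delta>)\<^sup>2 / (4 * \<theta>)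
      + (lam / 4 * (\<integral>x. (norm (e i x))\<^sup>2 \<partial>unit_interval) + (L * \<delta>)\<^sup>2 / lam * (\<integral>x. (norm (w' i x))\<^sup>2 \<partial>unit_interval))" by simp
  qed
  also have "\<dots> = lam / 2 * tri_norm2 e + 3 * (((\<epsilon> + 2 / c) * \<delta>)\<^sup>2 / (4 * \<theta>)) + (L * \<delta>)\<^sup>2 / lam * tri_norm2 w'"
    by (simp add: tri_norm2_def sum.distrib sum_distrib_left sum_divide_distrib)
  also have "(L * \<delta>)\<^sup>2 / lam * tri_norm2 w' \<le> (L * \<delta>)\<^sup>2 / lam * N"
    using velocity_bound[OF Cp J eps c p' w'] lam unfolding N_def lam_def by (intro mult_left_mono) auto
  finally have "lam / 2 * tri_norm2 e \<le> 3 * (((\<epsilon> + 2 / c) * \<delta>)\<^sup>2 / (4 * \<theta>)) + (L * \<delta>)\<^sup>2 / lam * N" by simp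
  also have "\<dots> = lam / 2 * (k * \<delta>\<^sup>2)"
  proof -
    have kd: "lam / 2 * (k * \<delta>\<^sup>2) = (3 * ((\<epsilon> + 2 / c)\<^sup>2 / (4 * \<theta>)) + L\<^sup>2 / lam * N) * \<delta>\<^sup>2"
      using lam by (simp add: k_def)
    show ?thesis unfolding kd power_mult_distrib by (simp add: distrib_left mult_ac)
  qed
  finally have "tri_norm2 e \<le> k * \<delta>\<^sup>2" using lam by (simp only: mult_le_cancel_left_pos half_gt_zero)
  then show "tri_norm2 (\<lambda>i x. w i x - w' i x) \<le> k * \<delta>\<^sup>2" by (simp add: e_def)
qed

section \<open>The regularized discrete flow\<close>

instance bcontfun :: (metric_space, banach) banach ..

text \<open>All nodal values in one Banach space that does not depend on \<open>J\<close>: on the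
  discrete type every function is continuous, so these are the bounded sequences of triples of
  points. Thus the number of nodes can be a variable although types cannot depend on it.\<close>

type_synonym state = "nat discrete \<Rightarrow>\<^sub>C ((real^2)^3)"

definition coord :: "state \<Rightarrow> nat \<Rightarrow> (real^2)^3" where
  "coord Y n = apply_bcontfun Y (discrete n)"

lemma coord_simps [simp]:
  "coord (Y + Z) n = coord Y n + coord Z n" "coord (Y - Z) n = coord Y n - coord Z n"
  "coord (c *\<^sub>R Y) n = c *\<^sub>R coord Y n" "coord 0 n = 0"
  by (simp_all add: coord_def)

lemma norm_coord_le: "norm (coord Y n) \<le> norm Y"
  unfolding coord_def by (rule norm_bounded)

lemma norm_state_le: "(\<And>n. norm (coord Y n) \<le> b) \<Longrightarrow> norm Y \<le> b"
  unfolding coord_def by (intro norm_bound) (metis of_discrete_inverse)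

lemma state_eqI: "(\<And>n. coord Y n = coord Z n) \<Longrightarrow> Y = Z"
  unfolding coord_def by (intro bcontfun_eqI) (metis of_discrete_inverse)

definition state_of :: "nat \<Rightarrow> (3 \<Rightarrow> nat \<Rightarrow> real^2) \<Rightarrow> state" where
  "state_of J y = Bcontfun (\<lambda>n. if of_discrete n \<le> J then (\<chi> i. y i (of_discrete n)) else 0)"

definition state_triple :: "nat \<Rightarrow> state \<Rightarrow> triple" where
  "state_triple J Y i = nodal J (\<lambda>j. coord Y j $ i)"

text \<open>The states of velocities and test triples: node \<open>J\<close>, which is the end
  \<open>x = 1\<close>, already carries the value 0, and all three curves agree at node 0.
  Positions, with end values \<open>P i\<close>, are not meant.\<close>

definition state_space :: "nat \<Rightarrow> state set" where
  "state_space J = {Y. (\<forall>n\<ge>J. coord Y n = 0) \<and> (\<forall>i k. coord Y 0 $ i = coord Y 0 $ k)}"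

definition state_slope :: "nat \<Rightarrow> state \<Rightarrow> 3 \<Rightarrow> nat \<Rightarrow> real^2" where
  "state_slope J Y i m = real J *\<^sub>R (coord Y (Suc m) $ i - coord Y m $ i)"

lemma coord_state_of: "coord (state_of J y) n $ i = (if n \<le> J then y i n else 0)"
proof -
  have "(\<lambda>n. if of_discrete n \<le> J then (\<chi> i. y i (of_discrete n)) else 0) \<in> bcontfun"
  proof (rule bcontfun_normI)
    show "continuous_on UNIV (\<lambda>n. if of_discrete n \<le> J then (\<chi> i. y i (of_discrete n)) else 0)"
      by (simp add: continuous_on_open_vimage open_discrete)
    show "norm (if of_discrete n \<le> J then (\<chi> i. y i (of_discrete n)) else 0) \<le> (\<Sum>n\<le>J. norm ((\<chi> i. y i n) :: (real^2)^3))" for n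
      using member_le_sum[of "of_discrete n" "{..J}" "\<lambda>n. norm ((\<chi> i. y i n) :: (real^2)^3)"] by (auto intro: sum_nonneg)
  qed
  then show ?thesis by (simp add: coord_def state_of_def Bcontfun_inverse discrete_inverse)
qed

lemma subspace_state_space: "subspace (state_space J)"
  unfolding subspace_def state_space_def by (auto; metis)

lemma state_triple_node: "j \<le> J \<Longrightarrow> 1 \<le> J \<Longrightarrow> state_triple J Y i (real j / real J) = coord Y j $ i"
  by (simp add: state_triple_def nodal_node)

lemma state_triple_fem: "1 \<le> J \<Longrightarrow> state_triple J Y i \<in> fem J"
  by (simp add: state_triple_def nodal_fem)

lemma state_triple_triods0_h:
  assumes J: "1 \<le> J" and Y: "Y \<in> state_space J"
  shows "state_triple J Y \<in> triods0_h J"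
proof -
  have "state_triple J Y i 1 = 0" "state_triple J Y i 0 = coord Y 0 $ i" for i
    using state_triple_node[of J J Y i] state_triple_node[of 0 J Y i] J Y by (auto simp: state_space_def)
  then show ?thesis
    using Y state_triple_fem[OF J] by (auto simp: triods0_h_def state_space_def)
qed

lemma triods0_h_state:
  assumes J: "1 \<le> J" and \<phi>: "\<phi> \<in> triods0_h J"
  shows "state_of J (\<lambda>i n. \<phi> i (real n / real J)) \<in> state_space J"
    and "\<And>i x. x \<in> {0..1} \<Longrightarrow> state_triple J (state_of J (\<lambda>i n. \<phi> i (real n / real J))) i x = \<phi> i x"
proof -
  show "state_of J (\<lambda>i n. \<phi> i (real n / real J)) \<in> state_space J"
    using \<phi> J by (auto simp: state_space_def vec_eq_iff coord_state_of triods0_h_def)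
  show "state_triple J (state_of J (\<lambda>i n. \<phi> i (real n / real J))) i x = \<phi> i x" if x: "x \<in> {0..1}" for i x
    using fem_eq_nodal[OF triods0_hD(1)[OF \<phi>] J x, of i]
    by (auto simp: state_triple_def nodal_def coord_state_of intro!: sum.cong)
qed

lemma state_triple_add: "state_triple J (Y + Z) = (\<lambda>i x. state_triple J Y i x + state_triple J Z i x)"
  by (intro ext) (simp add: state_triple_def nodal_def scaleR_add_right sum.distrib)

lemma state_triple_diff: "state_triple J (Y - Z) = (\<lambda>i x. state_triple J Y i x - state_triple J Z i x)"
  by (intro ext) (simp add: state_triple_def nodal_def scaleR_diff_right sum_subtractf)

lemma state_triple_scaleR: "state_triple J (c *\<^sub>R Y) = (\<lambda>i x. c *\<^sub>R state_triple J Y i x)"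
  by (intro ext) (simp add: state_triple_def nodal_def scaleR_sum_right mult.commute)

lemma slope_state_triple:
  assumes "1 \<le> J"
  shows "AE x in unit_interval. slope J (state_triple J Y i) x = cell_field J (state_slope J Y) i x"
  using AE_cell[OF assms]
proof eventually_elim
  case (elim x)
  then obtain l where l: "l < J" "\<lfloor>real J * x\<rfloor> = int l" by blast
  then show ?case
    using state_triple_node[of "Suc l" J Y i] state_triple_node[of l J Y i] assms
    by (simp add: slope_cell cell_field_def state_slope_def del: of_nat_Suc)
qed

text \<open>One half of a norm equivalence on a fixed mesh, from the inverse estimate evaluated at
  the nodes; the 3 counts the curves.\<close>

lemma state_norm_le:
  assumes Cp: "interpolation_constant Cp" and J: "1 \<le> J" and Y: "Y \<in> state_space J"
  shows "norm Y \<le> 3 * (Cp * sqrt (real J) * sqrt (tri_norm2 (state_triple J Y)))"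
proof (rule norm_state_le)
  fix n
  have C: "0 < Cp" using interpolation_constantD(1)[OF Cp J] .
  show "norm (coord Y n) \<le> 3 * (Cp * sqrt (real J) * sqrt (tri_norm2 (state_triple J Y)))"
  proof (cases "n \<le> J")
    case False
    then show ?thesis using Y C tri_norm2_nonneg by (auto simp: state_space_def)
  next
    case True
    have "norm (coord Y n $ i) \<le> Cp * sqrt (real J) * sqrt (tri_norm2 (state_triple J Y))" for i
    proof -
      have "norm (coord Y n $ i) = norm (state_triple J Y i (real n / real J))"
        using True J by (simp add: state_triple_node)
      also have "\<dots> \<le> Cp * sqrt (real J) * sqrt (\<integral>x. (norm (state_triple J Y i x))\<^sup>2 \<partial>unit_interval)"
        using True J by (intro fem_sup_L2[OF Cp J state_triple_fem[OF J]]) auto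
      also have "\<dots> \<le> Cp * sqrt (real J) * sqrt (tri_norm2 (state_triple J Y))"
        unfolding tri_norm2_def using C
        by (intro mult_left_mono real_sqrt_le_mono member_le_sum) (auto intro: Bochner_Integration.integral_nonneg)
      finally show ?thesis .
    qed
    then have "(\<Sum>i\<in>UNIV. norm (coord Y n $ i)) \<le> (\<Sum>i\<in>(UNIV::3 set). Cp * sqrt (real J) * sqrt (tri_norm2 (state_triple J Y)))"
      by (intro sum_mono) auto
    moreover have "norm (coord Y n) \<le> (\<Sum>i\<in>UNIV. norm (coord Y n $ i))"
      unfolding norm_vec_def by (rule L2_set_le_sum) simp
    ultimately show ?thesis by simp
  qed
qed

text \<open>Solvability rests on coercivity of the mass form over \<open>state_space\<close>; the
  separating functionals are the finitely many coordinates of the nodal values.\<close>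

lemma velocity_exists:
  assumes Cp: "interpolation_constant Cp" and J: "1 \<le> J" and eps: "0 < \<epsilon>" and c: "0 < c"
    and p: "\<And>i m. m < J \<Longrightarrow> c \<le> norm (p i m) \<and> norm (p i m) \<le> D"
  obtains Z where "Z \<in> state_space J" "solves_velocity J \<epsilon> p (state_triple J Z)"
proof -
  let ?p = "cell_field J p"
  define a where "a Y Z = mass_form \<epsilon> ?p (state_triple J Y) (state_triple J Z)" for Y Z
  define b where "b Z = - flux_form \<epsilon> ?p (\<lambda>i. slope J (state_triple J Z i))" for Z
  have pm: "?p i \<in> borel_measurable unit_interval" for i using J by (rule cell_field_measurable)
  have pb: "AE x in unit_interval. c \<le> norm (?p i x)" "AE x in unit_interval. norm (?p i x) \<le> D" for i
    using p J by (auto intro!: cell_field_AE)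
  have sc: "continuous_on {0..1} (state_triple J Y i)" for Y i
    unfolding state_triple_def by (rule continuous_on_nodal)
  have ai: "integrable unit_interval (\<lambda>x. aniso \<epsilon> (?p i x) (state_triple J Y i x) (state_triple J Z i x))" for i Y Z
    using pm pb(2) sc eps by (intro integrable_aniso) auto
  have bi: "integrable unit_interval (\<lambda>x. (\<epsilon> *\<^sub>R ?p i x + sgn (?p i x)) \<bullet> slope J (state_triple J Z i) x)" for i Z
    using pm pb(2) integrable_slope[OF J] eps by (intro integrable_flux) auto
  have a_lin: "linear (\<lambda>Y. a Y Z)" for Z
  proof (rule linearI)
    show "a (Y + Y') Z = a Y Z + a Y' Z" for Y Y'
      unfolding a_def mass_form_def state_triple_add aniso_add_left sum.distrib[symmetric]
      by (intro sum.cong refl Bochner_Integration.integral_add ai)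
    show "a (r *\<^sub>R Y) Z = r *\<^sub>R a Y Z" for r Y
      unfolding a_def mass_form_def state_triple_scaleR aniso_scaleR_left by (simp add: sum_distrib_left)
  qed
  have a_sym: "a Y Z = a Z Y" for Y Z
    unfolding a_def mass_form_def by (simp add: aniso_commute)
  have slope_lin: "slope J (\<lambda>x. v x + w x) x = slope J v x + slope J w x" "slope J (\<lambda>x. r *\<^sub>R v x) x = r *\<^sub>R slope J v x"
    for v w :: "real \<Rightarrow> real^2" and r x
    by (simp_all add: slope_def algebra_simps)
  have "\<exists>W\<in>state_space J. \<forall>Z\<in>state_space J. a W Z = b Z"
  proof (rule coercive_form_solvable[where L="(\<lambda>(n, i, k) Y. coord Y n $ i $ k) ` ({..J} \<times> UNIV \<times> UNIV)"])
    show "subspace (state_space J)" by (rule subspace_state_space)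
    show "linear l" if "l \<in> (\<lambda>(n, i, k) Y. coord Y n $ i $ k) ` ({..J} \<times> (UNIV::3 set) \<times> (UNIV::2 set))" for l
      using that by (auto intro!: linearI)
    show "v = 0" if v: "v \<in> state_space J"
      and z: "\<And>l. l \<in> (\<lambda>(n, i, k) Y. coord Y n $ i $ k) ` ({..J} \<times> (UNIV::3 set) \<times> (UNIV::2 set)) \<Longrightarrow> l v = 0" for v
    proof (rule state_eqI)
      fix n
      show "coord v n = coord 0 n"
      proof (cases "n \<le> J")
        case True
        have "coord v n $ i $ k = 0" for i k
          by (rule z, rule image_eqI[of _ _ "(n, i, k)"]) (use True in auto)
        then show ?thesis by (simp add: vec_eq_iff)
      next
        case False
        then show ?thesis using v by (simp add: state_space_def)
      qed
    qed
    show "linear (\<lambda>Y. a Y Z)" for Z by (rule a_lin)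
    then show "linear (a Z)" for Z unfolding a_sym[of Z, abs_def] .
    show "0 < a v v" if v: "v \<in> state_space J" "v \<noteq> 0" for v
    proof -
      have "tri_norm2 (state_triple J v) \<noteq> 0"
        using state_norm_le[OF Cp J v(1)] v(2) by auto
      then have "0 < tri_norm2 (state_triple J v)" using tri_norm2_nonneg[of "state_triple J v"] by simp
      then have "0 < min c (\<epsilon> * c\<^sup>2) * tri_norm2 (state_triple J v)" using c eps by simp
      also have "\<dots> \<le> a v v" unfolding a_def using pm pb sc eps c by (intro mass_form_coercive) auto
      finally show ?thesis .
    qed
    show "linear b"
    proof (rule linearI)
      show "b (Y + Z) = b Y + b Z" for Y Z
        unfolding b_def flux_form_def state_triple_add slope_lin inner_add_right using bi by (simp add: sum.distrib)
      show "b (r *\<^sub>R Y) = r *\<^sub>R b Y" for r Y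
        unfolding b_def flux_form_def state_triple_scaleR slope_lin inner_scaleR_right by (simp add: sum_distrib_left)
    qed
  qed auto
  then obtain W where W: "W \<in> state_space J" "\<And>Z. Z \<in> state_space J \<Longrightarrow> a W Z = b Z" by blast
  show thesis
  proof (rule that[OF W(1)], unfold solves_velocity_def, intro conjI ballI)
    show "state_triple J W \<in> triods0_h J" using J W(1) by (rule state_triple_triods0_h)
    fix \<phi> assume \<phi>: "\<phi> \<in> triods0_h J"
    define Z where "Z = state_of J (\<lambda>i n. \<phi> i (real n / real J))"
    note Z = triods0_h_state[OF J \<phi>, folded Z_def]
    have "mass_form \<epsilon> ?p (state_triple J W) \<phi> = a W Z"
      unfolding a_def mass_form_def using Z(2) by (intro sum.cong refl Bochner_Integration.integral_cong) auto
    also have "\<dots> = b Z" using Z(1) by (rule W(2))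
    also have "flux_form \<epsilon> ?p (\<lambda>i. slope J (state_triple J Z i)) = flux_form \<epsilon> ?p (\<lambda>i. slope J (\<phi> i))"
      unfolding flux_form_def
    proof (intro sum.cong refl integral_cong_AE)
      show "AE x in unit_interval. (\<epsilon> *\<^sub>R ?p i x + sgn (?p i x)) \<bullet> slope J (state_triple J Z i) x = (\<epsilon> *\<^sub>R ?p i x + sgn (?p i x)) \<bullet> slope J (\<phi> i) x" for i
        using AE_unit_interval
      proof eventually_elim
        case (elim x)
        have "slope J (state_triple J Z i) x = slope J (\<phi> i) x"
          using elim J by (intro slope_cong Z(2)) auto
        then show ?case by simp
      qed
    qed (intro borel_measurable_inner measurable_flux pm borel_measurable_integrable[OF integrable_slope[OF J]])+
    then have "b Z = - flux_form \<epsilon> ?p (\<lambda>i. slope J (\<phi> i))" by (simp add: b_def)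
    finally show "mass_form \<epsilon> ?p (state_triple J W) \<phi> = - flux_form \<epsilon> ?p (\<lambda>i. slope J (\<phi> i))" .
  qed
qed

lemma state_velocity_Lipschitz:
  assumes Cp: "interpolation_constant Cp" and J: "1 \<le> J" and eps: "0 < \<epsilon>" and c: "0 < c"
  obtains K where "0 < K"
    "\<And>p p' W W' \<delta>. (\<And>i m. m < J \<Longrightarrow> c \<le> norm (p i m) \<and> norm (p i m) \<le> D) \<Longrightarrow>
       (\<And>i m. m < J \<Longrightarrow> c \<le> norm (p' i m) \<and> norm (p' i m) \<le> D) \<Longrightarrow>
       (\<And>i m. m < J \<Longrightarrow> norm (p i m - p' i m) \<le> \<delta>) \<Longrightarrow> 0 \<le> \<delta> \<Longrightarrow>
       W \<in> state_space J \<Longrightarrow> W' \<in> state_space J \<Longrightarrow>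
       solves_velocity J \<epsilon> p (state_triple J W) \<Longrightarrow> solves_velocity J \<epsilon> p' (state_triple J W') \<Longrightarrow>
       norm (W - W') \<le> K * \<delta>"
proof -
  obtain k where k: "0 \<le> k" "\<And>p p' w w' \<delta>. (\<And>i m. m < J \<Longrightarrow> c \<le> norm (p i m) \<and> norm (p i m) \<le> D) \<Longrightarrow>
       (\<And>i m. m < J \<Longrightarrow> c \<le> norm (p' i m) \<and> norm (p' i m) \<le> D) \<Longrightarrow>
       (\<And>i m. m < J \<Longrightarrow> norm (p i m - p' i m) \<le> \<delta>) \<Longrightarrow>
       solves_velocity J \<epsilon> p w \<Longrightarrow> solves_velocity J \<epsilon> p' w' \<Longrightarrow>
       tri_norm2 (\<lambda>i x. w i x - w' i x) \<le> k * \<delta>\<^sup>2"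
    by (fact velocity_Lipschitz[OF Cp J eps c, where D=D])
  have C: "0 < Cp" using interpolation_constantD(1)[OF Cp J] .
  show thesis
  proof (rule that[of "3 * (Cp * sqrt (real J) * sqrt k) + 1"])
    show "0 < 3 * (Cp * sqrt (real J) * sqrt k) + 1" using C k(1) by (intro add_nonneg_pos mult_nonneg_nonneg) auto
    fix p p' W W' \<delta>
    assume p: "\<And>i m. m < J \<Longrightarrow> c \<le> norm (p i m) \<and> norm (p i m) \<le> D"
      "\<And>i m. m < J \<Longrightarrow> c \<le> norm (p' i m) \<and> norm (p' i m) \<le> D"
      "\<And>i m. m < J \<Longrightarrow> norm (p i m - p' i m) \<le> \<delta>" and "0 \<le> \<delta>"
      and W: "W \<in> state_space J" "W' \<in> state_space J"
      and s: "solves_velocity J \<epsilon> p (state_triple J W)" "solves_velocity J \<epsilon> p' (state_triple J W')"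
    have "W - W' \<in> state_space J" using W by (rule subspace_diff[OF subspace_state_space])
    then have "norm (W - W') \<le> 3 * (Cp * sqrt (real J) * sqrt (tri_norm2 (state_triple J (W - W'))))"
      by (rule state_norm_le[OF Cp J])
    also have "\<dots> \<le> 3 * (Cp * sqrt (real J) * sqrt (k * \<delta>\<^sup>2))"
      unfolding state_triple_diff using C by (intro mult_left_mono real_sqrt_le_mono k(2)[OF p s]) auto
    also have "\<dots> = 3 * (Cp * sqrt (real J) * sqrt k) * \<delta>"
      using \<open>0 \<le> \<delta>\<close> by (simp add: real_sqrt_mult)
    also have "\<dots> \<le> (3 * (Cp * sqrt (real J) * sqrt k) + 1) * \<delta>" using \<open>0 \<le> \<delta>\<close> by (simp add: algebra_simps)
    finally show "norm (W - W') \<le> (3 * (Cp * sqrt (real J) * sqrt k) + 1) * \<delta>" .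
  qed
qed

lemma state_slope_diff_le: "norm (state_slope J Y i m - state_slope J Z i m) \<le> 2 * real J * norm (Y - Z)"
proof -
  have 1: "norm (coord Y n $ i - coord Z n $ i) \<le> norm (Y - Z)" for n
    using norm_coord_le[of "Y - Z" n] Finite_Cartesian_Product.norm_nth_le[of "coord (Y - Z) n" i] by simp
  have "state_slope J Y i m - state_slope J Z i m = real J *\<^sub>R ((coord Y (Suc m) $ i - coord Z (Suc m) $ i)
      - (coord Y m $ i - coord Z m $ i))"
    by (simp add: state_slope_def algebra_simps)
  also have "norm \<dots> \<le> real J * (norm (Y - Z) + norm (Y - Z))"
    unfolding norm_scaleR
    using norm_triangle_ineq4[of "coord Y (Suc m) $ i - coord Z (Suc m) $ i" "coord Y m $ i - coord Z m $ i"]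
      1[of "Suc m"] 1[of m]
    by (intro mult_mono) auto
  finally show ?thesis by simp
qed

text \<open>
  Retracting the slopes onto balls around the reference slopes \<open>P\<close> makes the velocity globally
  Lipschitz without changing it as long as the slopes stay in these balls.
\<close>

definition retracted_slope :: "nat \<Rightarrow> real \<Rightarrow> (3 \<Rightarrow> nat \<Rightarrow> real^2) \<Rightarrow> state \<Rightarrow> 3 \<Rightarrow> nat \<Rightarrow> real^2" where
  "retracted_slope J r P Y i m = P i m + closest_point (cball 0 r) (state_slope J Y i m - P i m)"

lemma closest_point_cball_nonexpansive:
  "0 < r \<Longrightarrow> norm (closest_point (cball 0 r) x - closest_point (cball 0 r) y) \<le> norm (x - y :: 'a::euclidean_space)"
  using closest_point_lipschitz[of "cball 0 r" x y] by (simp add: dist_norm)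

text \<open>The margins \<open>r\<close> in the bounds on \<open>P\<close> keep every retracted
  slope between \<open>c\<close> and \<open>D\<close> in norm, where the velocity is a Lipschitz
  function of the slopes, and projection onto a ball does not increase distances. So the vector
  field is globally Lipschitz in the state and continuous in time.\<close>

lemma modified_flow:
  assumes Cp: "interpolation_constant Cp" and J: "1 \<le> J" and eps: "0 < \<epsilon>" and c: "0 < c" and r: "0 < r" and T: "0 < T"
    and P_cont: "\<And>i m. m < J \<Longrightarrow> continuous_on {0..T} (\<lambda>t. P t i m)"
    and P: "\<And>t i m. t \<in> {0..T} \<Longrightarrow> m < J \<Longrightarrow> c + r \<le> norm (P t i m) \<and> norm (P t i m) \<le> D - r"
  obtains Y V where "Y 0 = Y0" "\<And>t. t \<in> {0..T} \<Longrightarrow> (Y has_vector_derivative V t) (at t within {0..T})"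
    "continuous_on {0..T} V" "\<And>t. t \<in> {0..T} \<Longrightarrow> V t \<in> state_space J"
    "\<And>t. t \<in> {0..T} \<Longrightarrow> solves_velocity J \<epsilon> (retracted_slope J r (P t) (Y t)) (state_triple J (V t))"
proof -
  let ?q = "\<lambda>t Y. retracted_slope J r (P t) Y"
  have q: "c \<le> norm (?q t Y i m) \<and> norm (?q t Y i m) \<le> D" if "t \<in> {0..T}" "m < J" for t Y i m
  proof -
    have "closest_point (cball 0 r) (state_slope J Y i m - P t i m) \<in> cball 0 r"
      using r by (intro closest_point_in_set) auto
    then have "norm (closest_point (cball 0 r) (state_slope J Y i m - P t i m)) \<le> r" by simp
    then show ?thesis
      using P[OF that, of i] norm_triangle_ineq[of "P t i m" "closest_point (cball 0 r) (state_slope J Y i m - P t i m)"]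
        norm_diff_ineq[of "P t i m" "closest_point (cball 0 r) (state_slope J Y i m - P t i m)"]
      unfolding retracted_slope_def by linarith
  qed
  \<comment> \<open>The Lipschitz estimate below holds for any choice of solutions and, for equal
    slopes, shows that the choice is the only one.\<close>
  define f where "f t Y = (SOME Z. Z \<in> state_space J \<and> solves_velocity J \<epsilon> (?q t Y) (state_triple J Z))" for t Y
  have f: "f t Y \<in> state_space J" "solves_velocity J \<epsilon> (?q t Y) (state_triple J (f t Y))" if t: "t \<in> {0..T}" for t Y
  proof -
    have "\<exists>Z. Z \<in> state_space J \<and> solves_velocity J \<epsilon> (?q t Y) (state_triple J Z)"
      by (rule velocity_exists[OF Cp J eps c, of "?q t Y" D]) (use q[OF t] in blast)+
    then have "f t Y \<in> state_space J \<and> solves_velocity J \<epsilon> (?q t Y) (state_triple J (f t Y))"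
      unfolding f_def by (rule someI_ex)
    then show "f t Y \<in> state_space J" "solves_velocity J \<epsilon> (?q t Y) (state_triple J (f t Y))" by auto
  qed
  obtain K where K: "0 < K"
    "\<And>p p' W W' \<delta>. (\<And>i m. m < J \<Longrightarrow> c \<le> norm (p i m) \<and> norm (p i m) \<le> D) \<Longrightarrow>
       (\<And>i m. m < J \<Longrightarrow> c \<le> norm (p' i m) \<and> norm (p' i m) \<le> D) \<Longrightarrow>
       (\<And>i m. m < J \<Longrightarrow> norm (p i m - p' i m) \<le> \<delta>) \<Longrightarrow> 0 \<le> \<delta> \<Longrightarrow>
       W \<in> state_space J \<Longrightarrow> W' \<in> state_space J \<Longrightarrow>
       solves_velocity J \<epsilon> p (state_triple J W) \<Longrightarrow> solves_velocity J \<epsilon> p' (state_triple J W') \<Longrightarrow>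
       norm (W - W') \<le> K * \<delta>"
    by (fact state_velocity_Lipschitz[OF Cp J eps c, where D=D])
  have f_Lip: "norm (f t Y - f t Z) \<le> (K * (2 * real J)) * norm (Y - Z)" if t: "t \<in> {0..T}" for t Y Z
  proof -
    have "norm (?q t Y i m - ?q t Z i m) \<le> 2 * real J * norm (Y - Z)" if "m < J" for i m
    proof -
      have "norm (?q t Y i m - ?q t Z i m) \<le> norm ((state_slope J Y i m - P t i m) - (state_slope J Z i m - P t i m))"
        unfolding retracted_slope_def
        using closest_point_cball_nonexpansive[OF r, of "state_slope J Y i m - P t i m" "state_slope J Z i m - P t i m"]
        by (simp only: add_diff_cancel_left)
      also have "\<dots> \<le> 2 * real J * norm (Y - Z)" using state_slope_diff_le[of J Y i m Z] by simp
      finally show ?thesis .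
    qed
    then have "norm (f t Y - f t Z) \<le> K * (2 * real J * norm (Y - Z))"
      by (intro K(2)[OF q[OF t] q[OF t] _ _ f(1)[OF t] f(1)[OF t] f(2)[OF t] f(2)[OF t]]) auto
    then show ?thesis by (simp add: mult_ac)
  qed
  have f_cont: "continuous_on {0..T} (\<lambda>t. f t Y)" for Y
    unfolding continuous_on_def
  proof
    fix s assume s: "s \<in> {0..T}"
    \<comment> \<open>A single number above the changes of all reference slopes, obtained by
      summing; the 2 is due to \<open>P\<close> occurring both outside and inside the
      projection.\<close>
    define \<delta> where "\<delta> t = (\<Sum>i\<in>UNIV. \<Sum>m<J. 2 * norm (P t i m - P s i m))" for t
    have "((\<lambda>t. f t Y - f s Y) \<longlongrightarrow> 0) (at s within {0..T})"
    proof (rule Lim_null_comparison)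
      have "norm (f t Y - f s Y) \<le> K * \<delta> t" if t: "t \<in> {0..T}" for t
      proof (rule K(2)[OF q[OF t] q[OF s] _ _ f(1)[OF t] f(1)[OF s] f(2)[OF t] f(2)[OF s]])
        show "0 \<le> \<delta> t" unfolding \<delta>_def by (intro sum_nonneg) simp
        fix i m assume m: "m < J"
        have "norm (?q t Y i m - ?q s Y i m) \<le> norm (P t i m - P s i m)
           + norm (closest_point (cball 0 r) (state_slope J Y i m - P t i m) - closest_point (cball 0 r) (state_slope J Y i m - P s i m))"
          unfolding retracted_slope_def by (rule norm_diff_triangle_ineq)
        also have "\<dots> \<le> 2 * norm (P t i m - P s i m)"
          using closest_point_cball_nonexpansive[OF r, of "state_slope J Y i m - P t i m" "state_slope J Y i m - P s i m"]
          by (simp add: norm_minus_commute)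
        also have "\<dots> \<le> (\<Sum>m<J. 2 * norm (P t i m - P s i m))"
          using m by (intro member_le_sum[of m "{..<J}" "\<lambda>m. 2 * norm (P t i m - P s i m)"]) auto
        also have "\<dots> \<le> \<delta> t"
          unfolding \<delta>_def by (rule member_le_sum[of i UNIV "\<lambda>i. \<Sum>m<J. 2 * norm (P t i m - P s i m)"]) (auto intro: sum_nonneg)
        finally show "norm (?q t Y i m - ?q s Y i m) \<le> \<delta> t" .
      qed
      then show "\<forall>\<^sub>F t in at s within {0..T}. norm (f t Y - f s Y) \<le> K * \<delta> t"
        by (auto simp: eventually_at_filter)
      have "((\<lambda>t. K * \<delta> t) \<longlongrightarrow> K * \<delta> s) (at s within {0..T})"
        unfolding \<delta>_def using P_cont s
        by (intro tendsto_intros) (auto simp: continuous_on_def)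
      then show "((\<lambda>t. K * \<delta> t) \<longlongrightarrow> 0) (at s within {0..T})" by (simp add: \<delta>_def)
    qed
    then show "((\<lambda>t. f t Y) \<longlongrightarrow> f s Y) (at s within {0..T})" by (rule LIM_zero_cancel)
  qed
  have pos: "0 \<le> T" "0 < K * (2 * real J)" using T K(1) J by auto
  obtain Y where Y: "Y 0 = Y0" "\<And>t. t \<in> {0..T} \<Longrightarrow> (Y has_vector_derivative f t (Y t)) (at t within {0..T})"
    using Picard_Lindelof_global[of T "K * (2 * real J)" f Y0, OF pos f_Lip f_cont] by auto
  have Yc: "continuous_on {0..T} Y"
    using Y(2) by (meson continuous_on_eq_continuous_within has_vector_derivative_continuous)
  show thesis
  proof (rule that[of Y "\<lambda>t. f t (Y t)"])
    show "continuous_on {0..T} (\<lambda>t. f t (Y t))"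
      by (rule continuous_on_Lipschitz_field[OF f_Lip f_cont Yc])
  qed (fact Y f)+
qed

section \<open>The semi-discrete problem\<close>

text \<open>The cell values of \<open>slope\<close> as an array over curves and cells, free of the
  floor function. For fixed indices this is a combination of two point values and inherits their
  regularity in time.\<close>

definition node_slope :: "nat \<Rightarrow> triple \<Rightarrow> 3 \<Rightarrow> nat \<Rightarrow> real^2" where
  "node_slope J v i m = real J *\<^sub>R (v i (real (Suc m) / real J) - v i (real m / real J))"

lemma slope_eq_cell_field:
  assumes "1 \<le> J"
  shows "AE x in unit_interval. slope J (v i) x = cell_field J (node_slope J v) i x"
  using AE_cell[OF assms] by eventually_elim (auto simp: slope_cell cell_field_def node_slope_def)

text \<open>The field is constant on a cell, and a cell has positive measure; so a property valid
  almost everywhere holds for the value on every cell.\<close>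

lemma cell_field_AE_D:
  assumes J: "1 \<le> J" and m: "m < J" and AE: "AE x in unit_interval. R (cell_field J p i x)"
  shows "R (p i m)"
proof (rule ccontr)
  assume nR: "\<not> R (p i m)"
  define C where "C = {real m / real J<..<(real m + 1) / real J}"
  have C01: "C \<subseteq> {0..1}"
  proof
    fix x assume "x \<in> C"
    then have "real m / real J < x" "x < (real m + 1) / real J" by (auto simp: C_def)
    moreover have "0 \<le> real m / real J" "(real m + 1) / real J \<le> 1" using m by (auto simp: field_simps)
    ultimately have "0 \<le> x" "x \<le> 1" by linarith+
    then show "x \<in> {0..1}" by simp
  qed
  have "AE x in unit_interval. x \<notin> C"
    using AE
  proof eventually_elim
    case (elim x)
    show ?case
    proof
      assume "x \<in> C"
      then have "\<lfloor>real J * x\<rfloor> = int m" using J by (simp add: C_def floor_eq_iff field_simps)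
      then show False using elim nR by (simp add: cell_field_def)
    qed
  qed
  then have "AE x in lebesgue. x \<notin> C" using C01 by (subst (asm) AE_restrict_space_iff) (auto elim!: eventually_mono)
  \<comment> \<open>An open set that lies almost everywhere in a closed set lies in it. With the
    empty set in the role of the closed one, the cell would be empty, contrary to its
    midpoint.\<close>
  then have "AE x\<in>C in lebesgue. x \<in> {}" by (auto elim: eventually_mono)
  then have "x \<in> {}" if "x \<in> C" for x
    using that by (intro mem_closed_if_AE_lebesgue_open[of C "{}"]) (auto simp: C_def)
  moreover have "(real m + 1/2) / real J \<in> C" using J by (auto simp: C_def divide_strict_right_mono)
  ultimately show False by blast
qed

lemma weak_equation_fem_iff:
  assumes J: "1 \<le> J" and v: "\<And>i. v i \<in> fem J" and w: "\<And>i. continuous_on {0..1} (w i)"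
    and \<phi>: "\<phi> \<in> triods0_h J" and eps: "0 < \<epsilon>"
  shows "weak_equation \<epsilon> v w \<phi> \<longleftrightarrow>
     mass_form \<epsilon> (cell_field J (node_slope J v)) w \<phi> = - flux_form \<epsilon> (cell_field J (node_slope J v)) (\<lambda>i. slope J (\<phi> i))"
proof (rule weak_equation_iff)
  show "AE x in unit_interval. dx (v i) x = cell_field J (node_slope J v) i x" for i
    using dx_fem[OF v J, of i] slope_eq_cell_field[OF J, of v i] by eventually_elim simp
  show "dx (v i) \<in> borel_measurable unit_interval" for i
    using W1_square_integrable_dx[OF fem_W1[OF v J]] by (simp add: square_integrable_def)
  show "AE x in unit_interval. dx (\<phi> i) x = slope J (\<phi> i) x" for i
    using dx_fem[OF triods0_hD(1)[OF \<phi>] J] .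
  show "integrable unit_interval (dx (\<phi> i))" for i
    using weak_deriv_integrable(1)[OF W1_weak_deriv_dx[OF fem_W1[OF triods0_hD(1)[OF \<phi>] J]]] .
  show "cell_field J (node_slope J v) i \<in> borel_measurable unit_interval" for i using J by (rule cell_field_measurable)
  show "AE x in unit_interval. norm (cell_field J (node_slope J v) i x) \<le> (\<Sum>i\<in>UNIV. \<Sum>m<J. norm (node_slope J v i m))" for i
  proof (rule cell_field_AE[OF J])
    fix m assume "m < J"
    then have "norm (node_slope J v i m) \<le> (\<Sum>m<J. norm (node_slope J v i m))"
      by (intro member_le_sum[of m "{..<J}" "\<lambda>m. norm (node_slope J v i m)"]) auto
    also have "\<dots> \<le> (\<Sum>i\<in>UNIV. \<Sum>m<J. norm (node_slope J v i m))"
      by (rule member_le_sum[of i UNIV "\<lambda>i. \<Sum>m<J. norm (node_slope J v i m)"]) (auto intro: sum_nonneg)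
    finally show "norm (node_slope J v i m) \<le> (\<Sum>i\<in>UNIV. \<Sum>m<J. norm (node_slope J v i m))" .
  qed
qed (use w triods0_hD(2)[OF \<phi>] integrable_slope[OF J] eps in auto)

lemma regular_ae_fem_iff:
  assumes J: "1 \<le> J" and v: "\<And>i. v i \<in> fem J"
  shows "regular_ae (v i) \<longleftrightarrow> (\<forall>m<J. node_slope J v i m \<noteq> 0)"
proof -
  have e: "AE x in unit_interval. dx (v i) x = cell_field J (node_slope J v) i x"
    using dx_fem[OF v J, of i] slope_eq_cell_field[OF J, of v i] by eventually_elim simp
  have "(AE x in unit_interval. dx (v i) x \<noteq> 0) \<longleftrightarrow> (AE x in unit_interval. cell_field J (node_slope J v) i x \<noteq> 0)"
    using e by (intro AE_cong_simp refl iffI; elim eventually_rev_mp; intro always_eventually) (auto elim: eventually_mono)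
  then show ?thesis
    unfolding regular_ae_def
    using cell_field_AE_D[OF J, of _ "\<lambda>p. p \<noteq> 0" "node_slope J v" i] cell_field_AE[OF J, of "\<lambda>p. p \<noteq> 0" "node_slope J v" i] by blast
qed

text \<open>Differentiating the end and junction conditions in time shows that the velocity belongs
  to the test space; the finite element form is inherited because the hat expansion is a fixed
  finite sum over nodal values.\<close>

lemma SDP_velocity:
  assumes J: "1 \<le> J" and eps: "0 < \<epsilon>" and S: "SDP_solution J \<epsilon> T P u0 uh" and t: "t \<in> {0<..<T}"
  defines "Z \<equiv> state_of J (\<lambda>i n. dt (uh i) t (real n / real J))"
  shows "Z \<in> state_space J" "solves_velocity J \<epsilon> (node_slope J (\<lambda>i. uh i t)) (state_triple J Z)"
    and "\<And>i n. n \<le> J \<Longrightarrow> ((\<lambda>s. uh i s (real n / real J)) has_vector_derivative coord Z n $ i) (at t)"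
proof -
  have tri: "(\<lambda>i. uh i s) \<in> triods_h J P" if "s \<in> {0..T}" for s using S that by (simp add: SDP_solution_def)
  have fem: "uh i s \<in> fem J" if "s \<in> {0..T}" for s i using tri[OF that] by (simp add: triods_h_def)
  have hd: "((\<lambda>s. uh i s x) has_vector_derivative dt (uh i) t x) (at t)" if "x \<in> {0..1}" for i x
  proof -
    have "(\<lambda>s. uh i s x) differentiable (at t)" using S that t unfolding SDP_solution_def by blast
    then show ?thesis unfolding dt_def by (rule vector_derivative_works[THEN iffD1])
  qed
  have const: "dt (uh i) t x - dt (uh k) t y = 0"
    if "x \<in> {0..1}" "y \<in> {0..1}" "\<And>s. s \<in> {0..T} \<Longrightarrow> uh i s x - uh k s y = d" for i k x y d
  proof -
    have "((\<lambda>s. uh i s x - uh k s y) has_vector_derivative dt (uh i) t x - dt (uh k) t y) (at t)"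
      using that by (intro has_vector_derivative_diff hd)
    moreover have "((\<lambda>s. uh i s x - uh k s y) has_vector_derivative 0) (at t)"
      by (rule has_vector_derivative_transform_within_open[of "\<lambda>_. d" _ _ "{0<..<T}"])
         (use t that in auto)
    ultimately show ?thesis by (rule vector_derivative_unique_at)
  qed
  have hn: "dt (uh i) t 1 = 0" for i
  proof -
    have "((\<lambda>s. uh i s 1) has_vector_derivative 0) (at t)"
      by (rule has_vector_derivative_transform_within_open[of "\<lambda>_. P i" _ _ "{0<..<T}"])
         (use t tri in \<open>auto simp: triods_h_def\<close>)
    then show ?thesis using hd[of 1 i] by (auto intro: vector_derivative_unique_at)
  qed
  have h0: "dt (uh i) t 0 = dt (uh k) t 0" for i k
    using const[of 0 0 i k 0] tri by (auto simp: triods_h_def)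
  show Z: "Z \<in> state_space J"
    using hn h0 J by (auto simp: Z_def state_space_def vec_eq_iff coord_state_of)
  have rep: "dt (uh i) t x = state_triple J Z i x" if x: "x \<in> {0..1}" for i x
  proof -
    have "((\<lambda>s. nodal J (\<lambda>j. uh i s (real j / real J)) x) has_vector_derivative
       (\<Sum>j\<le>J. max 0 (1 - \<bar>real J * x - real j\<bar>) *\<^sub>R dt (uh i) t (real j / real J))) (at t)"
      unfolding nodal_def
    proof (rule has_vector_derivative_sum)
      fix j assume "j \<in> {..J}"
      then have "real j / real J \<in> {0..1}" using J by auto
      then show "((\<lambda>s. max 0 (1 - \<bar>real J * x - real j\<bar>) *\<^sub>R uh i s (real j / real J)) has_vector_derivative
          max 0 (1 - \<bar>real J * x - real j\<bar>) *\<^sub>R dt (uh i) t (real j / real J)) (at t)"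
        by (intro bounded_linear.has_vector_derivative[OF bounded_linear_scaleR_right] hd)
    qed
    then have "((\<lambda>s. uh i s x) has_vector_derivative
       (\<Sum>j\<le>J. max 0 (1 - \<bar>real J * x - real j\<bar>) *\<^sub>R dt (uh i) t (real j / real J))) (at t)"
      by (rule has_vector_derivative_transform_within_open[of _ _ _ "{0<..<T}"])
         (use t fem_eq_nodal[OF fem J x, symmetric] in auto)
    then have "dt (uh i) t x = (\<Sum>j\<le>J. max 0 (1 - \<bar>real J * x - real j\<bar>) *\<^sub>R dt (uh i) t (real j / real J))"
      using hd[OF x] by (auto intro: vector_derivative_unique_at)
    then show ?thesis by (simp add: state_triple_def nodal_def Z_def coord_state_of)
  qed
  show "solves_velocity J \<epsilon> (node_slope J (\<lambda>i. uh i t)) (state_triple J Z)"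
    unfolding solves_velocity_def
  proof (intro conjI ballI)
    show "state_triple J Z \<in> triods0_h J" using J Z by (rule state_triple_triods0_h)
    fix \<phi> assume \<phi>: "\<phi> \<in> triods0_h J"
    have "continuous_on {0..1} (dt (uh i) t)" for i
      using fem_continuous[OF state_triple_fem[OF J]] rep by (subst continuous_on_cong[OF refl]) auto
    then have "mass_form \<epsilon> (cell_field J (node_slope J (\<lambda>i. uh i t))) (\<lambda>i. dt (uh i) t) \<phi>
        = - flux_form \<epsilon> (cell_field J (node_slope J (\<lambda>i. uh i t))) (\<lambda>i. slope J (\<phi> i))"
      using S t \<phi> fem[of t] eps unfolding SDP_solution_def by (subst weak_equation_fem_iff[OF J, symmetric]) auto
    moreover have "mass_form \<epsilon> (cell_field J (node_slope J (\<lambda>i. uh i t))) (\<lambda>i. dt (uh i) t) \<phi>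
       = mass_form \<epsilon> (cell_field J (node_slope J (\<lambda>i. uh i t))) (state_triple J Z) \<phi>"
      unfolding mass_form_def using rep by (intro sum.cong refl Bochner_Integration.integral_cong) auto
    ultimately show "mass_form \<epsilon> (cell_field J (node_slope J (\<lambda>i. uh i t))) (state_triple J Z) \<phi>
        = - flux_form \<epsilon> (cell_field J (node_slope J (\<lambda>i. uh i t))) (\<lambda>i. slope J (\<phi> i))" by simp
  qed
  show "((\<lambda>s. uh i s (real n / real J)) has_vector_derivative coord Z n $ i) (at t)" if "n \<le> J" for i n
    using hd[of "real n / real J" i] that J by (simp add: Z_def coord_state_of)
qed

text \<open>Regularity excludes a zero slope on each of the finitely many cells at every time, and
  continuity on the compact time interval makes this quantitative. The constants depend on the
  solution, which is enough for uniqueness.\<close>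

lemma SDP_slope_bounds:
  assumes J: "1 \<le> J" and S: "SDP_solution J \<epsilon> T P u0 uh"
  obtains c D where "0 < c" "\<And>t i m. t \<in> {0..T} \<Longrightarrow> m < J \<Longrightarrow> c \<le> norm (node_slope J (\<lambda>i. uh i t) i m) \<and> norm (node_slope J (\<lambda>i. uh i t) i m) \<le> D"
proof -
  let ?g = "\<lambda>i m t. norm (node_slope J (\<lambda>i. uh i t) i m)"
  have g: "continuous_on {0..T} (?g i m)" if "m < J" for i m
  proof -
    have "real (Suc m) / real J \<in> {0..1}" "real m / real J \<in> {0..1}" using that by auto
    then show ?thesis
      using S unfolding node_slope_def SDP_solution_def by (intro continuous_intros) auto
  qed
  have fem: "uh i s \<in> fem J" "regular_ae (uh i s)" if "s \<in> {0..T}" for s i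
    using S that by (auto simp: SDP_solution_def triods_h_def)
  have nz: "?g i m t > 0" if "m < J" "t \<in> {0..T}" for i m t
    using regular_ae_fem_iff[OF J, of "\<lambda>i. uh i t" i] fem[OF that(2)] that by auto
  have "\<exists>cD. snd k < J \<longrightarrow> 0 < fst cD \<and> (\<forall>t\<in>{0..T}. fst cD \<le> ?g (fst k) (snd k) t \<and> ?g (fst k) (snd k) t \<le> snd cD)" for k
  proof (cases "{0..T} = {} \<or> J \<le> snd k")
    case False
    then have m: "snd k < J" and ne: "{0..T} \<noteq> {}" by auto
    obtain a where a: "a \<in> {0..T}" "\<forall>t\<in>{0..T}. ?g (fst k) (snd k) a \<le> ?g (fst k) (snd k) t"
      using continuous_attains_inf[OF compact_Icc ne g[OF m, of "fst k"]] by auto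
    obtain b where b: "\<forall>t\<in>{0..T}. ?g (fst k) (snd k) t \<le> ?g (fst k) (snd k) b"
      using continuous_attains_sup[OF compact_Icc ne g[OF m, of "fst k"]] by auto
    show ?thesis
      using a(2) b nz[OF m a(1), of "fst k"]
      by (intro exI[of _ "(?g (fst k) (snd k) a, ?g (fst k) (snd k) b)"]) simp
  qed (rule exI[of _ "(1::real, 1::real)"], auto)
  then have "\<exists>cD. \<forall>k. snd k < J \<longrightarrow> 0 < fst (cD k) \<and> (\<forall>t\<in>{0..T}. fst (cD k) \<le> ?g (fst k) (snd k) t \<and> ?g (fst k) (snd k) t \<le> snd (cD k))"
    by (intro choice allI)
  then obtain cD where cD0: "\<forall>k. snd k < J \<longrightarrow> 0 < fst (cD k) \<and> (\<forall>t\<in>{0..T}. fst (cD k) \<le> ?g (fst k) (snd k) t \<and> ?g (fst k) (snd k) t \<le> snd (cD k))"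
    ..
  note cD = cD0[THEN spec, THEN mp]
  define I where "I = (UNIV :: 3 set) \<times> {..<J}"
  have I: "finite I" "I \<noteq> {}" using J by (auto simp: I_def lessThan_empty_iff)
  show thesis
  proof (rule that[of "Min ((\<lambda>k. fst (cD k)) ` I)" "Max ((\<lambda>k. snd (cD k)) ` I)"])
    show "0 < Min ((\<lambda>k. fst (cD k)) ` I)" using I cD by (subst Min_gr_iff) (auto simp: I_def)
    fix t i m assume *: "t \<in> {0..T}" "m < J"
    then have k: "(i, m) \<in> I" by (simp add: I_def)
    have "Min ((\<lambda>k. fst (cD k)) ` I) \<le> fst (cD (i, m))" "snd (cD (i, m)) \<le> Max ((\<lambda>k. snd (cD k)) ` I)"
      using I k by (auto intro!: Min_le Max_ge)
    then show "Min ((\<lambda>k. fst (cD k)) ` I) \<le> ?g i m t \<and> ?g i m t \<le> Max ((\<lambda>k. snd (cD k)) ` I)"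
      using cD[of "(i, m)"] * by force
  qed
qed

lemma node_slope_diff_le:
  assumes "\<And>i n. n \<le> J \<Longrightarrow> norm (v i (real n / real J) - w i (real n / real J)) \<le> e" "m < J"
  shows "norm (node_slope J v i m - node_slope J w i m) \<le> 2 * real J * e"
proof -
  have "node_slope J v i m - node_slope J w i m = real J *\<^sub>R ((v i (real (Suc m) / real J) - w i (real (Suc m) / real J))
      - (v i (real m / real J) - w i (real m / real J)))"
    by (simp add: node_slope_def algebra_simps del: of_nat_Suc)
  also have "norm \<dots> \<le> real J * (e + e)"
    unfolding norm_scaleR
    using norm_triangle_ineq4[of "v i (real (Suc m) / real J) - w i (real (Suc m) / real J)" "v i (real m / real J) - w i (real m / real J)"]
      assms(1)[of "Suc m" i] assms(1)[of m i] assms(2)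
    by (intro mult_mono) auto
  finally show ?thesis by simp
qed

text \<open>The slopes of both solutions stay in a common range away from 0, where the velocity is
  Lipschitz in the slopes. Hence the sum \<open>E\<close> of squared nodal differences satisfies
  \<open>E' \<le> L * E\<close> inside the time interval and starts at 0; continuity covers the end
  times.\<close>

lemma SDP_unique:
  assumes Cp: "interpolation_constant Cp" and J: "1 \<le> J" and eps: "0 < \<epsilon>"
    and S: "SDP_solution J \<epsilon> T P u0 uh" and S': "SDP_solution J \<epsilon> T P u0 uh'"
    and t: "t \<in> {0..T}" and x: "x \<in> {0..1}"
  shows "uh' i t x = uh i t x"
proof -
  obtain c D where c: "0 < c" "\<And>t i m. t \<in> {0..T} \<Longrightarrow> m < J \<Longrightarrow> c \<le> norm (node_slope J (\<lambda>i. uh i t) i m) \<and> norm (node_slope J (\<lambda>i. uh i t) i m) \<le> D"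
    using SDP_slope_bounds[OF J S] by blast
  obtain c' D' where c': "0 < c'" "\<And>t i m. t \<in> {0..T} \<Longrightarrow> m < J \<Longrightarrow> c' \<le> norm (node_slope J (\<lambda>i. uh' i t) i m) \<and> norm (node_slope J (\<lambda>i. uh' i t) i m) \<le> D'"
    using SDP_slope_bounds[OF J S'] by blast
  define a b where "a = min c c'" and "b = max D D'"
  have "0 < a" using c c' by (simp add: a_def)
  obtain K where K: "0 < K"
    "\<And>p p' Z Z' \<delta>. (\<And>i m. m < J \<Longrightarrow> a \<le> norm (p i m) \<and> norm (p i m) \<le> b) \<Longrightarrow>
       (\<And>i m. m < J \<Longrightarrow> a \<le> norm (p' i m) \<and> norm (p' i m) \<le> b) \<Longrightarrow>
       (\<And>i m. m < J \<Longrightarrow> norm (p i m - p' i m) \<le> \<delta>) \<Longrightarrow> 0 \<le> \<delta> \<Longrightarrow>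
       Z \<in> state_space J \<Longrightarrow> Z' \<in> state_space J \<Longrightarrow>
       solves_velocity J \<epsilon> p (state_triple J Z) \<Longrightarrow> solves_velocity J \<epsilon> p' (state_triple J Z') \<Longrightarrow>
       norm (Z - Z') \<le> K * \<delta>"
    by (fact state_velocity_Lipschitz[OF Cp J eps \<open>0 < a\<close>, where D=b])
  define e where "e i n s = uh i s (real n / real J) - uh' i s (real n / real J)" for i n s
  define E where "E s = (\<Sum>i\<in>UNIV. \<Sum>n\<le>J. (norm (e i n s))\<^sup>2)" for s
  have node: "real n / real J \<in> {0..1}" if "n \<le> J" for n using that J by auto
  have E_nn: "0 \<le> E s" for s unfolding E_def by (intro sum_nonneg) simp
  have e_le: "norm (e i n s) \<le> sqrt (E s)" if "n \<le> J" for i n s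
  proof (rule real_le_rsqrt)
    have "(norm (e i n s))\<^sup>2 \<le> (\<Sum>n\<le>J. (norm (e i n s))\<^sup>2)"
      using that by (intro member_le_sum[of n "{..J}" "\<lambda>n. (norm (e i n s))\<^sup>2"]) auto
    also have "\<dots> \<le> E s"
      unfolding E_def by (rule member_le_sum[of i UNIV "\<lambda>i. \<Sum>n\<le>J. (norm (e i n s))\<^sup>2"]) (auto intro: sum_nonneg)
    finally show "(norm (e i n s))\<^sup>2 \<le> E s" .
  qed
  \<comment> \<open>Three curves, \<open>J + 1\<close> nodes and 2 from differentiating squares; the
    rest is the Lipschitz constant from nodal values through slopes to velocities.\<close>
  define L where "L = 3 * real (Suc J) * (2 * (K * (2 * real J)))"
  have E_deriv: "\<exists>y. (E has_real_derivative y) (at s) \<and> y \<le> L * E s" if s: "s \<in> {0<..<T}" for s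
  proof -
    define Z where "Z = state_of J (\<lambda>i n. dt (uh i) s (real n / real J))"
    define Z' where "Z' = state_of J (\<lambda>i n. dt (uh' i) s (real n / real J))"
    note V = SDP_velocity[OF J eps S s, folded Z_def] and V' = SDP_velocity[OF J eps S' s, folded Z'_def]
    have s': "s \<in> {0..T}" using s by auto
    have "norm (Z - Z') \<le> K * (2 * real J * sqrt (E s))"
    proof (rule K(2)[OF _ _ _ _ V(1) V'(1) V(2) V'(2)])
      show "a \<le> norm (node_slope J (\<lambda>i. uh i s) i m) \<and> norm (node_slope J (\<lambda>i. uh i s) i m) \<le> b" if "m < J" for i m
        using c(2)[OF s' that, of i] by (auto simp: a_def b_def)
      show "a \<le> norm (node_slope J (\<lambda>i. uh' i s) i m) \<and> norm (node_slope J (\<lambda>i. uh' i s) i m) \<le> b" if "m < J" for i m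
        using c'(2)[OF s' that, of i] by (auto simp: a_def b_def)
      show "norm (node_slope J (\<lambda>i. uh i s) i m - node_slope J (\<lambda>i. uh' i s) i m) \<le> 2 * real J * sqrt (E s)" if "m < J" for i m
        using e_le by (intro node_slope_diff_le that) (simp add: e_def)
      show "0 \<le> 2 * real J * sqrt (E s)" using E_nn by simp
    qed
    then have Wn: "norm (coord Z n $ i - coord Z' n $ i) \<le> K * (2 * real J) * sqrt (E s)" for n i
      using norm_coord_le[of "Z - Z'" n] Finite_Cartesian_Product.norm_nth_le[of "coord (Z - Z') n" i] by simp
    have ed: "((\<lambda>s. e i n s) has_vector_derivative (coord Z n $ i - coord Z' n $ i)) (at s)" if "n \<le> J" for i n
      unfolding e_def using that by (intro has_vector_derivative_diff V(3) V'(3))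
    have sq: "((\<lambda>s. (norm (e i n s))\<^sup>2) has_real_derivative 2 * (e i n s \<bullet> (coord Z n $ i - coord Z' n $ i))) (at s)" if "n \<le> J" for i n
      unfolding power2_norm_eq_inner has_field_derivative_def
      by (rule has_derivative_eq_rhs[OF has_derivative_inner[OF ed[OF that, unfolded has_vector_derivative_def] ed[OF that, unfolded has_vector_derivative_def]]])
         (auto simp: fun_eq_iff inner_commute algebra_simps)
    have "(E has_real_derivative (\<Sum>i\<in>UNIV. \<Sum>n\<le>J. 2 * (e i n s \<bullet> (coord Z n $ i - coord Z' n $ i)))) (at s)"
      unfolding E_def by (intro DERIV_sum sq) auto
    moreover have "(\<Sum>i\<in>UNIV. \<Sum>n\<le>J. 2 * (e i n s \<bullet> (coord Z n $ i - coord Z' n $ i))) \<le> (\<Sum>i\<in>(UNIV::3 set). \<Sum>n\<le>J. 2 * (K * (2 * real J)) * E s)"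
    proof (intro sum_mono)
      fix i :: 3 and n assume "n \<in> {..J}"
      then have "n \<le> J" by simp
      have "e i n s \<bullet> (coord Z n $ i - coord Z' n $ i) \<le> norm (e i n s) * norm (coord Z n $ i - coord Z' n $ i)" by (rule norm_cauchy_schwarz)
      also have "\<dots> \<le> sqrt (E s) * (K * (2 * real J) * sqrt (E s))"
        using e_le[OF \<open>n \<le> J\<close>] Wn E_nn by (intro mult_mono) auto
      also have "\<dots> = K * (2 * real J) * E s" using E_nn[of s] by (simp add: mult_ac)
      finally show "2 * (e i n s \<bullet> (coord Z n $ i - coord Z' n $ i)) \<le> 2 * (K * (2 * real J)) * E s"
        unfolding mult.assoc by (rule mult_left_mono) simp
    qed
    moreover have "(\<Sum>i\<in>(UNIV::3 set). \<Sum>n\<le>J. 2 * (K * (2 * real J)) * E s) = L * E s" by (simp add: L_def)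
    ultimately show ?thesis by auto
  qed
  have E_cont: "continuous_on {0..T} E"
    unfolding E_def e_def using S S' node unfolding SDP_solution_def by (intro continuous_intros) auto
  have "exp (- L * t) * E t \<le> exp (- L * 0) * E 0"
  proof (rule DERIV_nonpos_imp_decreasing_open[of 0 t "\<lambda>s. exp (- L * s) * E s"])
    show "0 \<le> t" using t by simp
    show "continuous_on {0..t} (\<lambda>s. exp (- L * s) * E s)"
      using t by (intro continuous_intros continuous_on_subset[OF E_cont]) auto
    fix s assume "0 < s" "s < t"
    then have "s \<in> {0<..<T}" using t by auto
    then obtain y where y: "(E has_real_derivative y) (at s)" "y \<le> L * E s" using E_deriv by blast
    have "((\<lambda>s. exp (- L * s) * E s) has_real_derivative exp (- L * s) * (y - L * E s)) (at s)"
      by (auto intro!: derivative_eq_intros y(1) simp: algebra_simps)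
    moreover have "exp (- L * s) * (y - L * E s) \<le> 0" using y(2) by (intro mult_nonneg_nonpos) auto
    ultimately show "\<exists>y. ((\<lambda>s. exp (- L * s) * E s) has_real_derivative y) (at s) \<and> y \<le> 0" by blast
  qed
  moreover have "E 0 = 0"
    unfolding E_def e_def using S S' node unfolding SDP_solution_def by simp
  ultimately have "E t = 0" using E_nn[of t] by (simp add: mult_le_0_iff)
  then have "uh i t (real n / real J) = uh' i t (real n / real J)" if "n \<le> J" for n
    using e_le[OF that, of i t] by (simp add: e_def)
  moreover have "uh i t \<in> fem J" "uh' i t \<in> fem J"
    using S S' t by (auto simp: SDP_solution_def triods_h_def)
  ultimately show ?thesis
    using fem_eq_nodal[OF _ J x, of "uh i t"] fem_eq_nodal[OF _ J x, of "uh' i t"] by (simp add: nodal_def)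
qed

section \<open>From a flow of states back to a solution of the semi-discrete problem\<close>

lemma bounded_linear_coord: "bounded_linear (\<lambda>Y. coord Y n $ i)"
proof (rule bounded_linear_intro[where K=1])
  show "norm (coord Y n $ i) \<le> norm Y * 1" for Y
    using order_trans[OF Finite_Cartesian_Product.norm_nth_le norm_coord_le] by simp
qed simp_all

lemma bounded_linear_state_triple: "bounded_linear (\<lambda>Y. state_triple J Y i x)"
  unfolding state_triple_def nodal_def
  by (intro bounded_linear_sum bounded_linear_compose[OF bounded_linear_scaleR_right] bounded_linear_coord)

lemma solves_velocity_cong:
  assumes J: "1 \<le> J" and eq: "\<And>i m. m < J \<Longrightarrow> p i m = p' i m" and w: "solves_velocity J \<epsilon> p w"
  shows "solves_velocity J \<epsilon> p' w"
proof -
  have cf: "AE x in unit_interval. cell_field J p i x = cell_field J p' i x" for i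
    using AE_cell[OF J] by eventually_elim (auto simp: cell_field_def eq)
  have w': "w \<in> triods0_h J" using w by (simp add: solves_velocity_def)
  have "mass_form \<epsilon> (cell_field J p) w \<phi> = mass_form \<epsilon> (cell_field J p') w \<phi>"
    and "flux_form \<epsilon> (cell_field J p) (\<lambda>i. slope J (\<phi> i)) = flux_form \<epsilon> (cell_field J p') (\<lambda>i. slope J (\<phi> i))"
    if \<phi>: "\<phi> \<in> triods0_h J" for \<phi>
  proof -
    show "mass_form \<epsilon> (cell_field J p) w \<phi> = mass_form \<epsilon> (cell_field J p') w \<phi>"
      unfolding mass_form_def
    proof (intro sum.cong refl integral_cong_AE)
      show "AE x in unit_interval. aniso \<epsilon> (cell_field J p i x) (w i x) (\<phi> i x) = aniso \<epsilon> (cell_field J p' i x) (w i x) (\<phi> i x)" for i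
        using cf[of i] by eventually_elim simp
    qed (intro measurable_aniso cell_field_measurable[OF J] continuous_measurable_unit triods0_hD(2)[OF \<phi>] triods0_hD(2)[OF w'])+
    show "flux_form \<epsilon> (cell_field J p) (\<lambda>i. slope J (\<phi> i)) = flux_form \<epsilon> (cell_field J p') (\<lambda>i. slope J (\<phi> i))"
      unfolding flux_form_def
    proof (intro sum.cong refl integral_cong_AE)
      show "AE x in unit_interval. (\<epsilon> *\<^sub>R cell_field J p i x + sgn (cell_field J p i x)) \<bullet> slope J (\<phi> i) x
          = (\<epsilon> *\<^sub>R cell_field J p' i x + sgn (cell_field J p' i x)) \<bullet> slope J (\<phi> i) x" for i
        using cf[of i] by eventually_elim simp
    qed (intro borel_measurable_inner measurable_flux cell_field_measurable[OF J] borel_measurable_integrable[OF integrable_slope[OF J]])+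
  qed
  then show ?thesis using w by (simp add: solves_velocity_def)
qed

lemma node_slope_state_triple: "m < J \<Longrightarrow> node_slope J (state_triple J Z) i m = state_slope J Z i m"
  using state_triple_node[of "Suc m" J Z i] state_triple_node[of m J Z i] by (simp add: node_slope_def state_slope_def)

lemma solves_velocity_weak_equation:
  assumes J: "1 \<le> J" and eps: "0 < \<epsilon>" and sol: "solves_velocity J \<epsilon> (state_slope J Y) (state_triple J V)" and \<phi>: "\<phi> \<in> triods0_h J"
  shows "weak_equation \<epsilon> (state_triple J Y) (state_triple J V) \<phi>"
proof -
  have "solves_velocity J \<epsilon> (node_slope J (state_triple J Y)) (state_triple J V)"
    by (rule solves_velocity_cong[OF J _ sol]) (simp add: node_slope_state_triple)
  then show ?thesis
    using \<phi> weak_equation_fem_iff[where v = "state_triple J Y" and w = "state_triple J V", OF J state_triple_fem[OF J] fem_continuous[OF state_triple_fem[OF J]] \<phi> eps]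
    unfolding solves_velocity_def by blast
qed

lemma dt_state_triple:
  assumes Y: "\<And>t. t \<in> {0..T} \<Longrightarrow> (Y has_vector_derivative V t) (at t within {0..T})" and t: "t \<in> {0<..<T}"
  shows "((\<lambda>t. state_triple J (Y t) i x) has_vector_derivative state_triple J (V t) i x) (at t)"
    and "dt (\<lambda>t. state_triple J (Y t) i) t x = state_triple J (V t) i x"
proof -
  have "at t within {0..T} = at t" using t by (intro at_within_interior) auto
  then show der: "((\<lambda>t. state_triple J (Y t) i x) has_vector_derivative state_triple J (V t) i x) (at t)"
    using bounded_linear.has_vector_derivative[OF bounded_linear_state_triple Y[of t]] t by auto
  show "dt (\<lambda>t. state_triple J (Y t) i) t x = state_triple J (V t) i x"
    unfolding dt_def using der by (rule vector_derivative_at)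
qed

text \<open>The velocity states vanish at node \<open>J\<close> and agree across the curves at node
  0, so end values and differences at the junction are constant in time and keep their initial
  values. Nonzero slopes give regularity.\<close>

lemma flow_imp_SDP_solution:
  assumes J: "1 \<le> J" and eps: "0 < \<epsilon>" and T: "0 < T"
    and u0: "\<And>i. u0 i 1 = P i" "\<And>i k. u0 i 0 = u0 k 0"
    and Y0: "Y 0 = state_of J (\<lambda>i n. u0 i (real n / real J))"
    and Y: "\<And>t. t \<in> {0..T} \<Longrightarrow> (Y has_vector_derivative V t) (at t within {0..T})"
    and V: "\<And>t. t \<in> {0..T} \<Longrightarrow> V t \<in> state_space J"
    and sol: "\<And>t. t \<in> {0..T} \<Longrightarrow> solves_velocity J \<epsilon> (state_slope J (Y t)) (state_triple J (V t))"
    and nz: "\<And>t i m. t \<in> {0..T} \<Longrightarrow> m < J \<Longrightarrow> state_slope J (Y t) i m \<noteq> 0"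
  shows "SDP_solution J \<epsilon> T P u0 (\<lambda>i t. state_triple J (Y t) i)"
proof -
  let ?u = "\<lambda>i t. state_triple J (Y t) i"
  have der: "((\<lambda>t. ?u i t x) has_vector_derivative state_triple J (V t) i x) (at t within {0..T})" if "t \<in> {0..T}" for i x t
    using bounded_linear.has_vector_derivative[OF bounded_linear_state_triple Y[OF that]] .
  have const: "f (Y t) = f (Y 0)" if f: "bounded_linear (f :: state \<Rightarrow> real^2)" and z: "\<And>t. t \<in> {0..T} \<Longrightarrow> f (V t) = 0" and t: "t \<in> {0..T}" for f t
  proof -
    have "((\<lambda>t. f (Y t)) has_vector_derivative 0) (at t within {0..T})" if "t \<in> {0..T}" for t
      using bounded_linear.has_vector_derivative[OF f Y[OF that]] z[OF that] by simp
    then obtain k where "\<And>t. t \<in> {0..T} \<Longrightarrow> f (Y t) = k"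
      using has_vector_derivative_zero_constant[of "{0..T}" "\<lambda>t. f (Y t)"] by auto
    then show ?thesis using t by simp
  qed
  have end1: "coord (Y t) J $ i = P i" if t: "t \<in> {0..T}" for t i
    using const[OF bounded_linear_coord[of J i] _ t] V u0 J unfolding Y0 by (simp add: coord_state_of state_space_def)
  have end0: "coord (Y t) 0 $ i = coord (Y t) 0 $ k" if t: "t \<in> {0..T}" for t i k
  proof -
    have "coord (Y t) 0 $ i - coord (Y t) 0 $ k = coord (Y 0) 0 $ i - coord (Y 0) 0 $ k"
      using V by (intro const[OF bounded_linear_sub[OF bounded_linear_coord[of 0 i] bounded_linear_coord[of 0 k]] _ t]) (auto simp: state_space_def)
    then show ?thesis unfolding Y0 coord_state_of using u0(2)[of i k] by simp
  qed
  show "SDP_solution J \<epsilon> T P u0 ?u"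
    unfolding SDP_solution_def
  proof (intro conjI ballI allI)
    fix t assume t: "t \<in> {0..T}"
    have "regular_ae (state_triple J (Y t) i)" for i
      using regular_ae_fem_iff[OF J, of "state_triple J (Y t)" i] state_triple_fem[OF J] nz[OF t] node_slope_state_triple by auto
    moreover have "state_triple J (Y t) i 1 = P i" "state_triple J (Y t) i 0 = coord (Y t) 0 $ i" for i
      using state_triple_node[of J J "Y t" i] state_triple_node[of 0 J "Y t" i] J end1[OF t] by auto
    ultimately show "(\<lambda>i. ?u i t) \<in> triods_h J P"
      using end0[OF t] state_triple_fem[OF J] by (auto simp: triods_h_def)
  next
    fix i x
    show "continuous_on {0..T} (\<lambda>t. ?u i t x)"
      using der by (meson continuous_on_eq_continuous_within has_vector_derivative_continuous)
    show "(\<lambda>s. ?u i s x) differentiable at t" if "t \<in> {0<..<T}" for t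
      using dt_state_triple(1)[OF Y that] by (rule differentiableI_vector)
    show "?u i 0 x = interpol J (u0 i) x"
      unfolding Y0 by (auto simp: state_triple_def interpol_eq_nodal nodal_def coord_state_of intro!: sum.cong)
  next
    fix t \<phi> assume t: "t \<in> {0<..<T}" and \<phi>: "\<phi> \<in> triods0_h J"
    have t': "t \<in> {0..T}" using t by auto
    have eq: "dt (?u i) t = state_triple J (V t) i" for i using dt_state_triple(2)[OF Y t] by auto
    show "weak_equation \<epsilon> (\<lambda>i. ?u i t) (\<lambda>i. dt (?u i) t) \<phi>"
      unfolding eq using solves_velocity_weak_equation[OF J eps sol[OF t'] \<phi>] by simp
  qed
qed

section \<open>The error identity at a fixed time\<close>

text \<open>Completeness of Lebesgue measure lets measurability survive changes on null sets, which
  here are sets of exceptional times.\<close>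

lemma borel_measurable_lebesgue_on_cong_AE:
  fixes f h :: "real \<Rightarrow> real"
  assumes h: "h \<in> borel_measurable (lebesgue_on {a..b})" and AE: "AE t in lebesgue_on {a..b}. f t = h t"
  shows "f \<in> borel_measurable (lebesgue_on {a..b})"
  unfolding borel_measurable_iff_le
proof
  fix r
  have "{w \<in> {a..b}. h w \<le> r} \<in> sets (lebesgue_on {a..b})"
    using h unfolding borel_measurable_iff_le by simp
  then have A: "{w \<in> {a..b}. h w \<le> r} \<in> sets lebesgue" by (subst (asm) sets_restrict_space_iff) auto
  have "{w \<in> {a..b}. f w \<le> r} \<in> sets lebesgue"
  proof (rule completion.in_sets_AE[OF _ A])
    show "AE x in lebesgue. x \<in> {w \<in> {a..b}. h w \<le> r} \<longleftrightarrow> x \<in> {w \<in> {a..b}. f w \<le> r}"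
      using AE by (subst (asm) AE_restrict_space_iff) (auto elim: eventually_mono)
  qed simp
  then show "{w \<in> space (lebesgue_on {a..b}). f w \<le> r} \<in> sets (lebesgue_on {a..b})"
    by (subst sets_restrict_space_iff) auto
qed

lemma Riemann_sum_tendsto:
  fixes f :: "real \<Rightarrow> real"
  assumes f: "continuous_on {0..1} f"
  shows "(\<lambda>n. (\<Sum>l<Suc n. f (real l / real (Suc n))) / real (Suc n)) \<longlonglongrightarrow> (\<integral>x. f x \<partial>unit_interval)"
proof -
  define s where "s n x = f (real_of_int \<lfloor>real (Suc n) * x\<rfloor> / real (Suc n))" for n x
  obtain B where B: "0 \<le> B" "\<And>x. x \<in> {0..1} \<Longrightarrow> norm (f x) \<le> B" using continuous_on_Icc_bounded[OF f] by metis
  have s01: "real_of_int \<lfloor>real (Suc n) * x\<rfloor> / real (Suc n) \<in> {0..1}" "\<bar>real_of_int \<lfloor>real (Suc n) * x\<rfloor> / real (Suc n) - x\<bar> \<le> 1 / real (Suc n)"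
    if x: "0 \<le> x" "x < 1" for n x
  proof -
    obtain l where l: "l < Suc n" "\<lfloor>real (Suc n) * x\<rfloor> = int l" "real l \<le> real (Suc n) * x" "real (Suc n) * x < real l + 1"
      using cell_index[OF x, of "Suc n"] by auto
    show "real_of_int \<lfloor>real (Suc n) * x\<rfloor> / real (Suc n) \<in> {0..1}" using l(1,2) by (simp add: field_simps)
    have "real_of_int \<lfloor>real (Suc n) * x\<rfloor> / real (Suc n) - x = (real l - real (Suc n) * x) / real (Suc n)"
      unfolding l(2) by (simp add: diff_divide_distrib del: of_nat_Suc)
    then have "\<bar>real_of_int \<lfloor>real (Suc n) * x\<rfloor> / real (Suc n) - x\<bar> = \<bar>real l - real (Suc n) * x\<bar> / real (Suc n)"
      by (simp only: abs_divide abs_of_nat)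
    also have "\<dots> \<le> 1 / real (Suc n)" using l(3,4) by (intro divide_right_mono) auto
    finally show "\<bar>real_of_int \<lfloor>real (Suc n) * x\<rfloor> / real (Suc n) - x\<bar> \<le> 1 / real (Suc n)" .
  qed
  have int: "integrable unit_interval (s n)" "(\<integral>x. s n x \<partial>unit_interval) = (\<Sum>l<Suc n. f (real l / real (Suc n))) / real (Suc n)" for n
    using integrable_step[of "Suc n" "\<lambda>m. f (real_of_int m / real (Suc n))"] integral_step[of "Suc n" "\<lambda>m. f (real_of_int m / real (Suc n))"]
    unfolding s_def[abs_def] by (simp_all add: divide_inverse mult.commute del: of_nat_Suc sum.lessThan_Suc)
  have "(\<lambda>n. \<integral>x. s n x \<partial>unit_interval) \<longlonglongrightarrow> (\<integral>x. f x \<partial>unit_interval)"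
  proof (rule integral_dominated_convergence[where w="\<lambda>x. B"])
    show "AE x in unit_interval. (\<lambda>n. s n x) \<longlonglongrightarrow> f x"
      using AE_unit_interval
    proof eventually_elim
      case (elim x)
      have "(\<lambda>n. real_of_int \<lfloor>real (Suc n) * x\<rfloor> / real (Suc n)) \<longlonglongrightarrow> x"
      proof (rule LIM_zero_cancel, rule Lim_null_comparison)
        show "\<forall>\<^sub>F n in sequentially. norm (real_of_int \<lfloor>real (Suc n) * x\<rfloor> / real (Suc n) - x) \<le> 1 / real (Suc n)"
          using s01(2) elim by (auto simp del: of_nat_Suc)
        show "(\<lambda>n. 1 / real (Suc n)) \<longlonglongrightarrow> 0" using LIMSEQ_Suc[OF lim_1_over_n] .
      qed
      then show ?case
        unfolding s_def using f s01(1) elim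
        by (intro continuous_on_tendsto_compose[OF f]) auto
    qed
    show "AE x in unit_interval. norm (s n x) \<le> B" for n
      using AE_unit_interval by eventually_elim (use s01(1) B(2) in \<open>auto simp: s_def simp del: of_nat_Suc\<close>)
  qed (use int(1) continuous_measurable_unit[OF f] in auto)
  then show ?thesis by (simp only: int(2))
qed

text \<open>Joint measurability in \<open>(t, x)\<close> is not among the hypotheses. Continuity in
  \<open>x\<close> writes the spatial integral as a limit of Riemann sums, each measurable in time
  as a finite combination of point values.\<close>

lemma borel_measurable_time_norm2:
  fixes f :: "real \<Rightarrow> real \<Rightarrow> 'a::euclidean_space"
  assumes m: "\<And>x. x \<in> {0..1} \<Longrightarrow> (\<lambda>t. f t x) \<in> borel_measurable (lebesgue_on {a..b})"
    and c: "AE t in lebesgue_on {a..b}. continuous_on {0..1} (f t)"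
  shows "(\<lambda>t. \<integral>x. (norm (f t x))\<^sup>2 \<partial>unit_interval) \<in> borel_measurable (lebesgue_on {a..b})"
proof -
  define S where "S n t = (\<Sum>l<Suc n. (norm (f t (real l / real (Suc n))))\<^sup>2) / real (Suc n)" for n t
  have "real l / real (Suc n) \<in> {0..1}" if "l < Suc n" for l n using that by (simp add: field_simps)
  then have S: "S n \<in> borel_measurable (lebesgue_on {a..b})" for n
    unfolding S_def using m by (intro borel_measurable_divide borel_measurable_sum borel_measurable_power borel_measurable_norm) auto
  show ?thesis
  proof (rule borel_measurable_lebesgue_on_cong_AE)
    show "(\<lambda>t. lim (\<lambda>n. S n t)) \<in> borel_measurable (lebesgue_on {a..b})"
      using S by (rule borel_measurable_lim_metric)
    show "AE t in lebesgue_on {a..b}. (\<integral>x. (norm (f t x))\<^sup>2 \<partial>unit_interval) = lim (\<lambda>n. S n t)"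
      using c
    proof eventually_elim
      case (elim t)
      then have "(\<lambda>n. S n t) \<longlonglongrightarrow> (\<integral>x. (norm (f t x))\<^sup>2 \<partial>unit_interval)"
        unfolding S_def by (intro Riemann_sum_tendsto continuous_intros)
      then show ?case by (simp add: limI)
    qed
  qed
qed

text \<open>The time derivative of \<open>rel_energy\<close> along a curve with velocity \<open>(p', q')\<close>.\<close>

definition rel_rate :: "real \<Rightarrow> 'a::real_inner \<Rightarrow> 'a \<Rightarrow> 'a \<Rightarrow> 'a \<Rightarrow> real" where
  "rel_rate \<epsilon> p q p' q' = (- (\<epsilon> *\<^sub>R (q - p)) - (q - (q \<bullet> sgn p) *\<^sub>R sgn p) /\<^sub>R norm p) \<bullet> p'
     + (\<epsilon> *\<^sub>R (q - p) + sgn q - sgn p) \<bullet> q'"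

text \<open>In the application \<open>p\<close> is the slope of the exact curve on the auxiliary
  mesh, \<open>q\<close> the discrete slope, \<open>g\<close> the weak derivative, and
  \<open>p'\<close>, \<open>q'\<close>, \<open>P'\<close> are slopes of velocities,
  \<open>P'\<close> being that of the interpolated exact one. The first term on the right is the one
  that the weak equations evaluate.\<close>

lemma rel_rate_le:
  fixes p q g p' q' P' :: "'a::real_inner"
  assumes "0 \<le> \<epsilon>" "0 < c" and c: "c \<le> norm p" "c \<le> norm q" "c \<le> norm g"
    and g: "norm (g - p) \<le> \<kappa>" and M: "norm p' \<le> M" and "0 < \<theta>"
  shows "rel_rate \<epsilon> p q p' q' \<le> ((\<epsilon> *\<^sub>R q + sgn q) - (\<epsilon> *\<^sub>R g + sgn g)) \<bullet> (q' - P')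
     + (\<theta> * (norm (q' - P'))\<^sup>2 + ((\<epsilon> + 2 / c) * \<kappa>)\<^sup>2 / (4 * \<theta>))
     + ((\<epsilon> + 2 / c)\<^sup>2 + 4 * M / c\<^sup>2) * (norm (q - p))\<^sup>2 + (norm (P' - p'))\<^sup>2"
proof -
  define G where "G x = \<epsilon> *\<^sub>R x + sgn x" for x :: 'a
  define L where "L = \<epsilon> + 2 / c"
  define R where "R = sgn q - sgn p - (q - (q \<bullet> sgn p) *\<^sub>R sgn p) /\<^sub>R norm p"
  have nz: "p \<noteq> 0" "q \<noteq> 0" using assms by auto
  \<comment> \<open>An exact splitting with \<open>G\<close> the flux: the tested flux difference,
    the mismatch of \<open>g\<close> and \<open>p\<close>, the interpolation error
    \<open>P' - p'\<close> of the velocity slope, and the Taylor remainder \<open>R\<close> of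
    \<open>sgn\<close>, which multiplies \<open>p'\<close>.\<close>
  have eq: "rel_rate \<epsilon> p q p' q' = (G q - G g) \<bullet> (q' - P') + (G g - G p) \<bullet> (q' - P') + (G q - G p) \<bullet> (P' - p') + R \<bullet> p'"
    unfolding rel_rate_def G_def R_def by (simp add: inner_diff_left inner_diff_right inner_add_left scaleR_diff_right)
  have "norm (G g - G p) \<le> L * norm (g - p)" unfolding G_def L_def using assms by (intro flux_Lipschitz) auto
  also have "\<dots> \<le> L * \<kappa>" unfolding L_def using assms by (intro mult_left_mono) auto
  finally have "(G g - G p) \<bullet> (q' - P') \<le> (L * \<kappa>) * norm (q' - P')"
    by (intro order_trans[OF norm_cauchy_schwarz] mult_right_mono) auto
  also have "\<dots> \<le> \<theta> * (norm (q' - P'))\<^sup>2 + (L * \<kappa>)\<^sup>2 / (4 * \<theta>)" using \<open>0 < \<theta>\<close> by (rule Young)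
  finally have 1: "(G g - G p) \<bullet> (q' - P') \<le> \<theta> * (norm (q' - P'))\<^sup>2 + (L * \<kappa>)\<^sup>2 / (4 * \<theta>)" .
  have "norm (G q - G p) \<le> L * norm (q - p)" unfolding G_def L_def using assms by (intro flux_Lipschitz) auto
  then have "(G q - G p) \<bullet> (P' - p') \<le> (L * norm (q - p)) * norm (P' - p')"
    by (intro order_trans[OF norm_cauchy_schwarz] mult_right_mono) auto
  also have "\<dots> \<le> 1 * (norm (P' - p'))\<^sup>2 + (L * norm (q - p))\<^sup>2 / (4 * 1)" by (rule Young) simp
  also have "\<dots> \<le> L\<^sup>2 * (norm (q - p))\<^sup>2 + (norm (P' - p'))\<^sup>2" by (simp add: power_mult_distrib)
  finally have 2: "(G q - G p) \<bullet> (P' - p') \<le> L\<^sup>2 * (norm (q - p))\<^sup>2 + (norm (P' - p'))\<^sup>2" .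
  have "norm R \<le> 4 * (norm (q - p))\<^sup>2 / (norm p)\<^sup>2" unfolding R_def using nz by (rule sgn_second_order_remainder)
  also have "\<dots> \<le> 4 * (norm (q - p))\<^sup>2 / c\<^sup>2"
    using assms nz by (intro divide_left_mono power_mono) auto
  finally have "R \<bullet> p' \<le> (4 * (norm (q - p))\<^sup>2 / c\<^sup>2) * M"
    using M by (intro order_trans[OF norm_cauchy_schwarz] mult_mono) auto
  then have 3: "R \<bullet> p' \<le> 4 * M / c\<^sup>2 * (norm (q - p))\<^sup>2" by (simp add: mult_ac)
  show ?thesis
    unfolding eq distrib_right[of _ _ "(norm (q - p))\<^sup>2"] using 1 2 3 unfolding G_def L_def by linarith
qed

text \<open>First the slope is changed with \<open>w\<close> kept, then the velocity with
  \<open>q\<close> kept; each change spends \<open>lam / 8\<close> on \<open>\<phi>\<close>.\<close>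

lemma aniso_consistency_le:
  assumes "0 \<le> \<epsilon>" and nz: "g \<noteq> 0" "q \<noteq> 0" and D: "norm g \<le> D" "norm q \<le> D" and M: "norm w \<le> M" and lam: "0 < lam"
  shows "aniso \<epsilon> g w \<phi> - aniso \<epsilon> q w' \<phi> \<le> lam / 4 * (norm \<phi>)\<^sup>2 + 2 * ((5 + \<epsilon> * (D + D)) * M)\<^sup>2 / lam * (norm (g - q))\<^sup>2
      + 2 * (D + \<epsilon> * D\<^sup>2)\<^sup>2 / lam * (norm (w - w'))\<^sup>2"
proof -
  define L where "L = 5 + \<epsilon> * (D + D)"
  define A where "A = D + \<epsilon> * D\<^sup>2"
  have D0: "0 \<le> D" using D(1) norm_ge_zero order_trans by blast
  have L0: "0 \<le> L" "0 \<le> A" using D0 \<open>0 \<le> \<epsilon>\<close> by (auto simp: L_def A_def)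
  have "aniso \<epsilon> g w \<phi> - aniso \<epsilon> q w \<phi> \<le> (5 + \<epsilon> * (norm g + norm q)) * norm (g - q) * norm w * norm \<phi>"
    using aniso_Lipschitz[OF \<open>0 \<le> \<epsilon>\<close> nz, of w \<phi>] by linarith
  also have "\<dots> \<le> L * norm (g - q) * M * norm \<phi>"
    unfolding L_def using D M D0 \<open>0 \<le> \<epsilon>\<close> by (intro mult_right_mono mult_mono add_mono mult_left_mono) auto
  also have "\<dots> = (L * M * norm (g - q)) * norm \<phi>" by simp
  also have "\<dots> \<le> lam / 8 * (norm \<phi>)\<^sup>2 + (L * M * norm (g - q))\<^sup>2 / (4 * (lam / 8))" using lam by (intro Young) auto
  also have "\<dots> = lam / 8 * (norm \<phi>)\<^sup>2 + 2 * (L * M)\<^sup>2 / lam * (norm (g - q))\<^sup>2" by (simp add: power_mult_distrib)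
  finally have 1: "aniso \<epsilon> g w \<phi> - aniso \<epsilon> q w \<phi> \<le> lam / 8 * (norm \<phi>)\<^sup>2 + 2 * (L * M)\<^sup>2 / lam * (norm (g - q))\<^sup>2" .
  have "aniso \<epsilon> q (w - w') \<phi> \<le> (norm q + \<epsilon> * (norm q)\<^sup>2) * norm (w - w') * norm \<phi>"
    using aniso_bound[OF \<open>0 \<le> \<epsilon>\<close>, of q "w - w'" \<phi>] by linarith
  also have "\<dots> \<le> A * norm (w - w') * norm \<phi>"
    unfolding A_def using D D0 \<open>0 \<le> \<epsilon>\<close> by (intro mult_right_mono add_mono mult_left_mono power_mono) auto
  also have "\<dots> \<le> lam / 8 * (norm \<phi>)\<^sup>2 + (A * norm (w - w'))\<^sup>2 / (4 * (lam / 8))" using lam by (intro Young) auto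
  also have "\<dots> = lam / 8 * (norm \<phi>)\<^sup>2 + 2 * A\<^sup>2 / lam * (norm (w - w'))\<^sup>2" by (simp add: power_mult_distrib)
  finally have 2: "aniso \<epsilon> q (w - w') \<phi> \<le> lam / 8 * (norm \<phi>)\<^sup>2 + 2 * A\<^sup>2 / lam * (norm (w - w'))\<^sup>2" .
  have "aniso \<epsilon> q (w - w') \<phi> = aniso \<epsilon> q w \<phi> - aniso \<epsilon> q w' \<phi>" by (rule aniso_diff_left)
  then show ?thesis using 1 2 unfolding L_def A_def by linarith
qed

lemma norm_diff_square_le: "(norm (a - b))\<^sup>2 \<le> 2 * (norm (a - c))\<^sup>2 + 2 * (norm (b - c))\<^sup>2" for a b c :: "'a::real_normed_vector"
proof -
  have "norm (a - b) \<le> norm (a - c) + norm (b - c)"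
    using norm_triangle_ineq4[of "a - c" "b - c"] by simp
  then have "(norm (a - b))\<^sup>2 \<le> (norm (a - c) + norm (b - c))\<^sup>2" by (intro power_mono) auto
  also have "\<dots> \<le> 2 * (norm (a - c))\<^sup>2 + 2 * (norm (b - c))\<^sup>2"
    using zero_le_power2[of "norm (a - c) - norm (b - c)"] by (simp add: power2_eq_square algebra_simps)
  finally show ?thesis .
qed

text \<open>
  The error identity at a fixed time: the discrete velocity error \<open>\<phi>\<close> is the test function in both
  weak equations. The slopes \<open>p\<close> of the exact solution are taken on an auxiliary mesh of size \<open>1 / K\<close>.
\<close>

lemma static_estimate:
  assumes Cp: "interpolation_constant Cp" and J: "1 \<le> J" and K: "1 \<le> K" and eps: "0 < \<epsilon>" and c: "0 < c"
    and v: "\<And>i. v i \<in> W 1" and vh: "\<And>i. vh i \<in> fem J" and wh: "\<And>i. wh i \<in> fem J" and w: "\<And>i. continuous_on {0..1} (w i)"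
    and g: "\<And>i. AE x in unit_interval. c \<le> norm (dx (v i) x) \<and> norm (dx (v i) x) \<le> D"
    and p: "\<And>i. AE x in unit_interval. c \<le> norm (slope K (v i) x)"
    and q: "\<And>i. AE x in unit_interval. c \<le> norm (slope J (vh i) x) \<and> norm (slope J (vh i) x) \<le> D"
    and gp: "\<And>i. AE x in unit_interval. norm (dx (v i) x - slope K (v i) x) \<le> \<kappa>"
    and wM: "\<And>i x. x \<in> {0..1} \<Longrightarrow> norm (w i x) \<le> M"
    and p': "\<And>i. AE x in unit_interval. norm (slope K (w i) x) \<le> M'"
    and \<phi>: "(\<lambda>i x. wh i x - interpol J (w i) x) \<in> triods0_h J"
    and eq: "weak_equation \<epsilon> v w (\<lambda>i x. wh i x - interpol J (w i) x)"
    and eqh: "weak_equation \<epsilon> vh wh (\<lambda>i x. wh i x - interpol J (w i) x)"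
    and int: "\<And>i. integrable unit_interval (\<lambda>x. rel_rate \<epsilon> (slope K (v i) x) (slope J (vh i) x) (slope K (w i) x) (slope J (wh i) x))"
      "\<And>i. integrable unit_interval (\<lambda>x. (norm (slope J (vh i) x - slope K (v i) x))\<^sup>2)"
      "\<And>i. integrable unit_interval (\<lambda>x. (norm (slope J (w i) x - slope K (w i) x))\<^sup>2)"
  defines "lam \<equiv> min c (\<epsilon> * c\<^sup>2)"
  shows "(\<Sum>i\<in>UNIV. \<integral>x. rel_rate \<epsilon> (slope K (v i) x) (slope J (vh i) x) (slope K (w i) x) (slope J (wh i) x) \<partial>unit_interval)
    \<le> - lam / 2 * tri_norm2 (\<lambda>i x. wh i x - interpol J (w i) x)
      + ((\<epsilon> + 2 / c)\<^sup>2 + 4 * M' / c\<^sup>2 + 4 * ((5 + \<epsilon> * (D + D)) * M)\<^sup>2 / lam)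
          * (\<Sum>i\<in>UNIV. \<integral>x. (norm (slope J (vh i) x - slope K (v i) x))\<^sup>2 \<partial>unit_interval)
      + 3 * (((\<epsilon> + 2 / c) * \<kappa>)\<^sup>2 * (Cp * real J)\<^sup>2 / lam + 4 * ((5 + \<epsilon> * (D + D)) * M)\<^sup>2 / lam * \<kappa>\<^sup>2)
      + (\<Sum>i\<in>UNIV. \<integral>x. (norm (slope J (w i) x - slope K (w i) x))\<^sup>2 \<partial>unit_interval)
      + 2 * (D + \<epsilon> * D\<^sup>2)\<^sup>2 / lam * (\<Sum>i\<in>UNIV. \<integral>x. (norm (w i x - interpol J (w i) x))\<^sup>2 \<partial>unit_interval)"
proof -
  define f where "f = (\<lambda>i x. wh i x - interpol J (w i) x)"
  \<comment> \<open>Makes the inverse estimate return a quarter of the coercivity, the share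
    allotted to the mismatch between \<open>dx (v i)\<close> and its difference quotient.\<close>
  define \<theta> where "\<theta> = lam / (4 * (Cp * real J)\<^sup>2)"
  define LG where "LG = \<epsilon> + 2 / c"
  define LM where "LM = (5 + \<epsilon> * (D + D)) * M"
  define A where "A = D + \<epsilon> * D\<^sup>2"
  have lam: "lam > 0" using c eps by (simp add: lam_def)
  have C: "0 < Cp" using interpolation_constantD(1)[OF Cp J] .
  have CJ: "0 < Cp * real J" using C J by simp
  have th: "\<theta> > 0"
    unfolding \<theta>_def by (rule divide_pos_pos[OF lam], rule mult_pos_pos, simp, rule zero_less_power[OF CJ])
  let ?g = "\<lambda>i. dx (v i)" and ?q = "\<lambda>i. slope J (vh i)" and ?p = "\<lambda>i. slope K (v i)"
  have f: "f \<in> triods0_h J" unfolding f_def by (rule \<phi>)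
  note fc = triods0_hD[OF f]
  have whc: "continuous_on {0..1} (wh i)" for i using wh by (rule fem_continuous)
  have Ic: "continuous_on {0..1} (interpol J (w i))" for i using interpol_fem[OF J] by (rule fem_continuous)
  have gm: "?g i \<in> borel_measurable unit_interval" for i using W1_square_integrable_dx[OF v] by (simp add: square_integrable_def)
  have qm: "?q i \<in> borel_measurable unit_interval" for i by (rule borel_measurable_integrable[OF integrable_slope[OF J]])
  have gb: "AE x in unit_interval. norm (?g i x) \<le> D" "AE x in unit_interval. norm (?q i x) \<le> D" "AE x in unit_interval. c \<le> norm (?q i x)" for i
    using g[of i] q[of i] by (auto elim: eventually_mono)
  have E1: "mass_form \<epsilon> ?g w f = - flux_form \<epsilon> ?g (\<lambda>i. slope J (f i))"
    using eq unfolding f_def[symmetric]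
    by (subst (asm) weak_equation_iff[where p="?g" and \<psi>="\<lambda>i. slope J (f i)" and B=D])
       (use gm gb(1) w fc dx_fem[OF fc(1) J] integrable_slope[OF J] eps weak_deriv_integrable(1)[OF W1_weak_deriv_dx[OF fem_W1[OF fc(1) J]]] in auto)
  have E2: "mass_form \<epsilon> ?q wh f = - flux_form \<epsilon> ?q (\<lambda>i. slope J (f i))"
    using eqh unfolding f_def[symmetric]
    by (subst (asm) weak_equation_iff[where p="?q" and \<psi>="\<lambda>i. slope J (f i)" and B=D])
       (use qm gb(2) whc fc dx_fem[OF fc(1) J] dx_fem[OF vh J] integrable_slope[OF J] eps weak_deriv_integrable(1)[OF W1_weak_deriv_dx[OF fem_W1[OF fc(1) J]]]
          weak_deriv_integrable(1)[OF W1_weak_deriv_dx[OF fem_W1[OF vh J]]] in auto)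
  have E3: "mass_form \<epsilon> ?q f f = mass_form \<epsilon> ?q wh f - mass_form \<epsilon> ?q (\<lambda>i. interpol J (w i)) f"
    using qm gb(2) whc Ic fc(2) eps mass_form_diff[of ?q D wh "\<lambda>i. interpol J (w i)" f \<epsilon>] by (simp add: f_def)
  have E4: "lam * tri_norm2 f \<le> mass_form \<epsilon> ?q f f"
    unfolding lam_def using qm gb(2,3) fc(2) eps c by (intro mass_form_coercive) auto
  have ig: "integrable unit_interval (\<lambda>x. (\<epsilon> *\<^sub>R ?g i x + sgn (?g i x)) \<bullet> slope J (f i) x)"
    "integrable unit_interval (\<lambda>x. (\<epsilon> *\<^sub>R ?q i x + sgn (?q i x)) \<bullet> slope J (f i) x)"
    "integrable unit_interval (\<lambda>x. aniso \<epsilon> (?g i x) (w i x) (f i x))"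
    "integrable unit_interval (\<lambda>x. aniso \<epsilon> (?q i x) (interpol J (w i) x) (f i x))" for i
    using gm[of i] qm[of i] gb[of i] integrable_slope[OF J] w[of i] Ic[of i] fc(2)[of i] eps
    by (auto intro!: integrable_flux integrable_aniso)
  have sq: "integrable unit_interval (\<lambda>x. (norm (slope J (f i) x))\<^sup>2)" "integrable unit_interval (\<lambda>x. (norm (f i x))\<^sup>2)"
    "integrable unit_interval (\<lambda>x. (norm (w i x - interpol J (w i) x))\<^sup>2)" for i
    using integrable_norm_square[OF square_integrable_slope[OF J]] integrable_norm_square_continuous[OF fc(2)]
      integrable_norm_square_continuous[OF continuous_on_diff[OF w Ic]] by auto
  \<comment> \<open>Interpolation does not change nodal values, so the slopes of the test function
    are differences of slopes of the two velocities. Here the test function meets the time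
    derivative of the discrete slopes.\<close>
  have sf: "AE x in unit_interval. slope J (f i) x = slope J (wh i) x - slope J (w i) x" for i
    using AE_unit_interval
  proof eventually_elim
    case (elim x)
    have "slope J (interpol J (w i)) x = slope J (w i) x"
      using elim J by (intro slope_cong interpol_node) auto
    then show ?case by (simp add: f_def slope_diff)
  qed
  have I1: "(\<integral>x. rel_rate \<epsilon> (?p i x) (?q i x) (slope K (w i) x) (slope J (wh i) x) \<partial>unit_interval)
     \<le> (\<integral>x. (\<epsilon> *\<^sub>R ?q i x + sgn (?q i x)) \<bullet> slope J (f i) x \<partial>unit_interval) - (\<integral>x. (\<epsilon> *\<^sub>R ?g i x + sgn (?g i x)) \<bullet> slope J (f i) x \<partial>unit_interval)
       + (lam / 4 * (\<integral>x. (norm (f i x))\<^sup>2 \<partial>unit_interval) + (LG * \<kappa>)\<^sup>2 / (4 * \<theta>))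
       + (LG\<^sup>2 + 4 * M' / c\<^sup>2) * (\<integral>x. (norm (?q i x - ?p i x))\<^sup>2 \<partial>unit_interval)
       + (\<integral>x. (norm (slope J (w i) x - slope K (w i) x))\<^sup>2 \<partial>unit_interval)" for i
  proof -
    have "(\<integral>x. rel_rate \<epsilon> (?p i x) (?q i x) (slope K (w i) x) (slope J (wh i) x) \<partial>unit_interval)
      \<le> (\<integral>x. ((\<epsilon> *\<^sub>R ?q i x + sgn (?q i x)) \<bullet> slope J (f i) x - (\<epsilon> *\<^sub>R ?g i x + sgn (?g i x)) \<bullet> slope J (f i) x)
         + (\<theta> * (norm (slope J (f i) x))\<^sup>2 + (LG * \<kappa>)\<^sup>2 / (4 * \<theta>))
         + (LG\<^sup>2 + 4 * M' / c\<^sup>2) * (norm (?q i x - ?p i x))\<^sup>2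
         + (norm (slope J (w i) x - slope K (w i) x))\<^sup>2 \<partial>unit_interval)"
    proof (rule integral_mono_AE[OF int(1)])
      show "AE x in unit_interval. rel_rate \<epsilon> (?p i x) (?q i x) (slope K (w i) x) (slope J (wh i) x) \<le>
          ((\<epsilon> *\<^sub>R ?q i x + sgn (?q i x)) \<bullet> slope J (f i) x - (\<epsilon> *\<^sub>R ?g i x + sgn (?g i x)) \<bullet> slope J (f i) x)
         + (\<theta> * (norm (slope J (f i) x))\<^sup>2 + (LG * \<kappa>)\<^sup>2 / (4 * \<theta>))
         + (LG\<^sup>2 + 4 * M' / c\<^sup>2) * (norm (?q i x - ?p i x))\<^sup>2
         + (norm (slope J (w i) x - slope K (w i) x))\<^sup>2"
        using g[of i] p[of i] q[of i] gp[of i] p'[of i] sf[of i]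
      proof eventually_elim
        case (elim x)
        have "rel_rate \<epsilon> (?p i x) (?q i x) (slope K (w i) x) (slope J (wh i) x)
          \<le> ((\<epsilon> *\<^sub>R ?q i x + sgn (?q i x)) - (\<epsilon> *\<^sub>R ?g i x + sgn (?g i x))) \<bullet> (slope J (wh i) x - slope J (w i) x)
           + (\<theta> * (norm (slope J (wh i) x - slope J (w i) x))\<^sup>2 + (LG * \<kappa>)\<^sup>2 / (4 * \<theta>))
           + (LG\<^sup>2 + 4 * M' / c\<^sup>2) * (norm (?q i x - ?p i x))\<^sup>2 + (norm (slope J (w i) x - slope K (w i) x))\<^sup>2"
          unfolding LG_def using elim eps c th by (intro rel_rate_le) auto
        then show ?case unfolding elim(6) inner_diff_left .
      qed
    qed (use ig sq int in auto)
    also have "\<dots> = (\<integral>x. (\<epsilon> *\<^sub>R ?q i x + sgn (?q i x)) \<bullet> slope J (f i) x \<partial>unit_interval) - (\<integral>x. (\<epsilon> *\<^sub>R ?g i x + sgn (?g i x)) \<bullet> slope J (f i) x \<partial>unit_interval)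
       + (\<theta> * (\<integral>x. (norm (slope J (f i) x))\<^sup>2 \<partial>unit_interval) + (LG * \<kappa>)\<^sup>2 / (4 * \<theta>))
       + (LG\<^sup>2 + 4 * M' / c\<^sup>2) * (\<integral>x. (norm (?q i x - ?p i x))\<^sup>2 \<partial>unit_interval)
       + (\<integral>x. (norm (slope J (w i) x - slope K (w i) x))\<^sup>2 \<partial>unit_interval)"
      using ig[of i] sq[of i] int(2,3)[of i] by (simp add: measure_restrict_space)
    also have "\<theta> * (\<integral>x. (norm (slope J (f i) x))\<^sup>2 \<partial>unit_interval) \<le> \<theta> * ((Cp * real J)\<^sup>2 * (\<integral>x. (norm (f i x))\<^sup>2 \<partial>unit_interval))"
      using fem_slope_L2[OF Cp J fc(1)] th by (intro mult_left_mono) auto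
    also have "\<dots> = lam / 4 * (\<integral>x. (norm (f i x))\<^sup>2 \<partial>unit_interval)" using C J by (auto simp: \<theta>_def)
    finally show ?thesis by simp
  qed
  have I2: "(\<integral>x. aniso \<epsilon> (?g i x) (w i x) (f i x) \<partial>unit_interval) - (\<integral>x. aniso \<epsilon> (?q i x) (interpol J (w i) x) (f i x) \<partial>unit_interval)
     \<le> lam / 4 * (\<integral>x. (norm (f i x))\<^sup>2 \<partial>unit_interval)
       + (4 * LM\<^sup>2 / lam * \<kappa>\<^sup>2 + 4 * LM\<^sup>2 / lam * (\<integral>x. (norm (?q i x - ?p i x))\<^sup>2 \<partial>unit_interval))
       + 2 * A\<^sup>2 / lam * (\<integral>x. (norm (w i x - interpol J (w i) x))\<^sup>2 \<partial>unit_interval)" for i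
  proof -
    have "(\<integral>x. aniso \<epsilon> (?g i x) (w i x) (f i x) - aniso \<epsilon> (?q i x) (interpol J (w i) x) (f i x) \<partial>unit_interval)
      \<le> (\<integral>x. lam / 4 * (norm (f i x))\<^sup>2 + (4 * LM\<^sup>2 / lam * \<kappa>\<^sup>2 + 4 * LM\<^sup>2 / lam * (norm (?q i x - ?p i x))\<^sup>2)
         + 2 * A\<^sup>2 / lam * (norm (w i x - interpol J (w i) x))\<^sup>2 \<partial>unit_interval)"
    proof (rule integral_mono_AE)
      show "AE x in unit_interval. aniso \<epsilon> (?g i x) (w i x) (f i x) - aniso \<epsilon> (?q i x) (interpol J (w i) x) (f i x)
        \<le> lam / 4 * (norm (f i x))\<^sup>2 + (4 * LM\<^sup>2 / lam * \<kappa>\<^sup>2 + 4 * LM\<^sup>2 / lam * (norm (?q i x - ?p i x))\<^sup>2)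
         + 2 * A\<^sup>2 / lam * (norm (w i x - interpol J (w i) x))\<^sup>2"
        using g[of i] q[of i] gp[of i] AE_unit_interval
      proof eventually_elim
        case (elim x)
        have "aniso \<epsilon> (?g i x) (w i x) (f i x) - aniso \<epsilon> (?q i x) (interpol J (w i) x) (f i x)
          \<le> lam / 4 * (norm (f i x))\<^sup>2 + 2 * LM\<^sup>2 / lam * (norm (?g i x - ?q i x))\<^sup>2 + 2 * A\<^sup>2 / lam * (norm (w i x - interpol J (w i) x))\<^sup>2"
          unfolding LM_def A_def using elim eps c lam wM[of x i] by (intro aniso_consistency_le) auto
        moreover have "2 * LM\<^sup>2 / lam * (norm (?g i x - ?q i x))\<^sup>2 \<le> 2 * LM\<^sup>2 / lam * (2 * \<kappa>\<^sup>2 + 2 * (norm (?q i x - ?p i x))\<^sup>2)"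
        proof (rule mult_left_mono)
          have "(norm (?g i x - ?q i x))\<^sup>2 \<le> 2 * (norm (?g i x - ?p i x))\<^sup>2 + 2 * (norm (?q i x - ?p i x))\<^sup>2" by (rule norm_diff_square_le)
          moreover have "(norm (?g i x - ?p i x))\<^sup>2 \<le> \<kappa>\<^sup>2" using elim by (intro power_mono) auto
          ultimately show "(norm (?g i x - ?q i x))\<^sup>2 \<le> 2 * \<kappa>\<^sup>2 + 2 * (norm (?q i x - ?p i x))\<^sup>2" by linarith
        qed (use lam in simp)
        ultimately show ?case by (simp add: distrib_left)
      qed
    qed (use ig sq int in auto)
    then show ?thesis using ig[of i] sq[of i] int(2)[of i] by (simp add: measure_restrict_space)
  qed
  have "(\<Sum>i\<in>UNIV. \<integral>x. rel_rate \<epsilon> (?p i x) (?q i x) (slope K (w i) x) (slope J (wh i) x) \<partial>unit_interval)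
    \<le> (\<Sum>i\<in>UNIV. ((\<integral>x. (\<epsilon> *\<^sub>R ?q i x + sgn (?q i x)) \<bullet> slope J (f i) x \<partial>unit_interval) - (\<integral>x. (\<epsilon> *\<^sub>R ?g i x + sgn (?g i x)) \<bullet> slope J (f i) x \<partial>unit_interval))
       + (lam / 4 * (\<integral>x. (norm (f i x))\<^sup>2 \<partial>unit_interval) + (LG * \<kappa>)\<^sup>2 / (4 * \<theta>))
       + (LG\<^sup>2 + 4 * M' / c\<^sup>2) * (\<integral>x. (norm (?q i x - ?p i x))\<^sup>2 \<partial>unit_interval)
       + (\<integral>x. (norm (slope J (w i) x - slope K (w i) x))\<^sup>2 \<partial>unit_interval))"
    by (intro sum_mono I1)
  also have "\<dots> = flux_form \<epsilon> ?q (\<lambda>i. slope J (f i)) - flux_form \<epsilon> ?g (\<lambda>i. slope J (f i))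
       + (lam / 4 * tri_norm2 f + 3 * ((LG * \<kappa>)\<^sup>2 / (4 * \<theta>)))
       + (LG\<^sup>2 + 4 * M' / c\<^sup>2) * (\<Sum>i\<in>UNIV. \<integral>x. (norm (?q i x - ?p i x))\<^sup>2 \<partial>unit_interval)
       + (\<Sum>i\<in>UNIV. \<integral>x. (norm (slope J (w i) x - slope K (w i) x))\<^sup>2 \<partial>unit_interval)"
    unfolding flux_form_def tri_norm2_def sum.distrib sum_subtractf sum_distrib_left[symmetric] by simp
  finally have S1: "(\<Sum>i\<in>UNIV. \<integral>x. rel_rate \<epsilon> (?p i x) (?q i x) (slope K (w i) x) (slope J (wh i) x) \<partial>unit_interval) \<le> \<dots>" .
  have "mass_form \<epsilon> ?g w f - mass_form \<epsilon> ?q (\<lambda>i. interpol J (w i)) f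
    \<le> (\<Sum>i\<in>UNIV. lam / 4 * (\<integral>x. (norm (f i x))\<^sup>2 \<partial>unit_interval)
       + (4 * LM\<^sup>2 / lam * \<kappa>\<^sup>2 + 4 * LM\<^sup>2 / lam * (\<integral>x. (norm (?q i x - ?p i x))\<^sup>2 \<partial>unit_interval))
       + 2 * A\<^sup>2 / lam * (\<integral>x. (norm (w i x - interpol J (w i) x))\<^sup>2 \<partial>unit_interval))"
    unfolding mass_form_def sum_subtractf[symmetric] by (intro sum_mono I2)
  also have "\<dots> = lam / 4 * tri_norm2 f
       + (3 * (4 * LM\<^sup>2 / lam * \<kappa>\<^sup>2) + 4 * LM\<^sup>2 / lam * (\<Sum>i\<in>UNIV. \<integral>x. (norm (?q i x - ?p i x))\<^sup>2 \<partial>unit_interval))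
       + 2 * A\<^sup>2 / lam * (\<Sum>i\<in>UNIV. \<integral>x. (norm (w i x - interpol J (w i) x))\<^sup>2 \<partial>unit_interval)"
    unfolding tri_norm2_def sum.distrib sum_distrib_left[symmetric] by simp
  finally have S2: "mass_form \<epsilon> ?g w f - mass_form \<epsilon> ?q (\<lambda>i. interpol J (w i)) f \<le> \<dots>" .
  have "(LG * \<kappa>)\<^sup>2 / (4 * \<theta>) = (LG * \<kappa>)\<^sup>2 * (Cp * real J)\<^sup>2 / lam" by (simp add: \<theta>_def)
  then have S3: "3 * (((LG * \<kappa>)\<^sup>2 * (Cp * real J)\<^sup>2 / lam) + 4 * LM\<^sup>2 / lam * \<kappa>\<^sup>2) = 3 * ((LG * \<kappa>)\<^sup>2 / (4 * \<theta>)) + 3 * (4 * LM\<^sup>2 / lam * \<kappa>\<^sup>2)"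
    by simp
  \<comment> \<open>The two weak equations turn the flux difference into mass forms, whose discrete
    part contributes minus the full coercivity \<open>lam\<close>; the two estimates consume a
    quarter each, leaving one half.\<close>
  show ?thesis
    unfolding f_def[symmetric] LG_def[symmetric] LM_def[symmetric] A_def[symmetric] S3
    using S1 S2 E1 E2 E3 E4 by (simp add: distrib_right)
qed

section \<open>Regularity of the exact solution\<close>

text \<open>Holds numbers only, so that the constant of the error estimate can be assembled before
  any solution is fixed; \<open>Nb\<close> stands for a common bound on norms of the data.\<close>

locale scheme_constants =
  fixes \<epsilon> T c0 Cp Nb :: real
  assumes eps: "0 < \<epsilon>" and T: "0 < T" and c0: "0 < c0" "c0 \<le> 1 / 2"
    and Cp: "interpolation_constant Cp" and Nb: "0 < Nb"
begin

lemma Cp_pos: "0 < Cp" using Cp by (simp add: interpolation_constant_def)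

text \<open>Bounds the time integral of the summed \<open>W 2\<close> norms of the velocities,
  through \<open>a \<le> 1 + a\<^sup>2\<close>. Then \<open>reg_bound\<close> covers the initial
  curve together with everything the velocity adds to it.\<close>

definition "vel_bound = T + 9 * Nb\<^sup>2"
definition "reg_bound = Nb + vel_bound"
text \<open>Coercivity and Lipschitz constants for slopes of norm between \<open>c0 / 2\<close> and
  \<open>2 / c0\<close>, the range guaranteed near the exact slopes. In \<open>mass_const\<close>,
  \<open>Nb\<close> is the sup bound of the exact velocity.\<close>

definition "coer = min (c0 / 2) (\<epsilon> * (c0 / 2)\<^sup>2)"
definition "flux_const = \<epsilon> + 2 / (c0 / 2)"
definition "mass_const = (5 + \<epsilon> * (2 / c0 + 2 / c0)) * Nb"
text \<open>The factor of the quadratic error splits into a constant and a multiple of the summed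
  velocity norms; \<open>growth\<close> bounds its time integral.\<close>

definition "growth0 = flux_const\<^sup>2 + 4 * mass_const\<^sup>2 / coer"
definition "growth1 = 4 * (Cp + 1) / (c0 / 2)\<^sup>2"
text \<open>Chosen so that \<open>consist / real K\<close> is the square of the sup-norm bound on
  slope errors for a mesh of \<open>K\<close> cells.\<close>

definition "consist = 4 * Cp\<^sup>2 * reg_bound\<^sup>2"
definition "source0 = 3 * (flux_const\<^sup>2 * consist * Cp\<^sup>2 / coer + 4 * mass_const\<^sup>2 / coer * consist)
   + 2 * (2 / c0 + \<epsilon> * (2 / c0)\<^sup>2)\<^sup>2 / coer * (3 * (Cp\<^sup>2 * Nb\<^sup>2))"
text \<open>In units of h^2: the initial energy, the accumulated consistency error, and the
  interpolation error of the velocity slopes.\<close>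

definition "source = (\<epsilon> / 2 + 2 / (c0 / 2)) * (12 * Cp\<^sup>2 * Nb\<^sup>2) + source0 * T + 4 * Cp\<^sup>2 * (9 * Nb\<^sup>2)"
definition "growth = growth0 * T + growth1 * vel_bound"
text \<open>The outcome of Gronwall's inequality for the energy, converted to slopes by the factor
  \<open>2 / \<epsilon>\<close>. Inserting it once more into the energy estimate gives
  \<open>vel_const\<close>.\<close>

definition "grad_const = 2 / \<epsilon> * source * exp (2 * (2 / \<epsilon> * growth))"
definition "vel_const = 2 / coer * (source + growth * grad_const)"
definition "error_const = 2 * Cp\<^sup>2 * Nb\<^sup>2 * T + 2 * vel_const + 2 * consist + 2 * grad_const + 1"

lemma const_pos:
  "0 < vel_bound" "0 < reg_bound" "0 < coer" "0 < flux_const" "0 < mass_const" "0 < growth0" "0 < growth1" "0 < consist"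
  "0 < source0" "0 < source" "0 < growth" "0 < grad_const" "0 < vel_const" "0 < error_const"
proof -
  note p = eps T c0(1) Nb Cp_pos
  show 1: "0 < vel_bound" unfolding vel_bound_def using p by (intro add_pos_nonneg) auto
  show 2: "0 < reg_bound" unfolding reg_bound_def using 1 p by simp
  show 3: "0 < coer" unfolding coer_def using p by simp
  show 4: "0 < flux_const" unfolding flux_const_def using p by (intro add_pos_pos) auto
  show 5: "0 < mass_const" unfolding mass_const_def using p by (intro mult_pos_pos add_pos_nonneg) auto
  show 6: "0 < growth0" unfolding growth0_def using 3 4 by (intro add_pos_nonneg) auto
  show 7: "0 < growth1" unfolding growth1_def using p by (intro divide_pos_pos mult_pos_pos) auto
  show 8: "0 < consist" unfolding consist_def using 2 p by (intro mult_pos_pos) auto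
  show 9: "0 < source0" unfolding source0_def using 3 4 5 8 p
    by (intro add_pos_nonneg mult_pos_pos divide_pos_pos mult_nonneg_nonneg divide_nonneg_pos) (auto intro: add_pos_nonneg)
  show 10: "0 < source" unfolding source_def using 9 p
    by (intro add_pos_nonneg add_nonneg_pos mult_nonneg_nonneg mult_pos_pos add_nonneg_nonneg) auto
  show 11: "0 < growth" unfolding growth_def using 1 6 7 p by (intro add_pos_pos mult_pos_pos)
  show 12: "0 < grad_const" unfolding grad_const_def using 10 p by (intro mult_pos_pos divide_pos_pos) auto
  show 13: "0 < vel_const" unfolding vel_const_def using 3 10 11 12 by (intro mult_pos_pos divide_pos_pos add_pos_pos) auto
  show "0 < error_const" unfolding error_const_def using 8 12 13 p by (intro add_nonneg_pos add_nonneg_nonneg mult_nonneg_nonneg) auto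
qed

end

text \<open>The data of the exact solution in the form in which they enter: at every time for the
  time-continuous curve, at almost every time for its velocity, with norms replaced by
  \<open>Nb\<close>.\<close>

locale exact_solution = scheme_constants +
  fixes P :: "3 \<Rightarrow> real^2" and u0 :: triple and u ut :: "3 \<Rightarrow> real \<Rightarrow> curve"
  assumes u0: "u0 i \<in> W 2" "u0 i 1 = P i" "u0 i 0 = u0 k 0" "W_norm 2 (u0 i) \<le> Nb"
    and uW: "t \<in> {0..T} \<Longrightarrow> u i t \<in> W 1"
    and u_bounds: "t \<in> {0..T} \<Longrightarrow> AE x in unit_interval. c0 \<le> norm (dx (u i t) x) \<and> norm (dx (u i t) x) \<le> 1 / c0"
    and u_init: "x \<in> {0..1} \<Longrightarrow> u i 0 x = u0 i x"
    and u_end: "t \<in> {0..T} \<Longrightarrow> u i t 1 = P i" "t \<in> {0..T} \<Longrightarrow> u i t 0 = u k t 0"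
    and u_cont: "x \<in> {0..1} \<Longrightarrow> continuous_on {0..T} (\<lambda>t. u i t x)"
    and u_weak: "x \<in> {0..1} \<Longrightarrow> has_weak_deriv 0 T (\<lambda>t. u i t x) (\<lambda>t. ut i t x)"
    and ut_W2: "AE t in lebesgue_on {0..T}. ut i t \<in> W 2"
    and ut_W1: "AE t in lebesgue_on {0..T}. W_norm 1 (ut i t) \<le> Nb"
    and ut_L2: "square_integrable 0 T (\<lambda>t. W_norm 2 (ut i t))" "L2_norm 0 T (\<lambda>t. W_norm 2 (ut i t)) \<le> Nb"
    and weq: "AE t in lebesgue_on {0..T}. \<forall>\<phi>\<in>triods0. weak_equation \<epsilon> (\<lambda>i. u i t) (\<lambda>i. ut i t) \<phi>"

text \<open>Nonnegativity of the variance: the unit interval has total mass 1.\<close>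

lemma square_integral_ge:
  fixes f :: "real \<Rightarrow> real"
  assumes f: "integrable unit_interval f" "integrable unit_interval (\<lambda>x. (f x)\<^sup>2)"
  shows "(\<integral>x. f x \<partial>unit_interval) \<le> sqrt (\<integral>x. (f x)\<^sup>2 \<partial>unit_interval)"
proof (rule real_le_rsqrt)
  define m where "m = (\<integral>x. f x \<partial>unit_interval)"
  have "0 \<le> (\<integral>x. (f x - m)\<^sup>2 \<partial>unit_interval)" by (rule Bochner_Integration.integral_nonneg) simp
  also have "\<dots> = (\<integral>x. (f x)\<^sup>2 - 2 * m * f x + m\<^sup>2 \<partial>unit_interval)"
    by (intro Bochner_Integration.integral_cong) (auto simp: power2_eq_square algebra_simps)
  also have "\<dots> = (\<integral>x. (f x)\<^sup>2 \<partial>unit_interval) - 2 * m * m + m\<^sup>2"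
    using f by (simp add: m_def measure_restrict_space)
  finally show "m\<^sup>2 \<le> (\<integral>x. (f x)\<^sup>2 \<partial>unit_interval)" by (simp add: power2_eq_square)
qed

text \<open>Integration of \<open>dx v\<close> from \<open>x\<close> to the end where
  \<open>v\<close> vanishes, followed by the comparison of the L1 and L2 norms.\<close>

lemma W1_sup_bound:
  assumes v: "v \<in> W 1" and v1: "v 1 = 0" and x: "x \<in> {0..1}"
  shows "norm (v x) \<le> W_norm 1 v"
proof -
  have d: "integrable unit_interval (dx v)" using weak_deriv_integrable(1)[OF W1_weak_deriv_dx[OF v]] .
  have "norm (v x) = norm (\<integral>y. dx v y \<partial>lebesgue_on {x..1})"
    using weak_deriv_ftc[OF W1_continuous[OF v] W1_weak_deriv_dx[OF v], of x 1] x v1 by (metis atLeastAtMost_iff diff_0 norm_minus_cancel order_refl zero_less_one)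
  also have "\<dots> \<le> (\<integral>y. norm (dx v y) \<partial>lebesgue_on {x..1})" by (rule integral_norm_bound)
  also have "\<dots> \<le> (\<integral>y. norm (dx v y) \<partial>unit_interval)"
    using d x by (intro integral_mono_lebesgue_on_AE) auto
  also have "\<dots> \<le> L2_norm 0 1 (dx v)"
    unfolding L2_norm_def using d integrable_norm_square[OF W1_square_integrable_dx[OF v]] by (intro square_integral_ge) auto
  also have "\<dots> \<le> W_norm 1 v" using L2_norm_le_W_norm[of 1 1 v] by simp
  finally show ?thesis .
qed

text \<open>Comparison with the mesh of a single cell, where the interpolant is the segment from
  \<open>v 0\<close> to 0. The interpolation estimate with \<open>J = 1\<close> thus acts as a
  Sobolev embedding for the derivative, with a constant expressed by \<open>Cp\<close>.\<close>

lemma W2_Lipschitz: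
  assumes Cp: "interpolation_constant Cp" and v: "v \<in> W 2" and v1: "v 1 = 0" and x: "x \<in> {0..1}" "y \<in> {0..1}"
  shows "norm (v x - v y) \<le> (Cp + 1) * W_norm 2 v * \<bar>x - y\<bar>"
proof -
  have I: "interpol 1 v z = (1 - z) *\<^sub>R v 0" if "z \<in> {0..1}" for z
    using that v1 nodal_formula[of 0 1 z "\<lambda>j. v (real j / 1)"] unfolding interpol_eq_nodal by simp
  have "norm (v 0) \<le> W_norm 2 v"
  proof -
    have "norm (v 0) \<le> W_norm 1 v" using v1 by (intro W1_sup_bound W2_W1[OF v]) auto
    also have "W_norm 1 v \<le> W_norm 2 v"
      unfolding W_norm_def by (intro real_sqrt_le_mono sum_mono2) auto
    finally show ?thesis .
  qed
  moreover have "interpol 1 v x - interpol 1 v y = (y - x) *\<^sub>R v 0"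
    unfolding I[OF x(1)] I[OF x(2)] by (simp add: algebra_simps)
  ultimately have "norm (interpol 1 v x - interpol 1 v y) \<le> W_norm 2 v * \<bar>x - y\<bar>"
    by (simp only: norm_scaleR abs_minus_commute[of y x] mult.commute[of "\<bar>x - y\<bar>"] mult_right_mono abs_ge_zero)
  moreover have "norm ((v x - interpol 1 v x) - (v y - interpol 1 v y)) \<le> Cp * W_norm 2 v * \<bar>x - y\<bar>"
    using interpol_error_Lipschitz[OF Cp _ v x, of 1] by simp
  ultimately show ?thesis
    using norm_triangle_ineq[of "(v x - interpol 1 v x) - (v y - interpol 1 v y)" "interpol 1 v x - interpol 1 v y"]
    by (simp add: algebra_simps)
qed

lemma node_slope_Lipschitz:
  assumes "\<And>x y. x \<in> {0..1} \<Longrightarrow> y \<in> {0..1} \<Longrightarrow> norm (v i x - v i y) \<le> L * \<bar>x - y\<bar>" and "m < J"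
  shows "norm (node_slope J v i m) \<le> L"
proof -
  have J: "0 < real J" using assms(2) by simp
  have "norm (node_slope J v i m) = real J * norm (v i (real (Suc m) / real J) - v i (real m / real J))"
    by (simp add: node_slope_def)
  also have "\<dots> \<le> real J * (L * \<bar>real (Suc m) / real J - real m / real J\<bar>)"
    using assms(2) by (intro mult_left_mono assms(1)) auto
  also have "\<bar>real (Suc m) / real J - real m / real J\<bar> = 1 / real J" by (simp add: diff_divide_distrib[symmetric])
  finally show ?thesis using J by simp
qed

text \<open>Both slopes are compared with \<open>dx v\<close>, and the finer mesh has the smaller
  error bound; 4 is 2 from the square of a sum times the two contributions.\<close>

lemma slope_interpol_diff_L2:
  assumes Cp: "interpolation_constant Cp" and J: "1 \<le> J" and K: "J \<le> K" and v: "v \<in> W 2"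
  shows "(\<integral>x. (norm (slope J v x - slope K v x))\<^sup>2 \<partial>unit_interval) \<le> 4 * Cp\<^sup>2 * (1 / real J)\<^sup>2 * (W_norm 2 v)\<^sup>2"
proof -
  have v1: "v \<in> W 1" using v by (rule W2_W1)
  have K1: "1 \<le> K" using J K by simp
  have sq: "(\<integral>x. (norm (dx v x - slope n v x))\<^sup>2 \<partial>unit_interval) \<le> (Cp * (1 / real J) * W_norm 2 v)\<^sup>2"
    and iq: "integrable unit_interval (\<lambda>x. (norm (dx v x - slope n v x))\<^sup>2)" if n: "1 \<le> n" "J \<le> n" for n
  proof -
    have m: "dx v \<in> borel_measurable unit_interval" "slope n v \<in> borel_measurable unit_interval"
      "dx (\<lambda>x. v x - interpol n v x) \<in> borel_measurable unit_interval"
    proof -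
      have "has_weak_deriv 0 1 (\<lambda>x. v x - interpol n v x) (dx (\<lambda>x. v x - interpol n v x))"
        unfolding dx_def by (rule someI[of "has_weak_deriv 0 1 _", OF dx_diff_interpol(1)[OF v1 n(1)]])
      then show "dx (\<lambda>x. v x - interpol n v x) \<in> borel_measurable unit_interval"
        by (intro borel_measurable_integrable weak_deriv_integrable(1))
      show "dx v \<in> borel_measurable unit_interval" "slope n v \<in> borel_measurable unit_interval"
        by (intro borel_measurable_integrable weak_deriv_integrable(1)[OF W1_weak_deriv_dx[OF v1]] integrable_slope n(1))+
    qed
    have "L2_norm 0 1 (dx (\<lambda>x. v x - interpol n v x)) \<le> Cp * (1 / real n) * W_norm 2 v"
      by (rule interpolation_constantD(3)[OF Cp n(1) v])
    also have "\<dots> \<le> Cp * (1 / real J) * W_norm 2 v"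
      using n J interpolation_constantD(1)[OF Cp J] by (intro mult_right_mono mult_left_mono divide_left_mono) auto
    finally have "(L2_norm 0 1 (dx (\<lambda>x. v x - interpol n v x)))\<^sup>2 \<le> (Cp * (1 / real J) * W_norm 2 v)\<^sup>2"
      by (intro power_mono) auto
    moreover have "(\<integral>x. (norm (dx (\<lambda>x. v x - interpol n v x) x))\<^sup>2 \<partial>unit_interval) = (\<integral>x. (norm (dx v x - slope n v x))\<^sup>2 \<partial>unit_interval)"
      using dx_diff_interpol(2)[OF v1 n(1)] m by (intro integral_cong_AE) (auto elim: eventually_mono)
    ultimately show "(\<integral>x. (norm (dx v x - slope n v x))\<^sup>2 \<partial>unit_interval) \<le> (Cp * (1 / real J) * W_norm 2 v)\<^sup>2"
      by (simp add: L2_norm_square)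
    show "integrable unit_interval (\<lambda>x. (norm (dx v x - slope n v x))\<^sup>2)"
    proof (rule Bochner_Integration.integrable_bound)
      show "integrable unit_interval (\<lambda>x. 2 * (norm (dx v x))\<^sup>2 + 2 * (norm (slope n v x))\<^sup>2)"
        by (intro Bochner_Integration.integrable_add integrable_mult_right integrable_norm_square W1_square_integrable_dx[OF v1] square_integrable_slope[OF n(1)])
      show "AE x in unit_interval. norm ((norm (dx v x - slope n v x))\<^sup>2) \<le> norm (2 * (norm (dx v x))\<^sup>2 + 2 * (norm (slope n v x))\<^sup>2)"
        using norm_diff_square_le[of "dx v _" "slope n v _" 0] by (intro AE_I2) simp
    qed (use m in simp)
  qed
  have m: "slope n v \<in> borel_measurable unit_interval" if "1 \<le> n" for n
    by (rule borel_measurable_integrable[OF integrable_slope[OF that]])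
  have "(\<integral>x. (norm (slope J v x - slope K v x))\<^sup>2 \<partial>unit_interval)
     \<le> (\<integral>x. 2 * (norm (dx v x - slope J v x))\<^sup>2 + 2 * (norm (dx v x - slope K v x))\<^sup>2 \<partial>unit_interval)"
  proof (rule integral_mono')
    show "integrable unit_interval (\<lambda>x. 2 * (norm (dx v x - slope J v x))\<^sup>2 + 2 * (norm (dx v x - slope K v x))\<^sup>2)"
      using iq[of J] iq[of K] J K by auto
    show "(norm (slope J v x - slope K v x))\<^sup>2 \<le> 2 * (norm (dx v x - slope J v x))\<^sup>2 + 2 * (norm (dx v x - slope K v x))\<^sup>2" for x
      using norm_diff_square_le[of "slope J v x" "slope K v x" "dx v x"] by (simp add: norm_minus_commute)
  qed simp
  also have "\<dots> = 2 * (\<integral>x. (norm (dx v x - slope J v x))\<^sup>2 \<partial>unit_interval) + 2 * (\<integral>x. (norm (dx v x - slope K v x))\<^sup>2 \<partial>unit_interval)"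
    using iq[of J] iq[of K] J K by simp
  also have "\<dots> \<le> 2 * (Cp * (1 / real J) * W_norm 2 v)\<^sup>2 + 2 * (Cp * (1 / real J) * W_norm 2 v)\<^sup>2"
    using sq[of J] sq[of K] J K by (intro add_mono mult_left_mono) auto
  finally show ?thesis unfolding power_mult_distrib by linarith
qed

section \<open>Bounds on the exact solution at every time, from integrating its velocity\<close>

context exact_solution
begin

definition "vel2 t = (\<Sum>i\<in>UNIV. W_norm 2 (ut i t))"

lemma vel2_nonneg: "0 \<le> vel2 t" by (simp add: vel2_def sum_nonneg)

lemma W_norm_le_vel2: "W_norm 2 (ut i t) \<le> vel2 t"
  unfolding vel2_def by (rule member_le_sum[of i UNIV "\<lambda>i. W_norm 2 (ut i t)"]) auto

lemma vel2_square_le: "(vel2 t)\<^sup>2 \<le> 3 * (\<Sum>i\<in>UNIV. (W_norm 2 (ut i t))\<^sup>2)"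
proof -
  have "(a + b + c)\<^sup>2 \<le> 3 * (a\<^sup>2 + b\<^sup>2 + c\<^sup>2)" for a b c :: real
    using zero_le_power2[of "a - b"] zero_le_power2[of "a - c"] zero_le_power2[of "b - c"]
    by (simp add: power2_eq_square algebra_simps)
  then show ?thesis by (simp add: vel2_def sum_3)
qed

lemma vel2_measurable: "vel2 \<in> borel_measurable (lebesgue_on {0..T})"
  unfolding vel2_def[abs_def] using ut_L2(1) by (intro borel_measurable_sum) (simp add: square_integrable_def)

text \<open>The 9 is 3 from the square of a sum of three terms, times three curves with bound
  \<open>Nb\<^sup>2\<close> each.\<close>

lemma vel2_square_integrable: "integrable (lebesgue_on {0..T}) (\<lambda>t. (vel2 t)\<^sup>2)"
  and vel2_square_integral: "(\<integral>t. (vel2 t)\<^sup>2 \<partial>lebesgue_on {0..T}) \<le> 9 * Nb\<^sup>2"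
proof -
  have i: "integrable (lebesgue_on {0..T}) (\<lambda>t. (W_norm 2 (ut i t))\<^sup>2)" for i
    using ut_L2(1)[of i] by (simp add: square_integrable_def)
  then have s: "integrable (lebesgue_on {0..T}) (\<lambda>t. 3 * (\<Sum>i\<in>UNIV. (W_norm 2 (ut i t))\<^sup>2))" by auto
  show v: "integrable (lebesgue_on {0..T}) (\<lambda>t. (vel2 t)\<^sup>2)"
    by (rule Bochner_Integration.integrable_bound[OF s])
       (use vel2_measurable vel2_square_le in \<open>auto intro!: AE_I2 order_trans[OF _ abs_ge_self]\<close>)
  have "(\<integral>t. (vel2 t)\<^sup>2 \<partial>lebesgue_on {0..T}) \<le> (\<integral>t. 3 * (\<Sum>i\<in>UNIV. (W_norm 2 (ut i t))\<^sup>2) \<partial>lebesgue_on {0..T})"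
    using v s vel2_square_le by (intro integral_mono) auto
  also have "\<dots> = 3 * (\<Sum>i\<in>UNIV. \<integral>t. (W_norm 2 (ut i t))\<^sup>2 \<partial>lebesgue_on {0..T})" using i by simp
  also have "\<dots> \<le> 3 * (\<Sum>i\<in>(UNIV::3 set). Nb\<^sup>2)"
  proof (intro mult_left_mono sum_mono)
    fix i
    have "(L2_norm 0 T (\<lambda>t. W_norm 2 (ut i t)))\<^sup>2 \<le> Nb\<^sup>2" using ut_L2(2)[of i] by (intro power_mono) auto
    then show "(\<integral>t. (W_norm 2 (ut i t))\<^sup>2 \<partial>lebesgue_on {0..T}) \<le> Nb\<^sup>2" by (simp add: L2_norm_square)
  qed simp
  finally show "(\<integral>t. (vel2 t)\<^sup>2 \<partial>lebesgue_on {0..T}) \<le> 9 * Nb\<^sup>2" by simp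
qed

lemma vel2_le: "vel2 t \<le> 1 + (vel2 t)\<^sup>2"
  using zero_le_power2[of "vel2 t - 1"] vel2_nonneg[of t] by (simp add: power2_eq_square algebra_simps)

lemma vel2_integrable: "integrable (lebesgue_on {0..T}) vel2"
  and vel2_integral: "t \<in> {0..T} \<Longrightarrow> (\<integral>r. vel2 r \<partial>lebesgue_on {0..t}) \<le> vel_bound"
proof -
  have s: "integrable (lebesgue_on {0..T}) (\<lambda>t. 1 + (vel2 t)\<^sup>2)" using vel2_square_integrable by auto
  show v: "integrable (lebesgue_on {0..T}) vel2"
    by (rule Bochner_Integration.integrable_bound[OF s])
       (use vel2_measurable vel2_nonneg vel2_le in \<open>auto intro!: AE_I2 order_trans[OF _ abs_ge_self]\<close>)
  assume t: "t \<in> {0..T}"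
  have "(\<integral>r. vel2 r \<partial>lebesgue_on {0..t}) \<le> (\<integral>r. vel2 r \<partial>lebesgue_on {0..T})"
    using v t vel2_nonneg by (intro integral_mono_lebesgue_on_AE) auto
  also have "\<dots> \<le> (\<integral>t. 1 + (vel2 t)\<^sup>2 \<partial>lebesgue_on {0..T})"
    using v s vel2_le by (intro integral_mono) auto
  also have "\<dots> \<le> vel_bound"
    using vel2_square_integrable vel2_square_integral T by (simp add: vel_bound_def measure_restrict_space)
  finally show "(\<integral>r. vel2 r \<partial>lebesgue_on {0..t}) \<le> vel_bound" .
qed

lemma ut_integrable: "x \<in> {0..1} \<Longrightarrow> integrable (lebesgue_on {0..T}) (\<lambda>r. ut i r x)"
  using u_weak[of x i] by (rule weak_deriv_integrable)

lemma u_diff: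
  assumes "x \<in> {0..1}" "0 \<le> s" "s \<le> t" "t \<le> T"
  shows "u i t x - u i s x = (\<integral>r. ut i r x \<partial>lebesgue_on {s..t})"
  using weak_deriv_ftc[OF u_cont[OF assms(1)] u_weak[OF assms(1)] T assms(2-4)] .

text \<open>As a weak time derivative, \<open>ut\<close> inherits the end and junction conditions
  for almost every time, from the vanishing of the corresponding integrals over all time
  intervals.\<close>

lemma ut_end: "AE t in lebesgue_on {0..T}. ut i t 1 = 0" and ut_joint: "AE t in lebesgue_on {0..T}. ut i t 0 = ut k t 0"
proof -
  show "AE t in lebesgue_on {0..T}. ut i t 1 = 0"
  proof (rule AE_eq_0_of_integral_intervals)
    show "(\<integral>r. ut i r 1 \<partial>lebesgue_on {s..t}) = 0" if "0 \<le> s" "s \<le> t" "t \<le> T" for s t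
      using u_diff[of 1 s t i] u_end(1) that by simp
  qed (rule ut_integrable, simp)
  have "AE t in lebesgue_on {0..T}. ut i t 0 - ut k t 0 = 0"
  proof (rule AE_eq_0_of_integral_intervals)
    show "integrable (lebesgue_on {0..T}) (\<lambda>t. ut i t 0 - ut k t 0)"
      by (intro Bochner_Integration.integrable_diff ut_integrable) auto
    show "(\<integral>r. ut i r 0 - ut k r 0 \<partial>lebesgue_on {s..t}) = 0" if st: "0 \<le> s" "s \<le> t" "t \<le> T" for s t
    proof -
      have "integrable (lebesgue_on {s..t}) (\<lambda>r. ut i r 0)" "integrable (lebesgue_on {s..t}) (\<lambda>r. ut k r 0)"
        using st by (auto intro!: integrable_subinterval[OF ut_integrable])
      then show ?thesis
        using u_diff[of 0 s t i] u_diff[of 0 s t k] u_end(2)[of s i k] u_end(2)[of t i k] st by simp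
    qed
  qed
  then show "AE t in lebesgue_on {0..T}. ut i t 0 = ut k t 0" by simp
qed

text \<open>Collects what holds at almost every time into one property, so that later arguments fix
  a single time and work there free of null sets in \<open>t\<close>.\<close>

definition "good t \<longleftrightarrow> (\<forall>i. ut i t \<in> W 2 \<and> W_norm 1 (ut i t) \<le> Nb \<and> ut i t 1 = 0 \<and> (\<forall>k. ut i t 0 = ut k t 0)) \<and>
   (\<forall>\<phi>\<in>triods0. weak_equation \<epsilon> (\<lambda>i. u i t) (\<lambda>i. ut i t) \<phi>)"

lemma AE_good: "AE t in lebesgue_on {0..T}. good t"
proof -
  have "AE t in lebesgue_on {0..T}. \<forall>i\<in>UNIV. ut i t \<in> W 2 \<and> W_norm 1 (ut i t) \<le> Nb \<and> ut i t 1 = 0 \<and> (\<forall>k\<in>UNIV. ut i t 0 = ut k t 0)"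
    by (intro AE_finite_allI AE_conjI ut_W2 ut_W1 ut_end ut_joint) auto
  then show ?thesis using weq by eventually_elim (simp add: good_def)
qed

lemma good_bound: "good t \<Longrightarrow> x \<in> {0..1} \<Longrightarrow> norm (ut i t x) \<le> Nb"
  using W1_sup_bound[OF W2_W1, of "ut i t" x] unfolding good_def by (metis order_trans)

text \<open>The pointwise bound is asked for at good times only; under the time integral this is
  enough.\<close>

lemma time_integral_mono:
  fixes f :: "real \<Rightarrow> 'a::euclidean_space"
  assumes f: "integrable (lebesgue_on {0..T}) f" and le: "\<And>r. good r \<Longrightarrow> norm (f r) \<le> C * vel2 r"
    and st: "0 \<le> s" "s \<le> t" "t \<le> T"
  shows "norm (\<integral>r. f r \<partial>lebesgue_on {s..t}) \<le> C * (\<integral>r. vel2 r \<partial>lebesgue_on {s..t})"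
proof -
  have i: "integrable (lebesgue_on {s..t}) f" "integrable (lebesgue_on {s..t}) vel2"
    using st by (auto intro!: integrable_subinterval[OF f] integrable_subinterval[OF vel2_integrable])
  have ae: "AE r in lebesgue_on {s..t}. good r"
    using AE_good st by (auto simp: AE_restrict_space_iff elim!: eventually_mono)
  have "norm (\<integral>r. f r \<partial>lebesgue_on {s..t}) \<le> (\<integral>r. norm (f r) \<partial>lebesgue_on {s..t})" by (rule integral_norm_bound)
  also have "\<dots> \<le> (\<integral>r. C * vel2 r \<partial>lebesgue_on {s..t})"
    using ae i by (intro integral_mono_AE) (auto elim!: eventually_mono intro: le)
  finally show ?thesis using i by simp
qed

lemma u_Lipschitz_time:
  assumes x: "x \<in> {0..1}" "y \<in> {0..1}" and st: "0 \<le> s" "s \<le> t" "t \<le> T"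
  shows "norm ((u i t x - u i s x) - (u i t y - u i s y)) \<le> ((Cp + 1) * (\<integral>r. vel2 r \<partial>lebesgue_on {s..t})) * \<bar>x - y\<bar>"
proof -
  have i: "integrable (lebesgue_on {s..t}) (\<lambda>r. ut i r z)" if "z \<in> {0..1}" for z
    using st that by (intro integrable_subinterval[OF ut_integrable]) auto
  have "(u i t x - u i s x) - (u i t y - u i s y) = (\<integral>r. ut i r x - ut i r y \<partial>lebesgue_on {s..t})"
    using u_diff[OF x(1) st] u_diff[OF x(2) st] i[OF x(1)] i[OF x(2)] by simp
  also have "norm \<dots> \<le> ((Cp + 1) * \<bar>x - y\<bar>) * (\<integral>r. vel2 r \<partial>lebesgue_on {s..t})"
  proof (rule time_integral_mono[OF _ _ st])
    show "integrable (lebesgue_on {0..T}) (\<lambda>r. ut i r x - ut i r y)" by (intro Bochner_Integration.integrable_diff ut_integrable x)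
    fix r assume "good r"
    then have "norm (ut i r x - ut i r y) \<le> (Cp + 1) * W_norm 2 (ut i r) * \<bar>x - y\<bar>"
      by (intro W2_Lipschitz[OF Cp _ _ x]) (auto simp: good_def)
    also have "\<dots> \<le> (Cp + 1) * vel2 r * \<bar>x - y\<bar>"
      using Cp_pos W_norm_le_vel2[of i r] by (intro mult_right_mono mult_left_mono) auto
    finally show "norm (ut i r x - ut i r y) \<le> (Cp + 1) * \<bar>x - y\<bar> * vel2 r" by (simp add: mult_ac)
  qed
  finally show ?thesis by (simp add: mult_ac)
qed

text \<open>An interpolant is a finite combination of point values, so interpolation commutes with
  the time integral of point values.\<close>

lemma interpol_u_diff:
  assumes K: "1 \<le> K" and t: "t \<in> {0..T}"
  shows "interpol K (u i t) x - interpol K (u0 i) x = (\<integral>r. interpol K (ut i r) x \<partial>lebesgue_on {0..t})"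
    and "integrable (lebesgue_on {0..T}) (\<lambda>r. interpol K (ut i r) x)"
proof -
  have n: "real j / real K \<in> {0..1}" if "j \<le> K" for j using K that by auto
  have i: "integrable (lebesgue_on {0..t}) (\<lambda>r. ut i r (real j / real K))" if "j \<le> K" for j
    using t that by (intro integrable_subinterval[OF ut_integrable[OF n]]) auto
  show "integrable (lebesgue_on {0..T}) (\<lambda>r. interpol K (ut i r) x)"
    unfolding interpol_def using ut_integrable[OF n] by auto
  have "u i t (real j / real K) - u0 i (real j / real K) = (\<integral>r. ut i r (real j / real K) \<partial>lebesgue_on {0..t})" if "j \<le> K" for j
    using u_diff[OF n[OF that], of 0 t i] u_init[OF n[OF that]] t by simp
  then show "interpol K (u i t) x - interpol K (u0 i) x = (\<integral>r. interpol K (ut i r) x \<partial>lebesgue_on {0..t})"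
    unfolding interpol_def using i by (simp add: sum_subtractf[symmetric] scaleR_diff_right[symmetric])
qed

text \<open>The leading 2 is the dimension of the plane, from \<open>weak_deriv_Lipschitz\<close>;
  the square root is that of the sup-norm interpolation estimate.\<close>

definition "interp_err K = 2 * (Cp * sqrt (1 / real K) * reg_bound)"

text \<open>Membership of \<open>u i t\<close> in \<open>W 2\<close> is known only for almost every
  \<open>t\<close>, so the interpolation estimate cannot be applied at a given time directly. Its
  error is instead propagated from \<open>u0\<close> along the velocity as a Lipschitz bound and
  converted back into a bound on derivatives at time \<open>t\<close>.\<close>

lemma dx_u_slope:
  assumes K: "1 \<le> K" and t: "t \<in> {0..T}"
  shows "AE x in unit_interval. norm (dx (u i t) x - slope K (u i t) x) \<le> interp_err K"
proof -
  let ?e = "\<lambda>v x. v x - interpol K v x"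
  have sq: "0 \<le> Cp * sqrt (1 / real K)" using Cp_pos by simp
  have L: "norm (?e (u i t) x - ?e (u i t) y) \<le> (Cp * sqrt (1 / real K) * reg_bound) * \<bar>x - y\<bar>" if x: "x \<in> {0..1}" "y \<in> {0..1}" for x y
  proof -
    have i: "integrable (lebesgue_on {0..T}) (\<lambda>r. ?e (ut i r) z)" if "z \<in> {0..1}" for z
      using ut_integrable[OF that] interpol_u_diff(2)[OF K t] by (rule Bochner_Integration.integrable_diff)
    have it: "integrable (lebesgue_on {0..t}) (\<lambda>r. ut i r z)" "integrable (lebesgue_on {0..t}) (\<lambda>r. interpol K (ut i r) z)" if "z \<in> {0..1}" for z
      using t that by (auto intro!: integrable_subinterval[OF ut_integrable] integrable_subinterval[OF interpol_u_diff(2)[OF K t]])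
    have e: "?e (u i t) z - ?e (u0 i) z = (\<integral>r. ?e (ut i r) z \<partial>lebesgue_on {0..t})" if z: "z \<in> {0..1}" for z
      using u_diff[OF z, of 0 t i] u_init[OF z] interpol_u_diff(1)[OF K t, of i z] it[OF z] t by (simp add: algebra_simps)
    have it2: "integrable (lebesgue_on {0..t}) (\<lambda>r. ?e (ut i r) z)" if "z \<in> {0..1}" for z
      using it[OF that] by simp
    have "(?e (u i t) x - ?e (u0 i) x) - (?e (u i t) y - ?e (u0 i) y) = (\<integral>r. ?e (ut i r) x - ?e (ut i r) y \<partial>lebesgue_on {0..t})"
      unfolding e[OF x(1)] e[OF x(2)] by (rule Bochner_Integration.integral_diff[OF it2[OF x(1)] it2[OF x(2)], symmetric])
    also have "norm \<dots> \<le> (Cp * sqrt (1 / real K) * \<bar>x - y\<bar>) * (\<integral>r. vel2 r \<partial>lebesgue_on {0..t})"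
    proof (rule time_integral_mono)
      show "integrable (lebesgue_on {0..T}) (\<lambda>r. ?e (ut i r) x - ?e (ut i r) y)"
        by (rule Bochner_Integration.integrable_diff[OF i[OF x(1)] i[OF x(2)]])
      fix r assume "good r"
      then have "norm (?e (ut i r) x - ?e (ut i r) y) \<le> Cp * sqrt (1 / real K) * W_norm 2 (ut i r) * \<bar>x - y\<bar>"
        by (intro interpol_error_Lipschitz[OF Cp K _ x]) (auto simp: good_def)
      also have "\<dots> \<le> Cp * sqrt (1 / real K) * vel2 r * \<bar>x - y\<bar>"
        using sq W_norm_le_vel2[of i r] by (intro mult_right_mono mult_left_mono) auto
      finally show "norm (?e (ut i r) x - ?e (ut i r) y) \<le> Cp * sqrt (1 / real K) * \<bar>x - y\<bar> * vel2 r" by (simp add: mult_ac)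
    qed (use t in auto)
    also have "\<dots> \<le> (Cp * sqrt (1 / real K) * \<bar>x - y\<bar>) * vel_bound"
      using sq t by (intro mult_left_mono vel2_integral) auto
    finally have 1: "norm ((?e (u i t) x - ?e (u0 i) x) - (?e (u i t) y - ?e (u0 i) y)) \<le> Cp * sqrt (1 / real K) * \<bar>x - y\<bar> * vel_bound" .
    have "norm (?e (u0 i) x - ?e (u0 i) y) \<le> Cp * sqrt (1 / real K) * W_norm 2 (u0 i) * \<bar>x - y\<bar>"
      by (rule interpol_error_Lipschitz[OF Cp K u0(1) x])
    also have "\<dots> \<le> Cp * sqrt (1 / real K) * Nb * \<bar>x - y\<bar>"
      using sq u0(4)[of i] by (intro mult_right_mono mult_left_mono) auto
    finally have 2: "norm (?e (u0 i) x - ?e (u0 i) y) \<le> Cp * sqrt (1 / real K) * Nb * \<bar>x - y\<bar>" .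
    have eq: "?e (u i t) x - ?e (u i t) y = ((?e (u i t) x - ?e (u0 i) x) - (?e (u i t) y - ?e (u0 i) y)) + (?e (u0 i) x - ?e (u0 i) y)"
      by (simp add: algebra_simps)
    have "norm (?e (u i t) x - ?e (u i t) y) \<le> Cp * sqrt (1 / real K) * \<bar>x - y\<bar> * vel_bound + Cp * sqrt (1 / real K) * Nb * \<bar>x - y\<bar>"
      unfolding eq by (rule norm_triangle_mono[OF 1 2])
    then show ?thesis by (simp add: reg_bound_def algebra_simps)
  qed
  have c: "continuous_on {0..1} (?e (u i t))"
    using uW[OF t, of i] interpol_fem[OF K, of "u i t"] by (intro continuous_intros W1_continuous fem_continuous)
  have "AE x in unit_interval. norm (dx (u i t) x - slope K (u i t) x) \<le> real DIM(real^2) * (Cp * sqrt (1 / real K) * reg_bound)"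
    by (rule weak_deriv_Lipschitz[OF c dx_diff_interpol(1)[OF uW[OF t] K] _ L]) auto
  then show ?thesis by (simp add: interp_err_def)
qed

text \<open>A modulus of continuity in time for the weak derivative, uniform in \<open>x\<close>
  outside a null set that may depend on \<open>s\<close> and \<open>t\<close>.\<close>

lemma dx_u_time:
  assumes st: "0 \<le> s" "s \<le> t" "t \<le> T"
  shows "AE x in unit_interval. norm (dx (u i t) x - dx (u i s) x) \<le> 2 * ((Cp + 1) * (\<integral>r. vel2 r \<partial>lebesgue_on {s..t}))"
proof -
  have W: "u i t \<in> W 1" "u i s \<in> W 1" using uW st by auto
  have d: "has_weak_deriv 0 1 (\<lambda>x. u i t x - u i s x) (\<lambda>x. dx (u i t) x - dx (u i s) x)"
    using W by (intro has_weak_deriv_diff W1_weak_deriv_dx W1_continuous W1_square_integrable_dx)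
  have "AE x in unit_interval. norm (dx (u i t) x - dx (u i s) x) \<le> real DIM(real^2) * ((Cp + 1) * (\<integral>r. vel2 r \<partial>lebesgue_on {s..t}))"
    by (rule weak_deriv_Lipschitz[OF _ d _ u_Lipschitz_time[OF _ _ st]]) (intro continuous_on_diff W1_continuous W | assumption | simp)+
  then show ?thesis by simp
qed

text \<open>An almost-everywhere bound transfers to the value on each cell. The deviation
  \<open>c0 / 4\<close> leaves another \<open>c0 / 4\<close> for the discrete slopes before they can
  drop below \<open>c0 / 2\<close>.\<close>

lemma node_slope_u:
  assumes K: "1 \<le> K" and small: "interp_err K \<le> c0 / 4" and t: "t \<in> {0..T}" and m: "m < K"
  shows "3 * c0 / 4 \<le> norm (node_slope K (\<lambda>i. u i t) i m)" "norm (node_slope K (\<lambda>i. u i t) i m) \<le> 1 / c0 + c0 / 4"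
proof -
  have "AE x in unit_interval. 3 * c0 / 4 \<le> norm (cell_field K (node_slope K (\<lambda>i. u i t)) i x) \<and> norm (cell_field K (node_slope K (\<lambda>i. u i t)) i x) \<le> 1 / c0 + c0 / 4"
    using dx_u_slope[OF K t, of i] u_bounds[OF t, of i] slope_eq_cell_field[OF K, of "\<lambda>i. u i t" i]
  proof eventually_elim
    case (elim x)
    have "\<bar>norm (dx (u i t) x) - norm (slope K (u i t) x)\<bar> \<le> c0 / 4"
      using norm_triangle_ineq3[of "dx (u i t) x" "slope K (u i t) x"] elim(1) small by linarith
    then have "norm (dx (u i t) x) - norm (slope K (u i t) x) \<le> c0 / 4" "norm (slope K (u i t) x) - norm (dx (u i t) x) \<le> c0 / 4"
      unfolding abs_le_iff by linarith+
    then show ?case unfolding elim(3)[symmetric] using elim(2) by linarith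
  qed
  from cell_field_AE_D[OF K m this]
  show "3 * c0 / 4 \<le> norm (node_slope K (\<lambda>i. u i t) i m)" "norm (node_slope K (\<lambda>i. u i t) i m) \<le> 1 / c0 + c0 / 4" by auto
qed

lemma node_slope_continuous:
  assumes "m < K"
  shows "continuous_on {0..T} (\<lambda>t. node_slope K (\<lambda>i. u i t) i m)"
  unfolding node_slope_def using assms by (intro continuous_intros u_cont) auto

end

section \<open>The error estimate\<close>

text \<open>The mesh with \<open>J * n\<close> cells subdivides the one with \<open>J\<close> cells:
  fine cell \<open>l\<close> lies in coarse cell \<open>l div n\<close>.\<close>

lemma two_scale_floor:
  assumes J: "1 \<le> J" and n: "1 \<le> n"
  shows "\<lfloor>real J * x\<rfloor> = \<lfloor>real (J * n) * x\<rfloor> div int n"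
proof -
  have "real J * x = (real (J * n) * x) / real_of_int (int n)" using n by simp
  then show ?thesis by (metis floor_divide_real_eq_div of_nat_0_le_iff)
qed

text \<open>The four slots, for two fields on the fine mesh and two on the coarse one, let a single
  lemma serve the energy, its rate and the slope gap.\<close>

lemma has_bochner_integral_two_scale:
  fixes G :: "real^2 \<Rightarrow> real^2 \<Rightarrow> real^2 \<Rightarrow> real^2 \<Rightarrow> 'b::euclidean_space"
  assumes J: "1 \<le> J" and n: "1 \<le> n"
  shows "has_bochner_integral unit_interval (\<lambda>x. G (slope (J * n) (v i) x) (slope J (w i) x) (slope (J * n) (v' i) x) (slope J (w' i) x))
    ((\<Sum>l<J * n. G (node_slope (J * n) v i l) (node_slope J w i (l div n)) (node_slope (J * n) v' i l) (node_slope J w' i (l div n))) /\<^sub>R real (J * n))"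
proof -
  define S where "S k f m = real k *\<^sub>R (f ((real_of_int m + 1) / real k) - f (real_of_int m / real k))" for k :: nat and f :: "real \<Rightarrow> real^2" and m
  have s: "slope k f x = S k f \<lfloor>real k * x\<rfloor>" for k f x by (simp add: slope_step S_def)
  have ns: "S k (f i) (int l) = node_slope k f i l" for k f l by (simp add: S_def node_slope_def add.commute)
  have "1 \<le> J * n" using J n by simp
  from has_bochner_integral_step[OF this, of "\<lambda>m. G (S (J * n) (v i) m) (S J (w i) (m div int n)) (S (J * n) (v' i) m) (S J (w' i) (m div int n))"]
  show ?thesis unfolding s two_scale_floor[OF J n] ns[symmetric] by (simp add: zdiv_int)
qed

lemma cell_two_scale_D:
  assumes J: "1 \<le> J" and n: "1 \<le> n" and AE: "AE x in unit_interval. R (slope (J * n) (v i) x) (slope J (w i) x)" and l: "l < J * n"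
  shows "R (node_slope (J * n) v i l) (node_slope J w i (l div n))"
proof -
  let ?p = "\<lambda>i l. (node_slope (J * n) v i l, node_slope J w i (l div n))"
  have Jn: "1 \<le> J * n" using J n by simp
  have "AE x in unit_interval. case_prod R (cell_field (J * n) ?p i x)"
    using AE AE_cell[OF Jn] slope_eq_cell_field[OF J, of w i] slope_eq_cell_field[OF Jn, of v i]
  proof eventually_elim
    case (elim x)
    then obtain k where "k < J * n" "\<lfloor>real (J * n) * x\<rfloor> = int k" by blast
    then have "nat \<lfloor>real J * x\<rfloor> = nat \<lfloor>real (J * n) * x\<rfloor> div n"
      unfolding two_scale_floor[OF J n] by (simp add: nat_div_distrib)
    then show ?case using elim by (simp add: cell_field_def)
  qed
  from cell_field_AE_D[OF Jn l this] show ?thesis by simp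
qed

text \<open>At the first time at which some member of the family reaches \<open>3 / 4 * r\<close>,
  all members have stayed below \<open>r\<close> so far. The improved bound \<open>r / 2\<close>
  then holds at that time, a contradiction.\<close>

lemma continuity_bootstrap:
  fixes f :: "'i \<Rightarrow> real \<Rightarrow> real"
  assumes A: "finite A" and f: "\<And>a. a \<in> A \<Longrightarrow> continuous_on {0..T} (f a)" and r: "0 < r"
    and f0: "\<And>a. a \<in> A \<Longrightarrow> f a 0 \<le> r / 2"
    and step: "\<And>t. t \<in> {0..T} \<Longrightarrow> (\<And>s a. s \<in> {0..t} \<Longrightarrow> a \<in> A \<Longrightarrow> f a s \<le> r) \<Longrightarrow> (\<And>a. a \<in> A \<Longrightarrow> f a t \<le> r / 2)"
    and t: "t \<in> {0..T}" and a: "a \<in> A"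
  shows "f a t \<le> r"
proof (rule ccontr)
  assume "\<not> f a t \<le> r"
  \<comment> \<open>Any level strictly between \<open>r / 2\<close> and \<open>r\<close> would do.
    The set is compact because \<open>A\<close> is finite, so a first such time exists.\<close>
  define H where "H = (\<Union>b\<in>A. {s \<in> {0..T}. 3 / 4 * r \<le> f b s})"
  have "compact H" unfolding H_def
  proof (intro compact_UN A)
    fix b assume "b \<in> A"
    then have "closed {s \<in> {0..T}. 3 / 4 * r \<le> f b s}"
      using continuous_closed_preimage[OF f[of b] closed_atLeastAtMost, of "{3 / 4 * r..}"] by (simp add: Int_def vimage_def)
    moreover have "bounded {s \<in> {0..T}. 3 / 4 * r \<le> f b s}" by (rule bounded_subset[of "{0..T}"]) auto
    ultimately show "compact {s \<in> {0..T}. 3 / 4 * r \<le> f b s}" by (simp add: compact_eq_bounded_closed)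
  qed
  moreover have "t \<in> H" using \<open>\<not> f a t \<le> r\<close> t a r by (auto simp: H_def intro!: bexI[of _ a])
  ultimately obtain s where s: "s \<in> H" "\<And>r. r \<in> H \<Longrightarrow> s \<le> r" using compact_attains_inf[of H] by blast
  have sT: "s \<in> {0..T}" using s(1) by (auto simp: H_def)
  have le: "f b q \<le> 3 / 4 * r" if q: "q \<in> {0..s}" and b: "b \<in> A" for b q
  proof (rule ccontr)
    assume gt: "\<not> f b q \<le> 3 / 4 * r"
    then have qH: "q \<in> H" using q b sT by (auto simp: H_def intro!: bexI[of _ b])
    then have q: "q = s" using s(2)[of q] q by auto
    have "\<exists>x\<ge>0. x \<le> s \<and> f b x = 3 / 4 * r"
      using f0[OF b] gt r sT q continuous_on_subset[OF f[OF b], of "{0..s}"] by (intro IVT') auto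
    then obtain x where x: "0 \<le> x" "x \<le> s" "f b x = 3 / 4 * r" by blast
    then have "x \<in> H" using b sT by (auto simp: H_def intro!: bexI[of _ b])
    then have "x = s" using s(2)[of x] x by simp
    then show False using x gt q by simp
  qed
  have "f b s \<le> r / 2" if "b \<in> A" for b
  proof (rule step[OF sT _ that])
    show "f c q \<le> r" if "q \<in> {0..s}" "c \<in> A" for q c using le[OF that] r by simp
  qed
  then show False using s(1) r by (fastforce simp: H_def)
qed

text \<open>The flow with retracted slopes on one mesh. That the retraction is inactive is not
  assumed; \<open>tube_always\<close> proves it for small mesh size.\<close>

locale scheme_flow = exact_solution +
  fixes J :: nat and Y V :: "real \<Rightarrow> state"
  assumes J: "1 \<le> J" and small: "interp_err J \<le> c0 / 4"
    and Y0: "Y 0 = state_of J (\<lambda>i n. u0 i (real n / real J))"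
    and Y: "t \<in> {0..T} \<Longrightarrow> (Y has_vector_derivative V t) (at t within {0..T})"
    and V_cont: "continuous_on {0..T} V" and V: "t \<in> {0..T} \<Longrightarrow> V t \<in> state_space J"
    and flow: "t \<in> {0..T} \<Longrightarrow> solves_velocity J \<epsilon> (retracted_slope J (c0 / 4) (node_slope J (\<lambda>i. u i t)) (Y t)) (state_triple J (V t))"
begin

text \<open>The auxiliary mesh has \<open>J ^ 4\<close> cells, written as a product with
  \<open>J\<close> so that each coarse cell visibly consists of \<open>J ^ 3\<close> fine
  ones.\<close>

abbreviation "refined \<equiv> J * J ^ 3"
abbreviation "uh i t \<equiv> state_triple J (Y t) i"
abbreviation "vh i t \<equiv> state_triple J (V t) i"

definition "tube t \<longleftrightarrow> (\<forall>i. \<forall>m<J. norm (state_slope J (Y t) i m - node_slope J (\<lambda>i. u i t) i m) \<le> c0 / 4)"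

definition "velocity_gap t = (\<lambda>i x. vh i t x - interpol J (ut i t) x)"

definition "gradient_gap t = (\<Sum>i\<in>UNIV. \<integral>x. (norm (slope J (uh i t) x - slope refined (u i t) x))\<^sup>2 \<partial>unit_interval)"

definition "energy t = (\<Sum>i\<in>UNIV. \<integral>x. rel_energy \<epsilon> (slope refined (u i t) x) (slope J (uh i t) x) \<partial>unit_interval)"

definition "energy_rate t = (\<Sum>i\<in>UNIV. \<integral>x. rel_rate \<epsilon> (slope refined (u i t) x) (slope J (uh i t) x) (slope refined (ut i t) x) (slope J (vh i t) x) \<partial>unit_interval)"

lemma J3: "1 \<le> J ^ 3" using J by simp

lemma refined: "1 \<le> refined" "J \<le> refined" using J by simp_all

lemma fine_real: "real refined = real J ^ 4" by (simp add: power_numeral_reduce)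

lemma coarse_index: "l < refined \<Longrightarrow> l div J ^ 3 < J" using J by (simp add: less_mult_imp_div_less)

lemma interp_err_nonneg: "0 \<le> interp_err K" using const_pos(2) Cp_pos by (simp add: interp_err_def)

lemma interp_err_square: "(interp_err K)\<^sup>2 = consist / real K"
  using const_pos(2) by (simp add: interp_err_def consist_def power_mult_distrib)

lemma interp_err_fine: "interp_err refined \<le> interp_err J"
proof -
  have "1 / real refined \<le> 1 / real J" using J refined by (intro divide_left_mono) auto
  then show ?thesis unfolding interp_err_def using Cp_pos const_pos(2) by (intro mult_left_mono mult_right_mono real_sqrt_le_mono) auto
qed

lemma consist_fine: "consist / real refined \<le> consist * (1 / real J)\<^sup>2"
proof -
  have "(real J)\<^sup>2 \<le> real J ^ 4" using J by (intro power_increasing) auto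
  then have "consist / real J ^ 4 \<le> consist / (real J)\<^sup>2" using J const_pos(8) by (intro divide_left_mono) auto
  then show ?thesis unfolding fine_real by (simp add: power_inverse divide_inverse)
qed

lemma fine_bounds:
  assumes "t \<in> {0..T}" "l < refined"
  shows "3 * c0 / 4 \<le> norm (node_slope refined (\<lambda>i. u i t) i l)" "norm (node_slope refined (\<lambda>i. u i t) i l) \<le> 1 / c0 + c0 / 4"
  using node_slope_u[OF refined(1) _ assms(1,2), of i] small interp_err_fine by linarith+

lemma c0_bound: "1 / c0 + c0 / 2 \<le> 2 / c0"
proof -
  have "c0 / 2 \<le> 1 / c0" using c0 mult_mono[of c0 1 c0 1] by (simp add: field_simps)
  then show ?thesis by (simp add: field_simps)
qed

lemma tube_bounds:
  assumes t: "t \<in> {0..T}" and tube: "tube t" and m: "m < J"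
  shows "c0 / 2 \<le> norm (state_slope J (Y t) i m)" "norm (state_slope J (Y t) i m) \<le> 2 / c0"
proof -
  let ?q = "state_slope J (Y t) i m" and ?p = "node_slope J (\<lambda>i. u i t) i m"
  have "norm (?q - ?p) \<le> c0 / 4" using tube m by (simp add: tube_def)
  then have "norm ?q \<le> norm ?p + c0 / 4" "norm ?p - c0 / 4 \<le> norm ?q"
    using norm_triangle_ineq2[of ?q ?p] norm_triangle_ineq2[of ?p ?q] by (auto simp: norm_minus_commute)
  then show "c0 / 2 \<le> norm ?q" "norm ?q \<le> 2 / c0"
    using node_slope_u[OF J small t m, of i] c0_bound by linarith+
qed

lemma uh_fem: "uh i t \<in> fem J" and vh_fem: "vh i t \<in> fem J"
  by (rule state_triple_fem[OF J])+

lemma tube_slope_bounds: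
  assumes t: "t \<in> {0..T}" and tube: "tube t"
  shows "AE x in unit_interval. c0 / 2 \<le> norm (slope J (uh i t) x) \<and> norm (slope J (uh i t) x) \<le> 2 / c0"
proof -
  have "AE x in unit_interval. c0 / 2 \<le> norm (cell_field J (state_slope J (Y t)) i x) \<and> norm (cell_field J (state_slope J (Y t)) i x) \<le> 2 / c0"
    using tube_bounds[OF t tube] by (intro cell_field_AE[OF J]) auto
  then show ?thesis using slope_state_triple[OF J, of "Y t" i] by eventually_elim simp
qed

lemma tube_flow:
  assumes t: "t \<in> {0..T}" and tube: "tube t"
  shows "solves_velocity J \<epsilon> (state_slope J (Y t)) (state_triple J (V t))"
proof (rule solves_velocity_cong[OF J _ flow[OF t]])
  fix i m assume m: "m < J"
  then have "norm (state_slope J (Y t) i m - node_slope J (\<lambda>i. u i t) i m) \<le> c0 / 4" using tube by (simp add: tube_def)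
  then show "retracted_slope J (c0 / 4) (node_slope J (\<lambda>i. u i t)) (Y t) i m = state_slope J (Y t) i m"
    by (simp add: retracted_slope_def closest_point_self)
qed

lemma tube_weak_equation:
  assumes t: "t \<in> {0..T}" and tube: "tube t" and \<phi>: "\<phi> \<in> triods0_h J"
  shows "weak_equation \<epsilon> (\<lambda>i. uh i t) (\<lambda>i. vh i t) \<phi>"
  using solves_velocity_weak_equation[OF J eps tube_flow[OF t tube] \<phi>] by simp

text \<open>On the refined mesh all integrands are constant on cells, so the integrals become finite
  sums whose time derivative can be taken cell by cell.\<close>

lemma energy_sum: "energy t = (\<Sum>i\<in>UNIV. (\<Sum>l<refined. rel_energy \<epsilon> (node_slope refined (\<lambda>i. u i t) i l) (state_slope J (Y t) i (l div J ^ 3))) / real refined)"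
  and gradient_gap_sum: "gradient_gap t = (\<Sum>i\<in>UNIV. (\<Sum>l<refined. (norm (state_slope J (Y t) i (l div J ^ 3) - node_slope refined (\<lambda>i. u i t) i l))\<^sup>2) / real refined)"
  and energy_rate_sum: "energy_rate t = (\<Sum>i\<in>UNIV. (\<Sum>l<refined. rel_rate \<epsilon> (node_slope refined (\<lambda>i. u i t) i l) (state_slope J (Y t) i (l div J ^ 3))
      (node_slope refined (\<lambda>i. ut i t) i l) (state_slope J (V t) i (l div J ^ 3))) / real refined)"
proof -
  note step = has_bochner_integral_two_scale[OF J J3, THEN has_bochner_integral_integral_eq, of _ "\<lambda>i. u i t" _ "state_triple J (Y t)" "\<lambda>i. ut i t" "state_triple J (V t)"]
  have ns: "node_slope J (state_triple J Z) i (l div J ^ 3) = state_slope J Z i (l div J ^ 3)" if "l < refined" for Z i l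
    using coarse_index[OF that] by (rule node_slope_state_triple)
  show "energy t = (\<Sum>i\<in>UNIV. (\<Sum>l<refined. rel_energy \<epsilon> (node_slope refined (\<lambda>i. u i t) i l) (state_slope J (Y t) i (l div J ^ 3))) / real refined)"
    unfolding energy_def step[of "\<lambda>a b c d. rel_energy \<epsilon> a b"] by (intro sum.cong refl) (simp add: ns divide_inverse mult.commute)
  show "gradient_gap t = (\<Sum>i\<in>UNIV. (\<Sum>l<refined. (norm (state_slope J (Y t) i (l div J ^ 3) - node_slope refined (\<lambda>i. u i t) i l))\<^sup>2) / real refined)"
    unfolding gradient_gap_def step[of "\<lambda>a b c d. (norm (b - a))\<^sup>2"] by (intro sum.cong refl) (simp add: ns divide_inverse mult.commute)
  show "energy_rate t = (\<Sum>i\<in>UNIV. (\<Sum>l<refined. rel_rate \<epsilon> (node_slope refined (\<lambda>i. u i t) i l) (state_slope J (Y t) i (l div J ^ 3))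
      (node_slope refined (\<lambda>i. ut i t) i l) (state_slope J (V t) i (l div J ^ 3))) / real refined)"
    unfolding energy_rate_def step[of "rel_rate \<epsilon>"] by (intro sum.cong refl) (simp add: ns divide_inverse mult.commute)
qed

lemma gradient_gap_nonneg: "0 \<le> gradient_gap t"
  unfolding gradient_gap_def by (intro sum_nonneg Bochner_Integration.integral_nonneg) simp

lemma energy_ge: "\<epsilon> / 2 * gradient_gap t \<le> energy t"
  unfolding energy_sum gradient_gap_sum sum_distrib_left times_divide_eq_right
  using rel_energy_ge by (intro sum_mono divide_right_mono) auto

lemma energy_le:
  assumes t: "t \<in> {0..T}" and tube: "tube t"
  shows "energy t \<le> (\<epsilon> / 2 + 2 / (c0 / 2)) * gradient_gap t"
  unfolding energy_sum gradient_gap_sum sum_distrib_left times_divide_eq_right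
proof (intro sum_mono divide_right_mono)
  fix i l assume l: "l \<in> {..<refined}"
  let ?p = "node_slope refined (\<lambda>i. u i t) i l" and ?q = "state_slope J (Y t) i (l div J ^ 3)"
  have p: "?p \<noteq> 0" and q: "c0 / 2 \<le> norm ?q" "?q \<noteq> 0"
    using fine_bounds(1)[OF t, of l i] tube_bounds(1)[OF t tube coarse_index, of l i] l c0 by auto
  have "rel_energy \<epsilon> ?p ?q \<le> (\<epsilon> / 2 + 2 / norm ?q) * (norm (?q - ?p))\<^sup>2" by (rule rel_energy_le[OF p q(2)])
  also have "\<dots> \<le> (\<epsilon> / 2 + 2 / (c0 / 2)) * (norm (?q - ?p))\<^sup>2"
    using q c0 by (intro mult_right_mono add_left_mono divide_left_mono) auto
  finally show "rel_energy \<epsilon> ?p ?q \<le> (\<epsilon> / 2 + 2 / (c0 / 2)) * (norm (?q - ?p))\<^sup>2" .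
qed simp

lemma Y_continuous: "continuous_on {0..T} Y"
  using Y by (meson continuous_on_eq_continuous_within has_vector_derivative_continuous)

lemma bounded_linear_state_slope: "bounded_linear (\<lambda>Z. state_slope J Z i m)"
  unfolding state_slope_def by (intro bounded_linear_const_scaleR bounded_linear_sub bounded_linear_coord)

lemma state_slope_continuous: "continuous_on {0..T} (\<lambda>t. state_slope J (Y t) i m)"
  by (rule bounded_linear.continuous_on[OF bounded_linear_state_slope Y_continuous])

lemma state_slope_velocity_continuous: "continuous_on {0..T} (\<lambda>t. state_slope J (V t) i m)"
  by (rule bounded_linear.continuous_on[OF bounded_linear_state_slope V_cont])

lemma state_slope_ftc:
  assumes "0 \<le> s" "s \<le> t" "t \<le> T"
  shows "state_slope J (Y t) i m - state_slope J (Y s) i m = (\<integral>r. state_slope J (V r) i m \<partial>lebesgue_on {s..t})"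
proof -
  have sub: "{s..t} \<subseteq> {0..T}" using assms by auto
  have "((\<lambda>r. state_slope J (Y r) i m) has_vector_derivative state_slope J (V r) i m) (at r within {s..t})" if "r \<in> {s..t}" for r
    using bounded_linear.has_vector_derivative[OF bounded_linear_state_slope Y[of r]] sub that
    by (intro has_vector_derivative_within_subset[OF _ sub]) auto
  then have "((\<lambda>r. state_slope J (V r) i m) has_integral state_slope J (Y t) i m - state_slope J (Y s) i m) {s..t}"
    by (intro fundamental_theorem_of_calculus assms(2))
  moreover have "integrable (lebesgue_on {s..t}) (\<lambda>r. state_slope J (V r) i m)"
    using continuous_imp_integrable_real[OF continuous_on_subset[OF state_slope_velocity_continuous sub]] .
  ultimately show ?thesis by (simp add: lebesgue_integral_eq_integral integral_unique)
qed

lemma fine_slope_ftc: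
  assumes "0 \<le> s" "s \<le> t" "t \<le> T" and l: "l < refined"
  shows "node_slope refined (\<lambda>i. u i t) i l - node_slope refined (\<lambda>i. u i s) i l = (\<integral>r. node_slope refined (\<lambda>i. ut i r) i l \<partial>lebesgue_on {s..t})"
    and "integrable (lebesgue_on {0..T}) (\<lambda>r. node_slope refined (\<lambda>i. ut i r) i l)"
proof -
  have n: "real (Suc l) / real refined \<in> {0..1}" "real l / real refined \<in> {0..1}"
  proof -
    have "real (Suc l) \<le> real refined" "real l \<le> real refined" "0 < real refined"
      using l unfolding of_nat_le_iff of_nat_0_less_iff by linarith+
    then show "real (Suc l) / real refined \<in> {0..1}" "real l / real refined \<in> {0..1}"
      by (auto simp del: of_nat_mult of_nat_power of_nat_Suc)
  qed
  show "integrable (lebesgue_on {0..T}) (\<lambda>r. node_slope refined (\<lambda>i. ut i r) i l)"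
    unfolding node_slope_def by (intro integrable_scaleR_right Bochner_Integration.integrable_diff ut_integrable n)
  have i: "integrable (lebesgue_on {s..t}) (\<lambda>r. ut i r x)" if "x \<in> {0..1}" for x
    using assms by (intro integrable_subinterval[OF ut_integrable[OF that]]) auto
  show "node_slope refined (\<lambda>i. u i t) i l - node_slope refined (\<lambda>i. u i s) i l = (\<integral>r. node_slope refined (\<lambda>i. ut i r) i l \<partial>lebesgue_on {s..t})"
    unfolding node_slope_def scaleR_diff_right[symmetric] using u_diff[OF n(1) assms(1-3), of i] u_diff[OF n(2) assms(1-3), of i] i[OF n(1)] i[OF n(2)]
    by (simp add: algebra_simps)
qed

text \<open>On one fine cell the pair of exact and discrete slope is an absolutely continuous curve.
  The exact slope is bounded below by \<open>fine_bounds\<close>, the discrete one by the tube, so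
  the pair stays where both vectors are nonzero and the energy is differentiable.\<close>

lemma cell_energy_chain:
  fixes i :: 3
  assumes t: "t \<in> {0..T}" and tube: "\<And>s. s \<in> {0..t} \<Longrightarrow> tube s" and l: "l < refined"
  defines "F \<equiv> \<lambda>r. rel_rate \<epsilon> (node_slope refined (\<lambda>i. u i r) i l) (state_slope J (Y r) i (l div J ^ 3))
      (node_slope refined (\<lambda>i. ut i r) i l) (state_slope J (V r) i (l div J ^ 3))"
  shows "integrable (lebesgue_on {0..t}) F"
    and "rel_energy \<epsilon> (node_slope refined (\<lambda>i. u i t) i l) (state_slope J (Y t) i (l div J ^ 3))
       - rel_energy \<epsilon> (node_slope refined (\<lambda>i. u i 0) i l) (state_slope J (Y 0) i (l div J ^ 3)) = (\<integral>r. F r \<partial>lebesgue_on {0..t})"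
proof -
  define z where "z r = (node_slope refined (\<lambda>i. u i r) i l, state_slope J (Y r) i (l div J ^ 3))" for r
  define z' where "z' r = (node_slope refined (\<lambda>i. ut i r) i l, state_slope J (V r) i (l div J ^ 3))" for r
  define S :: "((real^2) \<times> (real^2)) set" where "S = (- {0}) \<times> (- {0})"
  define g where "g = (\<lambda>z :: (real^2) \<times> (real^2). (- (\<epsilon> *\<^sub>R (snd z - fst z)) - (snd z - (snd z \<bullet> sgn (fst z)) *\<^sub>R sgn (fst z)) /\<^sub>R norm (fst z),
          \<epsilon> *\<^sub>R (snd z - fst z) + sgn (snd z) - sgn (fst z)))"
  have F: "F r = g (z r) \<bullet> z' r" for r by (simp add: F_def g_def z_def z'_def rel_rate_def)
  have sub: "{0..t} \<subseteq> {0..T}" using t by auto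
  have i1: "integrable (lebesgue_on {0..t}) (\<lambda>r. node_slope refined (\<lambda>i. ut i r) i l)"
    using t by (intro integrable_subinterval[OF fine_slope_ftc(2)[OF _ _ _ l, of 0 0]]) auto
  have i2: "integrable (lebesgue_on {0..t}) (\<lambda>r. state_slope J (V r) i (l div J ^ 3))"
    using continuous_imp_integrable_real[OF continuous_on_subset[OF state_slope_velocity_continuous sub]] .
  have pair: "has_bochner_integral M (\<lambda>r. (f r, h r)) (integral\<^sup>L M f, integral\<^sup>L M h)"
    if f: "integrable M f" and h: "integrable M h" for M and f h :: "real \<Rightarrow> real^2"
  proof -
    have "has_bochner_integral M (\<lambda>r. (f r, 0) + (0, h r)) ((integral\<^sup>L M f, 0) + (0, integral\<^sup>L M h))"
      using f h by (intro has_bochner_integral_add has_bochner_integral_bounded_linear[OF bounded_linear_Pair[OF bounded_linear_ident bounded_linear_zero]]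
        has_bochner_integral_bounded_linear[OF bounded_linear_Pair[OF bounded_linear_zero bounded_linear_ident]] has_bochner_integral_integrable)
    then show ?thesis by simp
  qed
  have z': "integrable (lebesgue_on {0..t}) z'"
    unfolding z'_def[abs_def] using pair[OF i1 i2] by (rule integrable.intros)
  have zz: "z b - z a = (\<integral>r. z' r \<partial>lebesgue_on {a..b})" if ab: "0 \<le> a" "a \<le> b" "b \<le> t" for a b
  proof -
    have bT: "b \<le> T" using ab t by auto
    have "integrable (lebesgue_on {a..b}) (\<lambda>r. node_slope refined (\<lambda>i. ut i r) i l)" "integrable (lebesgue_on {a..b}) (\<lambda>r. state_slope J (V r) i (l div J ^ 3))"
      using ab by (auto intro!: integrable_subinterval[OF i1] integrable_subinterval[OF i2])
    from has_bochner_integral_integral_eq[OF pair[OF this]] show ?thesis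
      unfolding z_def z'_def using fine_slope_ftc(1)[OF ab(1,2) bT l, of i] state_slope_ftc[OF ab(1,2) bT, of i "l div J ^ 3"] by simp
  qed
  have S: "open S" unfolding S_def by (intro open_Times) auto
  have zS: "z r \<in> S" if "r \<in> {0..t}" for r
    using fine_bounds(1)[of r l i] tube_bounds(1)[OF _ tube[OF that] coarse_index[OF l], of i] that sub l c0 by (auto simp: S_def z_def)
  have der: "((\<lambda>z. rel_energy \<epsilon> (fst z) (snd z)) has_derivative (\<lambda>v. g x \<bullet> v)) (at x)" if "x \<in> S" for x
    unfolding g_def using that by (intro rel_energy_has_derivative) (auto simp: S_def)
  have g: "continuous_on S g"
    unfolding g_def by (intro continuous_intros) (auto simp: S_def)
  have t0: "0 \<le> t" using t by simp
  note ch = chain_rule_indefinite_integral[OF z' zz S zS der g t0]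
  show "integrable (lebesgue_on {0..t}) F" using ch(1) by (simp add: F[abs_def])
  show "rel_energy \<epsilon> (node_slope refined (\<lambda>i. u i t) i l) (state_slope J (Y t) i (l div J ^ 3))
       - rel_energy \<epsilon> (node_slope refined (\<lambda>i. u i 0) i l) (state_slope J (Y 0) i (l div J ^ 3)) = (\<integral>r. F r \<partial>lebesgue_on {0..t})"
    using ch(2) by (simp add: F[abs_def] z_def)
qed

lemma energy_diff:
  assumes t: "t \<in> {0..T}" and tube: "\<And>s. s \<in> {0..t} \<Longrightarrow> tube s"
  shows "integrable (lebesgue_on {0..t}) energy_rate" "energy t - energy 0 = (\<integral>r. energy_rate r \<partial>lebesgue_on {0..t})"
proof -
  note ch = cell_energy_chain[OF t tube]
  have eq: "energy_rate = (\<lambda>r. \<Sum>i\<in>UNIV. (\<Sum>l<refined. rel_rate \<epsilon> (node_slope refined (\<lambda>i. u i r) i l) (state_slope J (Y r) i (l div J ^ 3))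
      (node_slope refined (\<lambda>i. ut i r) i l) (state_slope J (V r) i (l div J ^ 3))) / real refined)"
    by (rule ext) (rule energy_rate_sum)
  have i1: "integrable (lebesgue_on {0..t}) (\<lambda>r. \<Sum>l<refined. rel_rate \<epsilon> (node_slope refined (\<lambda>i. u i r) i l) (state_slope J (Y r) i (l div J ^ 3))
      (node_slope refined (\<lambda>i. ut i r) i l) (state_slope J (V r) i (l div J ^ 3)))" for i
    by (intro Bochner_Integration.integrable_sum ch(1)) auto
  show "integrable (lebesgue_on {0..t}) energy_rate"
    unfolding eq by (intro Bochner_Integration.integrable_sum integrable_divide_zero i1)
  have "(\<integral>r. energy_rate r \<partial>lebesgue_on {0..t}) = (\<Sum>i\<in>UNIV. (\<Sum>l<refined. \<integral>r. rel_rate \<epsilon> (node_slope refined (\<lambda>i. u i r) i l) (state_slope J (Y r) i (l div J ^ 3))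
      (node_slope refined (\<lambda>i. ut i r) i l) (state_slope J (V r) i (l div J ^ 3)) \<partial>lebesgue_on {0..t}) / real refined)"
    unfolding eq by (subst Bochner_Integration.integral_sum, intro integrable_divide_zero i1, intro sum.cong refl)
      (simp only: integral_divide_zero, subst Bochner_Integration.integral_sum, auto intro: ch(1))
  also have "\<dots> = energy t - energy 0"
    unfolding energy_sum sum_subtractf[symmetric] diff_divide_distrib[symmetric]
    using ch(2) by (intro sum.cong arg_cong2[where f = "(/)"] refl) auto
  finally show "energy t - energy 0 = (\<integral>r. energy_rate r \<partial>lebesgue_on {0..t})" ..
qed

text \<open>The same function is admissible in both problems: finite elements lie in
  \<open>W 1\<close>, and both velocities satisfy the homogeneous end and junction
  conditions.\<close>

lemma velocity_gap_test:
  assumes "good t" "t \<in> {0..T}"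
  shows "velocity_gap t \<in> triods0_h J" "velocity_gap t \<in> triods0"
proof -
  have f: "(\<lambda>x. vh i t x - interpol J (ut i t) x) = nodal J (\<lambda>j. coord (V t) j $ i - ut i t (real j / real J))" for i
    by (simp add: fun_eq_iff state_triple_def interpol_eq_nodal nodal_def sum_subtractf[symmetric] scaleR_diff_right)
  have "state_triple J (V t) \<in> triods0_h J" by (rule state_triple_triods0_h[OF J V[OF assms(2)]])
  then have V': "vh i t 1 = 0" "vh i t 0 = vh k t 0" for i k
    unfolding triods0_h_def by blast+
  have ut: "ut i t 1 = 0" "ut i t 0 = ut k t 0" for i k using assms(1) unfolding good_def by blast+
  have I: "interpol J (ut i t) 1 = 0" "interpol J (ut i t) 0 = interpol J (ut k t) 0" for i k
    using ut(1)[of i] ut(2)[of i k] interpol_node[of J J "ut i t"] interpol_node[of 0 J "ut i t"] interpol_node[of 0 J "ut k t"] J by simp_all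
  have m: "velocity_gap t i \<in> fem J" "velocity_gap t i 1 = 0" "velocity_gap t i 0 = velocity_gap t k 0" for i k
  proof -
    show "velocity_gap t i \<in> fem J" unfolding velocity_gap_def f by (rule nodal_fem[OF J])
    show "velocity_gap t i 1 = 0" unfolding velocity_gap_def by (simp only: V'(1) I(1) diff_self)
    show "velocity_gap t i 0 = velocity_gap t k 0" unfolding velocity_gap_def by (simp only: V'(2)[of i k] I(2)[of i k])
  qed
  show "velocity_gap t \<in> triods0_h J" unfolding triods0_h_def using m by blast
  show "velocity_gap t \<in> triods0" unfolding triods0_def using m fem_W1[OF m(1) J] by blast
qed

lemma sum_W_norm_square_le: "(\<Sum>i\<in>UNIV. (W_norm 2 (ut i t))\<^sup>2) \<le> (vel2 t)\<^sup>2"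
proof -
  have "0 \<le> W_norm 2 (ut i t)" for i by simp
  then have "a\<^sup>2 + b\<^sup>2 + c\<^sup>2 \<le> (a + b + c)\<^sup>2" if "0 \<le> a" "0 \<le> b" "0 \<le> c" for a b c :: real
    using mult_nonneg_nonneg[of a b] mult_nonneg_nonneg[of a c] mult_nonneg_nonneg[of b c] that by (simp add: power2_eq_square algebra_simps)
  then show ?thesis by (simp add: vel2_def sum_3)
qed

lemma energy_rate_le:
  assumes t: "t \<in> {0..T}" and tube: "tube t" and good: "good t"
  shows "energy_rate t \<le> - coer / 2 * tri_norm2 (velocity_gap t) + (growth0 + growth1 * vel2 t) * gradient_gap t
    + (1 / real J)\<^sup>2 * (source0 + 4 * Cp\<^sup>2 * (vel2 t)\<^sup>2)"
proof -
  have c: "0 < c0 / 2" using c0 by simp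
  note step = has_bochner_integral_two_scale[OF J J3, THEN integrable.intros, of _ "\<lambda>i. u i t" _ "state_triple J (Y t)" "\<lambda>i. ut i t" "state_triple J (V t)"]
  note step' = has_bochner_integral_two_scale[OF J J3, THEN integrable.intros, of _ "\<lambda>i. ut i t" _ "\<lambda>i. ut i t" "\<lambda>i. ut i t" "state_triple J (V t)"]
  have W: "ut i t \<in> W 2" for i using good by (simp add: good_def)
  have g: "AE x in unit_interval. c0 / 2 \<le> norm (dx (u i t) x) \<and> norm (dx (u i t) x) \<le> 2 / c0" for i
    using u_bounds[OF t, of i]
  proof eventually_elim
    case (elim x)
    then show ?case using c0 c0_bound by linarith
  qed
  have p: "AE x in unit_interval. c0 / 2 \<le> norm (slope refined (u i t) x)" for i
  proof -
    have "AE x in unit_interval. c0 / 2 \<le> norm (cell_field refined (node_slope refined (\<lambda>i. u i t)) i x)"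
      by (intro cell_field_AE[OF refined(1)] order_trans[OF _ fine_bounds(1)[OF t]]) (use c0 in auto)
    then show ?thesis using slope_eq_cell_field[OF refined(1), of "\<lambda>i. u i t" i] by eventually_elim simp
  qed
  have p': "AE x in unit_interval. norm (slope refined (ut i t) x) \<le> (Cp + 1) * vel2 t" for i
  proof -
    have "norm (node_slope refined (\<lambda>i. ut i t) i l) \<le> (Cp + 1) * W_norm 2 (ut i t)" if "l < refined" for l
      using W2_Lipschitz[OF Cp W, of i] good that by (intro node_slope_Lipschitz) (auto simp: good_def)
    also have "(Cp + 1) * W_norm 2 (ut i t) \<le> (Cp + 1) * vel2 t" using Cp_pos W_norm_le_vel2[of i t] by simp
    finally have "AE x in unit_interval. norm (cell_field refined (node_slope refined (\<lambda>i. ut i t)) i x) \<le> (Cp + 1) * vel2 t"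
      by (intro cell_field_AE[OF refined(1)])
    then show ?thesis using slope_eq_cell_field[OF refined(1), of "\<lambda>i. ut i t" i] by eventually_elim simp
  qed
  have vg: "(\<lambda>i x. vh i t x - interpol J (ut i t) x) \<in> triods0_h J" "(\<lambda>i x. vh i t x - interpol J (ut i t) x) \<in> triods0"
    using velocity_gap_test[OF good t] by (simp_all add: velocity_gap_def)
  have weq: "weak_equation \<epsilon> (\<lambda>i. u i t) (\<lambda>i. ut i t) (\<lambda>i x. vh i t x - interpol J (ut i t) x)"
    using good vg(2) by (auto simp: good_def)
  have "energy_rate t \<le> - coer / 2 * tri_norm2 (velocity_gap t)
      + ((\<epsilon> + 2 / (c0 / 2))\<^sup>2 + 4 * ((Cp + 1) * vel2 t) / (c0 / 2)\<^sup>2 + 4 * ((5 + \<epsilon> * (2 / c0 + 2 / c0)) * Nb)\<^sup>2 / coer) * gradient_gap t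
      + 3 * (((\<epsilon> + 2 / (c0 / 2)) * interp_err refined)\<^sup>2 * (Cp * real J)\<^sup>2 / coer + 4 * ((5 + \<epsilon> * (2 / c0 + 2 / c0)) * Nb)\<^sup>2 / coer * (interp_err refined)\<^sup>2)
      + (\<Sum>i\<in>UNIV. \<integral>x. (norm (slope J (ut i t) x - slope refined (ut i t) x))\<^sup>2 \<partial>unit_interval)
      + 2 * (2 / c0 + \<epsilon> * (2 / c0)\<^sup>2)\<^sup>2 / coer * (\<Sum>i\<in>UNIV. \<integral>x. (norm (ut i t x - interpol J (ut i t) x))\<^sup>2 \<partial>unit_interval)"
    unfolding energy_rate_def gradient_gap_def velocity_gap_def coer_def
  proof (rule static_estimate[OF Cp J refined(1) eps c, where v = "\<lambda>i. u i t" and vh = "\<lambda>i. uh i t" and wh = "\<lambda>i. vh i t" and w = "\<lambda>i. ut i t"])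
    show "integrable unit_interval (\<lambda>x. rel_rate \<epsilon> (slope refined (u i t) x) (slope J (uh i t) x) (slope refined (ut i t) x) (slope J (vh i t) x))" for i
      by (rule step)
    show "integrable unit_interval (\<lambda>x. (norm (slope J (uh i t) x - slope refined (u i t) x))\<^sup>2)" for i
      by (rule step[of "\<lambda>a b c d. (norm (b - a))\<^sup>2"])
    show "integrable unit_interval (\<lambda>x. (norm (slope J (ut i t) x - slope refined (ut i t) x))\<^sup>2)" for i
      by (rule step'[of "\<lambda>a b c d. (norm (b - a))\<^sup>2"])
    show "continuous_on {0..1} (ut i t)" for i using W1_continuous[OF W2_W1[OF W]] .
    show "norm (ut i t x) \<le> Nb" if "x \<in> {0..1}" for i x using good_bound[OF good that] .
  qed (fact uW[OF t] uh_fem vh_fem g p tube_slope_bounds[OF t tube] dx_u_slope[OF refined(1) t] p' vg(1) weq tube_weak_equation[OF t tube vg(1)])+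
  moreover have "(\<epsilon> + 2 / (c0 / 2))\<^sup>2 + 4 * ((Cp + 1) * vel2 t) / (c0 / 2)\<^sup>2 + 4 * ((5 + \<epsilon> * (2 / c0 + 2 / c0)) * Nb)\<^sup>2 / coer = growth0 + growth1 * vel2 t"
    by (simp add: growth0_def growth1_def flux_const_def mass_const_def)
  \<comment> \<open>The slope error of velocity interpolation is of order h times the
    \<open>W 2\<close> norm of the velocity, which is only square integrable in time; so it is kept
    as a time-dependent source.\<close>
  moreover have "(\<Sum>i\<in>UNIV. \<integral>x. (norm (slope J (ut i t) x - slope refined (ut i t) x))\<^sup>2 \<partial>unit_interval) \<le> (\<Sum>i\<in>UNIV. 4 * Cp\<^sup>2 * (1 / real J)\<^sup>2 * (W_norm 2 (ut i t))\<^sup>2)"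
    by (intro sum_mono slope_interpol_diff_L2[OF Cp J refined(2) W])
  moreover have "(\<Sum>i\<in>UNIV. 4 * Cp\<^sup>2 * (1 / real J)\<^sup>2 * (W_norm 2 (ut i t))\<^sup>2) \<le> 4 * Cp\<^sup>2 * (1 / real J)\<^sup>2 * (vel2 t)\<^sup>2"
    unfolding sum_distrib_left[symmetric] by (intro mult_left_mono sum_W_norm_square_le) simp
  \<comment> \<open>The inverse estimate costs a factor \<open>(real J)\<^sup>2\<close>, and the
    squared consistency error on the refined mesh is \<open>consist / real J ^ 4\<close>; the
    product is exactly of order h^2.\<close>
  moreover have "3 * (((\<epsilon> + 2 / (c0 / 2)) * interp_err refined)\<^sup>2 * (Cp * real J)\<^sup>2 / coer + 4 * ((5 + \<epsilon> * (2 / c0 + 2 / c0)) * Nb)\<^sup>2 / coer * (interp_err refined)\<^sup>2)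
     \<le> (1 / real J)\<^sup>2 * (3 * (flux_const\<^sup>2 * consist * Cp\<^sup>2 / coer + 4 * mass_const\<^sup>2 / coer * consist))"
  proof -
    have combine: "a = h * b \<Longrightarrow> d \<le> h * e \<Longrightarrow> 3 * (a + d) \<le> h * (3 * (b + e))" for a b d e h :: real by (simp add: algebra_simps)
    have cancel: "a\<^sup>2 * (consist / real J ^ 4) * (Cp\<^sup>2 * (real J)\<^sup>2) / coer = (1 / real J)\<^sup>2 * (a\<^sup>2 * consist * Cp\<^sup>2 / coer)" for a
      using J by (simp add: divide_simps power4_eq_xxxx power2_eq_square)
    have "((\<epsilon> + 2 / (c0 / 2)) * interp_err refined)\<^sup>2 * (Cp * real J)\<^sup>2 / coer = (1 / real J)\<^sup>2 * (flux_const\<^sup>2 * consist * Cp\<^sup>2 / coer)"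
      unfolding power_mult_distrib interp_err_square fine_real flux_const_def by (rule cancel)
    moreover have "4 * ((5 + \<epsilon> * (2 / c0 + 2 / c0)) * Nb)\<^sup>2 / coer * (interp_err refined)\<^sup>2 \<le> 4 * mass_const\<^sup>2 / coer * (consist * (1 / real J)\<^sup>2)"
      unfolding interp_err_square mass_const_def using consist_fine const_pos(3) by (intro mult_left_mono) auto
    ultimately show ?thesis by (intro combine) (simp_all only: mult_ac)
  qed
  moreover have "2 * (2 / c0 + \<epsilon> * (2 / c0)\<^sup>2)\<^sup>2 / coer * (\<Sum>i\<in>UNIV. \<integral>x. (norm (ut i t x - interpol J (ut i t) x))\<^sup>2 \<partial>unit_interval)
      \<le> 2 * (2 / c0 + \<epsilon> * (2 / c0)\<^sup>2)\<^sup>2 / coer * (\<Sum>i\<in>(UNIV::3 set). Cp\<^sup>2 * Nb\<^sup>2 * (1 / real J)\<^sup>2)"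
  proof (intro mult_left_mono sum_mono)
    fix i
    have "L2_norm 0 1 (\<lambda>x. ut i t x - interpol J (ut i t) x) \<le> Cp * (1 / real J) * W_norm 1 (ut i t)"
      by (rule interpolation_constantD(2)[OF Cp J W2_W1[OF W]])
    also have "\<dots> \<le> Cp * (1 / real J) * Nb" using good Cp_pos by (intro mult_left_mono) (auto simp: good_def)
    finally have "(L2_norm 0 1 (\<lambda>x. ut i t x - interpol J (ut i t) x))\<^sup>2 \<le> (Cp * (1 / real J) * Nb)\<^sup>2" by (intro power_mono) auto
    then show "(\<integral>x. (norm (ut i t x - interpol J (ut i t) x))\<^sup>2 \<partial>unit_interval) \<le> Cp\<^sup>2 * Nb\<^sup>2 * (1 / real J)\<^sup>2"
      unfolding L2_norm_square by (simp only: power_mult_distrib mult_ac)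
  qed (use const_pos(3) in simp)
  moreover have "(\<Sum>i\<in>(UNIV::3 set). Cp\<^sup>2 * Nb\<^sup>2 * (1 / real J)\<^sup>2) = 3 * (Cp\<^sup>2 * Nb\<^sup>2) * (1 / real J)\<^sup>2"
    by simp
  ultimately have "energy_rate t \<le> - coer / 2 * tri_norm2 (velocity_gap t) + (growth0 + growth1 * vel2 t) * gradient_gap t
      + (1 / real J)\<^sup>2 * (3 * (flux_const\<^sup>2 * consist * Cp\<^sup>2 / coer + 4 * mass_const\<^sup>2 / coer * consist))
      + 4 * Cp\<^sup>2 * (1 / real J)\<^sup>2 * (vel2 t)\<^sup>2
      + 2 * (2 / c0 + \<epsilon> * (2 / c0)\<^sup>2)\<^sup>2 / coer * (3 * (Cp\<^sup>2 * Nb\<^sup>2) * (1 / real J)\<^sup>2)"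
    by (simp only:)
  then show ?thesis unfolding source0_def by (simp only: algebra_simps)
qed

end

text \<open>The factor \<open>real J + 1\<close> is crude, but the bound serves integrability in
  time on a fixed mesh.\<close>

lemma norm_nodal_le:
  fixes y :: "nat \<Rightarrow> real^2"
  assumes y: "\<And>j. j \<le> J \<Longrightarrow> norm (y j) \<le> b"
  shows "norm (nodal J y x) \<le> (real J + 1) * b"
proof -
  have "norm (nodal J y x) \<le> (\<Sum>j\<le>J. b)"
    unfolding nodal_def
  proof (intro sum_norm_le)
    fix j assume "j \<in> {..J}"
    then have "norm (y j) \<le> b" using y by simp
    then have "max 0 (1 - \<bar>real J * x - real j\<bar>) * norm (y j) \<le> 1 * b" by (intro mult_mono) auto
    then show "norm (max 0 (1 - \<bar>real J * x - real j\<bar>) *\<^sub>R y j) \<le> b" by simp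
  qed
  then show ?thesis by (simp add: add.commute)
qed

lemma integrable_time_bounded:
  fixes f :: "real \<Rightarrow> real"
  assumes "f \<in> borel_measurable (lebesgue_on {0..T})" "AE t in lebesgue_on {0..T}. norm (f t) \<le> B"
  shows "integrable (lebesgue_on {0..T}) f"
proof -
  have "integrable (lebesgue_on {0..T}) (\<lambda>t::real. B)" by simp
  then show ?thesis
    by (rule Bochner_Integration.integrable_bound) (use assms in \<open>auto elim: eventually_mono\<close>)
qed

lemma square_integral_le:
  fixes f :: "real \<Rightarrow> 'a::euclidean_space"
  assumes "AE x in unit_interval. norm (f x) \<le> B" "0 \<le> B"
  shows "(\<integral>x. (norm (f x))\<^sup>2 \<partial>unit_interval) \<le> B\<^sup>2"
proof -
  have "(\<integral>x. (norm (f x))\<^sup>2 \<partial>unit_interval) \<le> (\<integral>x. B\<^sup>2 \<partial>unit_interval)"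
  proof (rule integral_mono_AE')
    show "AE x in unit_interval. (norm (f x))\<^sup>2 \<le> B\<^sup>2" using assms(1) by eventually_elim (simp add: power_mono)
  qed auto
  then show ?thesis by (simp add: measure_restrict_space)
qed

section \<open>Initial error, energy estimate and inactivity of the retraction\<close>

context scheme_flow
begin

lemma initial_slope:
  shows "m < J \<Longrightarrow> state_slope J (Y 0) i m = node_slope J u0 i m"
    and "l < K \<Longrightarrow> node_slope K (\<lambda>i. u i 0) i l = node_slope K u0 i l"
proof -
  show "m < J \<Longrightarrow> state_slope J (Y 0) i m = node_slope J u0 i m"
    by (simp add: Y0 state_slope_def node_slope_def coord_state_of)
  assume "l < K"
  then have n: "real (Suc l) / real K \<in> {0..1}" "real l / real K \<in> {0..1}" by auto
  show "node_slope K (\<lambda>i. u i 0) i l = node_slope K u0 i l"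
    unfolding node_slope_def u_init[OF n(1)] u_init[OF n(2)] ..
qed

lemma tube_0: "tube 0"
  unfolding tube_def
proof (intro allI impI)
  fix i m assume "m < J"
  then show "norm (state_slope J (Y 0) i m - node_slope J (\<lambda>i. u i 0) i m) \<le> c0 / 4"
    using c0 by (simp only: initial_slope) simp
qed

text \<open>The flow starts at the interpolant, so the slopes of \<open>u0\<close> on two meshes are
  compared; 12 is 3 curves times the 4 of the two-mesh estimate.\<close>

lemma initial_gap: "gradient_gap 0 \<le> 12 * Cp\<^sup>2 * Nb\<^sup>2 * (1 / real J)\<^sup>2"
proof -
  note step = has_bochner_integral_two_scale[OF J J3, THEN has_bochner_integral_integral_eq, of "\<lambda>a b c d. (norm (b - a))\<^sup>2" u0 _ u0]
  have "gradient_gap 0 = (\<Sum>i\<in>UNIV. \<integral>x. (norm (slope J (u0 i) x - slope refined (u0 i) x))\<^sup>2 \<partial>unit_interval)"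
    unfolding gradient_gap_sum step
    by (intro sum.cong refl) (simp add: initial_slope coarse_index divide_inverse mult.commute)
  also have "\<dots> \<le> (\<Sum>i\<in>(UNIV::3 set). 4 * Cp\<^sup>2 * (1 / real J)\<^sup>2 * Nb\<^sup>2)"
  proof (intro sum_mono)
    fix i
    have "(\<integral>x. (norm (slope J (u0 i) x - slope refined (u0 i) x))\<^sup>2 \<partial>unit_interval) \<le> 4 * Cp\<^sup>2 * (1 / real J)\<^sup>2 * (W_norm 2 (u0 i))\<^sup>2"
      by (rule slope_interpol_diff_L2[OF Cp J refined(2) u0(1)])
    also have "\<dots> \<le> 4 * Cp\<^sup>2 * (1 / real J)\<^sup>2 * Nb\<^sup>2" using u0(4) by (intro mult_left_mono power_mono) auto
    finally show "(\<integral>x. (norm (slope J (u0 i) x - slope refined (u0 i) x))\<^sup>2 \<partial>unit_interval) \<le> 4 * Cp\<^sup>2 * (1 / real J)\<^sup>2 * Nb\<^sup>2" .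
  qed
  finally show ?thesis by (simp add: mult_ac)
qed

lemma velocity_sup:
  obtains B where "0 \<le> B" "\<And>t i x. t \<in> {0..T} \<Longrightarrow> norm (vh i t x) \<le> B"
proof -
  obtain B where B: "0 \<le> B" "\<And>t. t \<in> {0..T} \<Longrightarrow> norm (V t) \<le> B"
    by (rule continuous_on_Icc_bounded[OF V_cont]) blast
  have "norm (vh i t x) \<le> (real J + 1) * B" if t: "t \<in> {0..T}" for t i x
    unfolding state_triple_def
  proof (rule norm_nodal_le)
    show "norm (coord (V t) j $ i) \<le> B" for j
      by (rule order_trans[OF Finite_Cartesian_Product.norm_nth_le order_trans[OF norm_coord_le B(2)[OF t]]])
  qed
  then show thesis using B(1) by (intro that[of "(real J + 1) * B"]) auto
qed

lemma velocity_measurable: "(\<lambda>t. vh i t x) \<in> borel_measurable (lebesgue_on {0..T})"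
  by (intro continuous_imp_measurable_on_sets_lebesgue bounded_linear.continuous_on[OF bounded_linear_state_triple V_cont]) simp

text \<open>At good times the nodal values of both velocities are bounded on the fixed mesh.
  Measurability in time comes from continuity in \<open>x\<close> and measurability at each fixed
  \<open>x\<close>.\<close>

lemma velocity_gap_integrable: "integrable (lebesgue_on {0..T}) (\<lambda>t. tri_norm2 (velocity_gap t))"
proof -
  obtain B where B: "0 \<le> B" "\<And>t i x. t \<in> {0..T} \<Longrightarrow> norm (vh i t x) \<le> B" by (fact velocity_sup)
  have "integrable (lebesgue_on {0..T}) (\<lambda>t. \<integral>x. (norm (velocity_gap t i x))\<^sup>2 \<partial>unit_interval)" for i
  proof (rule integrable_time_bounded)
    show "(\<lambda>t. \<integral>x. (norm (velocity_gap t i x))\<^sup>2 \<partial>unit_interval) \<in> borel_measurable (lebesgue_on {0..T})"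
    proof (rule borel_measurable_time_norm2)
      show "(\<lambda>t. velocity_gap t i x) \<in> borel_measurable (lebesgue_on {0..T})" for x
        unfolding velocity_gap_def by (intro borel_measurable_diff velocity_measurable borel_measurable_integrable interpol_u_diff(2)[OF J, of 0]) (use T in simp)
      show "AE t in lebesgue_on {0..T}. continuous_on {0..1} (velocity_gap t i)"
        unfolding velocity_gap_def by (intro AE_I2 continuous_on_diff fem_continuous[OF vh_fem] fem_continuous[OF interpol_fem[OF J]])
    qed
    show "AE t in lebesgue_on {0..T}. norm (\<integral>x. (norm (velocity_gap t i x))\<^sup>2 \<partial>unit_interval) \<le> (B + (real J + 1) * Nb)\<^sup>2"
      using AE_good AE_space
    proof eventually_elim
      case (elim t)
      have "norm (interpol J (ut i t) x) \<le> (real J + 1) * Nb" for x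
        unfolding interpol_eq_nodal using good_bound[OF elim(1)] J by (intro norm_nodal_le) auto
      then have "norm (velocity_gap t i x) \<le> B + (real J + 1) * Nb" for x
        unfolding velocity_gap_def using elim(2) by (intro norm_triangle_le_diff add_mono B(2)) auto
      then have "(\<integral>x. (norm (velocity_gap t i x))\<^sup>2 \<partial>unit_interval) \<le> (B + (real J + 1) * Nb)\<^sup>2"
        using B(1) Nb by (intro square_integral_le) auto
      then show ?case by (simp add: Bochner_Integration.integral_nonneg)
    qed
  qed
  then show ?thesis unfolding tri_norm2_def by auto
qed

definition "weight t = growth0 + growth1 * vel2 t"

lemma weight: "integrable (lebesgue_on {0..T}) weight" "0 \<le> weight t" "t \<in> {0..T} \<Longrightarrow> (\<integral>r. weight r \<partial>lebesgue_on {0..t}) \<le> growth"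
proof -
  show i: "integrable (lebesgue_on {0..T}) weight" unfolding weight_def[abs_def] using vel2_integrable by auto
  show "0 \<le> weight t" using const_pos(6,7) vel2_nonneg[of t] by (simp add: weight_def)
  assume t: "t \<in> {0..T}"
  have v: "integrable (lebesgue_on {0..t}) vel2" using t by (intro integrable_subinterval[OF vel2_integrable]) auto
  have "(\<integral>r. weight r \<partial>lebesgue_on {0..t}) = growth0 * t + growth1 * (\<integral>r. vel2 r \<partial>lebesgue_on {0..t})"
    unfolding weight_def using v t by (simp add: measure_restrict_space)
  also have "\<dots> \<le> growth" unfolding growth_def using t const_pos(6,7) vel2_integral[OF t] by (intro add_mono mult_left_mono) auto
  finally show "(\<integral>r. weight r \<partial>lebesgue_on {0..t}) \<le> growth" .
qed

lemma source_integral: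
  assumes t: "t \<in> {0..T}"
  shows "integrable (lebesgue_on {0..t}) (\<lambda>r. source0 + 4 * Cp\<^sup>2 * (vel2 r)\<^sup>2)"
    and "(\<integral>r. source0 + 4 * Cp\<^sup>2 * (vel2 r)\<^sup>2 \<partial>lebesgue_on {0..t}) \<le> source0 * T + 4 * Cp\<^sup>2 * (9 * Nb\<^sup>2)"
proof -
  have v: "integrable (lebesgue_on {0..t}) (\<lambda>r. (vel2 r)\<^sup>2)" using t by (intro integrable_subinterval[OF vel2_square_integrable]) auto
  then show "integrable (lebesgue_on {0..t}) (\<lambda>r. source0 + 4 * Cp\<^sup>2 * (vel2 r)\<^sup>2)" by auto
  have "(\<integral>r. (vel2 r)\<^sup>2 \<partial>lebesgue_on {0..t}) \<le> (\<integral>r. (vel2 r)\<^sup>2 \<partial>lebesgue_on {0..T})"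
    using vel2_square_integrable t by (intro integral_mono_lebesgue_on_AE) auto
  then have le: "(\<integral>r. (vel2 r)\<^sup>2 \<partial>lebesgue_on {0..t}) \<le> 9 * Nb\<^sup>2" using vel2_square_integral by simp
  have "(\<integral>r. source0 + 4 * Cp\<^sup>2 * (vel2 r)\<^sup>2 \<partial>lebesgue_on {0..t}) = source0 * t + 4 * Cp\<^sup>2 * (\<integral>r. (vel2 r)\<^sup>2 \<partial>lebesgue_on {0..t})"
    using v t by (simp add: measure_restrict_space)
  also have "\<dots> \<le> source0 * T + 4 * Cp\<^sup>2 * (9 * Nb\<^sup>2)" using t const_pos(9) le by (intro add_mono mult_left_mono) auto
  finally show "(\<integral>r. source0 + 4 * Cp\<^sup>2 * (vel2 r)\<^sup>2 \<partial>lebesgue_on {0..t}) \<le> source0 * T + 4 * Cp\<^sup>2 * (9 * Nb\<^sup>2)" .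
qed

lemma gradient_gap_continuous: "continuous_on {0..T} gradient_gap"
proof -
  have "continuous_on {0..T} (\<lambda>t. \<Sum>i\<in>UNIV. (\<Sum>l<refined. (norm (state_slope J (Y t) i (l div J ^ 3) - node_slope refined (\<lambda>i. u i t) i l))\<^sup>2) / real refined)"
    by (intro continuous_intros state_slope_continuous node_slope_continuous) (use refined in auto)
  then show ?thesis by (simp only: gradient_gap_sum[symmetric])
qed

lemma weighted_gap_integrable: "integrable (lebesgue_on {0..T}) (\<lambda>r. weight r * gradient_gap r)"
  using integrable_continuous_scaleR[OF gradient_gap_continuous weight(1)] by (simp add: mult.commute)

text \<open>Integration of the rate inequality over a time interval on which the tube holds. At time
  0 the energy is bounded by the initial gap, which is of order h^2.\<close>

lemma energy_estimate:
  assumes t: "t \<in> {0..T}" and tube: "\<And>s. s \<in> {0..t} \<Longrightarrow> tube s"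
  shows "energy t + coer / 2 * (\<integral>r. tri_norm2 (velocity_gap r) \<partial>lebesgue_on {0..t})
    \<le> source * (1 / real J)\<^sup>2 + (\<integral>r. weight r * gradient_gap r \<partial>lebesgue_on {0..t})"
proof -
  have sub: "integrable (lebesgue_on {0..t}) f" if "integrable (lebesgue_on {0..T}) f" for f :: "real \<Rightarrow> real"
    using t by (intro integrable_subinterval[OF that]) auto
  note i = sub[OF velocity_gap_integrable] sub[OF weighted_gap_integrable] source_integral(1)[OF t]
  have ae: "AE r in lebesgue_on {0..t}. good r"
    using AE_good t by (auto simp: AE_restrict_space_iff elim!: eventually_mono)
  have "energy t - energy 0 = (\<integral>r. energy_rate r \<partial>lebesgue_on {0..t})" by (rule energy_diff(2)[OF t tube])
  also have "\<dots> \<le> (\<integral>r. - (coer / 2) * tri_norm2 (velocity_gap r) + weight r * gradient_gap r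
      + (1 / real J)\<^sup>2 * (source0 + 4 * Cp\<^sup>2 * (vel2 r)\<^sup>2) \<partial>lebesgue_on {0..t})"
  proof (rule integral_mono_AE[OF energy_diff(1)[OF t tube]])
    show "integrable (lebesgue_on {0..t}) (\<lambda>r. - (coer / 2) * tri_norm2 (velocity_gap r) + weight r * gradient_gap r
        + (1 / real J)\<^sup>2 * (source0 + 4 * Cp\<^sup>2 * (vel2 r)\<^sup>2))"
      by (intro Bochner_Integration.integrable_add integrable_mult_right i)
    show "AE r in lebesgue_on {0..t}. energy_rate r \<le> - (coer / 2) * tri_norm2 (velocity_gap r) + weight r * gradient_gap r
        + (1 / real J)\<^sup>2 * (source0 + 4 * Cp\<^sup>2 * (vel2 r)\<^sup>2)"
      using ae AE_space
    proof eventually_elim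
      case (elim r)
      then have r: "r \<in> {0..t}" "r \<in> {0..T}" using t by auto
      show ?case using energy_rate_le[OF r(2) tube[OF r(1)] elim(1)] by (simp add: weight_def)
    qed
  qed auto
  also have "\<dots> = - (coer / 2) * (\<integral>r. tri_norm2 (velocity_gap r) \<partial>lebesgue_on {0..t}) + (\<integral>r. weight r * gradient_gap r \<partial>lebesgue_on {0..t})
      + (1 / real J)\<^sup>2 * (\<integral>r. source0 + 4 * Cp\<^sup>2 * (vel2 r)\<^sup>2 \<partial>lebesgue_on {0..t})"
    by (simp only: Bochner_Integration.integral_add Bochner_Integration.integrable_add integrable_mult_right integral_mult_right_zero i)
  finally have 1: "energy t + coer / 2 * (\<integral>r. tri_norm2 (velocity_gap r) \<partial>lebesgue_on {0..t})
      \<le> energy 0 + (\<integral>r. weight r * gradient_gap r \<partial>lebesgue_on {0..t}) + (1 / real J)\<^sup>2 * (\<integral>r. source0 + 4 * Cp\<^sup>2 * (vel2 r)\<^sup>2 \<partial>lebesgue_on {0..t})"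
    by (simp only: mult_minus_left)
  have "energy 0 \<le> (\<epsilon> / 2 + 2 / (c0 / 2)) * gradient_gap 0" using T by (intro energy_le tube_0) auto
  also have "\<dots> \<le> (\<epsilon> / 2 + 2 / (c0 / 2)) * (12 * Cp\<^sup>2 * Nb\<^sup>2 * (1 / real J)\<^sup>2)" using eps c0 by (intro mult_left_mono initial_gap) auto
  finally have 2: "energy 0 \<le> (\<epsilon> / 2 + 2 / (c0 / 2)) * (12 * Cp\<^sup>2 * Nb\<^sup>2 * (1 / real J)\<^sup>2)" .
  have "(1 / real J)\<^sup>2 * (\<integral>r. source0 + 4 * Cp\<^sup>2 * (vel2 r)\<^sup>2 \<partial>lebesgue_on {0..t}) \<le> (1 / real J)\<^sup>2 * (source0 * T + 4 * Cp\<^sup>2 * (9 * Nb\<^sup>2))"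
    by (intro mult_left_mono source_integral(2)[OF t]) simp
  moreover have "source * (1 / real J)\<^sup>2 = (\<epsilon> / 2 + 2 / (c0 / 2)) * (12 * Cp\<^sup>2 * Nb\<^sup>2 * (1 / real J)\<^sup>2)
      + (1 / real J)\<^sup>2 * (source0 * T + 4 * Cp\<^sup>2 * (9 * Nb\<^sup>2))"
    unfolding source_def by (simp only: algebra_simps)
  ultimately show ?thesis using 1 2 by linarith
qed

text \<open>Gronwall is applied to the energy, with the gap under the integral replaced by
  \<open>2 / \<epsilon>\<close> times the energy. The resulting bound on the gap is then put back
  into the energy estimate to extract the velocity term, which was dropped for Gronwall.\<close>

lemma gap_estimate:
  assumes t: "t \<in> {0..T}" and tube: "\<And>s. s \<in> {0..t} \<Longrightarrow> tube s"
  shows "gradient_gap t \<le> grad_const * (1 / real J)\<^sup>2"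
    and "(\<integral>r. tri_norm2 (velocity_gap r) \<partial>lebesgue_on {0..t}) \<le> vel_const * (1 / real J)\<^sup>2"
proof -
  have sub: "integrable (lebesgue_on {0..s}) f" if "integrable (lebesgue_on {0..T}) f" "s \<in> {0..t}" for f :: "real \<Rightarrow> real" and s
    using t that by (intro integrable_subinterval[OF that(1)]) auto
  have gap_nn: "0 \<le> (\<integral>r. tri_norm2 (velocity_gap r) \<partial>lebesgue_on {0..s})" for s
    by (intro Bochner_Integration.integral_nonneg tri_norm2_nonneg)
  have energy_nn: "0 \<le> energy s" for s
    using energy_ge[of s] gradient_gap_nonneg[of s] eps by (smt (verit) mult_nonneg_nonneg divide_nonneg_nonneg)
  have gap_le: "gradient_gap s \<le> 2 / \<epsilon> * energy s" for s
    using energy_ge[of s] eps by (simp add: field_simps)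
  define A where "A r = 2 / \<epsilon> * weight r" for r
  have A: "integrable (lebesgue_on {0..T}) A" "0 \<le> A s" for s
    unfolding A_def[abs_def] using weight eps by auto
  have tt: "t \<in> {0..t}" using t by simp
  \<comment> \<open>Within the tube the energy is an indefinite integral plus a constant, which
    gives the continuity required for Gronwall.\<close>
  have energy_cont: "continuous_on {0..t} energy"
  proof -
    have "continuous_on {0..t} (\<lambda>s. energy 0 + (\<integral>r. energy_rate r \<partial>lebesgue_on {0..s}))"
      by (intro continuous_intros indefinite_integral_continuous_real energy_diff(1)[OF t tube])
    then show ?thesis
    proof (rule continuous_on_cong[THEN iffD1, rotated -1])
      fix s assume "s \<in> {0..t}"
      then show "energy 0 + (\<integral>r. energy_rate r \<partial>lebesgue_on {0..s}) = energy s"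
        using energy_diff(2)[of s] t tube by auto
    qed simp
  qed
  have "integrable (lebesgue_on {0..t}) (\<lambda>r. energy r * A r)"
    using integrable_continuous_scaleR[OF energy_cont sub[OF A(1) tt]] by simp
  then have Ae: "integrable (lebesgue_on {0..t}) (\<lambda>r. A r * energy r)" by (simp add: mult.commute)
  have le: "weight r * gradient_gap r \<le> A r * energy r" for r
    using mult_left_mono[OF gap_le[of r] weight(2)[of r]] by (simp add: A_def mult_ac)
  have energy_le': "energy s \<le> source * (1 / real J)\<^sup>2 + (\<integral>r. A r * energy r \<partial>lebesgue_on {0..s})" if s: "s \<in> {0..t}" for s
  proof -
    have sT: "s \<in> {0..T}" using s t by auto
    have "(\<integral>r. weight r * gradient_gap r \<partial>lebesgue_on {0..s}) \<le> (\<integral>r. A r * energy r \<partial>lebesgue_on {0..s})"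
      using s by (intro integral_mono sub[OF weighted_gap_integrable s] le integrable_subinterval[OF Ae]) auto
    moreover have tb: "tube q" if "q \<in> {0..s}" for q using tube[of q] that s by simp
    moreover have "0 \<le> coer / 2 * (\<integral>r. tri_norm2 (velocity_gap r) \<partial>lebesgue_on {0..s})"
      using gap_nn const_pos(3) by (intro mult_nonneg_nonneg) auto
    ultimately show ?thesis using energy_estimate[OF sT tb] by linarith
  qed
  have gw: "energy s \<le> source * (1 / real J)\<^sup>2 * exp (2 * (\<integral>r. A r \<partial>lebesgue_on {0..t}))" if s: "s \<in> {0..t}" for s
    by (rule gronwall_integrable_weight[OF sub[OF A(1) tt] A(2) energy_cont energy_nn energy_le' s])
  have IA: "(\<integral>r. A r \<partial>lebesgue_on {0..t}) \<le> 2 / \<epsilon> * growth"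
    unfolding A_def using weight(3)[OF t] eps by (simp add: divide_right_mono)
  have gap: "gradient_gap s \<le> grad_const * (1 / real J)\<^sup>2" if s: "s \<in> {0..t}" for s
  proof -
    have "gradient_gap s \<le> 2 / \<epsilon> * (source * (1 / real J)\<^sup>2 * exp (2 * (\<integral>r. A r \<partial>lebesgue_on {0..t})))"
      using order_trans[OF gap_le mult_left_mono[OF gw[OF s]]] eps by simp
    also have "\<dots> \<le> 2 / \<epsilon> * (source * (1 / real J)\<^sup>2 * exp (2 * (2 / \<epsilon> * growth)))"
      using IA eps const_pos(10) by (intro mult_left_mono) auto
    finally show ?thesis by (simp only: grad_const_def mult_ac)
  qed
  show "gradient_gap t \<le> grad_const * (1 / real J)\<^sup>2" by (rule gap[OF tt])
  have "(\<integral>r. weight r * gradient_gap r \<partial>lebesgue_on {0..t}) \<le> (\<integral>r. grad_const * (1 / real J)\<^sup>2 * weight r \<partial>lebesgue_on {0..t})"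
  proof (rule integral_mono[OF sub[OF weighted_gap_integrable tt]])
    show "integrable (lebesgue_on {0..t}) (\<lambda>r. grad_const * (1 / real J)\<^sup>2 * weight r)" by (intro integrable_mult_right sub[OF weight(1) tt])
    show "weight r * gradient_gap r \<le> grad_const * (1 / real J)\<^sup>2 * weight r" if "r \<in> space (lebesgue_on {0..t})" for r
      using mult_left_mono[OF gap[of r] weight(2)[of r]] that by (simp add: mult_ac)
  qed
  also have "\<dots> = grad_const * (1 / real J)\<^sup>2 * (\<integral>r. weight r \<partial>lebesgue_on {0..t})" by simp
  also have "\<dots> \<le> grad_const * (1 / real J)\<^sup>2 * growth" using weight(3)[OF t] const_pos(12) by (intro mult_left_mono) auto
  finally have "coer / 2 * (\<integral>r. tri_norm2 (velocity_gap r) \<partial>lebesgue_on {0..t}) \<le> source * (1 / real J)\<^sup>2 + grad_const * (1 / real J)\<^sup>2 * growth"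
    using energy_estimate[OF t tube] energy_nn[of t] by linarith
  then have "(\<integral>r. tri_norm2 (velocity_gap r) \<partial>lebesgue_on {0..t}) \<le> 2 / coer * (source * (1 / real J)\<^sup>2 + grad_const * (1 / real J)\<^sup>2 * growth)"
    using const_pos(3) by (simp add: field_simps)
  then show "(\<integral>r. tri_norm2 (velocity_gap r) \<partial>lebesgue_on {0..t}) \<le> vel_const * (1 / real J)\<^sup>2"
    by (simp only: vel_const_def algebra_simps)
qed

lemma coarse_fine_gap:
  assumes t: "t \<in> {0..T}" and l: "l < refined"
  shows "norm (node_slope refined (\<lambda>i. u i t) i l - node_slope J (\<lambda>i. u i t) i (l div J ^ 3)) \<le> 2 * interp_err J"
proof (rule cell_two_scale_D[OF J J3 _ l, where R = "\<lambda>a b. norm (a - b) \<le> 2 * interp_err J" and v = "\<lambda>i. u i t" and w = "\<lambda>i. u i t"])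
  show "AE x in unit_interval. norm (slope refined (u i t) x - slope J (u i t) x) \<le> 2 * interp_err J"
    using dx_u_slope[OF J t, of i] dx_u_slope[OF refined(1) t, of i]
  proof eventually_elim
    case (elim x)
    have "norm (slope refined (u i t) x - slope J (u i t) x) \<le> norm (dx (u i t) x - slope J (u i t) x) + norm (dx (u i t) x - slope refined (u i t) x)"
      using norm_triangle_ineq4[of "dx (u i t) x - slope J (u i t) x" "dx (u i t) x - slope refined (u i t) x"] by simp
    then show ?case using elim interp_err_fine by linarith
  qed
qed

text \<open>An inverse estimate by hand: a coarse cell contains \<open>J ^ 3\<close> of the
  \<open>J ^ 4\<close> fine cells, so averaging over it controls its discrete slope by
  \<open>real J\<close> times the gap. With a gap of order h^2 the squared deviation is of order h.
  The 8 is 2 from the square of a sum times the squared 2 of \<open>coarse_fine_gap\<close>.\<close>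

lemma slope_gap_le:
  assumes t: "t \<in> {0..T}" and m: "m < J"
  shows "(norm (state_slope J (Y t) i m - node_slope J (\<lambda>i. u i t) i m))\<^sup>2 \<le> 2 * real J * gradient_gap t + 8 * (consist / real J)"
proof -
  define n where "n = J ^ 3"
  have n: "1 \<le> n" "refined = J * n" using J by (auto simp: n_def)
  let ?q = "state_slope J (Y t) i m" and ?p = "node_slope J (\<lambda>i. u i t) i m" and ?f = "node_slope refined (\<lambda>i. u i t) i"
  define D where "D i l = (norm (state_slope J (Y t) i (l div n) - node_slope refined (\<lambda>i. u i t) i l))\<^sup>2" for i l
  have cell: "l < refined" "l div n = m" if "l \<in> {m * n..<m * n + n}" for l
  proof -
    have "m * n + n \<le> J * n" using mult_le_mono1[of "Suc m" J n] m by simp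
    then show "l < refined" unfolding n(2) using that by simp
    show "l div n = m" using that n(1) by (intro div_nat_eqI) (auto simp: mult.commute)
  qed
  have "real n * (norm (?q - ?p))\<^sup>2 = (\<Sum>l\<in>{m * n..<m * n + n}. (norm (?q - ?p))\<^sup>2)" by simp
  also have "\<dots> \<le> (\<Sum>l\<in>{m * n..<m * n + n}. 2 * D i l + 8 * (interp_err J)\<^sup>2)"
  proof (intro sum_mono)
    fix l assume l: "l \<in> {m * n..<m * n + n}"
    have "(norm (?p - ?f l))\<^sup>2 \<le> (2 * interp_err J)\<^sup>2"
      using coarse_fine_gap[OF t cell(1)[OF l], of i] cell(2)[OF l] by (intro power_mono) (auto simp: norm_minus_commute n_def)
    then show "(norm (?q - ?p))\<^sup>2 \<le> 2 * D i l + 8 * (interp_err J)\<^sup>2"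
      using norm_diff_square_le[of ?q ?p "?f l"] by (simp add: D_def cell(2)[OF l] power_mult_distrib)
  qed
  also have "\<dots> = 2 * (\<Sum>l\<in>{m * n..<m * n + n}. D i l) + real n * (8 * (interp_err J)\<^sup>2)"
    by (simp add: sum.distrib sum_distrib_left)
  also have "(\<Sum>l\<in>{m * n..<m * n + n}. D i l) \<le> (\<Sum>l<refined. D i l)"
    using cell(1) by (intro sum_mono2) (auto simp: D_def)
  also have "(\<Sum>l<refined. D i l) = real refined * ((\<Sum>l<refined. D i l) / real refined)" using J by simp
  also have "real refined * ((\<Sum>l<refined. D i l) / real refined) \<le> real refined * gradient_gap t"
  proof (rule mult_left_mono)
    show "(\<Sum>l<refined. D i l) / real refined \<le> gradient_gap t"
      unfolding gradient_gap_sum D_def n_def by (rule member_le_sum) (auto intro!: sum_nonneg divide_nonneg_nonneg)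
  qed simp
  finally have "real n * (norm (?q - ?p))\<^sup>2 \<le> 2 * (real refined * gradient_gap t) + real n * (8 * (interp_err J)\<^sup>2)" by simp
  also have "\<dots> = real n * (2 * real J * gradient_gap t + 8 * (consist / real J))"
    unfolding n(2) interp_err_square by (simp add: algebra_simps)
  finally show ?thesis using n(1) by (subst (asm) mult_le_cancel_left_pos) auto
qed

text \<open>As long as the slopes stay within \<open>c0 / 4\<close> of the reference, the error
  estimate and \<open>close\<close> put them within \<open>c0 / 8\<close>, so by continuity they
  never leave.\<close>

lemma tube_always:
  assumes close: "(2 * grad_const + 8 * consist) / real J \<le> (c0 / 8)\<^sup>2" and t: "t \<in> {0..T}"
  shows "tube t"
proof -
  define f where "f a t = norm (state_slope J (Y t) (fst a) (snd a) - node_slope J (\<lambda>i. u i t) (fst a) (snd a))" for a t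
  have mem: "snd a < J" if "a \<in> UNIV \<times> {..<J}" for a :: "3 \<times> nat" using that by auto
  have tube_iff: "tube s \<longleftrightarrow> (\<forall>a\<in>UNIV \<times> {..<J}. f a s \<le> c0 / 4)" for s
  proof
    show "\<forall>a\<in>UNIV \<times> {..<J}. f a s \<le> c0 / 4" if "tube s" using that mem unfolding tube_def f_def by blast
    show "tube s" if *: "\<forall>a\<in>UNIV \<times> {..<J}. f a s \<le> c0 / 4"
      unfolding tube_def
    proof (intro allI impI)
      fix i m assume "m < J"
      then show "norm (state_slope J (Y s) i m - node_slope J (\<lambda>i. u i s) i m) \<le> c0 / 4"
        using bspec[OF *, of "(i, m)"] by (simp add: f_def)
    qed
  qed
  have cont: "continuous_on {0..T} (f b)" if "b \<in> UNIV \<times> {..<J}" for b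
    unfolding f_def by (intro continuous_on_norm continuous_on_diff state_slope_continuous node_slope_continuous mem[OF that])
  have init: "f b 0 \<le> c0 / 4 / 2" if b: "b \<in> UNIV \<times> {..<J}" for b
  proof -
    have "f b 0 = 0" unfolding f_def by (simp only: initial_slope(1)[OF mem[OF b]] initial_slope(2)[OF mem[OF b]] diff_self norm_zero)
    then show ?thesis using c0 by simp
  qed
  have step: "f b s \<le> c0 / 4 / 2"
    if s: "s \<in> {0..T}" and le: "\<And>r a. r \<in> {0..s} \<Longrightarrow> a \<in> UNIV \<times> {..<J} \<Longrightarrow> f a r \<le> c0 / 4"
      and b: "b \<in> UNIV \<times> {..<J}" for s b
  proof -
    have "tube r" if "r \<in> {0..s}" for r unfolding tube_iff by (intro ballI le[OF that])
    then have g: "gradient_gap s \<le> grad_const * (1 / real J)\<^sup>2" by (rule gap_estimate(1)[OF s])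
    have "(f b s)\<^sup>2 \<le> 2 * real J * gradient_gap s + 8 * (consist / real J)" unfolding f_def by (rule slope_gap_le[OF s mem[OF b]])
    also have "\<dots> \<le> 2 * real J * (grad_const * (1 / real J)\<^sup>2) + 8 * (consist / real J)" using g by (intro add_right_mono mult_left_mono) auto
    also have "\<dots> = (2 * grad_const + 8 * consist) / real J" using J by (simp add: field_simps power2_eq_square)
    finally have "(f b s)\<^sup>2 \<le> (c0 / 8)\<^sup>2" using close by simp
    then have "f b s \<le> c0 / 8" by (rule power2_le_imp_le) (use c0(1) in linarith)
    then show ?thesis by simp
  qed
  have "f a t \<le> c0 / 4" if a: "a \<in> UNIV \<times> {..<J}" for a
    using c0 by (intro continuity_bootstrap[OF _ cont _ init step t a]) simp_all
  then show ?thesis unfolding tube_iff by blast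
qed

end

text \<open>A modulus with two controls: in the application \<open>F\<close> is the time integral of
  the velocity norms, for the exact curve, and \<open>H\<close> the state of the discrete
  one.\<close>

lemma continuous_on_modulus:
  fixes G F :: "real \<Rightarrow> real" and H :: "real \<Rightarrow> 'a::real_normed_vector"
  assumes F: "continuous_on S F" and H: "continuous_on S H"
    and le: "\<And>s t. s \<in> S \<Longrightarrow> t \<in> S \<Longrightarrow> s \<le> t \<Longrightarrow> \<bar>G t - G s\<bar> \<le> a * \<bar>F t - F s\<bar> + b * norm (H t - H s)"
  shows "continuous_on S G"
  unfolding continuous_on_def
proof
  fix t assume t: "t \<in> S"
  have le': "\<bar>G s - G t\<bar> \<le> a * \<bar>F s - F t\<bar> + b * norm (H s - H t)" if "s \<in> S" for s
    using le[OF that t] le[OF t that] by (cases "s \<le> t") (auto simp: abs_minus_commute norm_minus_commute)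
  have "((\<lambda>s. a * \<bar>F s - F t\<bar> + b * norm (H s - H t)) \<longlongrightarrow> a * \<bar>F t - F t\<bar> + b * norm (H t - H t)) (at t within S)"
    using F H t by (intro tendsto_intros) (auto simp: continuous_on_def)
  then have "((\<lambda>s. a * \<bar>F s - F t\<bar> + b * norm (H s - H t)) \<longlongrightarrow> 0) (at t within S)" by simp
  then have "((\<lambda>s. G s - G t) \<longlongrightarrow> 0) (at t within S)"
  proof (rule Lim_null_comparison[rotated])
    show "\<forall>\<^sub>F s in at t within S. norm (G s - G t) \<le> a * \<bar>F s - F t\<bar> + b * norm (H s - H t)"
      unfolding eventually_at_filter real_norm_def by (intro always_eventually allI impI le')
  qed
  then show "(G \<longlongrightarrow> G t) (at t within S)" by (simp add: LIM_zero_cancel)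
qed

lemma abs_norm_square_diff_le: "norm a \<le> M \<Longrightarrow> norm b \<le> M \<Longrightarrow> \<bar>(norm a)\<^sup>2 - (norm b)\<^sup>2\<bar> \<le> 2 * M * norm (a - b)" for a b :: "'a::real_normed_vector"
proof -
  assume ab: "norm a \<le> M" "norm b \<le> M"
  have "\<bar>(norm a)\<^sup>2 - (norm b)\<^sup>2\<bar> = (norm a + norm b) * \<bar>norm a - norm b\<bar>"
    by (simp add: power2_eq_square square_diff_square_factored abs_mult)
  also have "\<dots> \<le> (2 * M) * norm (a - b)"
    using ab norm_triangle_ineq3[of a b] order_trans[OF norm_ge_zero ab(1)] by (intro mult_mono) auto
  finally show ?thesis .
qed

section \<open>The velocity error and the gradient error\<close>

context scheme_flow
begin

lemma velocity_error_estimate: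
  assumes gap: "(\<integral>r. tri_norm2 (velocity_gap r) \<partial>lebesgue_on {0..T}) \<le> vel_const * (1 / real J)\<^sup>2"
  shows "integrable (lebesgue_on {0..T}) (\<lambda>t. (velocity_error (ut i) (uh i) t)\<^sup>2)"
    and "(\<integral>t. (velocity_error (ut i) (uh i) t)\<^sup>2 \<partial>lebesgue_on {0..T}) \<le> (2 * Cp\<^sup>2 * Nb\<^sup>2 * T + 2 * vel_const) * (1 / real J)\<^sup>2"
proof -
  define g where "g t = (\<integral>x. (norm (ut i t x - vh i t x))\<^sup>2 \<partial>unit_interval)" for t
  obtain B where B: "0 \<le> B" "\<And>t i x. t \<in> {0..T} \<Longrightarrow> norm (vh i t x) \<le> B" by (fact velocity_sup)
  have cont: "continuous_on {0..1} (ut i t)" if "good t" for t using that W1_continuous[OF W2_W1, of "ut i t"] by (simp add: good_def)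
  have gm: "g \<in> borel_measurable (lebesgue_on {0..T})"
    unfolding g_def[abs_def]
  proof (rule borel_measurable_time_norm2)
    show "(\<lambda>t. ut i t x - vh i t x) \<in> borel_measurable (lebesgue_on {0..T})" if "x \<in> {0..1}" for x
      by (intro borel_measurable_diff velocity_measurable borel_measurable_integrable ut_integrable that)
    show "AE t in lebesgue_on {0..T}. continuous_on {0..1} (\<lambda>x. ut i t x - vh i t x)"
      using AE_good by eventually_elim (intro continuous_on_diff cont fem_continuous[OF vh_fem])
  qed
  have gi: "integrable (lebesgue_on {0..T}) g"
  proof (rule integrable_time_bounded[OF gm])
    show "AE t in lebesgue_on {0..T}. norm (g t) \<le> (Nb + B)\<^sup>2"
      using AE_good AE_space
    proof eventually_elim
      case (elim t)
      have t: "t \<in> {0..T}" using elim(2) by simp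
      have "AE x in unit_interval. norm (ut i t x - vh i t x) \<le> Nb + B"
        using AE_unit_interval
      proof eventually_elim
        case (elim x)
        then show ?case using good_bound[OF \<open>good t\<close>, of x i] B(2)[OF t, of i x] by (intro norm_triangle_le_diff add_mono) auto
      qed
      then have "g t \<le> (Nb + B)\<^sup>2" unfolding g_def using B(1) Nb by (intro square_integral_le) auto
      moreover have "0 \<le> g t" unfolding g_def by (intro Bochner_Integration.integral_nonneg) simp
      ultimately show ?case by simp
    qed
  qed
  \<comment> \<open>\<open>dt\<close> is identified with the velocity of the flow in the open time
    interval, so both end times are discarded.\<close>
  have ne: "AE t in lebesgue_on {0..T}. t \<noteq> 0" "AE t in lebesgue_on {0..T}. t \<noteq> T" by (simp_all add: AE_lebesgue_on_neq)
  have eq: "AE t in lebesgue_on {0..T}. (velocity_error (ut i) (uh i) t)\<^sup>2 = g t"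
    using ne AE_space
  proof eventually_elim
    case (elim t)
    then have "t \<in> {0<..<T}" by auto
    then show ?case unfolding velocity_error_def L2_norm_square g_def by (simp only: dt_state_triple(2)[OF Y])
  qed
  have vm: "(\<lambda>t. (velocity_error (ut i) (uh i) t)\<^sup>2) \<in> borel_measurable (lebesgue_on {0..T})"
    by (rule borel_measurable_lebesgue_on_cong_AE[OF gm eq])
  show "integrable (lebesgue_on {0..T}) (\<lambda>t. (velocity_error (ut i) (uh i) t)\<^sup>2)"
    using integrable_cong_AE[OF vm gm eq] gi by simp
  have "(\<integral>t. (velocity_error (ut i) (uh i) t)\<^sup>2 \<partial>lebesgue_on {0..T}) = (\<integral>t. g t \<partial>lebesgue_on {0..T})"
    by (rule integral_cong_AE[OF vm gm eq])
  also have "\<dots> \<le> (\<integral>t. 2 * (Cp * (1 / real J) * Nb)\<^sup>2 + 2 * tri_norm2 (velocity_gap t) \<partial>lebesgue_on {0..T})"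
  proof (rule integral_mono_AE[OF gi])
    show "integrable (lebesgue_on {0..T}) (\<lambda>t. 2 * (Cp * (1 / real J) * Nb)\<^sup>2 + 2 * tri_norm2 (velocity_gap t))"
      using velocity_gap_integrable by auto
    show "AE t in lebesgue_on {0..T}. g t \<le> 2 * (Cp * (1 / real J) * Nb)\<^sup>2 + 2 * tri_norm2 (velocity_gap t)"
      using AE_good
    proof eventually_elim
      case (elim t)
      have c1: "continuous_on {0..1} (\<lambda>x. ut i t x - interpol J (ut i t) x)" and c2: "continuous_on {0..1} (velocity_gap t i)"
        unfolding velocity_gap_def by (intro continuous_on_diff cont[OF elim] fem_continuous[OF vh_fem] fem_continuous[OF interpol_fem[OF J]])+
      have "L2_norm 0 1 (\<lambda>x. ut i t x - interpol J (ut i t) x) \<le> Cp * (1 / real J) * W_norm 1 (ut i t)"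
        using elim by (intro interpolation_constantD(2)[OF Cp J W2_W1]) (simp add: good_def)
      also have "\<dots> \<le> Cp * (1 / real J) * Nb" using elim Cp_pos by (intro mult_left_mono) (auto simp: good_def)
      finally have 1: "(L2_norm 0 1 (\<lambda>x. ut i t x - interpol J (ut i t) x))\<^sup>2 \<le> (Cp * (1 / real J) * Nb)\<^sup>2" by (intro power_mono) auto
      have "g t \<le> (\<integral>x. 2 * (norm (ut i t x - interpol J (ut i t) x))\<^sup>2 + 2 * (norm (velocity_gap t i x))\<^sup>2 \<partial>unit_interval)"
        unfolding g_def
      proof (rule integral_mono')
        show "integrable unit_interval (\<lambda>x. 2 * (norm (ut i t x - interpol J (ut i t) x))\<^sup>2 + 2 * (norm (velocity_gap t i x))\<^sup>2)"
          using integrable_norm_square_continuous[OF c1] integrable_norm_square_continuous[OF c2] by auto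
        show "(norm (ut i t x - vh i t x))\<^sup>2 \<le> 2 * (norm (ut i t x - interpol J (ut i t) x))\<^sup>2 + 2 * (norm (velocity_gap t i x))\<^sup>2" for x
          unfolding velocity_gap_def by (rule norm_diff_square_le)
      qed simp
      also have "\<dots> = 2 * (\<integral>x. (norm (ut i t x - interpol J (ut i t) x))\<^sup>2 \<partial>unit_interval) + 2 * (\<integral>x. (norm (velocity_gap t i x))\<^sup>2 \<partial>unit_interval)"
        using integrable_norm_square_continuous[OF c1] integrable_norm_square_continuous[OF c2] by simp
      also have "\<dots> \<le> 2 * (Cp * (1 / real J) * Nb)\<^sup>2 + 2 * tri_norm2 (velocity_gap t)"
        unfolding tri_norm2_def using 1 unfolding L2_norm_square
        by (intro add_mono mult_left_mono member_le_sum[of i UNIV "\<lambda>i. \<integral>x. (norm (velocity_gap t i x))\<^sup>2 \<partial>unit_interval"] Bochner_Integration.integral_nonneg) auto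
      finally show ?case .
    qed
  qed
  also have "\<dots> = T * (2 * (Cp * (1 / real J) * Nb)\<^sup>2) + 2 * (\<integral>r. tri_norm2 (velocity_gap r) \<partial>lebesgue_on {0..T})"
    using velocity_gap_integrable T by (simp add: measure_restrict_space)
  also have "\<dots> \<le> T * (2 * (Cp * (1 / real J) * Nb)\<^sup>2) + 2 * (vel_const * (1 / real J)\<^sup>2)" using gap by simp
  also have "\<dots> = (2 * Cp\<^sup>2 * Nb\<^sup>2 * T + 2 * vel_const) * (1 / real J)\<^sup>2" unfolding power_mult_distrib by (simp only: algebra_simps)
  finally show "(\<integral>t. (velocity_error (ut i) (uh i) t)\<^sup>2 \<partial>lebesgue_on {0..T}) \<le> (2 * Cp\<^sup>2 * Nb\<^sup>2 * T + 2 * vel_const) * (1 / real J)\<^sup>2" .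
qed

lemma gradient_error_square:
  assumes t: "t \<in> {0..T}"
  shows "(gradient_error (u i) (uh i) t)\<^sup>2 = (\<integral>x. (norm (dx (u i t) x - slope J (uh i t) x))\<^sup>2 \<partial>unit_interval)"
proof -
  have m: "dx (u i t) \<in> borel_measurable unit_interval" "dx (uh i t) \<in> borel_measurable unit_interval" "slope J (uh i t) \<in> borel_measurable unit_interval"
    by (intro borel_measurable_integrable weak_deriv_integrable(1)[OF W1_weak_deriv_dx[OF uW[OF t]]]
        weak_deriv_integrable(1)[OF W1_weak_deriv_dx[OF fem_W1[OF uh_fem J]]] integrable_slope[OF J])+
  have "AE x in unit_interval. dx (uh i t) x = slope J (uh i t) x" by (rule dx_fem[OF uh_fem J])
  then show ?thesis
    unfolding gradient_error_def L2_norm_square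
    using m by (intro integral_cong_AE) (auto elim: eventually_mono)
qed

text \<open>The detour through the refined slopes replaces \<open>dx (u i t)\<close> by quantities
  already estimated, at a cost of order h^4 in the square.\<close>

lemma gradient_error_le:
  assumes t: "t \<in> {0..T}"
  shows "(gradient_error (u i) (uh i) t)\<^sup>2 \<le> 2 * (consist / real refined) + 2 * gradient_gap t"
proof -
  have m: "dx (u i t) \<in> borel_measurable unit_interval" "slope refined (u i t) \<in> borel_measurable unit_interval"
    by (intro borel_measurable_integrable weak_deriv_integrable(1)[OF W1_weak_deriv_dx[OF uW[OF t]]] integrable_slope[OF refined(1)])+
  have e: "AE x in unit_interval. norm (dx (u i t) x - slope refined (u i t) x) \<le> interp_err refined" by (rule dx_u_slope[OF refined(1) t])
  have i1: "integrable unit_interval (\<lambda>x. (norm (dx (u i t) x - slope refined (u i t) x))\<^sup>2)"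
  proof (rule integrable_bounded)
    show "AE x in unit_interval. norm ((norm (dx (u i t) x - slope refined (u i t) x))\<^sup>2) \<le> (interp_err refined)\<^sup>2"
      using e by eventually_elim (simp add: power_mono)
  qed (use m in simp)
  have i2: "integrable unit_interval (\<lambda>x. (norm (slope J (uh i t) x - slope refined (u i t) x))\<^sup>2)"
    by (rule has_bochner_integral_two_scale[OF J J3, THEN integrable.intros, of "\<lambda>a b c d. (norm (b - a))\<^sup>2" "\<lambda>i. u i t" i "state_triple J (Y t)" "\<lambda>i. u i t" "state_triple J (Y t)"])
  have "(gradient_error (u i) (uh i) t)\<^sup>2 \<le> (\<integral>x. 2 * (norm (dx (u i t) x - slope refined (u i t) x))\<^sup>2
      + 2 * (norm (slope J (uh i t) x - slope refined (u i t) x))\<^sup>2 \<partial>unit_interval)"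
    unfolding gradient_error_square[OF t]
  proof (rule integral_mono')
    show "integrable unit_interval (\<lambda>x. 2 * (norm (dx (u i t) x - slope refined (u i t) x))\<^sup>2 + 2 * (norm (slope J (uh i t) x - slope refined (u i t) x))\<^sup>2)"
      using i1 i2 by auto
  qed (auto intro: norm_diff_square_le)
  also have "\<dots> = 2 * (\<integral>x. (norm (dx (u i t) x - slope refined (u i t) x))\<^sup>2 \<partial>unit_interval)
      + 2 * (\<integral>x. (norm (slope J (uh i t) x - slope refined (u i t) x))\<^sup>2 \<partial>unit_interval)"
    using i1 i2 by simp
  also have "\<dots> \<le> 2 * (interp_err refined)\<^sup>2 + 2 * gradient_gap t"
    unfolding gradient_gap_def
    by (intro add_mono mult_left_mono square_integral_le e interp_err_nonneg
      member_le_sum[of i UNIV "\<lambda>i. \<integral>x. (norm (slope J (uh i t) x - slope refined (u i t) x))\<^sup>2 \<partial>unit_interval"] Bochner_Integration.integral_nonneg) auto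
  finally show ?thesis unfolding interp_err_square .
qed

text \<open>This makes the maximum over time attained. In the sup norm, \<open>dx (u i t)\<close>
  moves by at most a multiple of the time integral of the velocity norms and the discrete slopes by
  a multiple of the change of state; the slope errors are bounded by \<open>3 / c0\<close>, so their
  squares move likewise.\<close>

lemma gradient_error_continuous:
  assumes tube: "\<And>t. t \<in> {0..T} \<Longrightarrow> tube t"
  shows "continuous_on {0..T} (\<lambda>t. (gradient_error (u i) (uh i) t)\<^sup>2)"
proof (rule continuous_on_modulus[OF indefinite_integral_continuous_real[OF vel2_integrable] Y_continuous])
  fix s t assume st: "s \<in> {0..T}" "t \<in> {0..T}" "s \<le> t"
  define d where "d = 2 * ((Cp + 1) * (\<integral>r. vel2 r \<partial>lebesgue_on {s..t})) + 2 * real J * norm (Y t - Y s)"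
  let ?e = "\<lambda>t x. dx (u i t) x - slope J (uh i t) x"
  have bound: "AE x in unit_interval. norm (?e t x) \<le> 3 / c0" if t: "t \<in> {0..T}" for t
    using u_bounds[OF t, of i] tube_slope_bounds[OF t tube[OF t], of i]
  proof eventually_elim
    case (elim x)
    then have "norm (?e t x) \<le> 1 / c0 + 2 / c0" by (intro norm_triangle_le_diff add_mono) auto
    then show ?case by (simp add: add_divide_distrib[symmetric])
  qed
  have m: "?e t \<in> borel_measurable unit_interval" if t: "t \<in> {0..T}" for t
    by (intro borel_measurable_diff borel_measurable_integrable weak_deriv_integrable(1)[OF W1_weak_deriv_dx[OF uW[OF t]]] integrable_slope[OF J])
  have int: "integrable unit_interval (\<lambda>x. (norm (?e t x))\<^sup>2)" if t: "t \<in> {0..T}" for t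
  proof (rule integrable_bounded)
    show "AE x in unit_interval. norm ((norm (?e t x))\<^sup>2) \<le> (3 / c0)\<^sup>2"
      using bound[OF t] by eventually_elim (simp add: power_mono)
  qed (intro borel_measurable_power measurable_compose[OF m[OF t] borel_measurable_norm])
  have sl: "AE x in unit_interval. norm (slope J (uh i t) x - slope J (uh i s) x) \<le> 2 * real J * norm (Y t - Y s)"
    using slope_state_triple[OF J, of "Y t" i] slope_state_triple[OF J, of "Y s" i]
    by eventually_elim (simp add: cell_field_def state_slope_diff_le)
  have tm: "AE x in unit_interval. norm (dx (u i t) x - dx (u i s) x) \<le> 2 * ((Cp + 1) * (\<integral>r. vel2 r \<partial>lebesgue_on {s..t}))"
    using st by (intro dx_u_time) auto
  have diff: "AE x in unit_interval. norm (?e t x - ?e s x) \<le> d"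
    using sl tm
  proof eventually_elim
    case (elim x)
    have "?e t x - ?e s x = (dx (u i t) x - dx (u i s) x) - (slope J (uh i t) x - slope J (uh i s) x)" by simp
    then show ?case unfolding d_def using elim by (simp only: norm_triangle_le_diff add_mono)
  qed
  have "\<bar>(gradient_error (u i) (uh i) t)\<^sup>2 - (gradient_error (u i) (uh i) s)\<^sup>2\<bar> = \<bar>\<integral>x. (norm (?e t x))\<^sup>2 - (norm (?e s x))\<^sup>2 \<partial>unit_interval\<bar>"
    unfolding gradient_error_square[OF st(1)] gradient_error_square[OF st(2)] using int[OF st(1)] int[OF st(2)] by simp
  also have "\<dots> \<le> (\<integral>x. \<bar>(norm (?e t x))\<^sup>2 - (norm (?e s x))\<^sup>2\<bar> \<partial>unit_interval)"
    by (rule integral_abs_bound)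
  also have "\<dots> \<le> (\<integral>x. 2 * (3 / c0) * d \<partial>unit_interval)"
  proof (rule integral_mono_AE)
    show "AE x in unit_interval. \<bar>(norm (?e t x))\<^sup>2 - (norm (?e s x))\<^sup>2\<bar> \<le> 2 * (3 / c0) * d"
      using bound[OF st(1)] bound[OF st(2)] diff
    proof eventually_elim
      case (elim x)
      have "\<bar>(norm (?e t x))\<^sup>2 - (norm (?e s x))\<^sup>2\<bar> \<le> 2 * (3 / c0) * norm (?e t x - ?e s x)" by (rule abs_norm_square_diff_le[OF elim(2,1)])
      also have "\<dots> \<le> 2 * (3 / c0) * d" using elim(3) c0 by (intro mult_left_mono) auto
      finally show ?case .
    qed
  qed (use int[OF st(1)] int[OF st(2)] in auto)
  also have "\<dots> = 2 * (3 / c0) * d" by (simp add: measure_restrict_space)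
  also have "\<dots> = (12 / c0 * (Cp + 1)) * (\<integral>r. vel2 r \<partial>lebesgue_on {s..t}) + (12 / c0 * real J) * norm (Y t - Y s)"
    by (simp add: d_def algebra_simps add_divide_distrib)
  also have "(\<integral>r. vel2 r \<partial>lebesgue_on {s..t}) = (\<integral>r. vel2 r \<partial>lebesgue_on {0..t}) - (\<integral>r. vel2 r \<partial>lebesgue_on {0..s})"
    using integral_lebesgue_on_split[OF vel2_integrable, of 0 s t] st by simp
  also have "(12 / c0 * (Cp + 1)) * \<dots> \<le> (12 / c0 * (Cp + 1)) * \<bar>(\<integral>r. vel2 r \<partial>lebesgue_on {0..t}) - (\<integral>r. vel2 r \<partial>lebesgue_on {0..s})\<bar>"
    using Cp_pos c0 by (intro mult_left_mono) auto
  finally show "\<bar>(gradient_error (u i) (uh i) t)\<^sup>2 - (gradient_error (u i) (uh i) s)\<^sup>2\<bar>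
      \<le> (12 / c0 * (Cp + 1)) * \<bar>(\<integral>r. vel2 r \<partial>lebesgue_on {0..t}) - (\<integral>r. vel2 r \<partial>lebesgue_on {0..s})\<bar> + (12 / c0 * real J) * norm (Y t - Y s)"
    by simp
qed

lemma flow_solution:
  assumes close: "(2 * grad_const + 8 * consist) / real J \<le> (c0 / 8)\<^sup>2"
  shows "unique_SDP_solution J \<epsilon> T P u0 (\<lambda>i t. uh i t)"
    and "error_estimate T (u i) (ut i) (\<lambda>t. uh i t) (error_const * (1 / real J)\<^sup>2)"
proof -
  note tube = tube_always[OF close]
  have "SDP_solution J \<epsilon> T P u0 (\<lambda>i t. uh i t)"
  proof (rule flow_imp_SDP_solution[OF J eps T u0(2,3) Y0 Y V])
    show "solves_velocity J \<epsilon> (state_slope J (Y t)) (state_triple J (V t))" if "t \<in> {0..T}" for t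
      by (rule tube_flow[OF that tube[OF that]])
    show "state_slope J (Y t) i m \<noteq> 0" if "t \<in> {0..T}" "m < J" for t i m
      using tube_bounds(1)[OF that(1) tube[OF that(1)] that(2), of i] c0 by auto
  qed
  then show "unique_SDP_solution J \<epsilon> T P u0 (\<lambda>i t. uh i t)"
    unfolding unique_SDP_solution_def using SDP_unique[OF Cp J eps] by blast
  have TT: "T \<in> {0..T}" using T by simp
  have sub: "tube s" if "t \<in> {0..T}" "s \<in> {0..t}" for s t using that by (intro tube) auto
  have vel: "(\<integral>r. tri_norm2 (velocity_gap r) \<partial>lebesgue_on {0..T}) \<le> vel_const * (1 / real J)\<^sup>2"
    by (rule gap_estimate(2)[OF TT sub[OF TT]])
  have "{0..T} \<noteq> {}" using T by simp
  then obtain s where s: "s \<in> {0..T}" "\<And>t. t \<in> {0..T} \<Longrightarrow> (gradient_error (u i) (uh i) t)\<^sup>2 \<le> (gradient_error (u i) (uh i) s)\<^sup>2"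
    using continuous_attains_sup[OF compact_Icc _ gradient_error_continuous[OF tube, of i]] by auto
  have "gradient_gap s \<le> grad_const * (1 / real J)\<^sup>2" by (rule gap_estimate(1)[OF s(1) sub[OF s(1)]])
  then have "(gradient_error (u i) (uh i) s)\<^sup>2 \<le> 2 * (consist * (1 / real J)\<^sup>2) + 2 * (grad_const * (1 / real J)\<^sup>2)"
    using gradient_error_le[OF s(1), of i] consist_fine by linarith
  then have "(\<integral>t. (velocity_error (ut i) (uh i) t)\<^sup>2 \<partial>lebesgue_on {0..T}) + (gradient_error (u i) (uh i) s)\<^sup>2
      \<le> (2 * Cp\<^sup>2 * Nb\<^sup>2 * T + 2 * vel_const) * (1 / real J)\<^sup>2 + (2 * (consist * (1 / real J)\<^sup>2) + 2 * (grad_const * (1 / real J)\<^sup>2))"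
    by (intro add_mono velocity_error_estimate(2)[OF vel])
  also have "\<dots> \<le> error_const * (1 / real J)\<^sup>2"
    unfolding error_const_def by (simp add: algebra_simps)
  finally show "error_estimate T (u i) (ut i) (\<lambda>t. uh i t) (error_const * (1 / real J)\<^sup>2)"
    unfolding error_estimate_def using velocity_error_estimate(1)[OF vel, of i] s by blast
qed

end

section \<open>Choice of the mesh threshold\<close>

context exact_solution
begin

lemma semidiscrete_convergence:
  "\<exists>h0>0. \<forall>J::nat. 1 \<le> J \<and> 1 / real J \<le> h0 \<longrightarrow>
     (\<exists>uh. unique_SDP_solution J \<epsilon> T P u0 uh \<and> (\<forall>i. error_estimate T (u i) (ut i) (uh i) (error_const * (1 / real J)\<^sup>2)))"
proof -
  \<comment> \<open>The first entry makes the interpolation error of the exact slopes at most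
    \<open>c0 / 4\<close>; the second closes the bootstrap for the discrete slopes.\<close>
  define h0 where "h0 = min ((c0 / (8 * Cp * reg_bound))\<^sup>2) ((c0 / 8)\<^sup>2 / (2 * grad_const + 8 * consist))"
  note pos = Cp_pos c0(1) const_pos(2,8,12)
  show ?thesis
  proof (intro exI[of _ h0] conjI allI impI)
    show "0 < h0" unfolding h0_def using pos by simp
    fix J :: nat assume "1 \<le> J \<and> 1 / real J \<le> h0"
    then have J: "1 \<le> J" and h: "1 / real J \<le> (c0 / (8 * Cp * reg_bound))\<^sup>2" "1 / real J \<le> (c0 / 8)\<^sup>2 / (2 * grad_const + 8 * consist)"
      by (auto simp: h0_def)
    have "sqrt (1 / real J) \<le> c0 / (8 * Cp * reg_bound)" using h(1) pos by (intro real_le_lsqrt) auto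
    then have small: "interp_err J \<le> c0 / 4"
      unfolding interp_err_def using pos by (simp add: field_simps)
    have close: "(2 * grad_const + 8 * consist) / real J \<le> (c0 / 8)\<^sup>2"
      using h(2) pos by (simp add: field_simps)
    \<comment> \<open>\<open>c0 / 4\<close> is the retraction radius, so retracted slopes keep a
      norm between \<open>c0 / 2\<close> and \<open>2 / c0\<close>, the range used in the
      constants.\<close>
    have bounds: "c0 / 2 + c0 / 4 \<le> norm (node_slope J (\<lambda>i. u i t) i m) \<and> norm (node_slope J (\<lambda>i. u i t) i m) \<le> 2 / c0 - c0 / 4"
      if "t \<in> {0..T}" "m < J" for t i m
    proof -
      have "c0 / 2 \<le> 1 / c0" using c0 mult_mono[of c0 1 c0 1] by (simp add: field_simps)
      then have "1 / c0 + c0 / 4 \<le> 2 / c0 - c0 / 4" by (simp add: field_simps)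
      then show ?thesis using node_slope_u[OF J small that, of i] by linarith
    qed
    have c: "0 < c0 / 2" "0 < c0 / 4" using c0 by auto
    obtain Y V where flow: "Y 0 = state_of J (\<lambda>i n. u0 i (real n / real J))"
      "\<And>t. t \<in> {0..T} \<Longrightarrow> (Y has_vector_derivative V t) (at t within {0..T})" "continuous_on {0..T} V" "\<And>t. t \<in> {0..T} \<Longrightarrow> V t \<in> state_space J"
      "\<And>t. t \<in> {0..T} \<Longrightarrow> solves_velocity J \<epsilon> (retracted_slope J (c0 / 4) (node_slope J (\<lambda>i. u i t)) (Y t)) (state_triple J (V t))"
      by (rule modified_flow[where P = "\<lambda>t. node_slope J (\<lambda>i. u i t)", OF Cp J eps c T], erule node_slope_continuous, erule (1) bounds, blast)
    interpret scheme_flow \<epsilon> T c0 Cp Nb P u0 u ut J Y V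
      by unfold_locales (fact J small flow)+
    show "\<exists>uh. unique_SDP_solution J \<epsilon> T P u0 uh \<and> (\<forall>i. error_estimate T (u i) (ut i) (uh i) (error_const * (1 / real J)\<^sup>2))"
      using flow_solution[OF close] by blast
  qed
qed

end

theorem theorem4p3:
  fixes \<epsilon> T c0 Cp :: real and N :: "3 \<Rightarrow> real \<times> real \<times> real \<times> real"
  assumes "0 < \<epsilon>" and "\<epsilon> \<le> 1 / 2"
    and "0 < T"
    and "0 < c0" and "c0 \<le> 1 / 2"
    and "interpolation_constant Cp"
  shows "\<exists>C>0. \<forall>(P :: 3 \<Rightarrow> real^2) (u0 :: triple) (u :: 3 \<Rightarrow> real \<Rightarrow> curve) (ut :: 3 \<Rightarrow> real \<Rightarrow> curve).
           u0 \<in> triods P \<and>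
           unique_CP_solution \<epsilon> T P u0 u ut \<and>
           assumption_A c0 T u0 u ut \<and>
           A_norms T u0 u ut = N \<longrightarrow>
           (\<exists>h0>0. \<forall>J::nat. 1 \<le> J \<and> 1 / real J \<le> h0 \<longrightarrow>
              (\<exists>uh. unique_SDP_solution J \<epsilon> T P u0 uh \<and>
                 (\<forall>i. error_estimate T (u i) (ut i) (uh i) (C * (1 / real J)\<^sup>2))))"
proof -
  \<comment> \<open>The constant is chosen for an arbitrary tuple \<open>N\<close>, before it is
    known to consist of norms; absolute values keep the sum nonnegative in every case.\<close>
  define Ni where "Ni i = (case N i of (a, b, c, d) \<Rightarrow> \<bar>b\<bar> + \<bar>c\<bar> + \<bar>d\<bar>)" for i
  \<comment> \<open>The 1 makes the bound positive even if all norms vanish, and the sum serves all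
    three curves at once.\<close>
  define Nb where "Nb = 1 + (\<Sum>i\<in>UNIV. Ni i)"
  have Ni: "0 \<le> Ni i" for i by (simp add: Ni_def split: prod.split)
  have Ni_le: "Ni i \<le> Nb" for i
    unfolding Nb_def using member_le_sum[of i UNIV Ni] Ni by (simp add: add_increasing)
  have Nb: "0 < Nb" unfolding Nb_def using Ni by (intro add_pos_nonneg sum_nonneg) auto
  interpret scheme_constants \<epsilon> T c0 Cp Nb
    by unfold_locales (fact assms Nb)+
  show ?thesis
  proof (rule exI[of _ error_const], intro conjI allI impI const_pos(14))
    fix P :: "3 \<Rightarrow> real^2" and u0 :: triple and u ut :: "3 \<Rightarrow> real \<Rightarrow> curve"
    assume *: "u0 \<in> triods P \<and> unique_CP_solution \<epsilon> T P u0 u ut \<and> assumption_A c0 T u0 u ut \<and> A_norms T u0 u ut = N"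
    then have u0: "u0 \<in> triods P" and CP: "CP_solution \<epsilon> T P u0 u ut" and A: "assumption_A c0 T u0 u ut" and N: "A_norms T u0 u ut = N"
      by (auto simp: unique_CP_solution_def)
    have Ni_eq: "Ni i = \<bar>Linf_W_norm 1 T (ut i)\<bar> + \<bar>L2_W_norm 2 T (ut i)\<bar> + \<bar>W_norm 2 (u0 i)\<bar>" for i
      unfolding Ni_def N[symmetric] A_norms_def by simp
    have le: "Linf_W_norm 1 T (ut i) \<le> Nb" "L2_W_norm 2 T (ut i) \<le> Nb" "W_norm 2 (u0 i) \<le> Nb" for i
      using Ni_le[of i] unfolding Ni_eq by linarith+
    have tr: "(\<lambda>i. u i t) \<in> triods P" if "t \<in> {0..T}" for t using CP that by (simp add: CP_solution_def)
    have wt: "has_weak_time_deriv T (u i) (ut i)" for i using CP by (simp add: CP_solution_def)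
    have A': "ut i \<in> Linf_W 1 T" "ut i \<in> L2_W 2 T" "u0 i \<in> W 2" for i using A by (auto simp: assumption_A_def)
    interpret exact_solution \<epsilon> T c0 Cp Nb P u0 u ut
    proof unfold_locales
      show "u0 i \<in> W 2" "W_norm 2 (u0 i) \<le> Nb" for i by (fact A'(3) le(3))+
      show "u0 i 1 = P i" "u0 i 0 = u0 k 0" for i k using u0 unfolding triods_def by blast+
      show "u i t \<in> W 1" "u i t 1 = P i" "u i t 0 = u k t 0" if "t \<in> {0..T}" for t i k
        using tr[OF that] unfolding triods_def by blast+
      show "AE x in unit_interval. c0 \<le> norm (dx (u i t) x) \<and> norm (dx (u i t) x) \<le> 1 / c0" if "t \<in> {0..T}" for t i
        using A that by (simp add: assumption_A_def)
      show "u i 0 x = u0 i x" if "x \<in> {0..1}" for x i using CP that by (simp add: CP_solution_def)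
      show "continuous_on {0..T} (\<lambda>t. u i t x)" "has_weak_deriv 0 T (\<lambda>t. u i t x) (\<lambda>t. ut i t x)" if "x \<in> {0..1}" for x i
        using wt[of i] that by (auto simp: has_weak_time_deriv_def)
      show "AE t in lebesgue_on {0..T}. ut i t \<in> W 2" for i
        using A'(2)[of i] by (simp add: L2_W_def strongly_measurable_W_def)
      show "square_integrable 0 T (\<lambda>t. W_norm 2 (ut i t))" for i using A'(2)[of i] by (simp add: L2_W_def)
      show "L2_norm 0 T (\<lambda>t. W_norm 2 (ut i t)) \<le> Nb" for i using le(2)[of i] by (simp add: L2_W_norm_def)
      show "AE t in lebesgue_on {0..T}. W_norm 1 (ut i t) \<le> Nb" for i
      proof -
        define E where "E = Linf_norm 0 T (\<lambda>t. W_norm 1 (ut i t))"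
        have fin: "E < \<infinity>" using A'(1)[of i] by (simp add: Linf_W_def E_def)
        have Nb': "real_of_ereal E \<le> Nb" using le(1)[of i] by (simp add: Linf_W_norm_def E_def)
        have "AE t in lebesgue_on {0..T}. ereal (norm (W_norm 1 (ut i t))) \<le> E"
          unfolding E_def Linf_norm_def by (rule esssup_AE)
        then show ?thesis
        proof eventually_elim
          case (elim t)
          \<comment> \<open>The essential supremum is below \<open>\<infinity>\<close> by assumption
            and, as it dominates a norm at time \<open>t\<close>, is not
            \<open>-\<infinity>\<close>. So its real part is a true bound rather than the default
            value 0 of \<open>real_of_ereal\<close>.\<close>
          then obtain r where "E = ereal r" using fin by (cases E) auto
          then show ?case using elim Nb' by simp
        qed
      qed
      show "AE t in lebesgue_on {0..T}. \<forall>\<phi>\<in>triods0. weak_equation \<epsilon> (\<lambda>i. u i t) (\<lambda>i. ut i t) \<phi>"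
        using CP by (simp add: CP_solution_def)
    qed
    show "\<exists>h0>0. \<forall>J::nat. 1 \<le> J \<and> 1 / real J \<le> h0 \<longrightarrow>
        (\<exists>uh. unique_SDP_solution J \<epsilon> T P u0 uh \<and> (\<forall>i. error_estimate T (u i) (ut i) (uh i) (error_const * (1 / real J)\<^sup>2)))"
      by (rule semidiscrete_convergence)
  qed
qed

end
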